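(* Let $\Sigma=\Sigma_{g,p}$ with $p\geqslant1$, and with $p\geqslant 3$ if $g=0$. For $n\in\mathbb Z$ let $\mathcal R_n(\Sigma)$ be the space of type-preserving representations of relative Euler class $n$. (1) If $g\geqslant1$, then for each $n\in\mathbb Z$ the number of connected components of $\mathcal R_n(\Sigma)$ equals $$\sum_{k=\max\{n+p+\chi(\Sigma),0\}}^{\min\{n-\chi(\Sigma),p\}}\binom pk.$$ (2) If $g=0$ and $n=0$, then the number of connected components of $\mathcal R_n(\Sigma)$ equals $$\sum_{k=\max\{n+p+\chi(\Sigma),0\}}^{\min\{n-\chi(\Sigma),p\}}\binom pk+2p.$$ (3) If $g=0$ and $n=\pm1$, then the number of connected components of $\mathcal R_n(\Sigma)$ equals $$\sum_{k=\max\{n+p+\chi(\Sigma),0\}}^{\min\{n-\chi(\Sigma),p\}}\binom pk+1.$$ (A sum whose lower limit exceeds its upper limit is $0$.)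
   Context: $\Sigma_{g,p}$ is the surface obtained from a closed connected oriented surface of genus $g$ by removing $p$ points; $\chi(\Sigma_{g,p})=2-2g-p$. Fix a presentation $\pi_1(\Sigma)=\langle a_1,b_1,\dots,a_g,b_g,c_1,\dots,c_p\mid [a_1,b_1]\cdots[a_g,b_g]c_1\cdots c_p\rangle$, where $c_1,\dots,c_p$ are the preferred peripheral elements, $c_i$ being represented by a loop freely homotopic to a circle around the $i$-th puncture. A non-trivial element $\pm A\in\mathrm{PSL}(2,\mathbb R)$ is hyperbolic, parabolic, or elliptic if $|\mathrm{tr}(A)|>2$, $=2$, or $<2$ respectively. A representation $\phi:\pi_1(\Sigma)\to\mathrm{PSL}(2,\mathbb R)$ is type-preserving if every $\phi(c_i)$ is parabolic. Relative Euler class: let $\widetilde{\mathrm{SL}}(2,\mathbb R)$ be the universal covering group of $\mathrm{PSL}(2,\mathbb R)$, with exponential map $\widetilde{\exp}$, and let $z=\widetilde{\exp}\begin{bmatrix}0&\pi\\-\pi&0\end{bmatrix}$, a generator of the center. A parabolic element of $\mathrm{PSL}(2,\mathbb R)$ has a unique lift lying in the image of $\widetilde{\exp}$. Let $\widetilde{\phi(c_i)}$ be this lift of $\phi(c_i)$, and $\widetilde{\phi(a_j)},\widetilde{\phi(b_j)}$ arbitrary lifts. Then $e(\phi)=n$ is the integer with $[\widetilde{\phi(a_1)},\widetilde{\phi(b_1)}]\cdots[\widetilde{\phi(a_g)},\widetilde{\phi(b_g)}]\,\widetilde{\phi(c_1)}\cdots\widetilde{\phi(c_p)}=z^n$. $\mathcal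 R_n(\Sigma)$ carries the subspace topology from $\mathrm{Hom}(\pi_1(\Sigma),\mathrm{PSL}(2,\mathbb R))$ with the compact-open topology. *)

theory Defs
  imports "HOL-Analysis.Analysis" "HOL-Algebra.Coset"
begin

section \<open>Group presentations\<close>

text \<open>
  Words are lists of signed letters: \<open>(s, True)\<close> stands for the generator \<open>s\<close> and
  \<open>(s, False)\<close> for its formal inverse. The group presented by generators \<open>S\<close> and relators \<open>R\<close>
  consists of the classes of words under the congruence generated by free cancellation and
  by inserting or deleting relators.
\<close>

type_synonym 's word = "('s \<times> bool) list"

definition words :: "'s set \<Rightarrow> 's word set" where
  "words S = lists (S \<times> UNIV)"

inductive word_eq :: "'s set \<Rightarrow> 's word set \<Rightarrow> 's word \<Rightarrow> 's word \<Rightarrow> bool"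
  for S :: "'s set" and R :: "'s word set" where
  refl: "w \<in> words S \<Longrightarrow> word_eq S R w w"
| sym: "word_eq S R v w \<Longrightarrow> word_eq S R w v"
| trans: "word_eq S R u v \<Longrightarrow> word_eq S R v w \<Longrightarrow> word_eq S R u w"
| cancel: "u \<in> words S \<Longrightarrow> v \<in> words S \<Longrightarrow> s \<in> S \<Longrightarrow>
    word_eq S R (u @ [(s, b), (s, \<not> b)] @ v) (u @ v)"
| relator: "u \<in> words S \<Longrightarrow> v \<in> words S \<Longrightarrow> r \<in> R \<Longrightarrow> r \<in> words S \<Longrightarrow>
    word_eq S R (u @ r @ v) (u @ v)"

definition word_class :: "'s set \<Rightarrow> 's word set \<Rightarrow> 's word \<Rightarrow> 's word set" where
  "word_class S R w = {v. word_eq S R w v}"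

definition presented_group :: "'s set \<Rightarrow> 's word set \<Rightarrow> 's word set monoid" where
  "presented_group S R =
    \<lparr>carrier = word_class S R ` words S,
     mult = (\<lambda>X Y. \<Union>x\<in>X. \<Union>y\<in>Y. word_class S R (x @ y)),
     one = word_class S R []\<rparr>"


section \<open>The fundamental group of the surface of genus g with p punctures\<close>

datatype surface_gen = GenA nat | GenB nat | GenC nat

definition surface_gens :: "nat \<Rightarrow> nat \<Rightarrow> surface_gen set" where
  "surface_gens g p = GenA ` {1..g} \<union> GenB ` {1..g} \<union> GenC ` {1..p}"

definition surface_relator :: "nat \<Rightarrow> nat \<Rightarrow> surface_gen word" where
  "surface_relator g p =
     concat (map (\<lambda>j. [(GenA j, True), (GenB j, True), (GenA j, False), (GenB j, False)])
       [1..<Suc g])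
     @ map (\<lambda>i. (GenC i, True)) [1..<Suc p]"

definition surface_group :: "nat \<Rightarrow> nat \<Rightarrow> surface_gen word set monoid" where
  "surface_group g p = presented_group (surface_gens g p) {surface_relator g p}"

definition surface_elem :: "nat \<Rightarrow> nat \<Rightarrow> surface_gen \<Rightarrow> surface_gen word set" where
  "surface_elem g p s = word_class (surface_gens g p) {surface_relator g p} [(s, True)]"

definition surface_euler_char :: "nat \<Rightarrow> nat \<Rightarrow> int" where
  "surface_euler_char g p = 2 - 2 * int g - int p"


section \<open>The topological group PSL(2,R)\<close>

type_synonym mat2 = "real^2^2"

definition SL2R :: "mat2 monoid" where
  "SL2R = \<lparr>carrier = {A. det A = 1}, mult = (**), one = mat 1\<rparr>"

definition PSL2R :: "mat2 set monoid" where
  "PSL2R = SL2R Mod {mat 1, - mat 1}"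

definition psl_class :: "mat2 \<Rightarrow> mat2 set" where
  "psl_class A = {mat 1, - mat 1} #>\<^bsub>SL2R\<^esub> A"

text \<open>The quotient topology induced by \<^term>\<open>psl_class\<close>; see \<open>openin_PSL2R_topology\<close> and
  \<open>quotient_map_psl_class\<close> below.\<close>

definition PSL2R_topology :: "mat2 set topology" where
  "PSL2R_topology = topology (\<lambda>U. U \<subseteq> carrier PSL2R \<and>
     openin (top_of_set (carrier SL2R)) {A \<in> carrier SL2R. psl_class A \<in> U})"

text \<open>The trace is defined up to sign, so the choice of representative is irrelevant.\<close>

definition parabolic :: "mat2 set \<Rightarrow> bool" where
  "parabolic X \<longleftrightarrow> X \<in> carrier PSL2R \<and> X \<noteq> \<one>\<^bsub>PSL2R\<^esub> \<and> (\<exists>A\<in>X. \<bar>trace A\<bar> = 2)"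


section \<open>The universal covering group\<close>

text \<open>
  The universal covering group of a (path-connected, locally contractible) topological group
  \<open>G\<close> with topology \<open>T\<close>, realised as homotopy classes relative to the endpoints of paths
  \<open>[0,1] \<rightarrow> G\<close> issuing from the identity, with pointwise multiplication. The covering
  projection is evaluation at the endpoint. Paths are functions on all of the reals whose
  values outside \<open>[0,1]\<close> play no role; the homotopy class of a path does not
  depend on them.
\<close>

definition path_class :: "'a topology \<Rightarrow> (real \<Rightarrow> 'a) \<Rightarrow> (real \<Rightarrow> 'a) set" where
  "path_class T p =
     {q. homotopic_with (\<lambda>r. r 0 = p 0 \<and> r 1 = p 1) (top_of_set {0..1}) T p q}"

definition universal_cover ::
    "('a, 'b) monoid_scheme \<Rightarrow> 'a topology \<Rightarrow> (real \<Rightarrow> 'a) set monoid" where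
  "universal_cover G T =
    \<lparr>carrier = path_class T ` {p. pathin T p \<and> p 0 = \<one>\<^bsub>G\<^esub>},
     mult = (\<lambda>U V. \<Union>p\<in>U. \<Union>q\<in>V. path_class T (\<lambda>t. p t \<otimes>\<^bsub>G\<^esub> q t)),
     one = path_class T (\<lambda>t. \<one>\<^bsub>G\<^esub>)\<rparr>"

definition cover_proj :: "(real \<Rightarrow> 'a) set \<Rightarrow> 'a" where
  "cover_proj U = the_elem ((\<lambda>p. p 1) ` U)"

abbreviation SL2R_tilde :: "(real \<Rightarrow> mat2 set) set monoid" where
  "SL2R_tilde \<equiv> universal_cover PSL2R PSL2R_topology"

text \<open>The library's \<^term>\<open>exp\<close> and power are not available for \<^typ>\<open>real^2^2\<close>
  with the matrix product.\<close>

definition matrix_exp :: "mat2 \<Rightarrow> mat2" where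
  "matrix_exp X = (\<Sum>n. (1 / fact n) *\<^sub>R (((**) X ^^ n) (mat 1)))"

definition sl2 :: "mat2 set" where
  "sl2 = {X. trace X = 0}"

text \<open>The exponential map of the covering group sends \<open>X\<close> to the endpoint of the lift of the
  one-parameter subgroup generated by \<open>X\<close>, i.e. to the class of that path on \<open>[0,1]\<close>.\<close>

definition exp_tilde :: "mat2 \<Rightarrow> (real \<Rightarrow> mat2 set) set" where
  "exp_tilde X = path_class PSL2R_topology (\<lambda>t. psl_class (matrix_exp (t *\<^sub>R X)))"

definition central_z :: "(real \<Rightarrow> mat2 set) set" where
  "central_z = exp_tilde (vector [vector [0, pi], vector [- pi, 0]])"

definition parabolic_lift :: "mat2 set \<Rightarrow> (real \<Rightarrow> mat2 set) set" where
  "parabolic_lift P = (THE u. u \<in> exp_tilde ` sl2 \<and> cover_proj u = P)"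


section \<open>Type-preserving representations and the relative Euler class\<close>

definition group_commutator :: "('a, 'b) monoid_scheme \<Rightarrow> 'a \<Rightarrow> 'a \<Rightarrow> 'a" where
  "group_commutator G x y = x \<otimes>\<^bsub>G\<^esub> y \<otimes>\<^bsub>G\<^esub> inv\<^bsub>G\<^esub> x \<otimes>\<^bsub>G\<^esub> inv\<^bsub>G\<^esub> y"

definition list_mult :: "('a, 'b) monoid_scheme \<Rightarrow> 'a list \<Rightarrow> 'a" where
  "list_mult G xs = foldr (\<lambda>x y. x \<otimes>\<^bsub>G\<^esub> y) xs \<one>\<^bsub>G\<^esub>"

text \<open>Representations are extensional functions, so that they are determined by their
  values on the carrier of the surface group.\<close>

definition representations :: "nat \<Rightarrow> nat \<Rightarrow> (surface_gen word set \<Rightarrow> mat2 set) set" where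
  "representations g p =
     hom (surface_group g p) PSL2R \<inter> extensional (carrier (surface_group g p))"

definition type_preserving ::
    "nat \<Rightarrow> nat \<Rightarrow> (surface_gen word set \<Rightarrow> mat2 set) \<Rightarrow> bool" where
  "type_preserving g p \<phi> \<longleftrightarrow> (\<forall>i\<in>{1..p}. parabolic (\<phi> (surface_elem g p (GenC i))))"

definition is_lift :: "(real \<Rightarrow> mat2 set) set \<Rightarrow> mat2 set \<Rightarrow> bool" where
  "is_lift u P \<longleftrightarrow> u \<in> carrier SL2R_tilde \<and> cover_proj u = P"

definition relative_euler_class ::
    "nat \<Rightarrow> nat \<Rightarrow> (surface_gen word set \<Rightarrow> mat2 set) \<Rightarrow> int" where
  "relative_euler_class g p \<phi> = (THE n::int.
     \<forall>\<alpha> \<beta>. (\<forall>j\<in>{1..g}. is_lift (\<alpha> j) (\<phi> (surface_elem g p (GenA j))) \<and>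
                     is_lift (\<beta> j) (\<phi> (surface_elem g p (GenB j)))) \<longrightarrow>
       list_mult SL2R_tilde
         (map (\<lambda>j. group_commutator SL2R_tilde (\<alpha> j) (\<beta> j)) [1..<Suc g]
          @ map (\<lambda>i. parabolic_lift (\<phi> (surface_elem g p (GenC i)))) [1..<Suc p])
       = central_z [^]\<^bsub>SL2R_tilde\<^esub> n)"

definition compact_open_topology :: "'a topology \<Rightarrow> 'b topology \<Rightarrow> ('a \<Rightarrow> 'b) topology" where
  "compact_open_topology X Y = topology_generated_by
     {{f \<in> extensional (topspace X). continuous_map X Y f \<and> f ` K \<subseteq> U} | K U.
        compactin X K \<and> openin Y U}"

text \<open>The fundamental group is a discrete group.\<close>

definition rep_space ::
    "nat \<Rightarrow> nat \<Rightarrow> int \<Rightarrow> (surface_gen word set \<Rightarrow> mat2 set) topology" where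
  "rep_space g p n = subtopology
     (compact_open_topology (discrete_topology (carrier (surface_group g p))) PSL2R_topology)
     {\<phi> \<in> representations g p. type_preserving g p \<phi> \<and> relative_euler_class g p \<phi> = n}"

text \<open>The sum runs over an integer interval, hence is zero when the lower limit exceeds the
  upper one. All its indices are nonnegative, so \<^term>\<open>nat\<close> does not truncate.\<close>

definition component_sum :: "nat \<Rightarrow> nat \<Rightarrow> int \<Rightarrow> nat" where
  "component_sum g p n =
     (\<Sum>k\<in>{max (n + int p + surface_euler_char g p) 0..min (n - surface_euler_char g p) (int p)}.
        p choose nat k)"

definition has_components :: "'a topology \<Rightarrow> nat \<Rightarrow> bool" where
  "has_components X N \<longleftrightarrow>
     finite (connected_components_of X) \<and> card (connected_components_of X) = N"


section \<open>Well-definedness of the quotient\<close>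

lemma group_SL2R: "group SL2R"
proof (rule groupI)
  fix A assume "A \<in> carrier SL2R"
  then have d: "det A = 1" by (simp add: SL2R_def)
  then have "invertible A" by (simp add: invertible_det_nz)
  then obtain B where B: "A ** B = mat 1" "B ** A = mat 1" unfolding invertible_def by blast
  have "det B * det A = det (mat 1 :: mat2)" by (metis B(2) det_mul)
  with d have "det B = 1" by simp
  with B show "\<exists>B\<in>carrier SL2R. B \<otimes>\<^bsub>SL2R\<^esub> A = \<one>\<^bsub>SL2R\<^esub>"
    by (intro bexI[of _ B]) (simp_all add: SL2R_def)
qed (simp_all add: SL2R_def det_mul matrix_mul_assoc)

lemma mat2_uminus_mul: "(- A) ** B = - (A ** (B::mat2))" "A ** (- B) = - (A ** (B::mat2))"
  by (simp_all add: vec_eq_iff matrix_matrix_mult_def sum_negf)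

lemma det_mat2_uminus: "det (- A) = det (A::mat2)"
  by (simp add: det_2)

lemma normal_pm_one: "{mat 1, - mat 1} \<lhd> SL2R"
proof -
  interpret group SL2R by (rule group_SL2R)
  have sq: "x \<otimes>\<^bsub>SL2R\<^esub> x = \<one>\<^bsub>SL2R\<^esub>" "x \<in> carrier SL2R" if "x \<in> {mat 1, - mat 1}" for x
    using that by (elim insertE emptyE; simp add: SL2R_def mat2_uminus_mul det_mat2_uminus)+
  have sub: "subgroup {mat 1, - mat 1} SL2R"
  proof
    fix x :: mat2 assume x: "x \<in> {mat 1, - mat 1}"
    have "inv\<^bsub>SL2R\<^esub> x = x" using sq[OF x] by (simp add: inv_equality)
    with x show "inv\<^bsub>SL2R\<^esub> x \<in> {mat 1, - mat 1}" by simp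
  next
    fix x y :: mat2 assume "x \<in> {mat 1, - mat 1}" "y \<in> {mat 1, - mat 1}"
    then show "x \<otimes>\<^bsub>SL2R\<^esub> y \<in> {mat 1, - mat 1}"
      by (elim insertE emptyE; simp add: SL2R_def mat2_uminus_mul)
  next
    show "{mat 1, - mat 1} \<subseteq> carrier SL2R" using sq(2) by blast
  next
    show "\<one>\<^bsub>SL2R\<^esub> \<in> {mat 1, - mat 1}" by (simp add: SL2R_def)
  qed
  show ?thesis
  proof (rule normalI[OF sub], rule ballI)
    fix x assume "x \<in> carrier SL2R"
    show "{mat 1, - mat 1} #>\<^bsub>SL2R\<^esub> x = x <#\<^bsub>SL2R\<^esub> {mat 1, - mat 1}"
      by (simp add: r_coset_def l_coset_def SL2R_def mat2_uminus_mul)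
  qed
qed

lemma group_PSL2R: "group PSL2R"
  unfolding PSL2R_def by (rule normal.factorgroup_is_group[OF normal_pm_one])

lemma psl_class_eq: "psl_class A = {A, - A}"
  by (simp add: psl_class_def r_coset_def SL2R_def mat2_uminus_mul insert_commute)

lemma carrier_PSL2R: "carrier PSL2R = psl_class ` carrier SL2R"
  by (auto simp only: PSL2R_def FactGroup_def RCOSETS_def psl_class_def partial_object.simps)

lemma openin_PSL2R_topology:
  "openin PSL2R_topology U \<longleftrightarrow> U \<subseteq> carrier PSL2R \<and>
     openin (top_of_set (carrier SL2R)) {A \<in> carrier SL2R. psl_class A \<in> U}"
proof -
  let ?pre = "\<lambda>U. {A \<in> carrier SL2R. psl_class A \<in> U}"
  have "istopology (\<lambda>U. U \<subseteq> carrier PSL2R \<and> openin (top_of_set (carrier SL2R)) (?pre U))"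
    unfolding istopology_def
  proof (intro conjI allI impI; (elim conjE)?)
    fix U V assume "openin (top_of_set (carrier SL2R)) (?pre U)"
      "openin (top_of_set (carrier SL2R)) (?pre V)"
    moreover have "?pre (U \<inter> V) = ?pre U \<inter> ?pre V" by blast
    ultimately show "openin (top_of_set (carrier SL2R)) (?pre (U \<inter> V))"
      by (simp only: openin_Int)
  next
    fix U V :: "mat2 set set" assume "U \<subseteq> carrier PSL2R"
    then show "U \<inter> V \<subseteq> carrier PSL2R" by blast
  next
    fix K assume K: "\<forall>U\<in>K. U \<subseteq> carrier PSL2R \<and>
      openin (top_of_set (carrier SL2R)) (?pre U)"
    then show "\<Union>K \<subseteq> carrier PSL2R" by blast
    have "?pre (\<Union>K) = \<Union>(?pre ` K)" by blast
    moreover have "openin (top_of_set (carrier SL2R)) (\<Union>(?pre ` K))"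
      using K by (intro openin_Union) blast
    ultimately show "openin (top_of_set (carrier SL2R)) (?pre (\<Union>K))"
      by (simp only:)
  qed
  then show ?thesis by (simp only: PSL2R_topology_def topology_inverse')
qed

lemma topspace_PSL2R_topology: "topspace PSL2R_topology = carrier PSL2R"
proof
  show "topspace PSL2R_topology \<subseteq> carrier PSL2R"
    using openin_PSL2R_topology[of "topspace PSL2R_topology"] openin_topspace by blast
  have "{A \<in> carrier SL2R. psl_class A \<in> carrier PSL2R} = carrier SL2R"
    unfolding carrier_PSL2R by blast
  then have "openin PSL2R_topology (carrier PSL2R)"
    by (simp only: openin_PSL2R_topology openin_subtopology_self subset_refl simp_thms)
  then show "carrier PSL2R \<subseteq> topspace PSL2R_topology" by (rule openin_subset)
qed

lemma quotient_map_psl_class: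
  "quotient_map (top_of_set (carrier SL2R)) PSL2R_topology psl_class"
  unfolding quotient_map_def topspace_PSL2R_topology topspace_euclidean_subtopology
  unfolding openin_PSL2R_topology carrier_PSL2R by blast

end

theory Submission
  imports Defs
begin

text \<open>
  The universal cover of PSL(2,R) acts on the universal cover of the projective line, so its elements are
  increasing maps of the real line that commute with integer translations. A representation together with
  its Euler class becomes a solution of the surface relation with right-hand side an integer translation.
  Each parabolic peripheral element lies in one of two conjugacy classes, its sign, and the sign vectors
  decompose the representation space into open pieces. It remains to see that every piece is connected and
  to decide when it is empty.

  For positive genus, every handle is deformed, with its commutator fixed, until b is hyperbolic; the
  commutator then is a product of two hyperbolic elements. The factors of the relation are removed one by
  one. The fibre of each such step is a set of fixed points v and strengths t; its projection to the
  circle is connected, because the displacement of an element of PSL(2,R) is governed by a binary quadratic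
  form, which changes sign at most twice. The last factor is solved for. In genus zero the same method applies
  to the parabolic factors. The 2p additional components consist of abelian representations in which exactly
  one sign differs from the others; in the additional component for n = 1 or n = -1 all signs agree.
\<close>

subsection \<open>Lifts of projective maps\<close>

text \<open>A fixed point is a real number of which only the class modulo integers matters, and a
  representation has many lifts. Forming quotients would spoil the product structure of the
  parameter spaces, so connectedness is expressed by clopen sets saturated for a relation
  (\<open>sconn\<close>). A fibration with connected fibres then needs only open horizontal slices,
  not local triviality. Displacement oscillates by less than 1. A window of length at least 1 for
  the displacement therefore cuts out an arc of fixed points, although an intersection of two arcs
  may be disconnected. The integer regions \<open>J\<close> and \<open>Lr\<close> are made so that
  removing a factor leads to a region of the same shape. Before the last factor is determined, the
  strength of the factor in front of it is adjusted until the maximal displacement is an integer.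
  The obstacle is a fixed point shared by these two factors. In a handle it can be moved away with
  the commutator kept. On a sphere it can be removed unless it is shared by all factors, and such
  abelian representations either connect to the others or make up a whole sign piece; the latter is
  the origin of the summand 2p.\<close>

text \<open>The real number x stands for the line spanned by (cos (pi x), sin (pi x)), so the integer translations are the
  deck transformations.\<close>

definition lifts :: "real \<Rightarrow> real \<Rightarrow> real \<Rightarrow> real \<Rightarrow> (real \<Rightarrow> real) \<Rightarrow> bool" where
  "lifts a b c d F \<longleftrightarrow> a * d - b * c = 1 \<and> continuous_on UNIV F \<and>
     (\<forall>x. \<exists>r>0. a * cos (pi * x) + b * sin (pi * x) = r * cos (pi * F x) \<and>
                c * cos (pi * x) + d * sin (pi * x) = r * sin (pi * F x))"

definition Gt :: "(real \<Rightarrow> real) set" where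
  "Gt = {F. \<exists>a b c d. lifts a b c d F}"

lemma lifts_Gt: "lifts a b c d F \<Longrightarrow> F \<in> Gt"
  unfolding Gt_def by blast

text \<open>The determinant is 1, so the wedge of two direction vectors equals the wedge of their
  images. The sign of the sine thus controls the order of the values of \<open>F\<close>.\<close>

lemma lifts_wedge:
  assumes "lifts a b c d F"
  shows "\<exists>r>0. sin (pi * (y - x)) = r * sin (pi * (F y - F x))"
proof -
  obtain r where r: "r > 0" "a * cos (pi * x) + b * sin (pi * x) = r * cos (pi * F x)"
    "c * cos (pi * x) + d * sin (pi * x) = r * sin (pi * F x)"
    using assms unfolding lifts_def by blast
  obtain s where s: "s > 0" "a * cos (pi * y) + b * sin (pi * y) = s * cos (pi * F y)"
    "c * cos (pi * y) + d * sin (pi * y) = s * sin (pi * F y)"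
    using assms unfolding lifts_def by blast
  have det: "a * d - b * c = 1" using assms unfolding lifts_def by blast
  have "sin (pi * (y - x)) = (a * d - b * c) * (sin (pi * y) * cos (pi * x) - cos (pi * y) * sin (pi * x))"
    by (simp add: det right_diff_distrib sin_diff)
  also have "\<dots> = (a * cos (pi * x) + b * sin (pi * x)) * (c * cos (pi * y) + d * sin (pi * y))
     - (c * cos (pi * x) + d * sin (pi * x)) * (a * cos (pi * y) + b * sin (pi * y))"
    by (simp add: algebra_simps)
  also have "\<dots> = (r * s) * sin (pi * (F y - F x))"
    unfolding r s by (simp add: right_diff_distrib sin_diff algebra_simps)
  finally show ?thesis using r(1) s(1) by (intro exI[of _ "r * s"]) simp
qed

text \<open>For \<open>y\<close> strictly between \<open>x\<close> and \<open>x + 1\<close> the sine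
  of \<open>pi * (F y - F x)\<close> is positive, so the difference avoids 1 and -1. It is 0 at
  \<open>y = x\<close> and by continuity stays between them.\<close>

lemma lifts_mono_bounds:
  assumes "lifts a b c d F" "x < y" "y < x + 1"
  shows "F x < F y" "F y < F x + 1"
proof -
  have cont: "continuous_on UNIV F" using assms unfolding lifts_def by blast
  have pos: "sin (pi * (F z - F x)) > 0" if z: "x < z" "z < x + 1" for z
  proof -
    obtain r where "r > 0" "sin (pi * (z - x)) = r * sin (pi * (F z - F x))"
      using lifts_wedge[OF assms(1)] by blast
    moreover have "sin (pi * (z - x)) > 0"
      using z by (intro sin_gt_zero) auto
    ultimately show ?thesis by (metis zero_less_mult_pos)
  qed
  have "F y - F x < 1"
  proof (rule ccontr)
    assume "\<not> F y - F x < 1"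
    then have "\<exists>z\<ge>x. z \<le> y \<and> F z = F x + 1"
      using assms continuous_on_subset[OF cont] by (intro IVT') auto
    then obtain z where z: "x \<le> z" "z \<le> y" "F z = F x + 1" by blast
    then have "x < z" by (cases "x = z") auto
    with pos[of z] z assms show False by auto
  qed
  then show "F y < F x + 1" by simp
  have "F y - F x > -1"
  proof (rule ccontr)
    assume "\<not> F y - F x > -1"
    then have "\<exists>z\<ge>x. z \<le> y \<and> F z = F x - 1"
      using assms continuous_on_subset[OF cont] by (intro IVT2') auto
    then obtain z where z: "x \<le> z" "z \<le> y" "F z = F x - 1" by blast
    then have "x < z" by (cases "x = z") auto
    with pos[of z] z assms show False by auto
  qed
  then show "F x < F y"
  proof (rule_tac ccontr)
    assume "F y - F x > -1" "\<not> F x < F y"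
    then have "0 \<le> sin (pi * (F x - F y))"
      by (intro sin_ge_zero) (auto simp: mult_le_cancel_left1)
    moreover have "sin (pi * (F x - F y)) = - sin (pi * (F y - F x))"
      by (metis minus_diff_eq mult_minus_right sin_minus)
    ultimately show False using pos[OF assms(2,3)] by simp
  qed
qed

text \<open>The vector at \<open>x + 1\<close> is the negative of the vector at \<open>x\<close>, so
  the increment is an odd integer; limits from the left confine it to \<open>[0, 1]\<close>.\<close>

lemma lifts_period:
  assumes "lifts a b c d F"
  shows "F (x + 1) = F x + 1"
proof -
  have cont: "continuous_on UNIV F" using assms unfolding lifts_def by blast
  have lim: "((\<lambda>y. F y) \<longlongrightarrow> F (x + 1)) (at_left (x + 1))"
    using cont by (auto simp: continuous_on_def intro: tendsto_within_subset)
  have ev: "eventually (\<lambda>y. x < y \<and> y < x + 1) (at_left (x + 1))"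
    unfolding eventually_at_left_field by (intro exI[of _ x]) auto
  have l: "F x \<le> F (x + 1)"
    by (rule tendsto_lowerbound[OF lim]) (use ev lifts_mono_bounds[OF assms] in \<open>auto elim!: eventually_mono intro: less_imp_le\<close>)
  have u: "F (x + 1) \<le> F x + 1"
    by (rule tendsto_upperbound[OF lim]) (use ev lifts_mono_bounds[OF assms] in \<open>auto elim!: eventually_mono intro: less_imp_le\<close>)
  obtain r where r: "r > 0" "a * cos (pi * x) + b * sin (pi * x) = r * cos (pi * F x)"
    "c * cos (pi * x) + d * sin (pi * x) = r * sin (pi * F x)"
    using assms unfolding lifts_def by blast
  obtain s where s: "s > 0" "a * cos (pi * (x+1)) + b * sin (pi * (x+1)) = s * cos (pi * F (x+1))"
    "c * cos (pi * (x+1)) + d * sin (pi * (x+1)) = s * sin (pi * F (x+1))"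
    using assms unfolding lifts_def by blast
  have e: "s * cos (pi * F (x+1)) = - (r * cos (pi * F x))" "s * sin (pi * F (x+1)) = - (r * sin (pi * F x))"
    using r s by (simp_all add: distrib_left)
  have "s * cos (pi * (F (x+1) - F x)) = s * cos (pi * F (x+1)) * cos (pi * F x) + s * sin (pi * F (x+1)) * sin (pi * F x)"
    by (simp add: right_diff_distrib cos_diff algebra_simps)
  also have "\<dots> = - r * (cos (pi * F x) * cos (pi * F x) + sin (pi * F x) * sin (pi * F x))"
    unfolding e by (simp only: distrib_left mult_minus_left mult.assoc)
  also have "\<dots> = - r" by (simp flip: power2_eq_square)
  finally have "s * cos (pi * (F (x+1) - F x)) = - r" .
  then have neg: "cos (pi * (F (x+1) - F x)) < 0" using r s
    by (metis mult_nonneg_nonneg neg_0_le_iff_le not_le less_le_not_le linorder_not_less)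
  have "s * sin (pi * (F (x+1) - F x)) = s * sin (pi * F (x+1)) * cos (pi * F x) - s * cos (pi * F (x+1)) * sin (pi * F x)"
    by (simp add: right_diff_distrib sin_diff algebra_simps)
  also have "\<dots> = 0" unfolding e by simp
  finally have z: "sin (pi * (F (x+1) - F x)) = 0" using s by simp
  have "F (x + 1) - F x = 1"
  proof (rule ccontr)
    assume "F (x + 1) - F x \<noteq> 1"
    then have lt: "F (x+1) - F x < 1" using u by simp
    show False
    proof (cases "F (x+1) - F x = 0")
      case True then show False using neg by simp
    next
      case False
      then have "sin (pi * (F (x+1) - F x)) > 0" using l lt by (intro sin_gt_zero) auto
      with z show False by simp
    qed
  qed
  then show ?thesis by simp
qed

lemma Gt_cont: "F \<in> Gt \<Longrightarrow> continuous_on S F"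
  unfolding Gt_def lifts_def by (auto intro: continuous_on_subset)

lemma Gt_isCont: "F \<in> Gt \<Longrightarrow> isCont F x"
  using Gt_cont[of F UNIV] by (simp add: continuous_on_eq_continuous_at)

lemma Gt_period: "F \<in> Gt \<Longrightarrow> F (x + 1) = F x + 1"
  unfolding Gt_def using lifts_period by blast

lemma Gt_period_int: "F \<in> Gt \<Longrightarrow> F (x + of_int k) = F x + of_int k"
proof (induct k rule: int_induct[where k=0])
  case (step1 i)
  then show ?case using Gt_period[of F "x + of_int i"] by (simp add: add.assoc)
next
  case (step2 i)
  then show ?case using Gt_period[of F "x + of_int (i - 1)"] by simp
qed simp

lemma Gt_less: assumes "F \<in> Gt" "x < y" shows "F x < F y"
proof -
  obtain a b c d where L: "lifts a b c d F" using assms unfolding Gt_def by blast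
  define k where "k = \<lfloor>y - x\<rfloor>"
  have k: "of_int k \<le> y - x" "y - x < of_int k + 1" "k \<ge> 0"
    unfolding k_def using assms by (auto simp: of_int_floor_le)
  have e: "F (y - of_int k) = F y - of_int k" using Gt_period_int[OF assms(1), of "y - of_int k" k] by simp
  show ?thesis
  proof (cases "y - x = of_int k")
    case True
    then have "F x = F y - of_int k" using e by (simp add: algebra_simps)
    moreover have "k > 0" using True assms(2) k(3) by (cases "k = 0") auto
    ultimately show ?thesis by simp
  next
    case False
    then have "F x < F (y - of_int k)" using k by (intro lifts_mono_bounds(1)[OF L]) auto
    then show ?thesis using e k(3) by simp
  qed
qed

lemma Gt_less_iff [simp]: "F \<in> Gt \<Longrightarrow> F x < F y \<longleftrightarrow> x < y"
  by (metis Gt_less linorder_neqE_linordered_idom order_less_asym)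

lemma Gt_le_iff [simp]: "F \<in> Gt \<Longrightarrow> F x \<le> F y \<longleftrightarrow> x \<le> y"
  by (simp add: linorder_not_less[symmetric])

lemma Gt_eq_iff [simp]: "F \<in> Gt \<Longrightarrow> F x = F y \<longleftrightarrow> x = y"
  by (simp add: order_eq_iff)

abbreviation ginv :: "(real \<Rightarrow> real) \<Rightarrow> real \<Rightarrow> real" where
  "ginv F \<equiv> inv_into UNIV F"

lemma lifts_id: "lifts 1 0 0 1 id"
  unfolding lifts_def by (auto intro!: exI[of _ 1] continuous_intros)

lemma id_Gt [simp]: "id \<in> Gt" using lifts_id by (rule lifts_Gt)

lemma lifts_comp:
  assumes "lifts a b c d F" "lifts a' b' c' d' G"
  shows "lifts (a*a' + b*c') (a*b' + b*d') (c*a' + d*c') (c*b' + d*d') (F \<circ> G)"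
  unfolding lifts_def
proof (intro conjI allI)
  have det: "a * d - b * c = 1" "a' * d' - b' * c' = 1" using assms unfolding lifts_def by blast+
  have "(a*a' + b*c') * (c*b' + d*d') - (a*b' + b*d') * (c*a' + d*c') = (a * d - b * c) * (a' * d' - b' * c')"
    by (simp add: algebra_simps)
  then show "(a*a' + b*c') * (c*b' + d*d') - (a*b' + b*d') * (c*a' + d*c') = 1" using det by simp
  show "continuous_on UNIV (F \<circ> G)"
    using assms unfolding lifts_def by (metis continuous_on_compose continuous_on_subset subset_UNIV)
  fix x
  obtain r where r: "r > 0" "a' * cos (pi * x) + b' * sin (pi * x) = r * cos (pi * G x)"
    "c' * cos (pi * x) + d' * sin (pi * x) = r * sin (pi * G x)"
    using assms unfolding lifts_def by blast
  obtain s where s: "s > 0" "a * cos (pi * G x) + b * sin (pi * G x) = s * cos (pi * F (G x))"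
    "c * cos (pi * G x) + d * sin (pi * G x) = s * sin (pi * F (G x))"
    using assms unfolding lifts_def by blast
  have "(a*a' + b*c') * cos (pi * x) + (a*b' + b*d') * sin (pi * x)
     = a * (a' * cos (pi * x) + b' * sin (pi * x)) + b * (c' * cos (pi * x) + d' * sin (pi * x))"
    by (simp add: algebra_simps)
  also have "\<dots> = r * (a * cos (pi * G x) + b * sin (pi * G x))"
    unfolding r by (simp add: algebra_simps)
  finally have 1: "(a*a' + b*c') * cos (pi * x) + (a*b' + b*d') * sin (pi * x) = r * s * cos (pi * (F \<circ> G) x)"
    unfolding s by simp
  have "(c*a' + d*c') * cos (pi * x) + (c*b' + d*d') * sin (pi * x)
     = c * (a' * cos (pi * x) + b' * sin (pi * x)) + d * (c' * cos (pi * x) + d' * sin (pi * x))"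
    by (simp add: algebra_simps)
  also have "\<dots> = r * (c * cos (pi * G x) + d * sin (pi * G x))"
    unfolding r by (simp add: algebra_simps)
  finally have 2: "(c*a' + d*c') * cos (pi * x) + (c*b' + d*d') * sin (pi * x) = r * s * sin (pi * (F \<circ> G) x)"
    unfolding s by simp
  show "\<exists>r>0. (a*a' + b*c') * cos (pi * x) + (a*b' + b*d') * sin (pi * x) = r * cos (pi * (F \<circ> G) x) \<and>
    (c*a' + d*c') * cos (pi * x) + (c*b' + d*d') * sin (pi * x) = r * sin (pi * (F \<circ> G) x)"
    using 1 2 r(1) s(1) by (intro exI[of _ "r * s"]) simp
qed

lemma comp_Gt [simp, intro]: "F \<in> Gt \<Longrightarrow> G \<in> Gt \<Longrightarrow> F \<circ> G \<in> Gt"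
  unfolding Gt_def using lifts_comp by blast

lemma Gt_bij: assumes "F \<in> Gt" shows "bij F"
proof (rule bijI)
  show "inj F" using assms by (auto intro: injI)
  show "surj F" unfolding surj_def
  proof
    fix y
    define k where "k = \<lfloor>y - F 0\<rfloor>"
    have "of_int k \<le> y - F 0" "y - F 0 \<le> of_int k + 1" unfolding k_def by linarith+
    then have "\<exists>x\<ge>of_int k. x \<le> of_int k + 1 \<and> F x = y"
      using Gt_period_int[OF assms, of 0 k] Gt_period_int[OF assms, of 0 "k+1"] assms
      by (intro IVT' Gt_cont) (auto simp: algebra_simps)
    then show "\<exists>x. y = F x" by blast
  qed
qed

lemma Gt_inv_simps [simp]: "F \<in> Gt \<Longrightarrow> ginv F (F x) = x" "F \<in> Gt \<Longrightarrow> F (ginv F x) = x"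
  using Gt_bij by (auto simp: bij_def inv_f_f surj_f_inv_f)

lemma Gt_inv_comp [simp]: "F \<in> Gt \<Longrightarrow> ginv F \<circ> F = id" "F \<in> Gt \<Longrightarrow> F \<circ> ginv F = id"
  by (auto simp: fun_eq_iff)

lemma lifts_inv: assumes "lifts a b c d F" shows "lifts d (-b) (-c) a (ginv F)"
  unfolding lifts_def
proof (intro conjI allI)
  have G: "F \<in> Gt" using assms by (rule lifts_Gt)
  have det: "a * d - b * c = 1" using assms unfolding lifts_def by blast+
  then show "d * a - - b * - c = 1" by (simp add: algebra_simps)
  show "continuous_on UNIV (ginv F)"
  proof -
    have "isCont (ginv F) (F x)" for x
      by (rule isCont_inverse_function[where d=1 and f=F]) (use G Gt_isCont in auto)
    then have "isCont (ginv F) x" for x using G by (metis Gt_inv_simps(2))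
    then show ?thesis by (simp add: continuous_on_eq_continuous_at)
  qed
  fix x
  define y where "y = ginv F x"
  have Fy: "F y = x" unfolding y_def using G by simp
  obtain r where r: "r > 0" "a * cos (pi * y) + b * sin (pi * y) = r * cos (pi * x)"
    "c * cos (pi * y) + d * sin (pi * y) = r * sin (pi * x)"
    using assms Fy unfolding lifts_def by metis
  have "r * (d * cos (pi * x) + - b * sin (pi * x)) = (a * d - b * c) * cos (pi * y)"
    using r by algebra
  then have 1: "d * cos (pi * x) + - b * sin (pi * x) = 1/r * cos (pi * y)"
    using det r(1) by (simp add: field_simps)
  have "r * (- c * cos (pi * x) + a * sin (pi * x)) = (a * d - b * c) * sin (pi * y)"
    using r by algebra
  then have 2: "- c * cos (pi * x) + a * sin (pi * x) = 1/r * sin (pi * y)"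
    using det r(1) by (simp add: field_simps)
  show "\<exists>r>0. d * cos (pi * x) + - b * sin (pi * x) = r * cos (pi * ginv F x) \<and>
             - c * cos (pi * x) + a * sin (pi * x) = r * sin (pi * ginv F x)"
    using 1 2 r(1) unfolding y_def by (intro exI[of _ "1/r"]) simp
qed

lemma inv_Gt [simp, intro]: "F \<in> Gt \<Longrightarrow> ginv F \<in> Gt"
  unfolding Gt_def using lifts_inv by blast

lemma inv_comp_Gt: "F \<in> Gt \<Longrightarrow> G \<in> Gt \<Longrightarrow> ginv (F \<circ> G) = ginv G \<circ> ginv F"
  by (rule o_inv_distrib) (auto intro: Gt_bij)

lemma inv_inv_Gt [simp]: "F \<in> Gt \<Longrightarrow> ginv (ginv F) = F"
  by (rule inv_inv_eq) (rule Gt_bij)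

lemma sin_eq_0_pi: "sin (pi * x) = 0 \<longleftrightarrow> (\<exists>k::int. x = of_int k)"
proof -
  have "(pi * x = of_int k * pi) = (x = of_int k)" for k by auto
  then show ?thesis unfolding sin_zero_iff_int2 by simp
qed

lemma continuous_int_valued_constant:
  fixes f :: "real \<Rightarrow> real"
  assumes "continuous_on UNIV f" "\<And>x. \<exists>k::int. f x = of_int k"
  obtains k :: int where "\<And>x. f x = of_int k"
proof -
  have "f constant_on UNIV"
  proof (rule continuous_discrete_range_constant[OF connected_UNIV assms(1)])
    fix x
    show "\<exists>e>0. \<forall>y. y \<in> UNIV \<and> f y \<noteq> f x \<longrightarrow> e \<le> norm (f y - f x)"
    proof (intro exI[of _ 1] conjI allI impI)
      fix y assume "y \<in> UNIV \<and> f y \<noteq> f x"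
      then show "1 \<le> norm (f y - f x)"
        using assms(2)[of x] assms(2)[of y]
        by (auto simp flip: of_int_diff of_int_abs)
    qed simp
  qed
  then obtain y where y: "\<And>x. f x = y" unfolding constant_on_def by auto
  then show ?thesis using assms(2)[of 0] that by metis
qed

text \<open>The image vectors are parallel at every \<open>x\<close>, so the difference of the lifts
  is an integer there and constant by continuity. The two alternatives are the two matrices over one
  element of PSL(2,R).\<close>

lemma lifts_unique_mod:
  assumes "lifts a b c d F" "lifts a' b' c' d' G"
    "(a' = a \<and> b' = b \<and> c' = c \<and> d' = d) \<or> (a' = -a \<and> b' = -b \<and> c' = -c \<and> d' = -d)"
  obtains k :: int where "\<And>x. G x = F x + of_int k"
proof -
  have "\<exists>k::int. G x - F x = of_int k" for x
  proof -
    obtain r where r: "r > 0" "a * cos (pi * x) + b * sin (pi * x) = r * cos (pi * F x)"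
      "c * cos (pi * x) + d * sin (pi * x) = r * sin (pi * F x)"
      using assms unfolding lifts_def by blast
    obtain s where s: "s > 0" "a' * cos (pi * x) + b' * sin (pi * x) = s * cos (pi * G x)"
      "c' * cos (pi * x) + d' * sin (pi * x) = s * sin (pi * G x)"
      using assms unfolding lifts_def by blast
    have "r * s * sin (pi * (G x - F x)) = (r * cos (pi * F x)) * (s * sin (pi * G x)) - (r * sin (pi * F x)) * (s * cos (pi * G x))"
      by (simp add: right_diff_distrib sin_diff algebra_simps)
    also have "\<dots> = 0" unfolding r(2,3)[symmetric] s(2,3)[symmetric] using assms(3) by (auto simp: algebra_simps)
    finally show ?thesis using r(1) s(1) by (simp add: sin_eq_0_pi)
  qed
  moreover have "continuous_on UNIV (\<lambda>x. G x - F x)"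
    using assms unfolding lifts_def by (intro continuous_intros) auto
  ultimately obtain k :: int where "\<And>x. G x - F x = of_int k"
    using continuous_int_valued_constant by metis
  then show ?thesis using that[of k] by (metis add_diff_cancel_left' diff_add_cancel add.commute)
qed

lemma lifts_eqI:
  assumes "lifts a b c d F" "lifts a' b' c' d' G"
    "(a' = a \<and> b' = b \<and> c' = c \<and> d' = d) \<or> (a' = -a \<and> b' = -b \<and> c' = -c \<and> d' = -d)"
    "F x = G x"
  shows "F = G"
proof -
  obtain k :: int where k: "\<And>x. G x = F x + of_int k" using lifts_unique_mod[OF assms(1-3)] by blast
  with assms(4) show ?thesis by (simp add: fun_eq_iff)
qed

text \<open>The two matrices agree on each direction up to a positive factor. The basis vectors and
  the diagonal, at \<open>x\<close> = 0, 1/2 and 1/4, force one common factor, and its square is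
  1.\<close>

lemma lifts_matrix_unique:
  assumes "lifts a b c d F" "lifts a' b' c' d' F"
  shows "a = a'" "b = b'" "c = c'" "d = d'"
proof -
  have det: "a * d - b * c = 1" "a' * d' - b' * c' = 1" using assms unfolding lifts_def by blast+
  have ex: "\<exists>k>0. a' * cos (pi * x) + b' * sin (pi * x) = k * (a * cos (pi * x) + b * sin (pi * x)) \<and>
     c' * cos (pi * x) + d' * sin (pi * x) = k * (c * cos (pi * x) + d * sin (pi * x))" for x
  proof -
    obtain r where r: "r > 0" "a * cos (pi * x) + b * sin (pi * x) = r * cos (pi * F x)"
      "c * cos (pi * x) + d * sin (pi * x) = r * sin (pi * F x)"
      using assms unfolding lifts_def by blast
    obtain s where s: "s > 0" "a' * cos (pi * x) + b' * sin (pi * x) = s * cos (pi * F x)"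
      "c' * cos (pi * x) + d' * sin (pi * x) = s * sin (pi * F x)"
      using assms unfolding lifts_def by blast
    show ?thesis using r s by (intro exI[of _ "s / r"]) simp
  qed
  obtain k0 where k0: "k0 > 0" "a' = k0 * a" "c' = k0 * c" using ex[of 0] by auto
  obtain k1 where k1: "k1 > 0" "b' = k1 * b" "d' = k1 * d" using ex[of "1/2"] by auto
  obtain k2 where "k2 > 0" "a' * cos (pi/4) + b' * sin (pi/4) = k2 * (a * cos (pi/4) + b * sin (pi/4))"
     "c' * cos (pi/4) + d' * sin (pi/4) = k2 * (c * cos (pi/4) + d * sin (pi/4))"
    using ex[of "1/4"] by auto
  then have "k2 > 0" "(a' + b') * sqrt 2 = k2 * (a + b) * sqrt 2" "(c' + d') * sqrt 2 = k2 * (c + d) * sqrt 2"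
    unfolding cos_45 sin_45 by (simp_all add: algebra_simps)
  then have k2: "k2 > 0" "a' + b' = k2 * (a + b)" "c' + d' = k2 * (c + d)"
    by simp_all
  have "(k0 - k2) * a + (k1 - k2) * b = 0" "(k0 - k2) * c + (k1 - k2) * d = 0"
    using k0 k1 k2 by (simp_all add: algebra_simps)
  then have "(k0 - k2) * (a * d - b * c) = 0" "(k1 - k2) * (a * d - b * c) = 0" by algebra+
  then have eq: "k0 = k2" "k1 = k2" using det by simp_all
  have "k2 * k2 * (a * d - b * c) = 1" using det(2) k0 k1 eq by (simp add: algebra_simps)
  then have "k2 * k2 = 1" using det by simp
  then have "k2 = 1" using k2(1) by (simp add: square_eq_1_iff)
  then show "a = a'" "b = b'" "c = c'" "d = d'" using k0 k1 eq by simp_all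
qed

section \<open>Rotations and upper triangular maps\<close>

definition T :: "real \<Rightarrow> real \<Rightarrow> real" where "T v x = x + v"

lemma lifts_T: "lifts (cos (pi * v)) (- sin (pi * v)) (sin (pi * v)) (cos (pi * v)) (T v)"
  unfolding lifts_def T_def
  by (auto intro!: continuous_intros exI[of _ 1]
     simp: distrib_left sin_add cos_add algebra_simps power2_eq_square[symmetric])

lemma T_Gt [simp, intro]: "T v \<in> Gt" using lifts_T by (rule lifts_Gt)

lemma T_comp [simp]: "T v \<circ> T w = T (v + w)" by (simp add: T_def fun_eq_iff)
lemma T_0 [simp]: "T 0 = id" by (simp add: T_def fun_eq_iff)
lemma inv_T [simp]: "ginv (T v) = T (- v)"
  by (rule inv_unique_comp) (simp_all)

lemma T_int_comm: "F \<in> Gt \<Longrightarrow> F \<circ> T (of_int k) = T (of_int k) \<circ> F"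
  by (simp add: fun_eq_iff T_def Gt_period_int)

text \<open>The image of the direction \<open>x\<close> under the matrix with rows
  \<open>(exp l, - t * exp l)\<close> and \<open>(0, exp (- l))\<close>, as a complex number. The
  minus sign makes a larger \<open>t\<close> push points in the positive direction.\<close>

definition Uvec :: "real \<times> real \<times> real \<Rightarrow> complex" where
  "Uvec = (\<lambda>(l, t, x). Complex (exp l * cos (pi * x) - t * exp l * sin (pi * x)) (exp (- l) * sin (pi * x)))"

text \<open>Lifts of upper triangular matrices are obtained from a continuous logarithm of the image vectors,
  which exists because the domain is simply connected.\<close>

definition Ulog :: "real \<times> real \<times> real \<Rightarrow> complex" where
  "Ulog = (SOME g. continuous_on UNIV g \<and> (\<forall>q. Uvec q = exp (g q)))"

text \<open>Subtracting the argument at \<open>x = 0\<close> selects the lift that fixes 0,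
  whichever logarithm was chosen.\<close>

definition Uz :: "real \<Rightarrow> real \<Rightarrow> real \<Rightarrow> real" where
  "Uz l t x = (Im (Ulog (l, t, x)) - Im (Ulog (l, t, 0))) / pi"

text \<open>By \<open>Gt_fix_U\<close> these are all elements fixing \<open>v\<close>. The
  eigenvalue at \<open>v\<close> is \<open>exp l\<close>; for \<open>l = 0\<close> they form the
  parabolic one-parameter group of \<open>v\<close>.\<close>

definition U :: "real \<Rightarrow> real \<Rightarrow> real \<Rightarrow> real \<Rightarrow> real" where
  "U v l t = T v \<circ> Uz l t \<circ> T (- v)"

lemma Uvec_nz: "Uvec q \<noteq> 0"
proof
  obtain l t x where q: "q = (l, t, x)" by (cases q) auto
  assume "Uvec q = 0"
  then have "sin (pi * x) = 0" "exp l * cos (pi * x) - t * exp l * sin (pi * x) = 0"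
    by (simp_all add: q Uvec_def complex_eq_iff)
  then have "sin (pi * x) = 0" "cos (pi * x) = 0" by simp_all
  then show False using sin_cos_squared_add[of "pi * x"] by simp
qed

lemma Ulog: "continuous_on UNIV Ulog" "Uvec q = exp (Ulog q)"
proof -
  have "continuous_on UNIV Uvec"
    unfolding Uvec_def Complex_eq by (simp add: case_prod_unfold) (intro continuous_intros)
  moreover have "contractible (UNIV :: (real \<times> real \<times> real) set)"
    by (intro convex_imp_contractible) simp
  ultimately obtain g where "continuous_on UNIV g" "\<And>q. q \<in> UNIV \<Longrightarrow> Uvec q = exp (g q)"
    using continuous_logarithm_on_contractible[of UNIV Uvec] Uvec_nz by metis
  then have "\<exists>g. continuous_on UNIV g \<and> (\<forall>q. Uvec q = exp (g q))" by blast
  then have "continuous_on UNIV Ulog \<and> (\<forall>q. Uvec q = exp (Ulog q))"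
    unfolding Ulog_def by (rule someI_ex)
  then show "continuous_on UNIV Ulog" "Uvec q = exp (Ulog q)" by blast+
qed

lemma continuous_on_Uz [continuous_intros]:
  assumes "continuous_on S l" "continuous_on S t" "continuous_on S x"
  shows "continuous_on S (\<lambda>q. Uz (l q) (t q) (x q))"
  unfolding Uz_def
  by (intro continuous_intros assms continuous_on_compose2[OF Ulog(1)]) auto

lemma lifts_Uz: "lifts (exp l) (- t * exp l) 0 (exp (- l)) (Uz l t)"
  unfolding lifts_def
proof (intro conjI allI)
  show "exp l * exp (- l) - - t * exp l * 0 = 1" by (simp flip: exp_add)
  show "continuous_on UNIV (Uz l t)" by (intro continuous_intros)
  fix x
  define g where "g = Ulog (l, t, x)"
  define h where "h = Ulog (l, t, 0)"
  \<comment> \<open>At \<open>x = 0\<close> the image vector is a positive real, so the subtracted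
    argument is a multiple of 2 pi and changes neither sine nor cosine.\<close>
  have "Uvec (l, t, 0) = exp h" unfolding h_def by (rule Ulog)
  then have "exp (Re h) * cos (Im h) = exp l" "exp (Re h) * sin (Im h) = 0"
    by (simp_all add: Uvec_def complex_eq_iff Re_exp Im_exp)
  then have "sin (Im h) = 0" "cos (Im h) > 0"
    by (simp, metis exp_gt_zero zero_less_mult_pos)
  then have h: "sin (Im h) = 0" "cos (Im h) = 1"
    using sin_cos_squared_add[of "Im h"] by (simp_all add: power2_eq_1_iff)
  have "Uvec (l, t, x) = exp g" unfolding g_def by (rule Ulog)
  then have g: "exp l * cos (pi * x) - t * exp l * sin (pi * x) = exp (Re g) * cos (Im g)"
    "exp (- l) * sin (pi * x) = exp (Re g) * sin (Im g)"
    by (simp_all add: Uvec_def complex_eq_iff Re_exp Im_exp)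
  have "pi * Uz l t x = Im g - Im h" by (simp add: Uz_def g_def h_def)
  then have "cos (pi * Uz l t x) = cos (Im g)" "sin (pi * Uz l t x) = sin (Im g)"
    using h by (simp_all add: cos_diff sin_diff)
  then show "\<exists>r>0. exp l * cos (pi * x) + - t * exp l * sin (pi * x) = r * cos (pi * Uz l t x) \<and>
             0 * cos (pi * x) + exp (- l) * sin (pi * x) = r * sin (pi * Uz l t x)"
    using g by (intro exI[of _ "exp (Re g)"]) simp
qed

lemma Uz_Gt [simp, intro]: "Uz l t \<in> Gt" using lifts_Uz by (rule lifts_Gt)
lemma U_Gt [simp, intro]: "U v l t \<in> Gt" unfolding U_def by simp
lemma Uz_0 [simp]: "Uz l t 0 = 0" by (simp add: Uz_def)
lemma U_fix [simp]: "U v l t v = v" by (simp add: U_def T_def)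
lemma U_zero: "U 0 l t = Uz l t" by (simp add: U_def)
lemma U_fix_int [simp]: "U v l t (v + of_int k) = v + of_int k" by (simp add: Gt_period_int)
lemma U_fix1 [simp]: "U v l t (v + 1) = v + 1" by (simp add: Gt_period)

lemma continuous_on_U_app [continuous_intros]:
  assumes "continuous_on S v" "continuous_on S l" "continuous_on S t" "continuous_on S x"
  shows "continuous_on S (\<lambda>q. U (v q) (l q) (t q) (x q))"
  unfolding U_def T_def o_def by (intro continuous_intros assms)

lemma continuous_on_U [continuous_intros]:
  assumes "continuous_on S v" "continuous_on S l" "continuous_on S t"
  shows "continuous_on S (\<lambda>q. U (v q) (l q) (t q))"
  by (intro continuous_on_coordinatewise_then_product continuous_intros assms)

lemma continuous_on_T [continuous_intros]:
  assumes "continuous_on S v"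
  shows "continuous_on S (\<lambda>q. T (v q))"
  unfolding T_def by (intro continuous_on_coordinatewise_then_product continuous_intros assms)

text \<open>Multiplication of upper triangular matrices. Both sides fix 0, which excludes a
  difference by an integer translation.\<close>

lemma Uz_comp: "Uz l t \<circ> Uz l' t' = Uz (l + l') (t' + t * exp (- 2 * l'))"
proof (rule lifts_eqI[where x=0, OF lifts_comp[OF lifts_Uz lifts_Uz] lifts_Uz])
  have e: "exp l' * exp (- 2 * l') = exp (- l')" by (simp flip: exp_add)
  have "(t' + t * exp (- 2 * l')) * exp (l + l') = t' * (exp l * exp l') + t * exp l * (exp l' * exp (- 2 * l'))"
    unfolding exp_add by algebra
  then have A: "(t' + t * exp (- 2 * l')) * exp (l + l') = t' * (exp l * exp l') + t * exp l * exp (- l')"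
    unfolding e .
  have "- (t' + t * exp (- 2 * l')) * exp (l + l') = exp l * (- t' * exp l') + - t * exp l * exp (- l')"
    by (subst mult_minus_left, subst A) algebra
  moreover have "exp (- (l + l')) = exp (- l) * exp (- l')" by (simp flip: exp_add)
  ultimately show "(exp (l + l') = exp l * exp l' + - t * exp l * 0 \<and>
     - (t' + t * exp (- 2 * l')) * exp (l + l') = exp l * (- t' * exp l') + - t * exp l * exp (- l') \<and>
     0 = 0 * exp l' + exp (- l) * 0 \<and> exp (- (l + l')) = 0 * (- t' * exp l') + exp (- l) * exp (- l')) \<or>
    (exp (l + l') = - (exp l * exp l' + - t * exp l * 0) \<and>
     - (t' + t * exp (- 2 * l')) * exp (l + l') = - (exp l * (- t' * exp l') + - t * exp l * exp (- l')) \<and>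
     0 = - (0 * exp l' + exp (- l) * 0) \<and> exp (- (l + l')) = - (0 * (- t' * exp l') + exp (- l) * exp (- l')))"
    by (simp add: exp_add)
qed simp

lemma U_comp: "U v l t \<circ> U v l' t' = U v (l + l') (t' + t * exp (- 2 * l'))"
proof -
  have "U v l t \<circ> U v l' t' = T v \<circ> (Uz l t \<circ> (T (- v) \<circ> T v) \<circ> Uz l' t') \<circ> T (- v)"
    unfolding U_def by (simp only: o_assoc)
  then show ?thesis by (simp add: Uz_comp U_def)
qed

lemma Uz_00 [simp]: "Uz 0 0 = id"
  by (rule lifts_eqI[where x=0, OF lifts_Uz lifts_id]) auto

lemma U_00 [simp]: "U v 0 0 = id" by (simp add: U_def)

lemma ginv_U: "ginv (U v l t) = U v (- l) (- t * exp (2 * l))"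
proof -
  have e: "exp (2 * l) * exp (- (2 * l)) = 1" by (simp flip: exp_add)
  show ?thesis by (rule inv_unique_comp) (simp_all add: U_comp e mult.assoc)
qed

lemma U_period: "U (v + of_int k) l t = U v l t"
proof
  fix x
  have "Uz l t (x - v + of_int (- k)) = Uz l t (x - v) + of_int (- k)" by (rule Gt_period_int) simp
  then show "U (v + of_int k) l t x = U v l t x" by (simp add: U_def T_def algebra_simps)
qed

lemma Uz_wedge:
  "\<exists>r>0. r * sin (pi * (Uz l s x - Uz l t x)) = (s - t) * (sin (pi * x))\<^sup>2"
proof -
  obtain a where a: "a > 0" "exp l * cos (pi * x) + - t * exp l * sin (pi * x) = a * cos (pi * Uz l t x)"
    "0 * cos (pi * x) + exp (- l) * sin (pi * x) = a * sin (pi * Uz l t x)"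
    using lifts_Uz[of l t] unfolding lifts_def by blast
  obtain b where b: "b > 0" "exp l * cos (pi * x) + - s * exp l * sin (pi * x) = b * cos (pi * Uz l s x)"
    "0 * cos (pi * x) + exp (- l) * sin (pi * x) = b * sin (pi * Uz l s x)"
    using lifts_Uz[of l s] unfolding lifts_def by blast
  have e: "exp l * exp (- l) = 1" by (simp flip: exp_add)
  have "(a * b) * sin (pi * (Uz l s x - Uz l t x)) = (a * cos (pi * Uz l t x)) * (b * sin (pi * Uz l s x)) - (a * sin (pi * Uz l t x)) * (b * cos (pi * Uz l s x))"
    by (simp add: right_diff_distrib sin_diff algebra_simps)
  also have "\<dots> = (s - t) * (sin (pi * x) * sin (pi * x)) * (exp l * exp (- l))"
    unfolding a(2,3)[symmetric] b(2,3)[symmetric] by (simp add: algebra_simps)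
  finally show ?thesis using a(1) b(1) e by (intro exI[of _ "a * b"]) (simp add: power2_eq_square)
qed

lemma Uz_bounds:
  assumes "0 < x" "x < 1" shows "0 < Uz l t x" "Uz l t x < 1"
proof -
  have "Uz l t 1 = 1" using Gt_period[OF Uz_Gt, of l t 0] by simp
  then show "0 < Uz l t x" "Uz l t x < 1"
    using Gt_less[OF Uz_Gt assms(1), of l t] Gt_less[OF Uz_Gt assms(2), of l t] Uz_0[of l t] by linarith+
qed

text \<open>The wedge of the two images is \<open>s - t\<close> times a square, and both images stay
  in \<open>(0, 1)\<close>, where the sign of the sine decides the order.\<close>

lemma Uz_less:
  assumes "0 < x" "x < 1" "t < s" shows "Uz l t x < Uz l s x"
proof (rule ccontr)
  assume "\<not> Uz l t x < Uz l s x"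
  then have "sin (pi * (Uz l t x - Uz l s x)) \<ge> 0"
    using Uz_bounds[OF assms(1,2), of l t] Uz_bounds[OF assms(1,2), of l s]
    by (intro sin_ge_zero) (auto simp: mult_le_cancel_left1)
  moreover obtain r where "r > 0" "r * sin (pi * (Uz l t x - Uz l s x)) = (t - s) * (sin (pi * x))\<^sup>2"
    using Uz_wedge by blast
  ultimately have "0 \<le> (t - s) * (sin (pi * x))\<^sup>2"
    by (metis mult_nonneg_nonneg less_imp_le)
  moreover have "sin (pi * x) > 0" using assms by (intro sin_gt_zero) auto
  then have "0 < (sin (pi * x))\<^sup>2" by simp
  ultimately show False using assms(3) by (simp add: zero_le_mult_iff)
qed

lemma U_less:
  assumes "v < x" "x < v + 1" "t < s" shows "U v l t x < U v l s x"
  using Uz_less[of "x - v" t s l] assms by (simp add: U_def T_def)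

lemma Uz_wedge_const:
  "\<exists>r>0. r * sin (pi * (Uz l t x - y)) = exp (- l) * sin (pi * x) * cos (pi * y) - exp l * (cos (pi * x) - t * sin (pi * x)) * sin (pi * y)"
proof -
  obtain a where a: "a > 0" "exp l * cos (pi * x) + - t * exp l * sin (pi * x) = a * cos (pi * Uz l t x)"
    "0 * cos (pi * x) + exp (- l) * sin (pi * x) = a * sin (pi * Uz l t x)"
    using lifts_Uz[of l t] unfolding lifts_def by blast
  have "a * sin (pi * (Uz l t x - y)) = (a * sin (pi * Uz l t x)) * cos (pi * y) - (a * cos (pi * Uz l t x)) * sin (pi * y)"
    by (simp add: right_diff_distrib sin_diff algebra_simps)
  also have "\<dots> = exp (- l) * sin (pi * x) * cos (pi * y) - exp l * (cos (pi * x) - t * sin (pi * x)) * sin (pi * y)"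
    unfolding a(2,3)[symmetric] by (simp add: algebra_simps)
  finally show ?thesis using a(1) by blast
qed

text \<open>The wedge of the image of \<open>x\<close> with the direction \<open>y\<close> is affine
  in \<open>t\<close> with the positive slope \<open>A\<close>, so its sign is eventually that of
  \<open>t\<close>.\<close>

lemma U_limit:
  assumes "v < x" "x < v + 1" "v < y" "y < v + 1"
  shows "\<exists>t0. \<forall>t\<ge>t0. U v l t x > y" "\<exists>t0. \<forall>t\<le>t0. U v l t x < y"
proof -
  define x' y' where "x' = x - v" and "y' = y - v"
  have xy: "0 < x'" "x' < 1" "0 < y'" "y' < 1" using assms by (auto simp: x'_def y'_def)
  have sx: "sin (pi * x') > 0" "sin (pi * y') > 0" using xy by (auto intro!: sin_gt_zero)
  define A where "A = exp l * sin (pi * x') * sin (pi * y')"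
  define B where "B = exp (- l) * sin (pi * x') * cos (pi * y') - exp l * cos (pi * x') * sin (pi * y')"
  have A: "A > 0" using sx by (simp add: A_def)
  have w: "\<exists>r>0. r * sin (pi * (Uz l t x' - y')) = B + t * A" for t
    using Uz_wedge_const[of l t x' y'] by (simp add: A_def B_def algebra_simps)
  have 1: "Uz l t x' > y'" if "B + t * A > 0" for t
  proof (rule ccontr)
    assume "\<not> Uz l t x' > y'"
    then have "sin (pi * (y' - Uz l t x')) \<ge> 0"
      using Uz_bounds[OF xy(1,2), of l t] xy by (intro sin_ge_zero) (auto simp: mult_le_cancel_left1)
    then have "sin (pi * (Uz l t x' - y')) \<le> 0"
      by (metis minus_diff_eq mult_minus_right neg_0_le_iff_le sin_minus)
    then show False using w[of t] that by (metis not_le mult_nonneg_nonpos less_imp_le)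
  qed
  have 2: "Uz l t x' < y'" if "B + t * A < 0" for t
  proof (rule ccontr)
    assume "\<not> Uz l t x' < y'"
    then have "sin (pi * (Uz l t x' - y')) \<ge> 0"
      using Uz_bounds[OF xy(1,2), of l t] xy by (intro sin_ge_zero) (auto simp: mult_le_cancel_left1)
    then show False using w[of t] that by (metis not_le mult_nonneg_nonneg less_imp_le)
  qed
  have "U v l t x > y" if "t \<ge> (\<bar>B\<bar> + 1) / A" for t
  proof -
    have "t * A \<ge> \<bar>B\<bar> + 1" using that A by (simp add: pos_divide_le_eq)
    then have "B + t * A > 0" by linarith
    then show ?thesis using 1[of t] by (simp add: U_def T_def x'_def y'_def)
  qed
  then show "\<exists>t0. \<forall>t\<ge>t0. U v l t x > y" by blast
  have "U v l t x < y" if "t \<le> - (\<bar>B\<bar> + 1) / A" for t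
  proof -
    have "t * A \<le> - (\<bar>B\<bar> + 1)" using that A by (simp add: pos_le_divide_eq)
    then have "B + t * A < 0" by linarith
    then show ?thesis using 2[of t] by (simp add: U_def T_def x'_def y'_def)
  qed
  then show "\<exists>t0. \<forall>t\<le>t0. U v l t x < y" by blast
qed

text \<open>Iwasawa decomposition: the rotation takes the positive first axis to the direction of
  the first column, and an upper triangular factor remains.\<close>

lemma lifts_exists: assumes "a * d - b * c = 1"
  obtains \<theta> l t where "lifts a b c d (T \<theta> \<circ> Uz l t)"
proof -
  define z where "z = Complex a c"
  have z0: "z \<noteq> 0" using assms by (auto simp: z_def complex_eq_iff)
  define \<theta> where "\<theta> = Arg z / pi"
  define \<rho> where "\<rho> = cmod z"
  have \<rho>: "\<rho> > 0" using z0 by (simp add: \<rho>_def)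
  have "z = of_real \<rho> * cis (Arg z)" unfolding \<rho>_def by (metis rcis_cmod_Arg rcis_def)
  then have ac: "a = \<rho> * cos (pi * \<theta>)" "c = \<rho> * sin (pi * \<theta>)"
    by (simp_all add: z_def \<theta>_def complex_eq_iff)
  define l where "l = ln \<rho>"
  have el: "exp l = \<rho>" "exp (- l) = 1 / \<rho>" using \<rho> by (auto simp: l_def exp_minus inverse_eq_divide)
  \<comment> \<open>The upper right entry of the triangular factor is the inner product of the
    columns over the norm of the first one, and it has to equal \<open>- t * exp l\<close>.\<close>
  define t where "t = - (a * b + c * d) / \<rho>\<^sup>2"
  define C where "C = cos (pi * \<theta>)"
  define S where "S = sin (pi * \<theta>)"
  have CS: "C * C + S * S = 1" unfolding C_def S_def by (simp flip: power2_eq_square)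
  have acs: "a = \<rho> * C" "c = \<rho> * S" using ac by (simp_all add: C_def S_def)
  have t\<rho>: "t * \<rho> = - (C * b + S * d)"
    using \<rho> by (simp add: t_def acs power2_eq_square field_simps)
  have i: "1 / \<rho> = C * d - S * b"
    using assms \<rho> by (simp add: acs field_simps)
  have "lifts (C * \<rho> + - S * 0) (C * (- t * \<rho>) + - S * (1 / \<rho>)) (S * \<rho> + C * 0) (S * (- t * \<rho>) + C * (1 / \<rho>)) (T \<theta> \<circ> Uz l t)"
    using lifts_comp[OF lifts_T lifts_Uz, of \<theta> l t] unfolding el C_def S_def by simp
  moreover have "C * (- t * \<rho>) + - S * (1 / \<rho>) = b"
  proof -
    have "C * (- t * \<rho>) + - S * (1 / \<rho>) = C * (C * b + S * d) - S * (C * d - S * b)"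
      using t\<rho> i by simp
    also have "\<dots> = b * (C * C + S * S)" by (simp add: algebra_simps)
    finally show ?thesis using CS by simp
  qed
  moreover have "S * (- t * \<rho>) + C * (1 / \<rho>) = d"
  proof -
    have "S * (- t * \<rho>) + C * (1 / \<rho>) = S * (C * b + S * d) + C * (C * d - S * b)"
      using t\<rho> i by simp
    also have "\<dots> = d * (C * C + S * S)" by (simp add: algebra_simps)
    finally show ?thesis using CS by simp
  qed
  ultimately have "lifts a b c d (T \<theta> \<circ> Uz l t)" by (simp add: acs mult.commute)
  then show ?thesis by (rule that)
qed

lemma Gt_decomp: assumes "F \<in> Gt" obtains l t where "F = T (F 0) \<circ> Uz l t"
proof -
  obtain a b c d where L: "lifts a b c d F" using assms unfolding Gt_def by blast
  then have "a * d - b * c = 1" unfolding lifts_def by blast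
  then obtain \<theta> l t where L': "lifts a b c d (T \<theta> \<circ> Uz l t)" using lifts_exists by blast
  obtain k :: int where k: "\<And>x. F x = (T \<theta> \<circ> Uz l t) x + of_int k"
    using lifts_unique_mod[OF L' L] by blast
  then have "F = T (F 0) \<circ> Uz l t" by (simp add: fun_eq_iff T_def)
  then show ?thesis using that by blast
qed

text \<open>After conjugation the fixed point is 0, and the rotation in the Iwasawa decomposition
  becomes trivial.\<close>

lemma Gt_fix_U: assumes "F \<in> Gt" "F v = v" obtains l t where "F = U v l t"
proof -
  have G: "T (- v) \<circ> F \<circ> T v \<in> Gt" using assms by simp
  obtain l t where "T (- v) \<circ> F \<circ> T v = T ((T (- v) \<circ> F \<circ> T v) 0) \<circ> Uz l t"
    using Gt_decomp[OF G] by blast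
  then have e: "T (- v) \<circ> F \<circ> T v = Uz l t" using assms(2) by (simp add: T_def)
  have "F = (T v \<circ> T (- v)) \<circ> F \<circ> (T v \<circ> T (- v))" by simp
  also have "\<dots> = T v \<circ> (T (- v) \<circ> F \<circ> T v) \<circ> T (- v)" by (simp only: o_assoc)
  also have "\<dots> = U v l t" unfolding e U_def ..
  finally show ?thesis using that by blast
qed

lemma Gt_fix_int_U: assumes "F \<in> Gt" "F v = v + of_int k" obtains l t where "F = T (of_int k) \<circ> U v l t"
proof -
  have "T (- of_int k) \<circ> F \<in> Gt" "(T (- of_int k) \<circ> F) v = v" using assms by (auto simp: T_def)
  then obtain l t where "T (- of_int k) \<circ> F = U v l t" using Gt_fix_U by metis
  then have "T (of_int k) \<circ> (T (- of_int k) \<circ> F) = T (of_int k) \<circ> U v l t" by simp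
  then have "F = T (of_int k) \<circ> U v l t" by (simp add: o_assoc)
  then show ?thesis using that by blast
qed

text \<open>Composition and inversion are continuous for pointwise convergence because all maps
  are monotone.\<close>

lemma continuous_on_real_betweenI:
  fixes f :: "'a::topological_space \<Rightarrow> real"
  assumes "\<And>q e. q \<in> S \<Longrightarrow> e > 0 \<Longrightarrow> eventually (\<lambda>q'. f q - e < f q' \<and> f q' < f q + e) (at q within S)"
  shows "continuous_on S f"
  unfolding continuous_on_def tendsto_iff
proof (intro ballI allI impI)
  fix q e assume "q \<in> S" "e > (0::real)"
  from assms[OF this] show "\<forall>\<^sub>F x in at q within S. dist (f x) (f q) < e"
    by eventually_elim (auto simp: dist_real_def)
qed

lemma continuous_on_Gt_app:
  fixes F :: "'a::topological_space \<Rightarrow> real \<Rightarrow> real"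
  assumes F: "continuous_on S F" "\<And>q. q \<in> S \<Longrightarrow> F q \<in> Gt" and g: "continuous_on S g"
  shows "continuous_on S (\<lambda>q. F q (g q))"
proof (rule continuous_on_real_betweenI)
  fix q e assume q: "q \<in> S" and e: "e > (0::real)"
  have Fx: "((\<lambda>q'. F q' x) \<longlongrightarrow> F q x) (at q within S)" for x
    using continuous_on_product_then_coordinatewise[OF F(1), of x] q by (simp add: continuous_on_def)
  have "isCont (F q) (g q)" using Gt_isCont F(2)[OF q] by blast
  then obtain d where d: "d > 0" "\<And>x. \<bar>x - g q\<bar> < d \<Longrightarrow> \<bar>F q x - F q (g q)\<bar> < e / 2"
    unfolding continuous_at_eps_delta using e
    by (metis dist_real_def half_gt_zero)
  \<comment> \<open>By monotonicity the values of nearby maps at \<open>g q - d'\<close> and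
    \<open>g q + d'\<close> enclose \<open>F q' (g q')\<close>, so convergence at these two points
    suffices.\<close>
  define d' where "d' = d / 2"
  have d': "d' > 0" "\<bar>F q (g q - d') - F q (g q)\<bar> < e / 2" "\<bar>F q (g q + d') - F q (g q)\<bar> < e / 2"
    using d(1) d(2)[of "g q - d'"] d(2)[of "g q + d'"] by (auto simp: d'_def)
  have "eventually (\<lambda>q'. \<bar>g q' - g q\<bar> < d') (at q within S)"
    using g q d'(1) unfolding continuous_on_def tendsto_iff dist_real_def by blast
  moreover have "eventually (\<lambda>q'. \<bar>F q' (g q - d') - F q (g q - d')\<bar> < e / 2) (at q within S)"
    using Fx e half_gt_zero unfolding tendsto_iff dist_real_def by blast
  moreover have "eventually (\<lambda>q'. \<bar>F q' (g q + d') - F q (g q + d')\<bar> < e / 2) (at q within S)"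
    using Fx e half_gt_zero unfolding tendsto_iff dist_real_def by blast
  moreover have "eventually (\<lambda>q'. q' \<in> S) (at q within S)"
    by (simp add: eventually_at_filter)
  ultimately show "eventually (\<lambda>q'. F q (g q) - e < F q' (g q') \<and> F q' (g q') < F q (g q) + e) (at q within S)"
  proof eventually_elim
    case (elim q')
    have "F q' (g q - d') \<le> F q' (g q')" "F q' (g q') \<le> F q' (g q + d')"
      using elim(1,4) F(2) by auto
    then show ?case using elim(2,3) d'(2,3) by linarith
  qed
qed

lemma continuous_on_Gt_comp [continuous_intros]:
  assumes "continuous_on S F" "\<And>q. q \<in> S \<Longrightarrow> F q \<in> Gt" "continuous_on S G"
  shows "continuous_on S (\<lambda>q. F q \<circ> G q)"
  unfolding o_def
proof (rule continuous_on_coordinatewise_then_product)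
  fix x
  show "continuous_on S (\<lambda>q. F q (G q x))"
    by (rule continuous_on_Gt_app[OF assms(1,2) continuous_on_product_then_coordinatewise[OF assms(3)]])
qed

lemma continuous_on_ginv_app:
  fixes F :: "'a::topological_space \<Rightarrow> real \<Rightarrow> real"
  assumes F: "continuous_on S F" "\<And>q. q \<in> S \<Longrightarrow> F q \<in> Gt"
  shows "continuous_on S (\<lambda>q. ginv (F q) x)"
proof (rule continuous_on_real_betweenI)
  fix q e assume q: "q \<in> S" and e: "e > (0::real)"
  have Fx: "((\<lambda>q'. F q' y) \<longlongrightarrow> F q y) (at q within S)" for y
    using continuous_on_product_then_coordinatewise[OF F(1), of y] q by (simp add: continuous_on_def)
  define y where "y = ginv (F q) x"
  have y: "F q y = x" unfolding y_def using F(2)[OF q] by simp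
  have "F q (y - e) < x" "x < F q (y + e)"
    using Gt_less[OF F(2)[OF q], of "y - e" y] Gt_less[OF F(2)[OF q], of y "y + e"] e y by auto
  then have "eventually (\<lambda>q'. F q' (y - e) < x) (at q within S)"
    "eventually (\<lambda>q'. x < F q' (y + e)) (at q within S)"
    using Fx order_tendstoD by blast+
  moreover have "eventually (\<lambda>q'. q' \<in> S) (at q within S)"
    by (simp add: eventually_at_filter)
  ultimately show "eventually (\<lambda>q'. ginv (F q) x - e < ginv (F q') x \<and> ginv (F q') x < ginv (F q) x + e) (at q within S)"
  proof eventually_elim
    case (elim q')
    have "y - e = ginv (F q') (F q' (y - e))" "y + e = ginv (F q') (F q' (y + e))"
      using F(2)[OF elim(3)] by simp_all
    then show ?case using elim(1,2) F(2)[OF elim(3)] inv_Gt Gt_less by (metis y_def)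
  qed
qed

lemma continuous_on_ginv [continuous_intros]:
  assumes "continuous_on S F" "\<And>q. q \<in> S \<Longrightarrow> F q \<in> Gt"
  shows "continuous_on S (\<lambda>q. ginv (F q))"
  by (rule continuous_on_coordinatewise_then_product) (rule continuous_on_ginv_app[OF assms])

text \<open>Displacement has period 1, so \<open>y\<close> may be taken in
  \<open>[x, x + 1)\<close>, where \<open>F y < F x + 1\<close>. This bound is behind every later
  comparison of displacements with integers.\<close>

lemma Gt_osc: assumes "F \<in> Gt" shows "F y - y < F x - x + 1"
proof -
  define k where "k = \<lfloor>y - x\<rfloor>"
  have k: "x \<le> y - of_int k" "y - of_int k < x + 1" unfolding k_def by linarith+
  have "F (y - of_int k) < F x + 1" using k(2) Gt_less[OF assms k(2)] Gt_period[OF assms] by simp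
  moreover have "F (y - of_int k) = F y - of_int k"
    using Gt_period_int[OF assms, of y "- k"] by simp
  ultimately show ?thesis using k(1) by linarith
qed

text \<open>Conjugation by the reflection of the line. It reverses orientation, so it exchanges the
  two parabolic classes and negates translations; half of the cases follow from the other
  half.\<close>

definition mirr :: "(real \<Rightarrow> real) \<Rightarrow> real \<Rightarrow> real" where "mirr F x = - F (- x)"

lemma lifts_mirr: assumes "lifts a b c d F" shows "lifts a (-b) (-c) d (mirr F)"
  unfolding lifts_def
proof (intro conjI allI)
  show "a * d - - b * - c = 1" using assms by (simp add: lifts_def)
  have "continuous_on UNIV F" using assms by (simp add: lifts_def)
  then have "continuous_on UNIV (\<lambda>x. F (- x))"
    by (rule continuous_on_compose2) (auto intro: continuous_intros)
  then show "continuous_on UNIV (mirr F)" unfolding mirr_def by (rule continuous_on_minus)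
  fix x
  obtain r where "r > 0" "a * cos (pi * (- x)) + b * sin (pi * (- x)) = r * cos (pi * F (- x))"
    "c * cos (pi * (- x)) + d * sin (pi * (- x)) = r * sin (pi * F (- x))"
    using assms unfolding lifts_def by blast
  then show "\<exists>r>0. a * cos (pi * x) + - b * sin (pi * x) = r * cos (pi * mirr F x) \<and>
             - c * cos (pi * x) + d * sin (pi * x) = r * sin (pi * mirr F x)"
    by (intro exI[of _ r]) (auto simp: mirr_def)
qed

lemma mirr_Gt [simp, intro]: "F \<in> Gt \<Longrightarrow> mirr F \<in> Gt"
  unfolding Gt_def using lifts_mirr by blast

lemma mirr_mirr [simp]: "mirr (mirr F) = F" by (simp add: mirr_def fun_eq_iff)
lemma mirr_Gt_iff [simp]: "mirr F \<in> Gt \<longleftrightarrow> F \<in> Gt" by (metis mirr_Gt mirr_mirr)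
lemma mirr_comp: "mirr (F \<circ> G) = mirr F \<circ> mirr G" by (simp add: mirr_def fun_eq_iff)
lemma mirr_id [simp]: "mirr id = id" by (simp add: mirr_def fun_eq_iff)
lemma mirr_T [simp]: "mirr (T v) = T (- v)" by (simp add: mirr_def fun_eq_iff T_def)
lemma mirr_ginv: "F \<in> Gt \<Longrightarrow> mirr (ginv F) = ginv (mirr F)"
  by (rule inv_unique_comp[symmetric]) (simp_all flip: mirr_comp)

lemma mirr_Uz: "mirr (Uz l t) = Uz l (- t)"
  by (rule lifts_eqI[where x=0, OF lifts_mirr[OF lifts_Uz] lifts_Uz]) (auto simp: mirr_def)

lemma mirr_U: "mirr (U v l t) = U (- v) l (- t)"
  unfolding U_def by (simp add: mirr_comp mirr_Uz)

lemma continuous_on_mirr [continuous_intros]: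
  assumes "continuous_on S F" shows "continuous_on S (\<lambda>q. mirr (F q))"
  unfolding mirr_def
  by (rule continuous_on_coordinatewise_then_product)
    (rule continuous_on_minus[OF continuous_on_product_then_coordinatewise[OF assms]])

subsection \<open>Displacement\<close>

lemma no_alternation0:
  assumes "F \<in> Gt" "0 < x2" "x2 < x3" "x3 < x4" "x4 < 1"
    "F 0 \<le> 0" "F x2 > x2" "F x3 \<le> x3" "F x4 > x4"
  shows False
proof -
  obtain a b c d where L: "lifts a b c d F" using assms unfolding Gt_def by blast
  \<comment> \<open>The wedge of a vector with its image, a binary quadratic form. It has the sign
    of the displacement as long as that lies strictly between -1 and 1, which \<open>pos\<close> and
    \<open>neg\<close> obtain from the oscillation bound.\<close>
  define Q where "Q x = c * (cos (pi * x))\<^sup>2 + (d - a) * sin (pi * x) * cos (pi * x) - b * (sin (pi * x))\<^sup>2" for x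
  have Q: "\<exists>r>0. Q x = r * sin (pi * (F x - x))" for x
  proof -
    obtain r where r: "r > 0" "a * cos (pi * x) + b * sin (pi * x) = r * cos (pi * F x)"
      "c * cos (pi * x) + d * sin (pi * x) = r * sin (pi * F x)"
      using L unfolding lifts_def by blast
    have "r * sin (pi * (F x - x)) = (r * sin (pi * F x)) * cos (pi * x) - (r * cos (pi * F x)) * sin (pi * x)"
      by (simp add: right_diff_distrib sin_diff algebra_simps)
    also have "\<dots> = Q x" unfolding r(2,3)[symmetric] Q_def by (simp add: power2_eq_square algebra_simps)
    finally show ?thesis using r(1) by metis
  qed
  have pos: "Q x > 0" if "F x > x" for x
  proof -
    have "F x - x < 1" using Gt_osc[OF assms(1), of x x3] assms(8) by simp
    then have "sin (pi * (F x - x)) > 0" using that by (intro sin_gt_zero) auto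
    then show ?thesis using Q[of x] by auto
  qed
  have neg: "Q x \<le> 0" if "F x \<le> x" for x
  proof -
    have "F x - x > -1" using Gt_osc[OF assms(1), of x2 x] assms(7) by simp
    then have "sin (pi * (x - F x)) \<ge> 0" using that by (intro sin_ge_zero) (auto simp: mult_le_cancel_left1)
    moreover have "sin (pi * (x - F x)) = - sin (pi * (F x - x))"
      by (metis minus_diff_eq mult_minus_right sin_minus)
    ultimately show ?thesis using Q[of x] by (auto simp: mult_le_0_iff)
  qed
  \<comment> \<open>Divided by the squared sine, the form becomes a quadratic polynomial in the
    cotangent, and the cotangent decreases on \<open>(0, 1)\<close>.\<close>
  define k where "k x = cos (pi * x) / sin (pi * x)" for x
  have s: "sin (pi * x) > 0" if "0 < x" "x < 1" for x using that by (intro sin_gt_zero) auto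
  have kQ: "Q x = (sin (pi * x))\<^sup>2 * (c * (k x)\<^sup>2 + (d - a) * k x - b)" if "0 < x" "x < 1" for x
    using s[OF that] by (simp add: Q_def k_def power2_eq_square field_simps)
  have kk: "k x > k y" if "0 < x" "x < y" "y < 1" for x y
  proof -
    have "sin (pi * (y - x)) > 0" using that by (intro sin_gt_zero) auto
    then have "sin (pi * y) * cos (pi * x) - cos (pi * y) * sin (pi * x) > 0"
      by (simp add: right_diff_distrib sin_diff)
    then show ?thesis using s[of x] s[of y] that by (simp add: k_def field_simps)
  qed
  define q where "q z = c * z\<^sup>2 + (d - a) * z - b" for z
  \<comment> \<open>The form takes the value \<open>c\<close> at 0, so the sign there makes the
    polynomial concave: positive at two points, it is positive between them. The identity below is
    this concavity as an equation.\<close>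
  have c: "c \<le> 0" using neg[of 0] assms(6) by (simp add: Q_def)
  have q2: "q (k x2) > 0" and q4: "q (k x4) > 0" and q3: "q (k x3) \<le> 0"
    using pos[of x2] pos[of x4] neg[of x3] kQ[of x2] kQ[of x3] kQ[of x4] s[of x2] s[of x3] s[of x4] assms
    by (auto simp: q_def zero_less_mult_iff mult_le_0_iff)
  have o: "k x2 > k x3" "k x3 > k x4" using kk assms by auto
  have "(k x2 - k x4) * q (k x3) = (k x3 - k x4) * q (k x2) + (k x2 - k x3) * q (k x4)
      - c * ((k x2 - k x4) * (k x2 - k x3) * (k x3 - k x4))"
    unfolding q_def by algebra
  moreover have "(k x3 - k x4) * q (k x2) > 0" "(k x2 - k x3) * q (k x4) > 0"
    using q2 q4 o by simp_all
  moreover have "c * ((k x2 - k x4) * (k x2 - k x3) * (k x3 - k x4)) \<le> 0"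
    using c o by (intro mult_nonpos_nonneg mult_nonneg_nonneg) auto
  moreover have "(k x2 - k x4) * q (k x3) \<le> 0"
    using q3 o by (intro mult_nonneg_nonpos) auto
  ultimately show False by linarith
qed

text \<open>The displacement of an element is the sign of a quadratic form along the circle, hence it
  cannot alternate more than twice.\<close>

lemma no_alternation:
  assumes "F \<in> Gt" "x1 < x2" "x2 < x3" "x3 < x4" "x4 < x1 + 1"
    "F x1 \<le> x1 + c" "F x2 > x2 + c" "F x3 \<le> x3 + c" "F x4 > x4 + c"
  shows False
proof (rule no_alternation0[where ?x2.0="x2 - x1" and ?x3.0="x3 - x1" and ?x4.0="x4 - x1"])
  show "T (- c - x1) \<circ> F \<circ> T x1 \<in> Gt" using assms by simp
qed (use assms in \<open>auto simp: T_def\<close>)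

text \<open>The preimage of a connected subset of the circle, without the quotient: cut open at any
  missing point \<open>v\<close>, the set is order convex in the following period.\<close>

definition arcset :: "real set \<Rightarrow> bool" where
  "arcset S \<longleftrightarrow> (\<forall>x. x + 1 \<in> S \<longleftrightarrow> x \<in> S) \<and>
     (\<forall>v x y z. v \<notin> S \<longrightarrow> v < x \<longrightarrow> x < y \<longrightarrow> y < z \<longrightarrow> z < v + 1 \<longrightarrow> x \<in> S \<longrightarrow> z \<in> S \<longrightarrow> y \<in> S)"

lemma arcset_UNIV [simp]: "arcset UNIV" by (simp add: arcset_def)

lemma arcset_gt: assumes "F \<in> Gt" shows "arcset {x. F x > x + c}"
  unfolding arcset_def
proof (intro conjI allI impI)
  fix x show "x + 1 \<in> {x. F x > x + c} \<longleftrightarrow> x \<in> {x. F x > x + c}"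
    using Gt_period[OF assms, of x] by simp
next
  fix v x y z assume "v \<notin> {x. x + c < F x}" "v < x" "x < y" "y < z" "z < v + 1" "x \<in> {x. x + c < F x}" "z \<in> {x. x + c < F x}"
  then show "y \<in> {x. x + c < F x}"
    using no_alternation[OF assms, of v x y z c] by fastforce
qed

lemma arcset_lt: assumes "F \<in> Gt" shows "arcset {x. F x < x + c}"
proof -
  have a: "arcset {x. mirr F x > x + (- c)}" using assms by (intro arcset_gt) simp
  have e: "x \<in> {x. F x < x + c} \<longleftrightarrow> - x \<in> {x. mirr F x > x + (- c)}" for x by (auto simp: mirr_def)
  show ?thesis unfolding arcset_def
  proof (intro conjI allI impI)
    fix x show "x + 1 \<in> {x. F x < x + c} \<longleftrightarrow> x \<in> {x. F x < x + c}"
      using Gt_period[OF assms, of x] by simp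
  next
    fix v x y z assume *: "v \<notin> {x. F x < x + c}" "v < x" "x < y" "y < z" "z < v + 1" "x \<in> {x. F x < x + c}" "z \<in> {x. F x < x + c}"
    \<comment> \<open>Reflection reverses the period that starts at \<open>v\<close>, so the cut has
      to be made at \<open>- (v + 1)\<close>.\<close>
    have "F (v + 1) = F v + 1" by (rule Gt_period[OF assms])
    then have "v + 1 \<notin> {x. F x < x + c}" using *(1) by simp
    then have "- (v + 1) \<notin> {x. mirr F x > x + (- c)}" unfolding e .
    moreover have "- z \<in> {x. mirr F x > x + (- c)}" "- x \<in> {x. mirr F x > x + (- c)}"
      using *(6,7) unfolding e by auto
    ultimately have "- y \<in> {x. mirr F x > x + (- c)}"
      using a[unfolded arcset_def, THEN conjunct2, rule_format, of "- (v + 1)" "- z" "- y" "- x"] *(2-5)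
      by simp
    then show "y \<in> {x. F x < x + c}" unfolding e .
  qed
qed

text \<open>Intersections of two arcs may be disconnected. Here the window is at least 1 long and
  the displacement oscillates by less, so at most one of the two bounds is active.\<close>

lemma arcset_between:
  assumes "F \<in> Gt" "a + 1 \<le> (b::real)" shows "arcset {x. x + a < F x \<and> F x < x + b}"
proof (cases "\<exists>x. F x \<le> x + a")
  case True
  then obtain x where "F x \<le> x + a" by blast
  then have "F y < y + b" for y using Gt_osc[OF assms(1), of y x] assms(2) by linarith
  then show ?thesis using arcset_gt[OF assms(1), of a] by simp
next
  case False
  then have "x + a < F x" for x by (meson not_le)
  then show ?thesis using arcset_lt[OF assms(1), of b] by simp
qed

lemma U_mono: assumes "t \<le> s" shows "U v l t x \<le> U v l s x"
proof (cases "t = s")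
  case False
  then have ts: "t < s" using assms by simp
  define k where "k = \<lfloor>x - v\<rfloor>"
  define y where "y = x - of_int k"
  have y: "v \<le> y" "y < v + 1" unfolding k_def y_def by linarith+
  have "U v l t y \<le> U v l s y"
  proof (cases "y = v")
    case False then show ?thesis using U_less[of v y t s l] y ts by simp
  qed simp
  moreover have "U v l r x = U v l r y + of_int k" for r
    using Gt_period_int[of "U v l r" y k] by (simp add: y_def)
  ultimately show ?thesis by simp
qed simp

lemma hyp_approx: "\<exists>x>0. x < 1 \<and> cos (pi * x) = K * sin (pi * x)"
proof (intro exI conjI)
  let ?x = "1/2 - arctan K / pi"
  have b: "- (pi/2) < arctan K" "arctan K < pi/2" using arctan_bounded[of K] by auto
  show "0 < ?x" "?x < 1" using b by (auto simp: field_simps)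
  have e: "pi * ?x = pi/2 - arctan K" by (simp add: right_diff_distrib)
  have "cos (arctan K) \<noteq> 0" by simp
  then have "sin (arctan K) = K * cos (arctan K)" using tan_arctan[of K] unfolding tan_def by (simp add: field_simps)
  then show "cos (pi * ?x) = K * sin (pi * ?x)" unfolding e by (simp add: cos_diff sin_diff)
qed

text \<open>\<open>J k k\<close> consists of the hyperbolic elements shifted by \<open>k\<close>,
  see \<open>hyp_two\<close>. The regions with \<open>a < b\<close> arise from such conditions when
  factors are removed.\<close>

definition J :: "int \<Rightarrow> int \<Rightarrow> (real \<Rightarrow> real) set" where
  "J a b = {F \<in> Gt. (\<exists>x. F x > x + of_int a) \<and> (\<exists>x. F x < x + of_int b)}"

text \<open>In contrast to \<open>J\<close> the upper bound holds everywhere. This is the form of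
  the condition when the strength to be solved for must be positive, see
  \<open>reg_region\<close>.\<close>

definition Lr :: "int \<Rightarrow> int \<Rightarrow> (real \<Rightarrow> real) set" where
  "Lr a b = {F \<in> Gt. (\<exists>x. F x > x + of_int a) \<and> (\<forall>x. F x < x + of_int b + 1)}"

lemma J_Gt: "F \<in> J a b \<Longrightarrow> F \<in> Gt" by (simp add: J_def)
lemma Lr_Gt: "F \<in> Lr a b \<Longrightarrow> F \<in> Gt" by (simp add: Lr_def)

text \<open>At a direction with cotangent \<open>K\<close> the wedge with its image is an affine
  function of \<open>K\<close> times a positive square. The slope \<open>\<kappa>\<close> is
  nonzero, so both signs occur.\<close>

lemma hyp_Uz: assumes "l \<noteq> 0" shows "\<exists>x. Uz l t x > x" "\<exists>x. Uz l t x < x"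
proof -
  define \<kappa> where "\<kappa> = exp (- l) - exp l"
  have \<kappa>: "\<kappa> \<noteq> 0" using assms by (simp add: \<kappa>_def)
  have w: "\<exists>r>0. r * sin (pi * (Uz l t x - x)) = (\<kappa> * K + exp l * t) * (sin (pi * x))\<^sup>2"
    if "cos (pi * x) = K * sin (pi * x)" for x K
  proof -
    obtain r where "r > 0" "r * sin (pi * (Uz l t x - x)) = exp (- l) * sin (pi * x) * cos (pi * x) - exp l * (cos (pi * x) - t * sin (pi * x)) * sin (pi * x)"
      using Uz_wedge_const by blast
    then show ?thesis unfolding that \<kappa>_def by (intro exI[of _ r]) (simp add: power2_eq_square algebra_simps)
  qed
  have s: "sin (pi * x) > 0" if "0 < x" "x < 1" for x using that by (intro sin_gt_zero) auto
  \<comment> \<open>This cotangent solves \<open>\<kappa> * K + exp l * t = 1\<close>; the second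
    half of the proof uses -1 on the right.\<close>
  obtain x where x: "x > 0" "x < 1" "cos (pi * x) = ((1 - exp l * t) / \<kappa>) * sin (pi * x)"
    using hyp_approx by blast
  obtain r where r: "r > 0" "r * sin (pi * (Uz l t x - x)) = (sin (pi * x))\<^sup>2"
    using w[OF x(3)] \<kappa> by auto
  have "Uz l t x > x"
  proof (rule ccontr)
    assume "\<not> Uz l t x > x"
    then have "sin (pi * (x - Uz l t x)) \<ge> 0" using Uz_bounds[of x l t] x
      by (intro sin_ge_zero) (auto simp: mult_le_cancel_left1)
    moreover have "sin (pi * (x - Uz l t x)) = - sin (pi * (Uz l t x - x))"
      by (metis minus_diff_eq mult_minus_right sin_minus)
    ultimately have "r * sin (pi * (Uz l t x - x)) \<le> 0" using r(1) by (intro mult_nonneg_nonpos) auto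
    then show False using r s[OF x(1,2)] by simp
  qed
  then show "\<exists>x. Uz l t x > x" by blast
  obtain x where x: "x > 0" "x < 1" "cos (pi * x) = ((- 1 - exp l * t) / \<kappa>) * sin (pi * x)"
    using hyp_approx by blast
  obtain r where r: "r > 0" "r * sin (pi * (Uz l t x - x)) = - (sin (pi * x))\<^sup>2"
    using w[OF x(3)] \<kappa> by auto
  have "Uz l t x < x"
  proof (rule ccontr)
    assume "\<not> Uz l t x < x"
    then have "sin (pi * (Uz l t x - x)) \<ge> 0" using Uz_bounds[of x l t] x
      by (intro sin_ge_zero) (auto simp: mult_le_cancel_left1)
    then have "r * sin (pi * (Uz l t x - x)) \<ge> 0" using r(1) by (intro mult_nonneg_nonneg) auto
    then show False using r s[OF x(1,2)] by simp
  qed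
  then show "\<exists>x. Uz l t x < x" by blast
qed

lemma hyp_U: assumes "l \<noteq> 0" shows "U v l t \<in> J 0 0"
proof -
  obtain x y where "Uz l t x > x" "Uz l t y < y" using hyp_Uz[OF assms] by blast
  then have "U v l t (x + v) > x + v" "U v l t (y + v) < y + v" by (simp_all add: U_def T_def)
  then show ?thesis by (auto simp: J_def)
qed

text \<open>A large strength moves a point \<open>x\<close> slightly to the right of
  \<open>v\<close> close to \<open>v + 1\<close>, and there \<open>u\<close> has a value near
  \<open>u v + 1\<close>. So the displacement gains almost one unit over its value at
  \<open>v\<close>; \<open>peel_up_bound\<close> shows that more is impossible.\<close>

lemma reach_up: assumes "u \<in> Gt" "u v > v + c"
  shows "\<exists>t0. \<forall>t\<ge>t0. \<exists>x. u (U v l t x) > x + c + 1"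
proof -
  define \<delta> where "\<delta> = min (1/2) ((u v - v - c) / 2)"
  have \<delta>: "\<delta> > 0" "\<delta> < 1" "\<delta> < u v - v - c" using assms by (auto simp: \<delta>_def min_def)
  define x where "x = v + \<delta>"
  have "u (v + 1) > x + c + 1" using Gt_period[OF assms(1), of v] \<delta> by (simp add: x_def)
  moreover have "(u \<longlongrightarrow> u (v + 1)) (at_left (v + 1))"
    using Gt_isCont[OF assms(1)] by (simp add: isCont_def filterlim_at_split)
  ultimately have "eventually (\<lambda>y. u y > x + c + 1) (at_left (v + 1))" by (rule order_tendstoD(1)[rotated])
  moreover have "eventually (\<lambda>y. y \<in> {v<..<v+1}) (at_left (v + 1))"
    by (rule eventually_at_left_real) simp
  ultimately have "eventually (\<lambda>y. u y > x + c + 1 \<and> y \<in> {v<..<v+1}) (at_left (v + 1))"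
    by eventually_elim blast
  then obtain y where y: "u y > x + c + 1" "v < y" "y < v + 1"
    using eventually_happens'[OF trivial_limit_at_left_real] by fastforce
  obtain t0 where "\<forall>t\<ge>t0. U v l t x > y" using U_limit(1)[of v x y l] \<delta> y by (auto simp: x_def)
  then have "\<forall>t\<ge>t0. u (U v l t x) > x + c + 1" using y(1) assms(1) Gt_less order.strict_trans by blast
  then show ?thesis by blast
qed

lemma reach_down: assumes "u \<in> Gt" "u v < v + c"
  shows "\<exists>t0. \<forall>t\<le>t0. \<exists>x. u (U v l t x) < x + c - 1"
proof -
  obtain t0 where t0: "\<forall>t\<ge>t0. \<exists>x. mirr u (U (- v) l t x) > x + (- c) + 1"
    using reach_up[of "mirr u" "- v" "- c" l] assms by (auto simp: mirr_def)
  have "\<exists>x. u (U v l t x) < x + c - 1" if "t \<le> - t0" for t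
  proof -
    obtain x where x: "mirr u (U (- v) l (- t) x) > x + (- c) + 1" using t0 \<open>t \<le> - t0\<close> by (metis le_minus_iff)
    have "U (- v) l (- t) x = - U v l t (- x)" using mirr_U[of v l t] by (metis mirr_def)
    then have "u (U v l t (- x)) < (- x) + c - 1" using x by (simp add: mirr_def)
    then show ?thesis by blast
  qed
  then show ?thesis by blast
qed

subsection \<open>Connectedness modulo a relation\<close>

text \<open>Connectedness of the quotient of X by the relation, without forming the quotient.\<close>

definition sat_clopen :: "('a::topological_space \<Rightarrow> 'a \<Rightarrow> bool) \<Rightarrow> 'a set \<Rightarrow> 'a set \<Rightarrow> bool" where
  "sat_clopen rel X W \<longleftrightarrow> W \<subseteq> X \<and> openin (top_of_set X) W \<and> openin (top_of_set X) (X - W) \<and>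
     (\<forall>y\<in>W. \<forall>y'\<in>X. rel y y' \<longrightarrow> y' \<in> W)"

text \<open>No clopen set of the quotient separates the points. This is an equivalence relation, so
  links by paths, by \<open>rel\<close> and inside fibres can be chained.\<close>

definition lnk :: "('a::topological_space \<Rightarrow> 'a \<Rightarrow> bool) \<Rightarrow> 'a set \<Rightarrow> 'a \<Rightarrow> 'a \<Rightarrow> bool" where
  "lnk rel X h h' \<longleftrightarrow> (\<forall>W. sat_clopen rel X W \<longrightarrow> (h \<in> W \<longleftrightarrow> h' \<in> W))"

definition sconn :: "('a::topological_space \<Rightarrow> 'a \<Rightarrow> bool) \<Rightarrow> 'a set \<Rightarrow> bool" where
  "sconn rel X \<longleftrightarrow> (\<forall>h\<in>X. \<forall>h'\<in>X. lnk rel X h h')"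

lemma lnk_refl [simp]: "lnk rel X h h" by (simp add: lnk_def)
lemma lnk_sym: "lnk rel X h h' \<Longrightarrow> lnk rel X h' h" by (simp add: lnk_def)
lemma lnk_trans [trans]: "lnk rel X h h' \<Longrightarrow> lnk rel X h' h'' \<Longrightarrow> lnk rel X h h''" by (simp add: lnk_def)

lemma lnk_rel: "rel h h' \<Longrightarrow> rel h' h \<Longrightarrow> h \<in> X \<Longrightarrow> h' \<in> X \<Longrightarrow> lnk rel X h h'"
  unfolding lnk_def sat_clopen_def by blast

lemma sconn_clopen: "sconn rel X \<Longrightarrow> sat_clopen rel X W \<Longrightarrow> W = {} \<or> W = X"
  unfolding sconn_def lnk_def sat_clopen_def by blast

lemma sconnI: "(\<And>W. sat_clopen rel X W \<Longrightarrow> W = {} \<or> W = X) \<Longrightarrow> sconn rel X"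
  unfolding sconn_def lnk_def by blast

lemma lnk_connected:
  assumes "connected S" "S \<subseteq> X" "h \<in> S" "h' \<in> S" shows "lnk rel X h h'"
  unfolding lnk_def
proof (intro allI impI)
  fix W assume W: "sat_clopen rel X W"
  obtain O1 O2 where O: "open O1" "W = X \<inter> O1" "open O2" "X - W = X \<inter> O2"
    using W unfolding sat_clopen_def openin_open by blast
  have "O1 \<inter> O2 \<inter> S = {}" "S \<subseteq> O1 \<union> O2" using O assms(2) by auto
  then have "O1 \<inter> S = {} \<or> O2 \<inter> S = {}" using assms(1) O(1,3) unfolding connected_def by blast
  then show "h \<in> W \<longleftrightarrow> h' \<in> W" using O assms(2-4) by blast
qed

lemma sconn_connected: "connected X \<Longrightarrow> sconn rel X"
  unfolding sconn_def using lnk_connected[of X X] by blast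

lemma lnk_image:
  assumes "continuous_on P \<Psi>" "\<Psi> ` P \<subseteq> X"
    and rel: "\<And>p p'. p \<in> P \<Longrightarrow> p' \<in> P \<Longrightarrow> relP p p' \<Longrightarrow> relX (\<Psi> p) (\<Psi> p')"
    and "lnk relP P p p'" "p \<in> P" "p' \<in> P"
  shows "lnk relX X (\<Psi> p) (\<Psi> p')"
  unfolding lnk_def
proof (intro allI impI)
  fix W assume W: "sat_clopen relX X W"
  have m: "\<Psi> \<in> P \<rightarrow> X" using assms(2) by auto
  have "openin (top_of_set P) (P \<inter> \<Psi> -` W)" "openin (top_of_set P) (P \<inter> \<Psi> -` (X - W))"
    using W continuous_openin_preimage[OF assms(1) m] unfolding sat_clopen_def by auto
  moreover have "P \<inter> \<Psi> -` (X - W) = P - (P \<inter> \<Psi> -` W)" using assms(2) by auto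
  moreover have "y' \<in> \<Psi> -` W" if "y \<in> P" "\<Psi> y \<in> W" "y' \<in> P" "relP y y'" for y y'
    using rel[OF that(1,3,4)] W that m unfolding sat_clopen_def by blast
  ultimately have "sat_clopen relP P (P \<inter> \<Psi> -` W)" unfolding sat_clopen_def by auto
  then have "p \<in> P \<inter> \<Psi> -` W \<longleftrightarrow> p' \<in> P \<inter> \<Psi> -` W" using assms(4) unfolding lnk_def by blast
  then show "\<Psi> p \<in> W \<longleftrightarrow> \<Psi> p' \<in> W" using assms(5,6) by blast
qed

lemma sconn_image:
  assumes "sconn relP P" "continuous_on P \<Psi>"
    and "\<And>p p'. p \<in> P \<Longrightarrow> p' \<in> P \<Longrightarrow> relP p p' \<Longrightarrow> relX (\<Psi> p) (\<Psi> p')"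
  shows "sconn relX (\<Psi> ` P)"
  unfolding sconn_def
proof (intro ballI)
  fix h h' assume "h \<in> \<Psi> ` P" "h' \<in> \<Psi> ` P"
  then obtain p p' where "p \<in> P" "h = \<Psi> p" "p' \<in> P" "h' = \<Psi> p'" by blast
  moreover from this have "lnk relP P p p'" using assms(1) unfolding sconn_def by blast
  ultimately show "lnk relX (\<Psi> ` P) h h'"
    using lnk_image[of P \<Psi> "\<Psi> ` P" relP relX p p'] assms(2,3) by blast
qed

text \<open>A saturated clopen set contains all or nothing of each fibre, so it comes from a subset
  of the base. By \<open>op\<close> the projection is open, hence that subset and its complement are
  open; \<open>inv\<close> makes it saturated.\<close>

lemma sconn_fibration:
  fixes E :: "('b::topological_space \<times> 'z::topological_space) set"
  assumes B: "sconn rB B"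
    and EB: "\<And>y z. (y, z) \<in> E \<Longrightarrow> y \<in> B" and ne: "\<And>y. y \<in> B \<Longrightarrow> \<exists>z. (y, z) \<in> E"
    and fib: "\<And>y. y \<in> B \<Longrightarrow> sconn (\<lambda>z z'. rE (y, z) (y, z')) {z. (y, z) \<in> E}"
    and op: "\<And>z. openin (top_of_set B) {y \<in> B. (y, z) \<in> E}"
    and inv: "\<And>y y' z. (y, z) \<in> E \<Longrightarrow> y' \<in> B \<Longrightarrow> rB y y' \<Longrightarrow> (y', z) \<in> E \<and> rE (y, z) (y', z)"
  shows "sconn rE E"
proof (rule sconnI)
  fix W assume W: "sat_clopen rE E W"
  have sl: "{z. (y, z) \<in> W} = {} \<or> {z. (y, z) \<in> W} = {z. (y, z) \<in> E}" if y: "y \<in> B" for y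
  proof (rule sconn_clopen[OF fib[OF y]])
    have c: "continuous_on {z. (y, z) \<in> E} (\<lambda>z. (y, z))" by (intro continuous_intros)
    have "openin (top_of_set {z. (y, z) \<in> E}) ({z. (y, z) \<in> E} \<inter> (\<lambda>z. (y, z)) -` V)"
      if "openin (top_of_set E) V" for V
      by (rule continuous_openin_preimage[OF c _ that]) auto
    from this[of W] this[of "E - W"]
    have "openin (top_of_set {z. (y, z) \<in> E}) ({z. (y, z) \<in> E} \<inter> (\<lambda>z. (y, z)) -` W)"
      "openin (top_of_set {z. (y, z) \<in> E}) ({z. (y, z) \<in> E} \<inter> (\<lambda>z. (y, z)) -` (E - W))"
      using W unfolding sat_clopen_def by auto
    moreover have "{z. (y, z) \<in> E} \<inter> (\<lambda>z. (y, z)) -` W = {z. (y, z) \<in> W}"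
      "{z. (y, z) \<in> E} \<inter> (\<lambda>z. (y, z)) -` (E - W) = {z. (y, z) \<in> E} - {z. (y, z) \<in> W}"
      using W unfolding sat_clopen_def by auto
    ultimately show "sat_clopen (\<lambda>z z'. rE (y, z) (y, z')) {z. (y, z) \<in> E} {z. (y, z) \<in> W}"
      using W unfolding sat_clopen_def by auto
  qed
  \<comment> \<open>The projection of an open set is the union of its horizontal slices, each of
    which is open in the base.\<close>
  have key: "openin (top_of_set B) {y \<in> B. \<exists>z. (y, z) \<in> V}" if V: "openin (top_of_set E) V" for V
  proof -
    have "openin (top_of_set B) {y \<in> B. (y, z) \<in> V}" for z
    proof -
      let ?D = "{y \<in> B. (y, z) \<in> E}"
      have c: "continuous_on ?D (\<lambda>y. (y, z))" by (intro continuous_intros)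
      have "openin (top_of_set ?D) (?D \<inter> (\<lambda>y. (y, z)) -` V)"
        by (rule continuous_openin_preimage[OF c _ V]) auto
      then have "openin (top_of_set B) (?D \<inter> (\<lambda>y. (y, z)) -` V)" using op[of z] by (rule openin_trans)
      moreover have "?D \<inter> (\<lambda>y. (y, z)) -` V = {y \<in> B. (y, z) \<in> V}"
        using openin_imp_subset[OF V] by auto
      ultimately show ?thesis by simp
    qed
    then have "openin (top_of_set B) (\<Union>z. {y \<in> B. (y, z) \<in> V})" by (intro openin_Union) auto
    moreover have "(\<Union>z. {y \<in> B. (y, z) \<in> V}) = {y \<in> B. \<exists>z. (y, z) \<in> V}" by auto
    ultimately show ?thesis by simp
  qed
  define W' where "W' = {y \<in> B. \<exists>z. (y, z) \<in> W}"
  have "openin (top_of_set B) {y \<in> B. \<exists>z. (y, z) \<in> E - W}" using W by (intro key) (simp add: sat_clopen_def)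
  moreover have "{y \<in> B. \<exists>z. (y, z) \<in> E - W} = B - W'"
    using sl ne by (auto simp: W'_def)
  moreover have "openin (top_of_set B) W'" using W unfolding W'_def by (intro key) (simp add: sat_clopen_def)
  moreover have "y' \<in> W'" if y: "y \<in> W'" "y' \<in> B" "rB y y'" for y y'
  proof -
    obtain z where z: "(y, z) \<in> W" using y(1) unfolding W'_def by blast
    then have "(y, z) \<in> E" using W unfolding sat_clopen_def by blast
    then have "(y', z) \<in> E" "rE (y, z) (y', z)" using inv[OF _ y(2,3)] by auto
    then have "(y', z) \<in> W" using W z unfolding sat_clopen_def by blast
    then show ?thesis using y(2) unfolding W'_def by blast
  qed
  ultimately have "sat_clopen rB B W'" unfolding sat_clopen_def W'_def by auto
  then have "W' = {} \<or> W' = B" using B sconn_clopen by blast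
  then show "W = {} \<or> W = E"
  proof
    assume "W' = {}"
    then have "W = {}" using W EB unfolding W'_def sat_clopen_def by fastforce
    then show ?thesis ..
  next
    assume W'B: "W' = B"
    have "(y, z) \<in> W" if "(y, z) \<in> E" for y z
      using sl[OF EB[OF that]] W'B EB[OF that] that unfolding W'_def by blast
    then show ?thesis using W unfolding sat_clopen_def by auto
  qed
qed

definition vrel :: "real \<times> real \<Rightarrow> real \<times> real \<Rightarrow> bool" where
  "vrel p p' \<longleftrightarrow> (\<exists>k::int. fst p' = fst p + of_int k) \<and> snd p' = snd p"

lemma arcset_int: assumes "arcset S" shows "x + of_int k \<in> S \<longleftrightarrow> x \<in> S"
proof (induct k rule: int_induct[where k=0])
  case (step1 i)
  then show ?case using assms unfolding arcset_def by (metis add.assoc of_int_1 of_int_add)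
next
  case (step2 i)
  have "x + of_int (i - 1) + 1 = x + of_int i" by simp
  then show ?case using step2 assms unfolding arcset_def by metis
qed simp

text \<open>At a missing point the circle can be cut open. The integer translate of that point just
  left of \<open>x0\<close> is used, so that the window contains \<open>x0\<close>.\<close>

lemma arcset_window:
  assumes S: "arcset S" "x0 \<in> S"
  obtains B where "connected B" "B \<subseteq> S" "x0 \<in> B" "\<And>v. v \<in> S \<Longrightarrow> \<exists>k. v + of_int k \<in> B"
proof (cases "S = UNIV")
  case True
  show ?thesis by (rule that[of UNIV]) (use True in auto)
next
  case False
  then obtain v1 where v1: "v1 \<notin> S" by blast
  define v0 where "v0 = v1 + of_int \<lfloor>x0 - v1\<rfloor>"
  have v0: "v0 \<notin> S" using v1 arcset_int[OF S(1)] by (simp add: v0_def)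
  have xb: "v0 \<le> x0" "x0 < v0 + 1" unfolding v0_def by linarith+
  define B where "B = S \<inter> {v0<..<v0+1}"
  have "is_interval B"
    unfolding is_interval_1
  proof (intro ballI allI impI)
    fix a b y assume *: "a \<in> B" "b \<in> B" "a \<le> y \<and> y \<le> b"
    show "y \<in> B"
    proof (cases "y = a \<or> y = b")
      case False
      then have "a < y" "y < b" using * by auto
      moreover have "a \<in> S" "b \<in> S" "v0 < a" "b < v0 + 1" using * by (auto simp: B_def)
      ultimately have "y \<in> S"
        using S(1)[unfolded arcset_def, THEN conjunct2, rule_format, OF v0, of a y b] by blast
      then show ?thesis using \<open>a < y\<close> \<open>y < b\<close> \<open>v0 < a\<close> \<open>b < v0 + 1\<close> by (simp add: B_def)
    qed (use * in auto)
  qed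
  moreover have "\<exists>k. v + of_int k \<in> B" if "v \<in> S" for v
  proof -
    define k where "k = - \<lfloor>v - v0\<rfloor>"
    have "v + of_int k \<in> S" using that arcset_int[OF S(1)] by simp
    moreover have "v0 \<le> v + of_int k" "v + of_int k < v0 + 1" unfolding k_def of_int_minus by linarith+
    moreover have "v + of_int k \<noteq> v0" using calculation(1) v0 by blast
    ultimately show ?thesis unfolding B_def by (intro exI[of _ k]) auto
  qed
  moreover have "x0 \<in> B" using S(2) xb v0 unfolding B_def by (cases "x0 = v0") auto
  ultimately show ?thesis using that[of B] is_interval_connected by (auto simp: B_def)
qed

lemma sconn_arcset:
  assumes "arcset S" shows "sconn (\<lambda>v v'. \<exists>k::int. v' = v + of_int k) S"
  unfolding sconn_def
proof (intro ballI)
  fix h h' assume h: "h \<in> S" "h' \<in> S"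
  obtain B where B: "connected B" "B \<subseteq> S" "h \<in> B" "\<And>v. v \<in> S \<Longrightarrow> \<exists>k. v + of_int k \<in> B"
    using arcset_window[OF assms h(1)] by blast
  obtain k where k: "h' + of_int k \<in> B" using B(4)[OF h(2)] by blast
  have "lnk (\<lambda>v v'. \<exists>k::int. v' = v + of_int k) S h (h' + of_int k)"
    by (rule lnk_connected[OF B(1,2)]) (use B k in auto)
  also have "lnk (\<lambda>v v'. \<exists>k::int. v' = v + of_int k) S (h' + of_int k) h'"
  proof (rule lnk_rel)
    show "\<exists>j::int. h' = h' + of_int k + of_int j" by (rule exI[of _ "- k"]) simp
  qed (use B k h in auto)
  finally show "lnk (\<lambda>v v'. \<exists>k::int. v' = v + of_int k) S h h'" .
qed

lemma sconn_window:
  assumes S: "arcset {v. \<exists>t. (v, t) \<in> V}"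
    and per: "\<And>v t k. (v + of_int k, t) \<in> V \<longleftrightarrow> (v, t) \<in> V"
    and sl: "\<And>v. is_interval {t. (v, t) \<in> V}"
    and op: "\<And>t. open {v. (v, t) \<in> V}"
  shows "sconn vrel V"
proof -
  have "sconn (\<lambda>v v'. \<exists>k::int. v' = v + of_int k) {v. \<exists>t. (v, t) \<in> V}" by (rule sconn_arcset[OF S])
  then show ?thesis
  proof (rule sconn_fibration)
    show "sconn (\<lambda>z z'. vrel (y, z) (y, z')) {z. (y, z) \<in> V}" for y
      using sl[of y] is_interval_connected sconn_connected by blast
    show "openin (top_of_set {v. \<exists>t. (v, t) \<in> V}) {y \<in> {v. \<exists>t. (v, t) \<in> V}. (y, z) \<in> V}" for z
    proof -
      have "{y \<in> {v. \<exists>t. (v, t) \<in> V}. (y, z) \<in> V} = {v. \<exists>t. (v, t) \<in> V} \<inter> {v. (v, z) \<in> V}" by auto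
      then show ?thesis using openin_open_Int[OF op[of z]] by simp
    qed
    show "(y', z) \<in> V \<and> vrel (y, z) (y', z)" if "(y, z) \<in> V" "\<exists>k::int. y' = y + of_int k" for y y' z
      using that per by (auto simp: vrel_def)
  qed auto
qed

text \<open>Makes a condition on all points open for pointwise convergence: monotonicity bounds
  \<open>F\<close> on each interval of a grid by its value at the right end, and uniform continuity
  provides a fine enough grid.\<close>

lemma displacement_lt_iff:
  assumes F: "F \<in> Gt"
  shows "(\<forall>x. F x < x + c) \<longleftrightarrow> (\<exists>N>0. \<forall>i<N. F (real (Suc i) / real N) < real i / real N + c)"
    (is "?L \<longleftrightarrow> ?R")
proof
  assume L: ?L
  have cont: "continuous_on S F" for S using F by (rule Gt_cont)
  have "continuous_on {0..1} (\<lambda>x. x + c - F x)" by (intro continuous_intros cont)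
  then have "\<exists>x0\<in>{0..1}. \<forall>x\<in>{0..1}. x0 + c - F x0 \<le> x + c - F x"
    by (rule continuous_attains_inf[rotated 2]) auto
  then obtain x0 where x0: "\<And>x. x \<in> {0..1} \<Longrightarrow> x0 + c - F x0 \<le> x + c - F x" by blast
  define m where "m = x0 + c - F x0"
  have m: "m > 0" using L[rule_format, of x0] by (simp add: m_def)
  have "uniformly_continuous_on {0..2} F" by (intro compact_uniformly_continuous cont) auto
  then obtain d where d: "d > 0" "\<And>x y. x \<in> {0..2} \<Longrightarrow> y \<in> {0..2} \<Longrightarrow> \<bar>y - x\<bar> < d \<Longrightarrow> \<bar>F y - F x\<bar> < m"
    unfolding uniformly_continuous_on_def dist_real_def using m by blast
  obtain N where N: "N > 0" "inverse (real N) < d" using reals_Archimedean[OF d(1)] by blast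
  have "F (real (Suc i) / real N) < real i / real N + c" if i: "i < N" for i
  proof -
    define x where "x = real i / real N"
    have e: "real (Suc i) / real N = x + inverse (real N)" by (simp add: x_def add_divide_distrib inverse_eq_divide)
    have x: "0 \<le> x" "x \<le> 1" using i N(1) by (auto simp: x_def)
    have "inverse (real N) \<le> 1" using N(1) by (simp add: inverse_eq_divide)
    then have "\<bar>F (x + inverse (real N)) - F x\<bar> < m" using x N by (intro d(2)) auto
    moreover have "m \<le> x + c - F x" using x0[of x] x by (simp add: m_def)
    ultimately show ?thesis unfolding e x_def by linarith
  qed
  then show ?R using N(1) by blast
next
  assume ?R
  then obtain N where N: "N > 0" "\<And>i. i < N \<Longrightarrow> F (real (Suc i) / real N) < real i / real N + c" by blast
  show ?L
  proof
    fix x :: real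
    define k where "k = \<lfloor>x\<rfloor>"
    define y where "y = x - of_int k"
    have y: "0 \<le> y" "y < 1" unfolding k_def y_def by linarith+
    define i where "i = nat \<lfloor>y * real N\<rfloor>"
    have "0 \<le> y * real N" using y by simp
    then have "real i = of_int \<lfloor>y * real N\<rfloor>" unfolding i_def by simp
    then have i: "real i \<le> y * real N" "y * real N < real (Suc i)"
      by linarith+
    have "y * real N < 1 * real N" using y N(1) by (intro mult_strict_right_mono) auto
    then have "real i < real N" using i(1) by linarith
    then have iN: "i < N" by simp
    have "y < real (Suc i) / real N" "real i / real N \<le> y"
      using i N(1) by (simp_all add: pos_less_divide_eq pos_divide_le_eq)
    then have "F y < y + c" using N(2)[OF iN] Gt_less[OF F, of y "real (Suc i) / real N"] by linarith
    moreover have "F x = F y + of_int k" using Gt_period_int[OF F, of y k] by (simp add: y_def)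
    ultimately show "F x < x + c" by (simp add: y_def)
  qed
qed

definition open_region :: "(real \<Rightarrow> real) set \<Rightarrow> bool" where
  "open_region R \<longleftrightarrow> (\<exists>W. open W \<and> R = Gt \<inter> W)"

lemma open_eval:
  "open {F :: real \<Rightarrow> real. F x > c}" "open {F :: real \<Rightarrow> real. F x < c}"
  by (intro open_Collect_less continuous_intros continuous_on_product_coordinates)+

lemma open_region_J: "open_region (J a b)"
proof -
  have "open ((\<Union>x. {F :: real \<Rightarrow> real. F x > x + of_int a}) \<inter> (\<Union>x. {F. F x < x + of_int b}))"
    by (intro open_Int open_UN ballI open_eval)
  moreover have "J a b = Gt \<inter> ((\<Union>x. {F. F x > x + of_int a}) \<inter> (\<Union>x. {F. F x < x + of_int b}))"
    by (auto simp: J_def)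
  ultimately show ?thesis unfolding open_region_def by blast
qed

lemma open_displacement_lt:
  obtains W where "open W" "Gt \<inter> {F. \<forall>x. F x < x + c} = Gt \<inter> W"
proof -
  let ?W = "\<Union>N\<in>{0<..}. \<Inter>i<N. {F :: real \<Rightarrow> real. F (real (Suc i) / real N) < real i / real N + c}"
  have "open ?W" by (intro open_UN ballI open_INT open_eval) auto
  moreover have "Gt \<inter> {F. \<forall>x. F x < x + c} = Gt \<inter> ?W"
  proof (rule Set.set_eqI)
    fix F show "F \<in> Gt \<inter> {F. \<forall>x. F x < x + c} \<longleftrightarrow> F \<in> Gt \<inter> ?W"
    proof (cases "F \<in> Gt")
      case True
      have "F \<in> ?W \<longleftrightarrow> (\<exists>N>0. \<forall>i<N. F (real (Suc i) / real N) < real i / real N + c)"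
        by blast
      then show ?thesis using True displacement_lt_iff[OF True, of c] by blast
    qed blast
  qed
  ultimately show ?thesis by (rule that)
qed

lemma open_region_L: "open_region (Lr a b)"
proof -
  obtain W where W: "open W" "Gt \<inter> {F. \<forall>x. F x < x + (of_int b + 1)} = Gt \<inter> W"
    using open_displacement_lt by metis
  have "open ((\<Union>x. {F :: real \<Rightarrow> real. F x > x + of_int a}) \<inter> W)"
    by (intro open_Int open_UN ballI open_eval W)
  moreover have "Lr a b = Gt \<inter> ((\<Union>x. {F. F x > x + of_int a}) \<inter> W)"
  proof -
    have "Lr a b = (Gt \<inter> {F. \<forall>x. F x < x + (of_int b + 1)}) \<inter> (\<Union>x. {F. F x > x + of_int a})"
      unfolding Lr_def by (auto simp: add.assoc)
    then show ?thesis unfolding W by blast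
  qed
  ultimately show ?thesis unfolding open_region_def by blast
qed

lemma openin_region:
  assumes "open_region R" "continuous_on S F" "\<And>q. q \<in> S \<Longrightarrow> F q \<in> Gt"
  shows "openin (top_of_set S) {q \<in> S. F q \<in> R}"
proof -
  obtain W where W: "open W" "R = Gt \<inter> W" using assms(1) unfolding open_region_def by blast
  have "{q \<in> S. F q \<in> R} = S \<inter> F -` W" using assms(3) W by auto
  then show ?thesis using continuous_openin_preimage_gen[OF assms(2) W(1)] by simp
qed

subsection \<open>Removing one block\<close>

text \<open>For l = 0 the kinds 1 and -1 are the two classes of parabolic elements; for l \<open>\<noteq>\<close> 0 the kind 0 is the
  conjugacy class of a hyperbolic element.\<close>

definition strengths :: "int \<Rightarrow> real set" where
  "strengths \<kappa> = {t. (\<kappa> = 1 \<longrightarrow> t > 0) \<and> (\<kappa> = -1 \<longrightarrow> t < 0)}"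

definition block :: "int \<Rightarrow> real \<Rightarrow> (real \<Rightarrow> real) set" where
  "block \<kappa> l = {U v l t | v t. t \<in> strengths \<kappa>}"

text \<open>The two facts needed when the last block of a product is dropped: which products remain,
  and that the parameters of the dropped block are connected.\<close>

definition peels :: "int \<Rightarrow> real \<Rightarrow> (real \<Rightarrow> real) set \<Rightarrow> (real \<Rightarrow> real) set \<Rightarrow> bool" where
  "peels \<kappa> l R R' \<longleftrightarrow> (\<forall>u\<in>Gt. (u \<in> R' \<longleftrightarrow> (\<exists>G\<in>block \<kappa> l. u \<circ> G \<in> R)) \<and>
     sconn vrel {(v, t). t \<in> strengths \<kappa> \<and> u \<circ> U v l t \<in> R})"

lemma block_Gt: "G \<in> block \<kappa> l \<Longrightarrow> G \<in> Gt" by (auto simp: block_def)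

lemma is_interval_strengths: "is_interval (strengths \<kappa>)"
  unfolding is_interval_1 strengths_def by auto

text \<open>The parameters of a block are fibred over the circle of fixed points, with an interval
  of strengths over each point. What varies from case to case is the arc of admissible fixed
  points.\<close>

lemma sconn_peel:
  assumes u: "u \<in> Gt" and R: "open_region R"
    and sl: "\<And>v. is_interval {t. t \<in> strengths \<kappa> \<and> u \<circ> U v l t \<in> R}"
    and arc: "arcset {v. \<exists>t\<in>strengths \<kappa>. u \<circ> U v l t \<in> R}"
  shows "sconn vrel {(v, t). t \<in> strengths \<kappa> \<and> u \<circ> U v l t \<in> R}"
proof (rule sconn_window)
  have "{v. \<exists>t. (v, t) \<in> {(v, t). t \<in> strengths \<kappa> \<and> u \<circ> U v l t \<in> R}} = {v. \<exists>t\<in>strengths \<kappa>. u \<circ> U v l t \<in> R}" by auto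
  then show "arcset {v. \<exists>t. (v, t) \<in> {(v, t). t \<in> strengths \<kappa> \<and> u \<circ> U v l t \<in> R}}" using arc by simp
  show "(v + of_int k, t) \<in> {(v, t). t \<in> strengths \<kappa> \<and> u \<circ> U v l t \<in> R} \<longleftrightarrow>
      (v, t) \<in> {(v, t). t \<in> strengths \<kappa> \<and> u \<circ> U v l t \<in> R}" for v t k by (simp add: U_period)
  show "is_interval {t. (v, t) \<in> {(v, t). t \<in> strengths \<kappa> \<and> u \<circ> U v l t \<in> R}}" for v using sl by simp
  show "open {v. (v, t) \<in> {(v, t). t \<in> strengths \<kappa> \<and> u \<circ> U v l t \<in> R}}" for t
  proof (cases "t \<in> strengths \<kappa>")
    case True
    have "continuous_on UNIV (\<lambda>v. u \<circ> U v l t)" using u by (intro continuous_intros) auto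
    then have "openin (top_of_set UNIV) {v \<in> UNIV. u \<circ> U v l t \<in> R}"
      by (rule openin_region[OF R]) (use u in auto)
    then show ?thesis using True by simp
  qed simp
qed

lemma slice_J:
  assumes "u \<in> Gt" shows "is_interval {t. t \<in> strengths \<kappa> \<and> u \<circ> U v l t \<in> J a b}"
  unfolding is_interval_1
proof (intro ballI allI impI)
  fix r s t assume *: "r \<in> {t. t \<in> strengths \<kappa> \<and> u \<circ> U v l t \<in> J a b}"
    "s \<in> {t. t \<in> strengths \<kappa> \<and> u \<circ> U v l t \<in> J a b}" "r \<le> t \<and> t \<le> s"
  have m: "u (U v l r x) \<le> u (U v l t x)" "u (U v l t x) \<le> u (U v l s x)" for x
    using U_mono * assms by auto
  have "t \<in> strengths \<kappa>" using is_interval_strengths[of \<kappa>] * unfolding is_interval_1 by blast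
  moreover obtain x y where "u (U v l r x) > x + of_int a" "u (U v l s y) < y + of_int b"
    using * unfolding J_def by auto
  then have "u (U v l t x) > x + of_int a" "u (U v l t y) < y + of_int b" using m[of x] m[of y] by auto
  ultimately show "t \<in> {t. t \<in> strengths \<kappa> \<and> u \<circ> U v l t \<in> J a b}" using assms by (auto simp: J_def)
qed

lemma slice_L:
  assumes "u \<in> Gt" shows "is_interval {t. t \<in> strengths \<kappa> \<and> u \<circ> U v l t \<in> Lr a b}"
  unfolding is_interval_1
proof (intro ballI allI impI)
  fix r s t assume *: "r \<in> {t. t \<in> strengths \<kappa> \<and> u \<circ> U v l t \<in> Lr a b}"
    "s \<in> {t. t \<in> strengths \<kappa> \<and> u \<circ> U v l t \<in> Lr a b}" "r \<le> t \<and> t \<le> s"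
  have m: "u (U v l r x) \<le> u (U v l t x)" "u (U v l t x) \<le> u (U v l s x)" for x
    using U_mono * assms by auto
  have "t \<in> strengths \<kappa>" using is_interval_strengths[of \<kappa>] * unfolding is_interval_1 by blast
  moreover obtain x where "u (U v l r x) > x + of_int a" using * unfolding Lr_def by auto
  then have "u (U v l t x) > x + of_int a" using m[of x] by auto
  moreover have "u (U v l t y) < y + of_int b + 1" for y
    using m(2)[of y] *(2) unfolding Lr_def by (auto simp: le_less_trans)
  ultimately show "t \<in> {t. t \<in> strengths \<kappa> \<and> u \<circ> U v l t \<in> Lr a b}" using assms by (auto simp: Lr_def)
qed

text \<open>The block does not move \<open>v\<close>, so the oscillation bound for the product
  compares \<open>x\<close> with the displacement of \<open>u\<close> at \<open>v\<close>.\<close>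

lemma peel_up_bound:
  assumes "u \<in> Gt" "u (U v l t x) > x + c" shows "u v > v + (c - 1)"
proof -
  have "(u \<circ> U v l t) x - x < (u \<circ> U v l t) v - v + 1" using assms(1) by (intro Gt_osc comp_Gt U_Gt)
  then show ?thesis using assms(2) by simp
qed

lemma peel_down_bound:
  assumes "u \<in> Gt" "u (U v l t x) < x + c" shows "u v < v + (c + 1)"
proof -
  have "(u \<circ> U v l t) v - v < (u \<circ> U v l t) x - x + 1" using assms(1) by (intro Gt_osc comp_Gt U_Gt)
  then show ?thesis using assms(2) by simp
qed

text \<open>The admissible fixed points are those where \<open>u\<close> has displacement in the
  window widened by 1 on both sides. At such a point one of the two conditions already holds at
  \<open>v\<close>, whatever the strength, and the other is forced by a large positive or negative
  strength.\<close>

lemma peel_H: assumes "a < b" shows "peels 0 l (J a b) (J (a - 1) (b + 1))"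
  unfolding peels_def
proof (intro ballI conjI)
  fix u assume u: "u \<in> Gt"
  define S where "S = {v. v + (of_int a - 1) < u v \<and> u v < v + (of_int b + 1)}"
  have S: "v \<in> S \<longleftrightarrow> (\<exists>t. u \<circ> U v l t \<in> J a b)" for v
  proof
    assume "\<exists>t. u \<circ> U v l t \<in> J a b"
    then obtain t x y where "u (U v l t x) > x + of_int a" "u (U v l t y) < y + of_int b"
      unfolding J_def by auto
    then show "v \<in> S" using peel_up_bound[OF u] peel_down_bound[OF u] unfolding S_def by auto
  next
    assume v: "v \<in> S"
    have "\<exists>t. (\<exists>x. u (U v l t x) > x + of_int a) \<and> (\<exists>x. u (U v l t x) < x + of_int b)"
    proof (cases "u v < v + of_int b")
      case True
      have "v + (of_int a - 1) < u v" using v by (simp add: S_def)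
      then obtain t where "\<exists>x. u (U v l t x) > x + (of_int a - 1) + 1"
        using reach_up[OF u, of v "of_int a - 1" l] by blast
      then have "\<exists>x. u (U v l t x) > x + of_int a" by simp
      moreover have "\<exists>x. u (U v l t x) < x + of_int b" using True by (intro exI[of _ v]) simp
      ultimately show ?thesis by blast
    next
      case False
      moreover have "real_of_int a < real_of_int b" using assms by simp
      ultimately have "u (U v l s v) > v + of_int a" for s by simp
      then have "\<exists>x. u (U v l s x) > x + of_int a" for s by blast
      moreover have "u v < v + (of_int b + 1)" using v by (simp add: S_def)
      then obtain t where "\<exists>x. u (U v l t x) < x + (of_int b + 1) - 1"
        using reach_down[OF u, of v "of_int b + 1" l] by blast
      then have "\<exists>x. u (U v l t x) < x + of_int b" by simp
      ultimately show ?thesis by blast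
    qed
    then show "\<exists>t. u \<circ> U v l t \<in> J a b" using u by (auto simp: J_def)
  qed
  have st: "strengths 0 = UNIV" by (auto simp: strengths_def)
  have SE: "{v. \<exists>t\<in>strengths 0. u \<circ> U v l t \<in> J a b} = S" using S st by auto
  show "sconn vrel {(v, t). t \<in> strengths 0 \<and> u \<circ> U v l t \<in> J a b}"
  proof (rule sconn_peel[OF u open_region_J slice_J[OF u]])
    have "of_int a - 1 + 1 \<le> real_of_int b + 1" using assms by simp
    then show "arcset {v. \<exists>t\<in>strengths 0. u \<circ> U v l t \<in> J a b}"
      unfolding SE S_def by (rule arcset_between[OF u])
  qed
  have "(\<exists>G\<in>block 0 l. u \<circ> G \<in> J a b) \<longleftrightarrow> (\<exists>v. v \<in> S)"
    unfolding S block_def st by blast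
  also have "\<dots> \<longleftrightarrow> u \<in> J (a - 1) (b + 1)"
  proof
    assume "\<exists>v. v \<in> S" then show "u \<in> J (a - 1) (b + 1)" using u by (auto simp: S_def J_def)
  next
    assume "u \<in> J (a - 1) (b + 1)"
    then obtain x y where xy: "u x > x + (of_int a - 1)" "u y < y + (of_int b + 1)" by (auto simp: J_def)
    \<comment> \<open>If the point with large displacement overshoots the window, the oscillation
      bound puts the point with small displacement into it.\<close>
    show "\<exists>v. v \<in> S"
    proof (cases "x \<in> S")
      case False
      then have "u x \<ge> x + (of_int b + 1)" using xy by (auto simp: S_def)
      then have "u y > y + of_int b" using Gt_osc[OF u, of x y] by linarith
      moreover have "real_of_int a < real_of_int b" using assms by simp
      ultimately have "y \<in> S" using xy unfolding S_def by simp
      then show ?thesis by blast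
    qed blast
  qed
  finally show "u \<in> J (a - 1) (b + 1) \<longleftrightarrow> (\<exists>G\<in>block 0 l. u \<circ> G \<in> J a b)" by simp
qed

text \<open>A parabolic block of small strength is near the identity, so inside an open region every
  fixed point is admissible.\<close>

lemma small_strength:
  assumes "u \<in> Gt" "u \<in> R" "open_region R" shows "\<exists>t>0. u \<circ> U v 0 t \<in> R"
proof -
  have "continuous_on UNIV (\<lambda>t. u \<circ> U v 0 t)" using assms by (intro continuous_intros) auto
  then have "openin (top_of_set UNIV) {t \<in> UNIV. u \<circ> U v 0 t \<in> R}"
    by (rule openin_region[OF assms(3)]) (use assms in auto)
  then have "open {t. u \<circ> U v 0 t \<in> R}" by simp
  moreover have "0 \<in> {t. u \<circ> U v 0 t \<in> R}" using assms by simp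
  ultimately obtain e where "e > 0" "\<And>t. dist t 0 < e \<Longrightarrow> t \<in> {t. u \<circ> U v 0 t \<in> R}"
    unfolding open_dist by blast
  then show ?thesis by (intro exI[of _ "e/2"]) auto
qed

lemma not_J_parabolic: "T (of_int a) \<circ> U v 0 s \<notin> J a a"
proof
  assume "T (of_int a) \<circ> U v 0 s \<in> J a a"
  then obtain x y where xy: "U v 0 s x > x" "U v 0 s y < y" by (auto simp: J_def T_def)
  show False
    using U_mono[of 0 s v 0 y] U_mono[of s 0 v 0 x] xy by (cases "s \<ge> 0") auto
qed

text \<open>A positive parabolic block only raises displacements, so only the lower bound is
  relaxed. If \<open>u\<close> already lies in the region, all fixed points are admissible;
  otherwise they form the arc with displacement between \<open>a - 1\<close> and
  \<open>b\<close>.\<close>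

lemma peel_P: assumes "a \<le> b" shows "peels 1 0 (J a b) (J (a - 1) b)"
  unfolding peels_def
proof (intro ballI conjI)
  fix u assume u: "u \<in> Gt"
  have st: "strengths 1 = {0<..}" by (auto simp: strengths_def)
  have blk: "(\<exists>G\<in>block 1 0. u \<circ> G \<in> J a b) \<longleftrightarrow> (\<exists>v t. t > 0 \<and> u \<circ> U v 0 t \<in> J a b)"
    unfolding block_def st by blast
  have "arcset {v. \<exists>t\<in>strengths 1. u \<circ> U v 0 t \<in> J a b} \<and>
     (u \<in> J (a - 1) b \<longleftrightarrow> (\<exists>v t. t > 0 \<and> u \<circ> U v 0 t \<in> J a b))"
  proof (cases "u \<in> J a b")
    case True
    have "\<exists>t>0. u \<circ> U v 0 t \<in> J a b" for v
      using small_strength[OF u True open_region_J] .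
    moreover have "u \<in> J (a - 1) b"
    proof -
      obtain x where "u x > x + of_int a" using True by (auto simp: J_def)
      then have "u x > x + of_int (a - 1)" by simp
      then show ?thesis using True by (auto simp: J_def)
    qed
    ultimately show ?thesis by (simp add: st greaterThan_iff Bex_def)
  next
    case nJ: False
    define S where "S = {v. v + (of_int a - 1) < u v \<and> u v < v + of_int b}"
    show ?thesis
    proof (cases "\<exists>x. u x < x + of_int b")
      case False
      have "u \<circ> U v 0 t \<notin> J a b" if "t > 0" for v t
      proof
        assume "u \<circ> U v 0 t \<in> J a b"
        then obtain x where x: "u (U v 0 t x) < x + of_int b" by (auto simp: J_def)
        have "u x \<le> u (U v 0 t x)" using U_mono[of 0 t v 0 x] that u by simp
        then show False using x False by (meson le_less_trans)
      qed
      moreover have "u \<notin> J (a - 1) b" using False by (auto simp: J_def)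
      moreover have "arcset {}" by (simp add: arcset_def)
      ultimately show ?thesis by (simp add: st Bex_def)
    next
      case True
      then have le: "u x \<le> x + of_int a" for x using nJ u unfolding J_def by (auto simp: not_less)
      have S: "v \<in> S \<longleftrightarrow> (\<exists>t>0. u \<circ> U v 0 t \<in> J a b)" for v
      proof
        assume v: "v \<in> S"
        obtain t0 where t0: "\<And>t. t \<ge> t0 \<Longrightarrow> \<exists>x. u (U v 0 t x) > x + (of_int a - 1) + 1"
          using reach_up[OF u, of v "of_int a - 1" 0] v unfolding S_def by auto
        define t where "t = max t0 1"
        have "t > 0" "\<exists>x. u (U v 0 t x) > x + of_int a" using t0[of t] by (auto simp: t_def)
        moreover have "\<exists>x. u (U v 0 t x) < x + of_int b" using v by (intro exI[of _ v]) (simp add: S_def)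
        ultimately have "t > 0" "u \<circ> U v 0 t \<in> J a b" using u by (simp_all add: J_def)
        then show "\<exists>t>0. u \<circ> U v 0 t \<in> J a b" by blast
      next
        assume "\<exists>t>0. u \<circ> U v 0 t \<in> J a b"
        then obtain t where t: "t > 0" "u \<circ> U v 0 t \<in> J a b" by blast
        then obtain x where "u (U v 0 t x) > x + of_int a" by (auto simp: J_def)
        then have up: "v + (of_int a - 1) < u v" using peel_up_bound[OF u] by blast
        \<comment> \<open>On the excluded boundary \<open>a = b\<close>, and \<open>u\<close>
          shifted by \<open>a\<close> fixes \<open>v\<close> without ever moving a point forward. It
          is then parabolic or trivial at \<open>v\<close>, and so is its product with the block,
          which contradicts membership in \<open>J a a\<close>.\<close>
        have "u v < v + of_int b"
        proof (rule ccontr)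
          assume "\<not> u v < v + of_int b"
          then have ab: "a = b" "u v = v + of_int a" using le[of v] assms by auto
          obtain l s where us: "u = T (of_int a) \<circ> U v l s" using Gt_fix_int_U[OF u ab(2)] by blast
          have "l = 0"
          proof (rule ccontr)
            assume "l \<noteq> 0"
            then obtain x where "U v l s x > x" using hyp_U[of l v s] by (auto simp: J_def)
            then have "u x > x + of_int a" by (simp add: us T_def)
            then show False using le[of x] by simp
          qed
          then have "u \<circ> U v 0 t = T (of_int a) \<circ> U v 0 (t + s)"
            unfolding us o_assoc[symmetric] by (simp add: U_comp)
          then show False using t(2) ab not_J_parabolic by metis
        qed
        then show "v \<in> S" using up by (simp add: S_def)
      qed
      have SE: "{v. \<exists>t\<in>strengths 1. u \<circ> U v 0 t \<in> J a b} = S" using S st by auto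
      have "of_int a - 1 + 1 \<le> real_of_int b" using assms by simp
      then have arc: "arcset S" unfolding S_def by (rule arcset_between[OF u])
      have "(\<exists>v t. t > 0 \<and> u \<circ> U v 0 t \<in> J a b) \<longleftrightarrow> (\<exists>v. v \<in> S)" using S by blast
      also have "\<dots> \<longleftrightarrow> u \<in> J (a - 1) b"
      proof
        assume "\<exists>v. v \<in> S" then show "u \<in> J (a - 1) b" using u by (auto simp: S_def J_def)
      next
        assume "u \<in> J (a - 1) b"
        then obtain x y where xy: "u x > x + (of_int a - 1)" "u y < y + of_int b" by (auto simp: J_def)
        show "\<exists>v. v \<in> S"
        proof (cases "x \<in> S")
          case False
          then have "u x \<ge> x + of_int b" using xy by (auto simp: S_def)
          then have "u y > y + (of_int b - 1)" using Gt_osc[OF u, of x y] by linarith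
          moreover have "real_of_int a \<le> real_of_int b" using assms by simp
          ultimately have "y \<in> S" using xy unfolding S_def by simp
          then show ?thesis by blast
        qed blast
      qed
      finally show ?thesis using arc SE by simp
    qed
  qed
  then show "sconn vrel {(v, t). t \<in> strengths 1 \<and> u \<circ> U v 0 t \<in> J a b}" "u \<in> J (a - 1) b \<longleftrightarrow> (\<exists>G\<in>block 1 0. u \<circ> G \<in> J a b)"
    unfolding blk by (auto intro!: sconn_peel[OF u open_region_J slice_J[OF u]])
qed

lemma mirr_J: "mirr F \<in> J a b \<longleftrightarrow> F \<in> J (- b) (- a)"
proof -
  have "(\<exists>x. mirr F x > x + of_int a) \<longleftrightarrow> (\<exists>x. F x < x + of_int (- a))"
    unfolding mirr_def by (metis (no_types, lifting) add.inverse_inverse less_minus_iff minus_add_distrib of_int_minus)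
  moreover have "(\<exists>x. mirr F x < x + of_int b) \<longleftrightarrow> (\<exists>x. F x > x + of_int (- b))"
    unfolding mirr_def by (metis (no_types, lifting) add.inverse_inverse minus_less_iff minus_add_distrib of_int_minus)
  ultimately show ?thesis unfolding J_def by auto
qed

lemma mirr_block: "mirr ` block \<kappa> l = block (- \<kappa>) l"
proof -
  have "mirr ` block \<kappa> l \<subseteq> block (- \<kappa>) l" for \<kappa>
    unfolding block_def by (auto simp: mirr_U strengths_def) (metis minus_minus neg_0_less_iff_less neg_less_0_iff_less)+
  from this[of \<kappa>] this[of "- \<kappa>"] show ?thesis by (force simp: image_subset_iff)
qed

text \<open>Mirror image of \<open>peel_P\<close>; the parameters are carried over by negating both
  the fixed point and the strength.\<close>

lemma peel_N: assumes "a \<le> b" shows "peels (- 1) 0 (J a b) (J a (b + 1))"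
  unfolding peels_def
proof (intro ballI)
  fix u assume u: "u \<in> Gt"
  let ?P = "{(v, t). t \<in> strengths 1 \<and> mirr u \<circ> U v 0 t \<in> J (- b) (- a)}"
  let ?N = "{(v, t). t \<in> strengths (- 1) \<and> u \<circ> U v 0 t \<in> J a b}"
  have P: "(mirr u \<in> J (- b - 1) (- a) \<longleftrightarrow> (\<exists>G\<in>block 1 0. mirr u \<circ> G \<in> J (- b) (- a)))" "sconn vrel ?P"
    using peel_P[of "- b" "- a"] assms u unfolding peels_def by auto
  have e: "mirr u \<circ> G \<in> J (- b) (- a) \<longleftrightarrow> u \<circ> mirr G \<in> J a b" for G
  proof -
    have "mirr (u \<circ> mirr G) = mirr u \<circ> G" by (simp add: mirr_comp)
    then show ?thesis using mirr_J[of "u \<circ> mirr G" "- b" "- a"] by simp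
  qed
  have b: "block (- 1) 0 = mirr ` block 1 0" by (simp add: mirr_block)
  have im: "(\<lambda>(v, t). (- v, - t)) ` ?P = ?N"
  proof -
    have 1: "t \<in> strengths 1 \<longleftrightarrow> - t \<in> strengths (- 1)" for t by (auto simp: strengths_def)
    have 2: "mirr u \<circ> U v 0 t \<in> J (- b) (- a) \<longleftrightarrow> u \<circ> U (- v) 0 (- t) \<in> J a b" for v t
      unfolding e mirr_U ..
    show ?thesis
    proof (intro equalityI subsetI)
      fix p assume "p \<in> (\<lambda>(v, t). (- v, - t)) ` ?P" then show "p \<in> ?N" using 1 2 by auto
    next
      fix p assume "p \<in> ?N"
      then have "(- fst p, - snd p) \<in> ?P" using 1[of "- snd p"] 2[of "- fst p" "- snd p"] by auto
      then show "p \<in> (\<lambda>(v, t). (- v, - t)) ` ?P" by (rule rev_image_eqI) simp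
    qed
  qed
  have "sconn vrel ((\<lambda>(v, t). (- v, - t)) ` ?P)"
  proof (rule sconn_image[OF P(2)])
    show "continuous_on ?P (\<lambda>(v, t). (- v, - t))" unfolding case_prod_unfold by (intro continuous_intros)
    show "vrel (case p of (v, t) \<Rightarrow> (- v, - t)) (case p' of (v, t) \<Rightarrow> (- v, - t))" if "vrel p p'" for p p'
    proof -
      obtain k :: int where "fst p' = fst p + of_int k" "snd p' = snd p" using \<open>vrel p p'\<close> unfolding vrel_def by blast
      then show ?thesis unfolding vrel_def case_prod_unfold by (auto intro!: exI[of _ "- k"])
    qed
  qed
  moreover have "mirr u \<in> J (- b - 1) (- a) \<longleftrightarrow> u \<in> J a (b + 1)"
    using mirr_J[of u "- b - 1" "- a"] by (simp add: add.commute)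
  moreover have "(\<exists>G\<in>block 1 0. mirr u \<circ> G \<in> J (- b) (- a)) \<longleftrightarrow> (\<exists>G\<in>block (- 1) 0. u \<circ> G \<in> J a b)"
    unfolding b e by auto
  ultimately show "(u \<in> J a (b + 1) \<longleftrightarrow> (\<exists>G\<in>block (- 1) 0. u \<circ> G \<in> J a b)) \<and> sconn vrel ?N"
    using P(1) im by simp
qed

lemma peel_L: assumes "a \<le> b" shows "peels 1 0 (Lr a b) (Lr (a - 1) b)"
  unfolding peels_def
proof (intro ballI conjI)
  fix u assume u: "u \<in> Gt"
  have st: "strengths 1 = {0<..}" by (auto simp: strengths_def)
  have blk: "(\<exists>G\<in>block 1 0. u \<circ> G \<in> Lr a b) \<longleftrightarrow> (\<exists>v t. t > 0 \<and> u \<circ> U v 0 t \<in> Lr a b)"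
    unfolding block_def st by blast
  have "arcset {v. \<exists>t\<in>strengths 1. u \<circ> U v 0 t \<in> Lr a b} \<and>
     (u \<in> Lr (a - 1) b \<longleftrightarrow> (\<exists>v t. t > 0 \<and> u \<circ> U v 0 t \<in> Lr a b))"
  proof (cases "u \<in> Lr a b")
    case True
    have "\<exists>t>0. u \<circ> U v 0 t \<in> Lr a b" for v
      using small_strength[OF u True open_region_L] .
    moreover have "u \<in> Lr (a - 1) b"
    proof -
      obtain x where "u x > x + of_int a" using True by (auto simp: Lr_def)
      then have "u x > x + of_int (a - 1)" by simp
      then show ?thesis using True by (auto simp: Lr_def)
    qed
    ultimately show ?thesis by (simp add: st greaterThan_iff Bex_def)
  next
    case nL: False
    show ?thesis
    proof (cases "\<forall>x. u x < x + of_int b + 1")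
      case False
      have "u \<circ> U v 0 t \<notin> Lr a b" if "t > 0" for v t
      proof
        assume L: "u \<circ> U v 0 t \<in> Lr a b"
        have "u x \<le> u (U v 0 t x)" for x using U_mono[of 0 t v 0 x] that u by simp
        then show False using L False unfolding Lr_def by (auto, meson le_less_trans)
      qed
      moreover have "u \<notin> Lr (a - 1) b" using False by (auto simp: Lr_def)
      moreover have "arcset {}" by (simp add: arcset_def)
      ultimately show ?thesis by (simp add: st Bex_def)
    next
      case True
      then have le: "u x \<le> x + of_int a" for x using nL u unfolding Lr_def by (auto simp: not_less)
      define S where "S = {v. v + (of_int a - 1) < u v}"
      have S: "v \<in> S \<longleftrightarrow> (\<exists>t>0. u \<circ> U v 0 t \<in> Lr a b)" for v
      proof
        assume v: "v \<in> S"
        obtain t0 where t0: "\<And>t. t \<ge> t0 \<Longrightarrow> \<exists>x. u (U v 0 t x) > x + (of_int a - 1) + 1"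
          using reach_up[OF u, of v "of_int a - 1" 0] v unfolding S_def by auto
        define t where "t = max t0 1"
        have "t > 0" "\<exists>x. u (U v 0 t x) > x + of_int a" using t0[of t] by (auto simp: t_def)
        \<comment> \<open>The upper bound survives any strength: at \<open>v\<close> the product has
          displacement at most \<open>a\<close>, hence less than \<open>a + 1\<close>
          everywhere.\<close>
        moreover have "u (U v 0 t x) < x + of_int b + 1" for x
        proof -
          have "(u \<circ> U v 0 t) x - x < (u \<circ> U v 0 t) v - v + 1" using u by (intro Gt_osc comp_Gt U_Gt)
          moreover have "real_of_int a \<le> real_of_int b" using assms by simp
          ultimately show ?thesis using le[of v] by simp
        qed
        ultimately have "t > 0" "u \<circ> U v 0 t \<in> Lr a b" using u by (simp_all add: Lr_def)
        then show "\<exists>t>0. u \<circ> U v 0 t \<in> Lr a b" by blast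
      next
        assume "\<exists>t>0. u \<circ> U v 0 t \<in> Lr a b"
        then obtain t where t: "t > 0" "u \<circ> U v 0 t \<in> Lr a b" by blast
        then obtain x where "u (U v 0 t x) > x + of_int a" by (auto simp: Lr_def)
        then show "v \<in> S" using peel_up_bound[OF u] by (simp add: S_def)
      qed
      have SE: "{v. \<exists>t\<in>strengths 1. u \<circ> U v 0 t \<in> Lr a b} = S" using S st by auto
      have arc: "arcset S" unfolding S_def by (rule arcset_gt[OF u])
      have "(\<exists>v t. t > 0 \<and> u \<circ> U v 0 t \<in> Lr a b) \<longleftrightarrow> (\<exists>v. v \<in> S)" using S by blast
      also have "\<dots> \<longleftrightarrow> u \<in> Lr (a - 1) b" using u True by (auto simp: S_def Lr_def)
      finally show ?thesis using arc SE by simp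
    qed
  qed
  then show "sconn vrel {(v, t). t \<in> strengths 1 \<and> u \<circ> U v 0 t \<in> Lr a b}" "u \<in> Lr (a - 1) b \<longleftrightarrow> (\<exists>G\<in>block 1 0. u \<circ> G \<in> Lr a b)"
    unfolding blk by (auto intro!: sconn_peel[OF u open_region_L slice_L[OF u]])
qed

subsection \<open>Products of blocks\<close>

definition gprod :: "'i list \<Rightarrow> ('i \<Rightarrow> real \<Rightarrow> real) \<Rightarrow> real \<Rightarrow> real" where
  "gprod js x = foldr (\<lambda>j F. x j \<circ> F) js id"

lemma gprod_Nil [simp]: "gprod [] x = id" by (simp add: gprod_def)
lemma gprod_Cons [simp]: "gprod (j # js) x = x j \<circ> gprod js x" by (simp add: gprod_def)
lemma gprod_append: "gprod (is @ js) x = gprod is x \<circ> gprod js x"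
  by (induct "is") (simp_all add: o_assoc)
lemma gprod_Gt: "(\<And>j. j \<in> set js \<Longrightarrow> x j \<in> Gt) \<Longrightarrow> gprod js x \<in> Gt"
  by (induct js) auto
lemma gprod_cong: "(\<And>j. j \<in> set js \<Longrightarrow> x j = y j) \<Longrightarrow> gprod js x = gprod js y"
  by (induct js) auto

lemma continuous_on_gprod:
  fixes X :: "'a::topological_space \<Rightarrow> 'i \<Rightarrow> real \<Rightarrow> real"
  assumes "\<And>j. j \<in> set js \<Longrightarrow> continuous_on S (\<lambda>q. X q j)" "\<And>j q. j \<in> set js \<Longrightarrow> q \<in> S \<Longrightarrow> X q j \<in> Gt"
  shows "continuous_on S (\<lambda>q. gprod js (X q))"
  using assms
proof (induct js)
  case (Cons j js)
  show ?case unfolding gprod_Cons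
    by (intro continuous_on_Gt_comp Cons) (use Cons in auto)
qed simp

definition pblock :: "('i \<Rightarrow> real) \<Rightarrow> ('i \<Rightarrow> real \<times> real) \<Rightarrow> 'i \<Rightarrow> real \<Rightarrow> real" where
  "pblock l x j = U (fst (x j)) (l j) (snd (x j))"

text \<open>Parameters outside \<open>js\<close> are pinned to \<open>(0, 0)\<close>, so that a
  family over the whole index type amounts to a family over \<open>js\<close>.\<close>

definition block_space :: "('i \<Rightarrow> int) \<Rightarrow> ('i \<Rightarrow> real) \<Rightarrow> 'i list \<Rightarrow> (real \<Rightarrow> real) set \<Rightarrow> ('i \<Rightarrow> real \<times> real) set" where
  "block_space \<kappa> l js R = {x. (\<forall>j\<in>set js. snd (x j) \<in> strengths (\<kappa> j)) \<and> (\<forall>j. j \<notin> set js \<longrightarrow> x j = (0, 0)) \<and>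
     gprod js (pblock l x) \<in> R}"

definition prel :: "('i \<Rightarrow> real \<times> real) \<Rightarrow> ('i \<Rightarrow> real \<times> real) \<Rightarrow> bool" where
  "prel x x' \<longleftrightarrow> (\<forall>j. vrel (x j) (x' j))"

lemma pblock_Gt [simp]: "pblock l x j \<in> Gt" by (simp add: pblock_def)
lemma gprod_pblock_Gt [simp]: "gprod js (pblock l x) \<in> Gt" by (rule gprod_Gt) simp

lemma pblock_prel: "prel x x' \<Longrightarrow> pblock l x = pblock l x'"
proof
  fix j assume "prel x x'"
  then obtain k :: int where "fst (x' j) = fst (x j) + of_int k" "snd (x' j) = snd (x j)"
    unfolding prel_def vrel_def by blast
  then show "pblock l x j = pblock l x' j" by (simp add: pblock_def U_period)
qed

lemma vrel_refl [simp]: "vrel p p" unfolding vrel_def by (auto intro: exI[of _ 0])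
lemma prel_refl [simp]: "prel x x" by (simp add: prel_def)

lemma continuous_on_pblock [continuous_intros]:
  assumes "continuous_on S l" "continuous_on S x"
  shows "continuous_on S (\<lambda>q. pblock (l q) (x q) j)"
  unfolding pblock_def
  by (intro continuous_on_U continuous_on_fst continuous_on_snd
      continuous_on_product_then_coordinatewise[OF assms(1)] continuous_on_product_then_coordinatewise[OF assms(2)])

lemma continuous_on_gprod_pblock [continuous_intros]:
  assumes "continuous_on S l" "continuous_on S x"
  shows "continuous_on S (\<lambda>q. gprod js (pblock (l q) (x q)))"
  by (rule continuous_on_gprod) (auto intro: continuous_intros assms)

text \<open>The longer product space is a fibration over the shorter one with region
  \<open>R'\<close>: \<open>peels\<close> supplies the image and the fibres, and inserting the last
  pair of parameters is a continuous surjection from the total space.\<close>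

lemma block_space_snoc:
  assumes d: "distinct (js @ [j])" and R: "open_region R" and P: "peels (\<kappa> j) (l j) R R'" and G: "R' \<subseteq> Gt"
    and c: "sconn prel (block_space \<kappa> l js R')"
  shows "sconn prel (block_space \<kappa> l (js @ [j]) R)"
    "block_space \<kappa> l (js @ [j]) R \<noteq> {} \<longleftrightarrow> block_space \<kappa> l js R' \<noteq> {}"
proof -
  define B where "B = block_space \<kappa> l js R'"
  define E where "E = {(x, v, t). x \<in> B \<and> t \<in> strengths (\<kappa> j) \<and> gprod js (pblock l x) \<circ> U v (l j) t \<in> R}"
  define \<Phi> :: "(('a \<Rightarrow> real \<times> real) \<times> (real \<times> real)) \<Rightarrow> 'a \<Rightarrow> real \<times> real" where "\<Phi> = (\<lambda>(x, p). x(j := p))"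
  define rE :: "(('a \<Rightarrow> real \<times> real) \<times> (real \<times> real)) \<Rightarrow> (('a \<Rightarrow> real \<times> real) \<times> (real \<times> real)) \<Rightarrow> bool"
    where "rE = (\<lambda>(x, p) (x', p'). prel x x' \<and> vrel p p')"
  have j: "j \<notin> set js" using d by simp
  have pj: "gprod js (pblock l (x(j := p))) = gprod js (pblock l x)" for x p
    using j by (intro gprod_cong) (auto simp: pblock_def)
  have im: "\<Phi> ` E = block_space \<kappa> l (js @ [j]) R"
  proof (intro equalityI subsetI)
    fix y assume "y \<in> \<Phi> ` E"
    then show "y \<in> block_space \<kappa> l (js @ [j]) R"
      using j by (auto simp: \<Phi>_def E_def B_def block_space_def gprod_append pj) (auto simp: pblock_def)
  next
    fix y assume y: "y \<in> block_space \<kappa> l (js @ [j]) R"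
    have yR: "snd (y j) \<in> strengths (\<kappa> j)" "gprod js (pblock l y) \<circ> U (fst (y j)) (l j) (snd (y j)) \<in> R"
      using y by (auto simp: block_space_def gprod_append pblock_def)
    then have "\<exists>G\<in>block (\<kappa> j) (l j). gprod js (pblock l y) \<circ> G \<in> R" unfolding block_def by blast
    then have "gprod js (pblock l y) \<in> R'" using P unfolding peels_def by simp
    then have "y(j := (0, 0)) \<in> B" using y j by (auto simp: B_def block_space_def pj)
    then have "(y(j := (0, 0)), y j) \<in> E" using yR by (simp add: E_def pj case_prod_unfold)
    moreover have "\<Phi> (y(j := (0, 0)), y j) = y" by (simp add: \<Phi>_def)
    ultimately show "y \<in> \<Phi> ` E" by force
  qed
  have ne: "\<exists>p. (x, p) \<in> E" if "x \<in> B" for x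
  proof -
    have "gprod js (pblock l x) \<in> R'" using that by (simp add: B_def block_space_def)
    then obtain H where "H \<in> block (\<kappa> j) (l j)" "gprod js (pblock l x) \<circ> H \<in> R"
      using P unfolding peels_def by auto
    then show ?thesis using that unfolding E_def block_def by auto
  qed
  show "block_space \<kappa> l (js @ [j]) R \<noteq> {} \<longleftrightarrow> block_space \<kappa> l js R' \<noteq> {}"
    unfolding im[symmetric] using ne by (auto simp: B_def[symmetric] E_def)
  have "sconn rE E"
  proof (rule sconn_fibration[of prel B])
    show "sconn prel B" using c by (simp add: B_def)
    show "y \<in> B" if "(y, z) \<in> E" for y z using that by (auto simp: E_def)
    show "\<exists>z. (y, z) \<in> E" if "y \<in> B" for y using ne[OF that] .
    show "sconn (\<lambda>z z'. rE (y, z) (y, z')) {z. (y, z) \<in> E}" if "y \<in> B" for y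
    proof -
      have "{z. (y, z) \<in> E} = {(v, t). t \<in> strengths (\<kappa> j) \<and> gprod js (pblock l y) \<circ> U v (l j) t \<in> R}"
        using that by (auto simp: E_def)
      moreover have "(\<lambda>z z'. rE (y, z) (y, z')) = vrel" by (auto simp: rE_def fun_eq_iff)
      ultimately show ?thesis using P unfolding peels_def by auto
    qed
    show "openin (top_of_set B) {y \<in> B. (y, z) \<in> E}" for z
    proof (cases "snd z \<in> strengths (\<kappa> j)")
      case True
      have "continuous_on B (\<lambda>y. gprod js (pblock l y))"
        by (intro continuous_intros)
      then have "continuous_on B (\<lambda>y. gprod js (pblock l y) \<circ> U (fst z) (l j) (snd z))"
        by (rule continuous_on_Gt_comp) (auto intro: continuous_intros)
      then have "openin (top_of_set B) {y \<in> B. gprod js (pblock l y) \<circ> U (fst z) (l j) (snd z) \<in> R}"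
        by (rule openin_region[OF R]) auto
      then show ?thesis using True by (simp add: E_def case_prod_unfold Collect_conj_eq)
    qed (auto simp: E_def case_prod_unfold)
    show "(y', z) \<in> E \<and> rE (y, z) (y', z)" if "(y, z) \<in> E" "y' \<in> B" "prel y y'" for y y' z
      using that pblock_prel[OF that(3), of l] by (auto simp: E_def rE_def)
  qed
  then have "sconn prel (\<Phi> ` E)"
  proof (rule sconn_image)
    show "continuous_on E \<Phi>"
      unfolding \<Phi>_def case_prod_unfold
    proof (rule continuous_on_coordinatewise_then_product)
      fix i
      have "continuous_on E (\<lambda>q. fst q i)"
        by (rule continuous_on_product_then_coordinatewise) (intro continuous_intros)
      then show "continuous_on E (\<lambda>q. ((fst q)(j := snd q)) i)"
        by (cases "i = j") (simp_all add: continuous_on_snd continuous_on_id)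
    qed
    show "prel (\<Phi> p) (\<Phi> p')" if "rE p p'" for p p'
      using that by (auto simp: \<Phi>_def rE_def prel_def case_prod_unfold)
  qed
  then show "sconn prel (block_space \<kappa> l (js @ [j]) R)" by (simp add: im)
qed

text \<open>The blocks able to raise the displacement; a hyperbolic block counts here and in
  \<open>downs\<close>.\<close>

definition ups :: "('i \<Rightarrow> int) \<Rightarrow> 'i list \<Rightarrow> int" where
  "ups \<kappa> js = (\<Sum>j\<leftarrow>js. if \<kappa> j = -1 then 0 else 1)"

definition downs :: "('i \<Rightarrow> int) \<Rightarrow> 'i list \<Rightarrow> int" where
  "downs \<kappa> js = (\<Sum>j\<leftarrow>js. if \<kappa> j = 1 then 0 else 1)"

lemma sconn_trivial [simp]: "sconn rel {}" "sconn rel {a}" by (simp_all add: sconn_def)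

lemma block_space_Nil: "block_space \<kappa> l [] R = (if id \<in> R then {\<lambda>_. (0, 0)} else {})"
  by (auto simp: block_space_def)

text \<open>Each removed block lowers \<open>a\<close> or raises \<open>b\<close> or does both, so
  that in the end the identity has to lie in \<open>J (a - ups) (b + downs)\<close>. The strict
  inequality needed for hyperbolic blocks persists because the window only grows.\<close>

lemma block_space_J:
  assumes "distinct js" "a < b \<or> a = b \<and> (\<forall>j\<in>set js. \<kappa> j \<noteq> 0)"
    "\<And>j. j \<in> set js \<Longrightarrow> \<kappa> j \<in> {-1, 0, 1}" "\<And>j. j \<in> set js \<Longrightarrow> \<kappa> j \<noteq> 0 \<Longrightarrow> l j = 0"
  shows "sconn prel (block_space \<kappa> l js (J a b)) \<and>
    (block_space \<kappa> l js (J a b) \<noteq> {} \<longleftrightarrow> a < ups \<kappa> js \<and> 0 < b + downs \<kappa> js)"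
  using assms
proof (induct js arbitrary: a b rule: rev_induct)
  case Nil
  have "id \<in> J a b \<longleftrightarrow> a < 0 \<and> 0 < b" by (auto simp: J_def)
  then show ?case by (simp add: block_space_Nil ups_def downs_def)
next
  case (snoc j js)
  define a' b' where "a' = (if \<kappa> j = -1 then a else a - 1)" and "b' = (if \<kappa> j = 1 then b else b + 1)"
  have P: "peels (\<kappa> j) (l j) (J a b) (J a' b')"
  proof -
    consider "\<kappa> j = -1" | "\<kappa> j = 0" | "\<kappa> j = 1" using snoc.prems(3)[of j] by auto
    then show ?thesis
    proof cases
      case 1 then show ?thesis using peel_N[of a b] snoc.prems(2) snoc.prems(4)[of j] by (auto simp: a'_def b'_def)
    next
      case 2 then show ?thesis using peel_H[of a b "l j"] snoc.prems(2) by (auto simp: a'_def b'_def)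
    next
      case 3 then show ?thesis using peel_P[of a b] snoc.prems(2) snoc.prems(4)[of j] by (auto simp: a'_def b'_def)
    qed
  qed
  have IH: "sconn prel (block_space \<kappa> l js (J a' b')) \<and>
    (block_space \<kappa> l js (J a' b') \<noteq> {} \<longleftrightarrow> a' < ups \<kappa> js \<and> 0 < b' + downs \<kappa> js)"
    by (rule snoc.hyps) (use snoc.prems in \<open>auto simp: a'_def b'_def\<close>)
  have G: "J a' b' \<subseteq> Gt" using J_Gt by blast
  note step = block_space_snoc[OF snoc.prems(1) open_region_J P G conjunct1[OF IH]]
  have "ups \<kappa> (js @ [j]) = ups \<kappa> js + (a - a')" "b + downs \<kappa> (js @ [j]) = b' + downs \<kappa> js"
    by (auto simp: ups_def downs_def a'_def b'_def)
  then show ?case using step IH by (auto simp: algebra_simps)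
qed

lemma block_space_L:
  assumes "distinct js" "a \<le> b" "\<And>j. j \<in> set js \<Longrightarrow> \<kappa> j = 1 \<and> l j = 0"
  shows "sconn prel (block_space \<kappa> l js (Lr a b)) \<and>
    (block_space \<kappa> l js (Lr a b) \<noteq> {} \<longleftrightarrow> a < int (length js) \<and> 0 \<le> b)"
  using assms
proof (induct js arbitrary: a rule: rev_induct)
  case Nil
  have "(0::real) < of_int b + 1 \<longleftrightarrow> 0 \<le> b" by linarith
  then have "id \<in> Lr a b \<longleftrightarrow> a < 0 \<and> 0 \<le> b" by (auto simp: Lr_def)
  then show ?case by (simp add: block_space_Nil)
next
  case (snoc j js)
  have P: "peels (\<kappa> j) (l j) (Lr a b) (Lr (a - 1) b)"
    using peel_L[of a b] snoc.prems by auto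
  have IH: "sconn prel (block_space \<kappa> l js (Lr (a - 1) b)) \<and>
    (block_space \<kappa> l js (Lr (a - 1) b) \<noteq> {} \<longleftrightarrow> a - 1 < int (length js) \<and> 0 \<le> b)"
    by (rule snoc.hyps) (use snoc.prems in auto)
  have G: "Lr (a - 1) b \<subseteq> Gt" using Lr_Gt by blast
  note step = block_space_snoc[OF snoc.prems(1) open_region_L P G conjunct1[OF IH]]
  show ?case using step IH by auto
qed

subsection \<open>Solving for a parabolic last factor\<close>

text \<open>The displacement has maximum \<open>n\<close> and is not constant. By
  \<open>touches_block\<close> this is what \<open>w\<close> must satisfy for the factor determined
  by the relation to be positive parabolic.\<close>

definition touches :: "int \<Rightarrow> (real \<Rightarrow> real) \<Rightarrow> bool" where
  "touches n w \<longleftrightarrow> (\<forall>x. w x \<le> x + of_int n) \<and> (\<exists>x. w x = x + of_int n) \<and> (\<exists>x. w x < x + of_int n)"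

lemma U_less_all: assumes "t < s" "\<And>k::int. x \<noteq> v + of_int k" shows "U v l t x < U v l s x"
proof -
  define k where "k = \<lfloor>x - v\<rfloor>"
  define y where "y = x - of_int k"
  have "v \<le> y" "y < v + 1" unfolding k_def y_def by linarith+
  moreover have "y \<noteq> v" using assms(2)[of k] by (auto simp: y_def)
  ultimately have "U v l t y < U v l s y" using U_less[of v y t s l] assms(1) by simp
  moreover have "U v l r x = U v l r y + of_int k" for r
    using Gt_period_int[OF U_Gt, of v l r y k] by (simp add: y_def)
  ultimately show ?thesis by simp
qed

definition below :: "int \<Rightarrow> (real \<Rightarrow> real) \<Rightarrow> bool" where
  "below n w \<longleftrightarrow> (\<forall>x. w x < x + of_int n)"

definition exceeds :: "int \<Rightarrow> (real \<Rightarrow> real) \<Rightarrow> bool" where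
  "exceeds n w \<longleftrightarrow> (\<exists>x. w x > x + of_int n)"

lemma not_below_max: assumes "w \<in> Gt" "\<not> below n w" shows "\<exists>x. w x \<ge> x + of_int n"
  using assms unfolding below_def by (auto simp: not_less)

text \<open>Displacements increase strictly with the strength except at the translates of
  \<open>v\<close>, and there they are below \<open>n\<close> by assumption. So the maximum passes
  the value \<open>n\<close> at one strength only.\<close>

lemma solve_trichotomy:
  assumes u: "u \<in> Gt" and v: "u v < v + of_int n"
    and t: "\<not> below n (u \<circ> U v l t)" "\<not> exceeds n (u \<circ> U v l t)"
  shows "s < t \<Longrightarrow> below n (u \<circ> U v l s)" "t < s \<Longrightarrow> exceeds n (u \<circ> U v l s)"
proof -
  have le: "u (U v l t x) \<le> x + of_int n" for x using t(2) by (auto simp: exceeds_def not_less)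
  have per: "u (v + of_int k) < (v + of_int k) + of_int n" for k :: int
    using v Gt_period_int[OF u, of v k] by simp
  show "below n (u \<circ> U v l s)" if "s < t"
    unfolding below_def
  proof
    fix x
    show "(u \<circ> U v l s) x < x + of_int n"
    proof (cases "\<exists>k::int. x = v + of_int k")
      case True then show ?thesis using per by auto
    next
      case False
      then have "U v l s x < U v l t x" using U_less_all[OF \<open>s < t\<close>] by blast
      then have "u (U v l s x) < u (U v l t x)" using u by simp
      then show ?thesis using le[of x] by simp
    qed
  qed
  show "exceeds n (u \<circ> U v l s)" if "t < s"
  proof -
    obtain x where x: "u (U v l t x) \<ge> x + of_int n" using not_below_max[OF _ t(1)] u by auto
    have "x \<noteq> v + of_int k" for k :: int
    proof
      assume "x = v + of_int k"
      then show False using x per[of k] by simp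
    qed
    then have "u (U v l t x) < u (U v l s x)" using U_less_all[OF \<open>t < s\<close>] u by simp
    then show ?thesis using x unfolding exceeds_def by (intro exI[of _ x]) simp
  qed
qed

text \<open>A very negative strength pushes all of the period up to \<open>x0\<close> below
  \<open>y\<close>, where \<open>u\<close> is still less than \<open>v + n\<close>. On the short
  rest up to \<open>v + 1\<close> the value \<open>u v + 1\<close> is bound enough.\<close>

lemma solve_low:
  assumes u: "u \<in> Gt" and v: "u v < v + of_int n"
  shows "\<exists>t. below n (u \<circ> U v l t)"
proof -
  have "(u \<longlongrightarrow> u v) (at_right v)"
    using Gt_isCont[OF u] by (simp add: isCont_def filterlim_at_split)
  then have "eventually (\<lambda>y. u y < v + of_int n) (at_right v)" by (rule order_tendstoD(2)) (rule v)
  moreover have "eventually (\<lambda>y. y \<in> {v<..<v+1}) (at_right v)" by (rule eventually_at_right_real) simp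
  ultimately have "eventually (\<lambda>y. u y < v + of_int n \<and> y \<in> {v<..<v+1}) (at_right v)" by eventually_elim blast
  then obtain y where y: "u y < v + of_int n" "v < y" "y < v + 1"
    using eventually_happens'[OF trivial_limit_at_right_real] by fastforce
  \<comment> \<open>Chosen so close to \<open>v + 1\<close> that \<open>u v + 1 < x0 + n\<close>;
    the maximum with \<open>v + 1/2\<close> keeps it to the right of \<open>v\<close>.\<close>
  define x0 where "x0 = max (v + 1/2) ((u v + 1 - of_int n + (v + 1)) / 2)"
  have x0: "v < x0" "x0 < v + 1" "u v + 1 - of_int n < x0" using v by (auto simp: x0_def max_def)
  obtain t where t: "U v l t x0 < y" using U_limit(2)[of v x0 y l] x0 y by blast
  have "u (U v l t x) < x + of_int n" if x: "v \<le> x" "x < v + 1" for x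
  proof (cases "x \<le> x0")
    case True
    then have "u (U v l t x) \<le> u (U v l t x0)" using u by simp
    also have "\<dots> < u y" using t u by simp
    finally show ?thesis using y(1) x(1) by linarith
  next
    case False
    have "u (U v l t x) < u (U v l t (v + 1))" using Gt_less[OF u Gt_less[OF U_Gt x(2)]] .
    also have "\<dots> = u v + 1" using Gt_period[OF u] by simp
    finally show ?thesis using x0(3) False by linarith
  qed
  then have "(u \<circ> U v l t) x < x + of_int n" for x
  proof -
    define k where "k = \<lfloor>x - v\<rfloor>"
    have "v \<le> x - of_int k" "x - of_int k < v + 1" unfolding k_def by linarith+
    then have "(u \<circ> U v l t) (x - of_int k) < (x - of_int k) + of_int n" using \<open>\<And>x. v \<le> x \<Longrightarrow> x < v + 1 \<Longrightarrow> u (U v l t x) < x + of_int n\<close> by simp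
    moreover have "(u \<circ> U v l t) x = (u \<circ> U v l t) (x - of_int k) + of_int k"
      using Gt_period_int[of "u \<circ> U v l t" "x - of_int k" k] u by (metis comp_Gt U_Gt diff_add_cancel)
    ultimately show ?thesis by simp
  qed
  then show ?thesis unfolding below_def by blast
qed

lemma openin_below:
  assumes "continuous_on S F" "\<And>q. q \<in> S \<Longrightarrow> F q \<in> Gt"
  shows "openin (top_of_set S) {q \<in> S. below n (F q)}" "openin (top_of_set S) {q \<in> S. exceeds n (F q)}"
proof -
  obtain W where W: "open W" "Gt \<inter> {F. \<forall>x. F x < x + of_int n} = Gt \<inter> W"
    using open_displacement_lt by metis
  have "{q \<in> S. below n (F q)} = S \<inter> F -` W"
  proof (intro equalityI subsetI)
    fix q assume "q \<in> {q \<in> S. below n (F q)}"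
    then have "q \<in> S" "F q \<in> Gt \<inter> {F. \<forall>x. F x < x + of_int n}" using assms(2) by (auto simp: below_def)
    then show "q \<in> S \<inter> F -` W" unfolding W by blast
  next
    fix q assume "q \<in> S \<inter> F -` W"
    then have "q \<in> S" "F q \<in> Gt \<inter> W" using assms(2) by auto
    then show "q \<in> {q \<in> S. below n (F q)}" unfolding W(2)[symmetric] by (auto simp: below_def)
  qed
  then show "openin (top_of_set S) {q \<in> S. below n (F q)}"
    using continuous_openin_preimage_gen[OF assms(1) W(1)] by simp
  have "open (\<Union>x. {F :: real \<Rightarrow> real. F x > x + of_int n})" by (intro open_UN ballI open_eval)
  moreover have "{q \<in> S. exceeds n (F q)} = S \<inter> F -` (\<Union>x. {F. F x > x + of_int n})" by (auto simp: exceeds_def)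
  ultimately show "openin (top_of_set S) {q \<in> S. exceeds n (F q)}"
    using continuous_openin_preimage_gen[OF assms(1)] by simp
qed

definition solves :: "int \<Rightarrow> real \<Rightarrow> (real \<Rightarrow> real) \<Rightarrow> real \<Rightarrow> real \<Rightarrow> bool" where
  "solves n l u v t \<longleftrightarrow> \<not> below n (u \<circ> U v l t) \<and> \<not> exceeds n (u \<circ> U v l t)"

text \<open>Meaningful only if \<open>displaced n u v\<close>, see \<open>solves_ex1\<close>.\<close>

definition tau :: "int \<Rightarrow> real \<Rightarrow> (real \<Rightarrow> real) \<Rightarrow> real \<Rightarrow> real" where
  "tau n l u v = (THE t. solves n l u v t)"

text \<open>The condition on the fixed point under which a strength with maximal displacement
  \<open>n\<close> exists and is unique: the lower bound lets the maximum exceed \<open>n\<close>,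
  the upper one lets it fall below \<open>n\<close>.\<close>

definition displaced :: "int \<Rightarrow> (real \<Rightarrow> real) \<Rightarrow> real \<Rightarrow> bool" where
  "displaced n u v \<longleftrightarrow> v + (of_int n - 1) < u v \<and> u v < v + of_int n"

text \<open>The strengths with maximum below \<open>n\<close> and those with maximum above
  \<open>n\<close> are disjoint, open and nonempty, so they do not cover the line.\<close>

lemma solves_ex1: assumes u: "u \<in> Gt" and v: "displaced n u v" shows "\<exists>!t. solves n l u v t"
proof -
  have vn: "u v < v + of_int n" "u v > v + (of_int n - 1)" using v by (auto simp: displaced_def)
  have c: "continuous_on UNIV (\<lambda>t. u \<circ> U v l t)" using u by (intro continuous_intros) auto
  have G: "u \<circ> U v l t \<in> Gt" for t using u by blast
  have o: "open {t. below n (u \<circ> U v l t)}" "open {t. exceeds n (u \<circ> U v l t)}"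
    using openin_below[OF c G, where n=n] by simp_all
  have ne1: "{t. below n (u \<circ> U v l t)} \<noteq> {}" using solve_low[OF u vn(1)] by blast
  obtain t0 where "\<forall>t\<ge>t0. \<exists>x. u (U v l t x) > x + (of_int n - 1) + 1" using reach_up[OF u vn(2)] by blast
  then have "\<exists>x. u (U v l t0 x) > x + (of_int n - 1) + 1" by blast
  then have "exceeds n (u \<circ> U v l t0)" unfolding exceeds_def by simp
  then have ne2: "{t. exceeds n (u \<circ> U v l t)} \<noteq> {}" by blast
  have disj: "{t. below n (u \<circ> U v l t)} \<inter> {t. exceeds n (u \<circ> U v l t)} = {}"
    unfolding below_def exceeds_def by (auto simp: not_less dest: less_imp_le order.asym)
  have "\<exists>t. solves n l u v t"
  proof (rule ccontr)
    assume "\<nexists>t. solves n l u v t"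
    then have "UNIV \<subseteq> {t. below n (u \<circ> U v l t)} \<union> {t. exceeds n (u \<circ> U v l t)}" unfolding solves_def by blast
    then show False using connected_UNIV[where 'a=real] o ne1 ne2 disj unfolding connected_def by blast
  qed
  moreover have "s = t" if "solves n l u v s" "solves n l u v t" for s t
    using solve_trichotomy[OF u vn(1), of l t s] that unfolding solves_def by (meson linorder_neqE)
  ultimately show ?thesis by blast
qed

lemma solves_tau: assumes "u \<in> Gt" "displaced n u v" shows "solves n l u v (tau n l u v)"
  unfolding tau_def by (rule theI') (rule solves_ex1[OF assms])

lemma tau_eqI: "u \<in> Gt \<Longrightarrow> displaced n u v \<Longrightarrow> solves n l u v t \<Longrightarrow> tau n l u v = t"
  using solves_ex1 solves_tau by blast

lemma tau_less: assumes "u \<in> Gt" "displaced n u v"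
  shows "s < tau n l u v \<longleftrightarrow> below n (u \<circ> U v l s)" "tau n l u v < s \<longleftrightarrow> exceeds n (u \<circ> U v l s)"
proof -
  have v: "u v < v + of_int n" using assms(2) by (simp add: displaced_def)
  have s: "\<not> below n (u \<circ> U v l (tau n l u v))" "\<not> exceeds n (u \<circ> U v l (tau n l u v))"
    using solves_tau[OF assms, of l] unfolding solves_def by auto
  note tri = solve_trichotomy[OF assms(1) v s, of s]
  have nb: "\<not> (below n F \<and> exceeds n F)" for F unfolding below_def exceeds_def by (meson order.asym)
  show "s < tau n l u v \<longleftrightarrow> below n (u \<circ> U v l s)"
    using tri s nb[of "u \<circ> U v l s"] by (cases s "tau n l u v" rule: linorder_cases) auto
  show "tau n l u v < s \<longleftrightarrow> exceeds n (u \<circ> U v l s)"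
    using tri s nb[of "u \<circ> U v l s"] by (cases s "tau n l u v" rule: linorder_cases) auto
qed

text \<open>Comparing \<open>tau\<close> with a number \<open>a\<close> amounts to
  \<open>below\<close> or \<open>exceeds\<close> at strength \<open>a\<close>, and both conditions
  are open.\<close>

lemma continuous_on_tau:
  assumes "continuous_on S u" "continuous_on S l" "continuous_on S v"
    and G: "\<And>q. q \<in> S \<Longrightarrow> u q \<in> Gt" and d: "\<And>q. q \<in> S \<Longrightarrow> displaced n (u q) (v q)"
  shows "continuous_on S (\<lambda>q. tau n (l q) (u q) (v q))"
proof -
  have c: "continuous_on S (\<lambda>q. u q \<circ> U (v q) (l q) a)" for a
    by (rule continuous_on_Gt_comp) (auto intro: continuous_intros assms)
  have o: "openin (top_of_set S) {q \<in> S. a < tau n (l q) (u q) (v q)}"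
    "openin (top_of_set S) {q \<in> S. tau n (l q) (u q) (v q) < a}" for a
  proof -
    have "{q \<in> S. a < tau n (l q) (u q) (v q)} = {q \<in> S. below n (u q \<circ> U (v q) (l q) a)}"
      "{q \<in> S. tau n (l q) (u q) (v q) < a} = {q \<in> S. exceeds n (u q \<circ> U (v q) (l q) a)}"
      using tau_less G d by auto
    then show "openin (top_of_set S) {q \<in> S. a < tau n (l q) (u q) (v q)}"
      "openin (top_of_set S) {q \<in> S. tau n (l q) (u q) (v q) < a}"
      using openin_below[OF c, where n=n] G by simp_all
  qed
  show ?thesis
  proof (rule continuous_on_real_betweenI)
    fix q e assume q: "q \<in> S" and e: "e > (0::real)"
    let ?f = "\<lambda>q. tau n (l q) (u q) (v q)"
    have "openin (top_of_set S) ({q' \<in> S. ?f q - e < ?f q'} \<inter> {q' \<in> S. ?f q' < ?f q + e})"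
      by (intro openin_Int o)
    then obtain W where W: "open W" "{q' \<in> S. ?f q - e < ?f q'} \<inter> {q' \<in> S. ?f q' < ?f q + e} = S \<inter> W"
      unfolding openin_open by blast
    have "q \<in> {q' \<in> S. ?f q - e < ?f q'} \<inter> {q' \<in> S. ?f q' < ?f q + e}" using q e by simp
    then have "q \<in> W" unfolding W(2) by blast
    then have "eventually (\<lambda>q'. q' \<in> W) (at q within S)"
      unfolding eventually_at_topological using W(1) by blast
    moreover have "eventually (\<lambda>q'. q' \<in> S) (at q within S)" by (simp add: eventually_at_filter)
    ultimately show "eventually (\<lambda>q'. ?f q - e < ?f q' \<and> ?f q' < ?f q + e) (at q within S)"
    proof eventually_elim
      case (elim q')
      then have "q' \<in> {q' \<in> S. ?f q - e < ?f q'} \<inter> {q' \<in> S. ?f q' < ?f q + e}" unfolding W(2) by blast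
      then show ?case by simp
    qed
  qed
qed

lemma tau_period: "u \<in> Gt \<Longrightarrow> tau n l u (v + of_int k) = tau n l u v"
  unfolding tau_def solves_def by (simp add: U_period)

lemma solves_touches:
  assumes "u \<in> Gt" "displaced n u v" shows "solves n l u v t \<longleftrightarrow> touches n (u \<circ> U v l t)"
proof
  assume s: "solves n l u v t"
  have le: "(u \<circ> U v l t) x \<le> x + of_int n" for x using s unfolding solves_def exceeds_def by (auto simp: not_less)
  obtain x where "(u \<circ> U v l t) x \<ge> x + of_int n"
    using s not_below_max[of "u \<circ> U v l t" n] assms unfolding solves_def by blast
  then have "(u \<circ> U v l t) x = x + of_int n" using le[of x] by simp
  moreover have "(u \<circ> U v l t) v < v + of_int n" using assms by (simp add: displaced_def)
  ultimately show "touches n (u \<circ> U v l t)" using le unfolding touches_def by blast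
next
  assume "touches n (u \<circ> U v l t)"
  then show "solves n l u v t" unfolding touches_def solves_def below_def exceeds_def
    by (metis less_irrefl not_less)
qed

text \<open>The lower bound follows from the oscillation bound at a point of maximal displacement;
  the upper one fails only if \<open>v\<close> itself is such a point.\<close>

lemma displaced_iff_touches:
  assumes "u \<in> Gt" "touches n (u \<circ> U v l t)"
  shows "displaced n u v \<longleftrightarrow> (u \<circ> U v l t) v \<noteq> v + of_int n"
proof -
  obtain x where x: "(u \<circ> U v l t) x = x + of_int n" using assms unfolding touches_def by blast
  have "(u \<circ> U v l t) x - x < (u \<circ> U v l t) v - v + 1" using assms(1) by (intro Gt_osc comp_Gt U_Gt)
  then have "u v > v + (of_int n - 1)" using x by simp
  moreover have "u v \<le> v + of_int n" using assms unfolding touches_def by (metis comp_apply U_fix)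
  ultimately show ?thesis by (auto simp: displaced_def)
qed

lemma parabolic_displacement: "t > 0 \<Longrightarrow> U v 0 t x \<ge> x" "t < 0 \<Longrightarrow> U v 0 t x \<le> x"
  "t > 0 \<Longrightarrow> (\<And>k::int. x \<noteq> v + of_int k) \<Longrightarrow> U v 0 t x > x"
  "t < 0 \<Longrightarrow> (\<And>k::int. x \<noteq> v + of_int k) \<Longrightarrow> U v 0 t x < x"
  using U_mono[of 0 t v 0 x] U_mono[of t 0 v 0 x] U_less_all[of 0 t x v 0] U_less_all[of t 0 x v 0] by auto

lemma block_one: "block 1 0 = {U v 0 t | v t. t > 0}" "block (-1) 0 = {U v 0 t | v t. t < 0}"
  unfolding block_def strengths_def by auto

text \<open>At a touching point \<open>w\<close> is a shifted \<open>U x l s\<close>. It never moves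
  points forward relative to the shift, so it is not hyperbolic and its strength is negative;
  inversion reverses the sign.\<close>

lemma touches_block:
  assumes w: "w \<in> Gt" shows "touches n w \<longleftrightarrow> ginv w \<circ> T (of_int n) \<in> block 1 0"
proof
  assume t: "touches n w"
  obtain x where x: "w x = x + of_int n" using t unfolding touches_def by blast
  obtain l s where ls: "w = T (of_int n) \<circ> U x l s" using Gt_fix_int_U[OF w x] by blast
  have le: "U x l s y \<le> y" for y using t unfolding touches_def ls by (simp add: T_def)
  have l0: "l = 0"
  proof (rule ccontr)
    assume "l \<noteq> 0"
    then have "U x l s \<in> J 0 0" by (rule hyp_U)
    then show False using le unfolding J_def by (auto simp: not_less[symmetric])
  qed
  obtain y where y: "U x 0 s y < y" using t unfolding touches_def ls l0 by (auto simp: T_def)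
  have "s < 0" using y parabolic_displacement(1)[where t=s and v=x and x=y] by (cases s "0::real" rule: linorder_cases) auto
  have "ginv w = U x 0 (- s) \<circ> T (- of_int n)" unfolding ls l0 by (simp add: inv_comp_Gt ginv_U)
  then have "ginv w \<circ> T (of_int n) = U x 0 (- s)" by (simp add: o_assoc[symmetric])
  then show "ginv w \<circ> T (of_int n) \<in> block 1 0" using \<open>s < 0\<close> unfolding block_one by (metis (mono_tags, lifting) mem_Collect_eq neg_0_less_iff_less)
next
  assume "ginv w \<circ> T (of_int n) \<in> block 1 0"
  then obtain v s where vs: "s > 0" "ginv w \<circ> T (of_int n) = U v 0 s" unfolding block_one by blast
  have "T (- of_int n) \<circ> w = ginv (ginv w \<circ> T (of_int n))" using w by (simp add: inv_comp_Gt)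
  then have "T (- of_int n) \<circ> w = U v 0 (- s)" unfolding vs by (simp add: ginv_U)
  then have e: "w x = U v 0 (- s) x + of_int n" for x by (metis T_def comp_apply diff_conv_add_uminus diff_add_cancel)
  have "U v 0 (- s) (v + 1/2) < v + 1/2" using U_less[of v "v + 1/2" "- s" 0 0] vs(1) by simp
  then show "touches n w" unfolding touches_def e
    using parabolic_displacement(2)[of "- s" v] vs(1) by (auto intro: exI[of _ v] exI[of _ "v + 1/2"])
qed

subsection \<open>Conjugacy classes\<close>

definition conjG :: "(real \<Rightarrow> real) \<Rightarrow> (real \<Rightarrow> real) \<Rightarrow> real \<Rightarrow> real" where
  "conjG K F = K \<circ> F \<circ> ginv K"

lemma conjG_Gt [simp, intro]: "K \<in> Gt \<Longrightarrow> F \<in> Gt \<Longrightarrow> conjG K F \<in> Gt"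
  by (simp add: conjG_def)
lemma conjG_comp: "K \<in> Gt \<Longrightarrow> conjG K (F \<circ> H) = conjG K F \<circ> conjG K H"
  by (simp add: conjG_def fun_eq_iff)
lemma conjG_id [simp]: "K \<in> Gt \<Longrightarrow> conjG K id = id" by (simp add: conjG_def)
lemma conjG_T [simp]: "K \<in> Gt \<Longrightarrow> conjG K (T (of_int k)) = T (of_int k)"
  by (simp add: conjG_def T_int_comm o_assoc[symmetric])
lemma conjG_conjG: "K \<in> Gt \<Longrightarrow> H \<in> Gt \<Longrightarrow> conjG K (conjG H F) = conjG (K \<circ> H) F"
  by (simp add: conjG_def inv_comp_Gt o_assoc)
lemma conjG_ginv: "K \<in> Gt \<Longrightarrow> F \<in> Gt \<Longrightarrow> ginv (conjG K F) = conjG K (ginv F)"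
  by (simp add: conjG_def inv_comp_Gt o_assoc)
lemma conjG_inverse: "K \<in> Gt \<Longrightarrow> conjG K (conjG (ginv K) F) = F" "K \<in> Gt \<Longrightarrow> conjG (ginv K) (conjG K F) = F"
  by (simp_all add: conjG_def fun_eq_iff)
lemma conjG_app: "K \<in> Gt \<Longrightarrow> conjG K F (K x) = K (F x)" by (simp add: conjG_def)

lemma continuous_on_conjG [continuous_intros]:
  assumes "continuous_on S K" "\<And>q. q \<in> S \<Longrightarrow> K q \<in> Gt" "continuous_on S F" "\<And>q. q \<in> S \<Longrightarrow> F q \<in> Gt"
  shows "continuous_on S (\<lambda>q. conjG (K q) (F q))"
  unfolding conjG_def
  by (rule continuous_on_Gt_comp[OF continuous_on_Gt_comp[OF assms(1,2,3)]])
    (use assms in \<open>auto intro: continuous_intros\<close>)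

text \<open>Up to a translation \<open>K\<close> fixes \<open>K v\<close>, hence belongs to the
  group of maps \<open>U (K v)\<close>, where conjugation leaves the eigenvalue unchanged.\<close>

lemma conj_U: assumes "K \<in> Gt" obtains t' where "conjG K (U v l t) = U (K v) l t'"
proof -
  define c where "c = K v - v"
  have "(K \<circ> T (- c)) (K v) = K v" by (simp add: T_def c_def)
  then obtain m s where ms: "K \<circ> T (- c) = U (K v) m s" using Gt_fix_U[of "K \<circ> T (- c)" "K v"] assms by auto
  have K: "K = U (K v) m s \<circ> T c"
    unfolding ms[symmetric] by (simp add: o_assoc[symmetric])
  have "conjG (T c) (U v l t) = U (K v) l t"
    unfolding conjG_def U_def by (simp add: c_def fun_eq_iff T_def algebra_simps)
  then have "conjG K (U v l t) = conjG (U (K v) m s) (U (K v) l t)"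
    by (subst K) (simp flip: conjG_conjG)
  moreover have "\<exists>t'. conjG (U (K v) m s) (U (K v) l t) = U (K v) l t'"
    unfolding conjG_def ginv_U U_comp by (simp add: exI)
  ultimately show ?thesis using that by metis
qed

text \<open>An increasing map preserves the direction in which a point is moved. This is tested at
  \<open>v + 1/2\<close>, which is not a translate of the fixed point.\<close>

lemma conj_block: assumes "K \<in> Gt" "C \<in> block \<kappa> 0" "\<kappa> \<in> {1, -1}" shows "conjG K C \<in> block \<kappa> 0"
proof -
  obtain v t where C: "C = U v 0 t" "t \<in> strengths \<kappa>" using assms(2) unfolding block_def by blast
  obtain t' where t': "conjG K C = U (K v) 0 t'" unfolding C(1) using conj_U[OF assms(1)] by metis
  have "t' \<in> strengths \<kappa>"
  proof -
    let ?x = "v + 1/2"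
    have nk: "?x \<noteq> v + of_int k" for k :: int
    proof
      assume "?x = v + of_int k"
      then have "of_int (2 * k) = (1::real)" by simp
      then have "2 * k = 1" by (metis of_int_eq_1_iff)
      then show False by presburger
    qed
    have e: "U (K v) 0 t' (K ?x) = K (C ?x)" unfolding t'[symmetric] using conjG_app[OF assms(1)] by simp
    show ?thesis
    proof (cases "\<kappa> = 1")
      case True
      then have "C ?x > ?x" using parabolic_displacement(3)[OF _ nk] C by (simp add: strengths_def)
      then have "U (K v) 0 t' (K ?x) > K ?x" unfolding e using assms(1) by simp
      then have "t' > 0" using parabolic_displacement(2)[where t=t' and v="K v" and x="K ?x"] by (cases t' "0::real" rule: linorder_cases) auto
      then show ?thesis using True by (simp add: strengths_def)
    next
      case False
      then have k: "\<kappa> = -1" using assms(3) by simp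
      then have "C ?x < ?x" using parabolic_displacement(4)[OF _ nk] C by (simp add: strengths_def)
      then have "U (K v) 0 t' (K ?x) < K ?x" unfolding e using assms(1) by simp
      then have "t' < 0" using parabolic_displacement(1)[where t=t' and v="K v" and x="K ?x"] by (cases t' "0::real" rule: linorder_cases) auto
      then show ?thesis using k by (simp add: strengths_def)
    qed
  qed
  then show ?thesis unfolding t' block_def by blast
qed

lemma J_conj: assumes "K \<in> Gt" "F \<in> J k k" shows "conjG K F \<in> J k k"
proof -
  obtain x y where xy: "F x > x + of_int k" "F y < y + of_int k" "F \<in> Gt" using assms(2) unfolding J_def by auto
  have "conjG K F (K x) > K x + of_int k" "conjG K F (K y) < K y + of_int k"
    unfolding conjG_app[OF assms(1)] Gt_period_int[OF assms(1), symmetric] using xy assms(1) by simp_all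
  then show ?thesis using xy(3) assms(1) unfolding J_def by blast
qed

lemma J_shift: "T (of_int j) \<circ> F \<in> J (j + a) (j + b) \<longleftrightarrow> F \<in> J a b"
proof -
  have "T (of_int j) \<circ> F \<in> Gt \<longleftrightarrow> F \<in> Gt"
  proof
    assume "T (of_int j) \<circ> F \<in> Gt"
    then have "T (- of_int j) \<circ> (T (of_int j) \<circ> F) \<in> Gt" by blast
    then show "F \<in> Gt" by (simp add: o_assoc)
  qed auto
  moreover have "(T (of_int j) \<circ> F) x > x + of_int (j + a) \<longleftrightarrow> F x > x + of_int a"
    "(T (of_int j) \<circ> F) x < x + of_int (j + b) \<longleftrightarrow> F x < x + of_int b" for x by (auto simp: T_def)
  ultimately show ?thesis unfolding J_def by simp
qed

text \<open>A diagonal matrix also preserves the second axis, the direction 1/2, with the inverse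
  eigenvalue; a quarter turn exchanges the axes.\<close>

lemma Uz_half: "Uz l 0 = U (1/2) (- l) 0"
proof -
  have L: "lifts (exp l) 0 0 (exp (- l)) (Uz l 0)" using lifts_Uz[of l 0] by simp
  have "lifts (exp l) 0 0 (exp (- l)) (U (1/2) (- l) 0)"
    using lifts_comp[OF lifts_comp[OF lifts_T[of "1/2"] lifts_Uz[of "- l" 0]] lifts_T[of "- (1/2)"]]
    unfolding U_def by simp
  moreover have "Uz l 0 (1/2) = U (1/2) (- l) 0 (1/2)"
  proof -
    obtain r where r: "r > 0" "exp l * cos (pi * (1/2)) + 0 * sin (pi * (1/2)) = r * cos (pi * Uz l 0 (1/2))"
      using L unfolding lifts_def by blast
    then have c: "cos (pi * Uz l 0 (1/2)) = 0" by simp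
    have b: "0 < Uz l 0 (1/2)" "Uz l 0 (1/2) < 1" using Uz_bounds[of "1/2" l 0] by auto
    have "pi * Uz l 0 (1/2) = pi / 2"
    proof (rule cos_inj_pi)
      show "pi * Uz l 0 (1/2) \<le> pi" using b by (simp add: mult_le_cancel_left1)
    qed (use b c in auto)
    then show ?thesis by simp
  qed
  ultimately show ?thesis using lifts_eqI[OF L, of "exp l" 0 0 "exp (- l)" "U (1/2) (- l) 0" "1/2"] by simp
qed

lemma Uz_half_fix [simp]: "Uz l 0 (1/2) = 1/2" unfolding Uz_half by simp

lemma conjG_half: assumes "K \<in> Gt" shows "conjG (K \<circ> T (1/2)) (Uz (- l) 0) = conjG K (Uz l 0)"
  unfolding Uz_half[of l] U_def using conjG_conjG[OF assms, of "T (1/2)" "Uz (- l) 0"] by (simp add: conjG_def o_assoc)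

lemma no_half: "(1/2::real) \<noteq> of_int j"
proof
  assume "(1/2::real) = of_int j"
  then have "of_int (2 * j) = (1::real)" by simp
  then have "2 * j = 1" by (metis of_int_eq_1_iff)
  then show False by presburger
qed

text \<open>A conjugator from the diagonal element \<open>Uz l 0\<close> to \<open>U v l t\<close>
  that depends continuously on the parameters as long as \<open>l\<close> is nonzero. The quotient
  is the shear \<open>s\<close> with \<open>s * (exp (- 2 * l) - 1) = t\<close>.\<close>

definition frame :: "real \<Rightarrow> real \<Rightarrow> real \<Rightarrow> real \<Rightarrow> real" where
  "frame v l t = T v \<circ> Uz 0 (t / (exp (- 2 * l) - 1))"

lemma frame_Gt [simp, intro]: "frame v l t \<in> Gt" by (simp add: frame_def)
lemma frame_0 [simp]: "frame v l t 0 = v" by (simp add: frame_def T_def)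
lemma frame_period: "frame (v + of_int k) l t = T (of_int k) \<circ> frame v l t"
  by (simp add: frame_def fun_eq_iff T_def)

lemma frame_conj: assumes "l \<noteq> 0" shows "conjG (frame v l t) (Uz l 0) = U v l t"
proof -
  have ne: "exp (- 2 * l) - 1 \<noteq> 0" using assms by simp
  define s where "s = t / (exp (- 2 * l) - 1)"
  have "s * (exp (- 2 * l) - 1) = t" using nonzero_eq_divide_eq[OF ne, of s t] s_def by blast
  then have s: "s * exp (- 2 * l) - s = t" by (simp add: right_diff_distrib)
  have "ginv (Uz 0 s) = Uz 0 (- s)" using ginv_U[of 0 0 s] by (simp add: U_zero)
  then have "conjG (Uz 0 s) (Uz l 0) = Uz l t"
    unfolding conjG_def Uz_comp using s by (simp add: Uz_comp)
  then have "conjG (frame v l t) (Uz l 0) = conjG (T v) (Uz l t)"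
    unfolding frame_def s_def[symmetric] by (simp flip: conjG_conjG)
  then show ?thesis by (simp add: conjG_def U_def)
qed

lemma continuous_on_frame [continuous_intros]:
  assumes "continuous_on S v" "continuous_on S l" "continuous_on S t" "\<And>q. q \<in> S \<Longrightarrow> l q \<noteq> 0"
  shows "continuous_on S (\<lambda>q. frame (v q) (l q) (t q))"
proof -
  have Uc: "continuous_on S (\<lambda>q. Uz 0 (t q / (exp (- 2 * l q) - 1)))"
    by (intro continuous_on_coordinatewise_then_product continuous_intros assms) (use assms(4) in auto)
  show ?thesis unfolding frame_def
    by (rule continuous_on_Gt_comp[OF continuous_on_T[OF assms(1)] _ Uc]) simp
qed

text \<open>The displacement takes values on both sides of \<open>k\<close>, so some point is moved
  by exactly \<open>k\<close>; the strength there can be removed by a frame because \<open>l\<close>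
  is nonzero.\<close>

lemma hyp_two:
  assumes "F \<in> J k k"
  obtains K l where "K \<in> Gt" "l > 0" "F = T (of_int k) \<circ> conjG K (Uz l 0)"
proof -
  have G: "F \<in> Gt" using assms by (rule J_Gt)
  obtain x y where xy: "F x > x + of_int k" "F y < y + of_int k" using assms unfolding J_def by auto
  define y' where "y' = y + of_int \<lceil>x - y\<rceil>"
  have y': "x \<le> y'" "F y' < y' + of_int k" unfolding y'_def using xy(2) Gt_period_int[OF G] by (auto, linarith)
  have "\<exists>v\<ge>x. v \<le> y' \<and> F v - v = of_int k"
    using xy y' by (intro IVT2' continuous_intros Gt_cont[OF G]) auto
  then obtain v where "F v = v + of_int k" by (auto simp: algebra_simps)
  then obtain l t where lt: "F = T (of_int k) \<circ> U v l t" using Gt_fix_int_U[OF G] by blast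
  have l: "l \<noteq> 0" using not_J_parabolic assms lt by metis
  show ?thesis
  proof (cases "l > 0")
    case True
    then show ?thesis using that[of "frame v l t" l] frame_conj[OF l] lt by simp
  next
    case False
    \<comment> \<open>A negative \<open>l\<close> becomes positive when the other fixed point, a
      quarter turn away in the frame, is taken as the origin.\<close>
    have "U v l t = conjG (frame v l t \<circ> T (1/2)) (Uz (- l) 0)"
      using frame_conj[OF l, of v t] by (simp add: conjG_half)
    then show ?thesis using that[of "frame v l t \<circ> T (1/2)" "- l"] False l lt by simp
  qed
qed

lemma conj_Uz: assumes "K \<in> Gt" shows "\<exists>t. conjG K (Uz l 0) = U (K 0) l t" "\<exists>t. conjG K (Uz l 0) = U (K (1/2)) (- l) t"
  using conj_U[OF assms, of 0 l 0] conj_U[OF assms, of "1/2" "- l" 0] unfolding U_zero Uz_half[symmetric] by metis+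

lemma hyp_conj: assumes "K \<in> Gt" "l \<noteq> 0" shows "T (of_int k) \<circ> conjG K (Uz l 0) \<in> J k k"
proof -
  have "Uz l 0 \<in> J 0 0" using hyp_U[OF assms(2), of 0 0] by (simp add: U_zero)
  then have "conjG K (Uz l 0) \<in> J 0 0" using J_conj[OF assms(1)] by blast
  then show ?thesis using J_shift[of k _ 0 0] by simp
qed

subsection \<open>One-parameter subgroups\<close>

lemma JI: "F \<in> Gt \<Longrightarrow> F x > x + of_int a \<Longrightarrow> F y < y + of_int b \<Longrightarrow> F \<in> J a b"
  by (auto simp: J_def)

lemma Gt_cases:
  assumes F: "F \<in> Gt"
  obtains (hyp) k where "F \<in> J k k"
  | (par) k v t where "F = T (of_int k) \<circ> U v 0 t"
  | (ell) k where "\<And>x. x + of_int k < F x" "\<And>x. F x < x + of_int k + 1"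
proof (cases "\<exists>x k::int. F x = x + of_int k")
  case True
  then obtain x and k :: int where x: "F x = x + of_int k" by blast
  obtain l t where lt: "F = T (of_int k) \<circ> U x l t" using Gt_fix_int_U[OF F x] by blast
  show ?thesis
  proof (cases "l = 0")
    case True then show ?thesis using par lt by blast
  next
    case False
    then have "F \<in> J k k" unfolding lt using hyp_U[of l x t] J_shift[of k _ 0 0] by simp
    then show ?thesis by (rule hyp)
  qed
next
  case False
  define k where "k = \<lfloor>F 0\<rfloor>"
  have c: "continuous_on S (\<lambda>x. F x - x)" for S by (intro continuous_intros Gt_cont[OF F])
  have k0: "of_int k < F 0 - 0" "F 0 - 0 < of_int k + 1"
    using False[unfolded not_ex, rule_format, of 0 k] unfolding k_def by (auto simp: order_less_le, linarith+)
  have nz: "F x - x \<noteq> of_int j" for x and j :: int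
    using False[unfolded not_ex, rule_format, of x j] by (auto simp: algebra_simps)
  have 1: "\<not> F x - x < of_int k" for x
  proof
    assume a: "F x - x < of_int k"
    have "connected ((\<lambda>x. F x - x) ` UNIV)" by (intro connected_continuous_image c connected_UNIV)
    then have "of_int k \<in> (\<lambda>x. F x - x) ` UNIV"
      using a k0 unfolding connected_iff_interval by (meson less_imp_le rangeI)
    then obtain x where "of_int k = F x - x" by blast
    then show False using nz[of x k] by simp
  qed
  have 2: "\<not> F x - x > of_int k + 1" for x
  proof
    assume a: "F x - x > of_int k + 1"
    have "connected ((\<lambda>x. F x - x) ` UNIV)" by (intro connected_continuous_image c connected_UNIV)
    then have "of_int k + 1 \<in> (\<lambda>x. F x - x) ` UNIV"
      using a k0 unfolding connected_iff_interval by (meson less_imp_le rangeI)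
    then obtain x where "of_int k + 1 = F x - x" by blast
    then show False using nz[of x "k + 1"] by simp
  qed
  have "x + of_int k < F x" "F x < x + of_int k + 1" for x
    using 1[of x] 2[of x] nz[of x k] nz[of x "k + 1"] by auto
  then show ?thesis by (rule ell)
qed

text \<open>The Moebius action of the matrix has a fixed point in the upper half plane. Conjugation
  by the upper triangular matrix that sends the imaginary unit to it leaves a rotation.\<close>

lemma elliptic_conj:
  assumes F: "F \<in> Gt" and e: "\<And>x. x + of_int k < F x" "\<And>x. F x < x + of_int k + 1"
  obtains K \<theta> where "K \<in> Gt" "F = conjG K (T \<theta>)" "of_int k < \<theta>" "\<theta> < of_int k + 1"
proof -
  obtain a b c d where L: "lifts a b c d F" using F unfolding Gt_def by blast
  have det: "a * d - b * c = 1" using L by (simp add: lifts_def)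
  \<comment> \<open>The wedge of a vector with its image vanishes only where the displacement is an
    integer, and there is no such point.\<close>
  have Q: "c * (cos (pi * x))\<^sup>2 + (d - a) * sin (pi * x) * cos (pi * x) - b * (sin (pi * x))\<^sup>2 \<noteq> 0" for x
  proof
    assume z: "c * (cos (pi * x))\<^sup>2 + (d - a) * sin (pi * x) * cos (pi * x) - b * (sin (pi * x))\<^sup>2 = 0"
    obtain r where r: "r > 0" "a * cos (pi * x) + b * sin (pi * x) = r * cos (pi * F x)"
      "c * cos (pi * x) + d * sin (pi * x) = r * sin (pi * F x)"
      using L unfolding lifts_def by blast
    have "r * sin (pi * (F x - x)) = (r * sin (pi * F x)) * cos (pi * x) - (r * cos (pi * F x)) * sin (pi * x)"
      by (simp add: right_diff_distrib sin_diff algebra_simps)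
    also have "\<dots> = 0" unfolding r(2,3)[symmetric] using z by (simp add: power2_eq_square algebra_simps)
    finally have "sin (pi * (F x - x)) = 0" using r(1) by simp
    then obtain j :: int where "F x - x = of_int j" unfolding sin_eq_0_pi by blast
    then have "of_int k < (of_int j :: real)" "of_int j < (of_int (k + 1) :: real)" using e[of x] by auto
    then show False unfolding of_int_less_iff by simp
  qed
  have c0: "c \<noteq> 0" using Q[of 0] by simp
  define D where "D = 4 - (a + d)\<^sup>2"
  \<comment> \<open>Otherwise the fixed point equation has a real root \<open>R\<close>, which is
    the cotangent of a fixed direction.\<close>
  have D: "D > 0"
  proof (rule ccontr)
    assume "\<not> D > 0"
    then have "- D \<ge> 0" by simp
    define R where "R = ((a - d) + sqrt (- D)) / (2 * c)"
    have Dd: "- D = (d - a)\<^sup>2 + 4 * (b * c)" unfolding D_def using det by (simp add: power2_eq_square algebra_simps)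
    have s2: "sqrt (- D) * sqrt (- D) = (d - a)\<^sup>2 + 4 * (b * c)" using \<open>- D \<ge> 0\<close> Dd by simp
    have "2 * c * R = (a - d) + sqrt (- D)" using c0 by (simp add: R_def)
    then have "(2 * c * R + (d - a)) * (2 * c * R + (d - a)) = (d - a)\<^sup>2 + 4 * (b * c)" using s2 by simp
    then have "4 * c * (c * R\<^sup>2 + (d - a) * R - b) = 0" by (simp add: power2_eq_square algebra_simps)
    then have R: "c * R\<^sup>2 + (d - a) * R - b = 0" using c0 by simp
    obtain x where x: "cos (pi * x) = R * sin (pi * x)" using hyp_approx by blast
    have "c * (cos (pi * x))\<^sup>2 + (d - a) * sin (pi * x) * cos (pi * x) - b * (sin (pi * x))\<^sup>2
      = (sin (pi * x))\<^sup>2 * (c * R\<^sup>2 + (d - a) * R - b)" unfolding x by (simp add: power2_eq_square algebra_simps)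
    then show False using Q[of x] R by simp
  qed
  \<comment> \<open>\<open>y\<close> and \<open>x\<close> are the imaginary and real part of the
    fixed point, and \<open>exp l\<close> is the square root of \<open>y\<close>.\<close>
  define y where "y = sqrt D / (2 * \<bar>c\<bar>)"
  define x where "x = (a - d) / (2 * c)"
  define l where "l = ln y / 2"
  have y: "y > 0" using D c0 by (simp add: y_def)
  have el: "exp l * exp l = y" using y unfolding l_def by (simp flip: exp_add)
  have el': "exp l * exp (- l) = 1" by (simp flip: exp_add)
  define t where "t = - x / y"
  define q where "q = exp l"
  define q' where "q' = exp (- l)"
  have qq: "q * q = y" "q * q' = 1" using el el' by (simp_all add: q_def q'_def)
  have tq: "- t * q = x * q'"
  proof -
    have "t * y = - x" using y by (simp add: t_def)
    then have "t * (q * q) * q' = - x * q'" using qq by simp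
    then have "t * q * (q * q') = - x * q'" by (simp add: algebra_simps)
    then show ?thesis using qq by simp
  qed
  let ?g = "Uz l t"
  have G: "lifts q (x * q') 0 q' ?g" using lifts_Uz[of l t] tq by (simp add: q_def q'_def)
  have M: "lifts (q' * (a * q + b * 0) + - (x * q') * (c * q + d * 0)) (q' * (a * (x * q') + b * q') + - (x * q') * (c * (x * q') + d * q'))
     (- 0 * (a * q + b * 0) + q * (c * q + d * 0)) (- 0 * (a * (x * q') + b * q') + q * (c * (x * q') + d * q')) (ginv ?g \<circ> (F \<circ> ?g))"
    by (rule lifts_comp[OF lifts_inv[OF G] lifts_comp[OF L G]])
  define m where "m = (a + d) / 2"
  have cx: "2 * (c * x) = a - d" using c0 by (simp add: x_def)
  have m1: "q' * (a * q + b * 0) + - (x * q') * (c * q + d * 0) = m"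
  proof -
    have "q' * (a * q + b * 0) + - (x * q') * (c * q + d * 0) = (q * q') * (a - c * x)" by (simp add: algebra_simps)
    also have "\<dots> = m" using qq(2) cx unfolding m_def by simp
    finally show ?thesis .
  qed
  have m4: "- 0 * (a * (x * q') + b * q') + q * (c * (x * q') + d * q') = m"
  proof -
    have "- 0 * (a * (x * q') + b * q') + q * (c * (x * q') + d * q') = (q * q') * (d + c * x)" by (simp add: algebra_simps)
    also have "\<dots> = m" using qq(2) cx unfolding m_def by simp
    finally show ?thesis .
  qed
  have m3: "- 0 * (a * q + b * 0) + q * (c * q + d * 0) = c * y" using qq by (simp add: algebra_simps)
  have cy2: "4 * (c * y) * (c * y) = D"
    using c0 D by (simp add: y_def abs_mult_self_eq field_simps)
  have mm: "m * m + (c * y) * (c * y) = 1"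
    using cy2 by (simp add: m_def D_def power2_eq_square field_simps)
  have m2: "q' * (a * (x * q') + b * q') + - (x * q') * (c * (x * q') + d * q') = - (c * y)"
  proof -
    have e1: "q' * (a * (x * q') + b * q') + - (x * q') * (c * (x * q') + d * q') = (q' * q') * (b + (a - d) * x - c * x * x)"
      by (simp add: algebra_simps)
    have "4 * c * (b + (a - d) * x - c * x * x) = 4 * (b * c) + 2 * (a - d) * (2 * (c * x)) - (2 * (c * x)) * (2 * (c * x))"
      by (simp add: algebra_simps)
    also have "\<dots> = 4 * (b * c) + (a - d) * (a - d)" unfolding cx by (simp add: algebra_simps)
    also have "\<dots> = - D" using det by (simp add: D_def power2_eq_square algebra_simps)
    also have "\<dots> = 4 * c * (- (c * y * y))" using cy2 by (simp add: algebra_simps)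
    finally have f: "4 * c * (b + (a - d) * x - c * x * x) = 4 * c * (- (c * y * y))" .
    have fX: "b + (a - d) * x - c * x * x = - (c * y * y)"
      by (rule mult_left_cancel[of "4 * c", THEN iffD1, OF _ f]) (use c0 in simp)
    have "(q' * q') * (b + (a - d) * x - c * x * x) = (q' * q') * (- (c * y * (q * q)))"
      by (simp only: fX qq(1))
    also have "\<dots> = - (c * y * ((q * q') * (q * q')))" by (simp add: algebra_simps)
    finally show ?thesis using e1 qq by simp
  qed
  have M': "lifts m (- (c * y)) (c * y) m (ginv ?g \<circ> (F \<circ> ?g))"
    using M unfolding m1 m2 m3 m4 .
  have "m\<^sup>2 + (c * y)\<^sup>2 = 1" using mm by (simp add: power2_eq_square)
  then obtain \<phi> where \<phi>: "m = cos \<phi>" "c * y = sin \<phi>" using sincos_total_2pi by metis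
  define \<theta> where "\<theta> = \<phi> / pi"
  have "lifts m (- (c * y)) (c * y) m (T \<theta>)" using lifts_T[of \<theta>] \<phi> by (simp add: \<theta>_def)
  then obtain j :: int where j: "\<And>x. (ginv ?g \<circ> (F \<circ> ?g)) x = T \<theta> x + of_int j"
    using lifts_unique_mod[OF _ M'] by blast
  then have conj: "ginv ?g \<circ> (F \<circ> ?g) = T (\<theta> + of_int j)" by (simp add: fun_eq_iff T_def)
  have "conjG ?g (ginv ?g \<circ> (F \<circ> ?g)) = F" by (simp add: conjG_def fun_eq_iff)
  then have FT: "F = conjG ?g (T (\<theta> + of_int j))" unfolding conj by simp
  have "F (?g 0) = ?g (\<theta> + of_int j)" unfolding FT using conjG_app[of ?g "T (\<theta> + of_int j)" 0] by (simp add: T_def)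
  moreover have "?g (of_int k) < F (?g 0)" "F (?g 0) < ?g (of_int (k + 1))"
    using e[of "?g 0"] Gt_period_int[OF Uz_Gt, of l t 0 k] Gt_period_int[OF Uz_Gt, of l t 0 "k + 1"] by simp_all
  ultimately have "of_int k < \<theta> + of_int j" "\<theta> + of_int j < of_int k + 1" by simp_all
  then show ?thesis using that[OF Uz_Gt FT] by blast
qed

lemma parabolic_fix: assumes "t \<noteq> 0" "U v 0 t x = x" shows "\<exists>k::int. x = v + of_int k"
  using assms parabolic_displacement(3,4)[of t x v] by (metis less_irrefl linorder_neqE_linordered_idom)

lemma Uz_fixed: assumes "m \<noteq> 0" "Uz m 0 z = z" shows "\<exists>j::int. Uz l 0 z = z + of_int j"
proof -
  obtain r r' where r: "r' > 0" "r * sin (pi * (Uz m 0 z - z)) = exp (- m) * sin (pi * z) * cos (pi * z) - exp m * (cos (pi * z) - 0 * sin (pi * z)) * sin (pi * z)"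
    "r' * sin (pi * (Uz l 0 z - z)) = exp (- l) * sin (pi * z) * cos (pi * z) - exp l * (cos (pi * z) - 0 * sin (pi * z)) * sin (pi * z)"
    using Uz_wedge_const by meson
  have "(exp (- m) - exp m) * (sin (pi * z) * cos (pi * z)) = 0" using r(2) assms(2) by (simp add: algebra_simps)
  then have "sin (pi * z) * cos (pi * z) = 0" using assms(1) by simp
  then have "sin (pi * (Uz l 0 z - z)) = 0" using r(1,3) by auto
  then obtain j :: int where "Uz l 0 z - z = of_int j" unfolding sin_eq_0_pi by blast
  then have "Uz l 0 z = z + of_int j" by simp
  then show ?thesis by blast
qed

text \<open>Every element is a central translation times the time-one map of a one-parameter group.
  The last property says that no other member of the group has new fixed points;
  \<open>handle_point\<close> uses it to push a point off its place.\<close>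

lemma one_parameter:
  assumes "Q \<in> Gt"
  obtains K and k :: int where "continuous_on UNIV K" "\<And>s. K s \<in> Gt" "K 0 = id"
    "\<And>s. K s \<circ> Q = Q \<circ> K s" "Q = T (of_int k) \<circ> K (1::real)"
    "\<And>s x. s \<noteq> 0 \<Longrightarrow> K s x = x \<Longrightarrow> \<exists>j::int. Q x = x + of_int j"
proof (cases rule: Gt_cases[OF assms])
  case (1 k)
  then obtain H l where H: "H \<in> Gt" "l > 0" "Q = T (of_int k) \<circ> conjG H (Uz l 0)" using hyp_two by metis
  show ?thesis
  proof (rule that[of "\<lambda>s. conjG H (Uz (s * l) 0)" k])
    show "continuous_on UNIV (\<lambda>s. conjG H (Uz (s * l) 0))"
      unfolding U_zero[symmetric] by (intro continuous_intros) (use H in auto)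
    show "conjG H (Uz (s * l) 0) \<circ> Q = Q \<circ> conjG H (Uz (s * l) 0)" for s
    proof -
      have "conjG H (Uz (s * l) 0) \<circ> conjG H (Uz l 0) = conjG H (Uz l 0) \<circ> conjG H (Uz (s * l) 0)"
        using H by (simp flip: conjG_comp add: Uz_comp add.commute)
      moreover have "conjG H (Uz (s * l) 0) \<circ> T (of_int k) = T (of_int k) \<circ> conjG H (Uz (s * l) 0)"
        using H by (intro T_int_comm) auto
      ultimately show ?thesis unfolding H(3) by (metis comp_assoc)
    qed
    show "\<exists>j::int. Q x = x + of_int j" if s: "s \<noteq> 0" "conjG H (Uz (s * l) 0) x = x" for s x
    proof -
      define z where "z = ginv H x"
      have x: "x = H z" using H(1) by (simp add: z_def)
      have "Uz (s * l) 0 z = z" using s(2) H(1) unfolding x by (simp add: conjG_app)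
      then obtain j :: int where "Uz l 0 z = z + of_int j" using Uz_fixed[of "s * l"] s(1) H(2) by (metis less_irrefl mult_eq_0_iff)
      then have "Q x = x + of_int (j + k)" unfolding H(3) x by (simp add: T_def conjG_app H(1) Gt_period_int)
      then show ?thesis by blast
    qed
  qed (use H in auto)
next
  case (2 k v t)
  show ?thesis
  proof (rule that[of "\<lambda>s. U v 0 (s * t)" k])
    show "continuous_on UNIV (\<lambda>s. U v 0 (s * t))" by (intro continuous_intros)
    show "U v 0 (s * t) \<circ> Q = Q \<circ> U v 0 (s * t)" for s
    proof -
      have "U v 0 (s * t) \<circ> U v 0 t = U v 0 t \<circ> U v 0 (s * t)" by (simp add: U_comp add.commute)
      moreover have "U v 0 (s * t) \<circ> T (of_int k) = T (of_int k) \<circ> U v 0 (s * t)" by (intro T_int_comm) auto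
      ultimately show ?thesis unfolding 2 by (metis comp_assoc)
    qed
    show "\<exists>j::int. Q x = x + of_int j" if s: "s \<noteq> 0" "U v 0 (s * t) x = x" for s x
    proof (cases "t = 0")
      case False
      then obtain j :: int where "x = v + of_int j" using parabolic_fix[of "s * t" v x] s by auto
      then show ?thesis by (simp add: 2 T_def)
    qed (simp add: 2 T_def)
  qed (use 2 in auto)
next
  case (3 k)
  then obtain H \<theta> where H: "H \<in> Gt" "Q = conjG H (T \<theta>)" using elliptic_conj[OF assms] by metis
  show ?thesis
  proof (rule that[of "\<lambda>s. conjG H (T (s * \<theta>))" 0])
    show "continuous_on UNIV (\<lambda>s. conjG H (T (s * \<theta>)))"
      by (intro continuous_intros) (use H in auto)
    show "conjG H (T (s * \<theta>)) \<circ> Q = Q \<circ> conjG H (T (s * \<theta>))" for s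
      unfolding H(2) using H(1) by (simp flip: conjG_comp add: add.commute)
    show "\<exists>j::int. Q x = x + of_int j" if s: "s \<noteq> 0" "conjG H (T (s * \<theta>)) x = x" for s x
    proof -
      have "ginv H (conjG H (T (s * \<theta>)) x) = ginv H x" using s(2) by simp
      then have "\<theta> = 0" using s(1) H(1) by (simp add: conjG_def T_def)
      then have "Q x = x + of_int 0" using H by simp
      then show ?thesis by blast
    qed
  qed (use H in auto)
qed

lemma conjG_T_left: "F \<in> Gt \<Longrightarrow> conjG (T (of_int j)) F = F"
  by (simp add: conjG_def T_int_comm[symmetric] o_assoc[symmetric])

subsection \<open>Handles\<close>

definition cmt :: "(real \<Rightarrow> real) \<Rightarrow> (real \<Rightarrow> real) \<Rightarrow> real \<Rightarrow> real" where
  "cmt A B = A \<circ> B \<circ> ginv A \<circ> ginv B"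

definition handles :: "(real \<Rightarrow> real) \<Rightarrow> ((real \<Rightarrow> real) \<times> (real \<Rightarrow> real)) set" where
  "handles c = {(A, B). A \<in> Gt \<and> B \<in> Gt \<and> cmt A B = c}"

lemma cmt_Gt [simp, intro]: "A \<in> Gt \<Longrightarrow> B \<in> Gt \<Longrightarrow> cmt A B \<in> Gt" by (simp add: cmt_def)

text \<open>Twist deformation of a handle: a factor that commutes with one generator cancels in the
  commutator when it is multiplied to the other.\<close>

lemma cmt_twist:
  assumes "A \<in> Gt" "B \<in> Gt" "K \<in> Gt"
  shows "K \<circ> B = B \<circ> K \<Longrightarrow> cmt (A \<circ> K) B = cmt A B" "K \<circ> A = A \<circ> K \<Longrightarrow> cmt A (B \<circ> K) = cmt A B"
proof -
  show "cmt (A \<circ> K) B = cmt A B" if c: "K \<circ> B = B \<circ> K"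
  proof -
    have "K \<circ> B \<circ> ginv K = B" using c assms by (metis comp_assoc comp_id Gt_inv_comp(2))
    then have "K (B (ginv K x)) = B x" for x by (metis comp_apply)
    then show ?thesis using assms by (simp add: cmt_def inv_comp_Gt fun_eq_iff)
  qed
  show "cmt A (B \<circ> K) = cmt A B" if c: "K \<circ> A = A \<circ> K"
  proof -
    have "K \<circ> ginv A = ginv A \<circ> K" using c assms
      by (metis (no_types, lifting) Gt_inv_comp(1,2) comp_assoc comp_id id_comp)
    then have "K (ginv A (ginv K x)) = ginv A x" for x
      using assms(3) by (metis Gt_inv_simps(2) comp_apply)
    then show ?thesis using assms by (simp add: cmt_def inv_comp_Gt fun_eq_iff)
  qed
qed

lemma lnk_path:
  fixes \<gamma> :: "real \<Rightarrow> 'a::topological_space"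
  assumes "continuous_on UNIV \<gamma>" "\<And>s. \<gamma> s \<in> X" shows "lnk rel X (\<gamma> s) (\<gamma> t)"
  by (rule lnk_connected[of "range \<gamma>"]) (use assms connected_continuous_image[OF assms(1)] in auto)

lemma handle_twist:
  assumes A: "A \<in> Gt" "B \<in> Gt" and K: "continuous_on UNIV K" "\<And>s. K s \<in> Gt" "K 0 = id"
  shows "(\<And>s. K s \<circ> B = B \<circ> K s) \<Longrightarrow> lnk (=) (handles (cmt A B)) (A, B) (A \<circ> K (r::real), B)"
    "(\<And>s. K s \<circ> A = A \<circ> K s) \<Longrightarrow> lnk (=) (handles (cmt A B)) (A, B) (A, B \<circ> K r)"
proof -
  have c: "continuous_on UNIV (\<lambda>s. A \<circ> K s)" "continuous_on UNIV (\<lambda>s. B \<circ> K s)"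
    by (rule continuous_on_Gt_comp[OF continuous_on_const]; use A K in simp)+
  have cp: "continuous_on UNIV (\<lambda>s. (A \<circ> K s, B))" "continuous_on UNIV (\<lambda>s. (A, B \<circ> K s))"
    by (intro continuous_on_Pair c continuous_on_const)+
  show "lnk (=) (handles (cmt A B)) (A, B) (A \<circ> K r, B)" if "\<And>s. K s \<circ> B = B \<circ> K s"
    using lnk_path[of "\<lambda>s. (A \<circ> K s, B)" "handles (cmt A B)" "(=)" 0 r] that A K cp
    by (auto simp: handles_def cmt_twist)
  show "lnk (=) (handles (cmt A B)) (A, B) (A, B \<circ> K r)" if "\<And>s. K s \<circ> A = A \<circ> K s"
    using lnk_path[of "\<lambda>s. (A, B \<circ> K s)" "handles (cmt A B)" "(=)" 0 r] that A K cp
    by (auto simp: handles_def cmt_twist)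
qed

lemma conj_Uz_path:
  assumes "K \<in> Gt" shows "continuous_on UNIV (\<lambda>s. conjG K (Uz s 0))" "\<And>s. conjG K (Uz s 0) \<in> Gt"
    "conjG K (Uz 0 0) = id" "\<And>s. conjG K (Uz s 0) \<circ> (T (of_int k) \<circ> conjG K (Uz l 0)) = (T (of_int k) \<circ> conjG K (Uz l 0)) \<circ> conjG K (Uz s 0)"
proof -
  show "continuous_on UNIV (\<lambda>s. conjG K (Uz s 0))"
    unfolding U_zero[symmetric] by (intro continuous_intros) (use assms in auto)
  show "conjG K (Uz s 0) \<in> Gt" for s using assms by simp
  show "conjG K (Uz 0 0) = id" using assms by simp
  show "conjG K (Uz s 0) \<circ> (T (of_int k) \<circ> conjG K (Uz l 0)) = (T (of_int k) \<circ> conjG K (Uz l 0)) \<circ> conjG K (Uz s 0)" for s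
  proof -
    have "conjG K (Uz s 0) \<circ> conjG K (Uz l 0) = conjG K (Uz l 0) \<circ> conjG K (Uz s 0)"
      using assms by (simp flip: conjG_comp add: Uz_comp add.commute)
    moreover have "conjG K (Uz s 0) \<circ> T (of_int k) = T (of_int k) \<circ> conjG K (Uz s 0)"
      using assms by (intro T_int_comm) auto
    ultimately show ?thesis by (metis comp_assoc)
  qed
qed

text \<open>The whole fibre is saturated and clopen in itself, so a link that starts in it cannot
  leave it.\<close>

lemma handles_cmt: "lnk rel (handles c) (A, B) (A', B') \<Longrightarrow> rel = (=) \<Longrightarrow> (A, B) \<in> handles c \<Longrightarrow> (A', B') \<in> handles c"
proof -
  assume *: "lnk rel (handles c) (A, B) (A', B')" "rel = (=)" "(A, B) \<in> handles c"
  have "sat_clopen rel (handles c) (handles c)" using *(2) unfolding sat_clopen_def by auto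
  then show "(A', B') \<in> handles c" using * unfolding lnk_def by blast
qed

lemma twist_inverse:
  assumes A: "A \<in> Gt"
  obtains K and j :: int where "continuous_on UNIV K" "\<And>s. K s \<in> Gt" "K 0 = id" "\<And>s. K s \<circ> A = A \<circ> K s"
    "K (1::real) = T (of_int j) \<circ> ginv A"
proof -
  obtain K and k :: int where K: "continuous_on UNIV K" "\<And>s. K s \<in> Gt" "K 0 = id"
    "\<And>s. K s \<circ> ginv A = ginv A \<circ> K s" "ginv A = T (of_int k) \<circ> K (1::real)"
    using one_parameter[OF inv_Gt[OF A]] by metis
  have "K s \<circ> A = A \<circ> K s" for s
  proof
    fix x show "(K s \<circ> A) x = (A \<circ> K s) x"
      using fun_cong[OF K(4)[of s], of "A x"] A by (metis comp_apply Gt_inv_simps)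
  qed
  moreover have "K 1 = T (of_int (- k)) \<circ> ginv A" unfolding K(5) by (simp add: o_assoc)
  ultimately show ?thesis using that K by blast
qed

text \<open>The substitution A := AB, B := A^-1 preserves the commutator; up to the center it is realised by a path,
  because every element lies on a one-parameter group.\<close>

lemma handle_move:
  assumes A: "A \<in> Gt" and B: "B \<in> Gt"
  shows "\<exists>i j::int. lnk (=) (handles (cmt A B)) (A, B) (T (of_int i) \<circ> (A \<circ> B), T (of_int j) \<circ> ginv A)"
proof -
  obtain K and k :: int where K: "continuous_on UNIV K" "\<And>s. K s \<in> Gt" "K 0 = id"
    "\<And>s. K s \<circ> B = B \<circ> K s" "B = T (of_int k) \<circ> K (1::real)" using one_parameter[OF B] by metis
  define A1 where "A1 = A \<circ> K 1"
  have "K 1 = T (of_int (- k)) \<circ> B" by (subst K(5)) (simp add: o_assoc)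
  then have "A1 = T (of_int (- k)) \<circ> (A \<circ> B)"
    using T_int_comm[OF A, of "- k"] by (simp only: A1_def o_assoc)
  moreover have "A1 \<in> Gt" using comp_Gt[OF A K(2)] by (simp add: A1_def)
  ultimately have A1: "A1 = T (of_int (- k)) \<circ> (A \<circ> B)" "A1 \<in> Gt" .
  have l1: "lnk (=) (handles (cmt A B)) (A, B) (A1, B)"
    unfolding A1_def by (rule handle_twist(1)[OF A B K(1-3)]) (rule K(4))
  have c: "cmt A1 B = cmt A B" unfolding A1_def by (rule cmt_twist(1)[OF A B K(2) K(4)])
  obtain K' and j :: int where K': "continuous_on UNIV K'" "\<And>s. K' s \<in> Gt" "K' 0 = id" "\<And>s. K' s \<circ> A1 = A1 \<circ> K' s"
    "K' (1::real) = T (of_int j) \<circ> ginv A1" by (rule twist_inverse[OF A1(2)]) (rule that)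
  have l2: "lnk (=) (handles (cmt A1 B)) (A1, B) (A1, B \<circ> K' 1)"
    by (rule handle_twist(2)[OF A1(2) B K'(1-3)]) (rule K'(4))
  have "B \<circ> K' 1 = T (of_int (j + k)) \<circ> ginv A"
  proof
    fix x
    have "ginv A1 x = ginv B (ginv A x) + of_int k"
      unfolding A1(1) using A B Gt_period_int[OF inv_Gt[OF A], of x k] Gt_period_int[OF inv_Gt[OF B], of "ginv A x" k]
      by (simp add: inv_comp_Gt T_def)
    then show "(B \<circ> K' 1) x = (T (of_int (j + k)) \<circ> ginv A) x"
      unfolding K'(5) using B Gt_period_int[OF B, of "ginv B (ginv A x)" "k + j"] by (simp add: T_def add.assoc add.commute)
  qed
  then show ?thesis using lnk_trans[OF l1 l2[unfolded c]] unfolding A1(1) by metis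
qed

text \<open>The move of \<open>handle_move\<close> puts the inverse of \<open>A\<close>, up to the
  center, into the second place.\<close>

lemma hyp_first:
  assumes A: "A \<in> J m m" and B: "B \<in> Gt"
  shows "\<exists>A' B' k. lnk (=) (handles (cmt A B)) (A, B) (A', B') \<and> B' \<in> J k k"
proof -
  have AG: "A \<in> Gt" using A by (rule J_Gt)
  obtain i j :: int where l: "lnk (=) (handles (cmt A B)) (A, B) (T (of_int i) \<circ> (A \<circ> B), T (of_int j) \<circ> ginv A)"
    using handle_move[OF AG B] by blast
  obtain x y where "A x > x + of_int m" "A y < y + of_int m" using A unfolding J_def by auto
  then have "ginv A \<in> J (- m) (- m)" using AG by (intro JI[of _ "A y" _ "A x"]) simp_all
  then have "T (of_int j) \<circ> ginv A \<in> J (j - m) (j - m)" using J_shift[of j _ "- m" "- m"] by simp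
  then show ?thesis using l by blast
qed

text \<open>On homology the move has order six and its cube is -1, so three moves turn
  \<open>B\<close> into a conjugate of its inverse.\<close>

lemma handle_move3:
  assumes A: "A \<in> Gt" and B: "B \<in> Gt"
  shows "\<exists>A' (j::int). lnk (=) (handles (cmt A B)) (A, B) (A', T (of_int j) \<circ> conjG A (ginv B))"
proof -
  let ?c = "cmt A B"
  have step: "\<exists>i j::int. lnk (=) (handles ?c) (A, B) (T (of_int i) \<circ> (X \<circ> Y), T (of_int j) \<circ> ginv X)"
    if l: "lnk (=) (handles ?c) (A, B) (X, Y)" for X Y
  proof -
    have "X \<in> Gt" "Y \<in> Gt" "cmt X Y = ?c" using handles_cmt[OF l] A B by (auto simp: handles_def)
    then show ?thesis using handle_move[of X Y] lnk_trans[OF l] by metis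
  qed
  obtain i j :: int where l1: "lnk (=) (handles ?c) (A, B) (T (of_int i) \<circ> (A \<circ> B), T (of_int j) \<circ> ginv A)"
    using step[OF lnk_refl] by blast
  define X where "X = T (of_int i) \<circ> (A \<circ> B)"
  obtain i' j' :: int where l2: "lnk (=) (handles ?c) (A, B) (T (of_int i') \<circ> (X \<circ> (T (of_int j) \<circ> ginv A)), T (of_int j') \<circ> ginv X)"
    using step[OF l1] unfolding X_def by blast
  obtain j'' :: int where l3: "\<exists>A'. lnk (=) (handles ?c) (A, B) (A', T (of_int j'') \<circ> ginv (T (of_int i') \<circ> (X \<circ> (T (of_int j) \<circ> ginv A))))"
    using step[OF l2] by blast
  have "T (of_int i') \<circ> (X \<circ> (T (of_int j) \<circ> ginv A)) = T (of_int (i' + i + j)) \<circ> conjG A B"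
    using A B by (simp add: fun_eq_iff X_def T_def conjG_def Gt_period_int)
  then have "ginv (T (of_int i') \<circ> (X \<circ> (T (of_int j) \<circ> ginv A))) = T (of_int (- (i' + i + j))) \<circ> conjG A (ginv B)"
    using A B T_int_comm[of "conjG A (ginv B)" "- (i' + i + j)"] by (simp add: inv_comp_Gt conjG_ginv)
  then have "T (of_int j'') \<circ> ginv (T (of_int i') \<circ> (X \<circ> (T (of_int j) \<circ> ginv A))) = T (of_int (j'' - (i' + i + j))) \<circ> conjG A (ginv B)"
    by (simp add: fun_eq_iff T_def)
  then show ?thesis using l3 by metis
qed

text \<open>If \<open>B\<close> is not hyperbolic, twisting \<open>A\<close> along the one-parameter
  group of \<open>B\<close> makes \<open>A\<close> hyperbolic, and the move then exchanges the
  roles. If that is impossible, \<open>A\<close> can be twisted to the center.\<close>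

theorem handle_hyp:
  assumes A: "A \<in> Gt" and B: "B \<in> Gt"
  shows "\<exists>A' B' k. lnk (=) (handles (cmt A B)) (A, B) (A', B') \<and> B' \<in> J k k"
proof -
  have m: "(A, B) \<in> handles (cmt A B)" using A B by (simp add: handles_def)
  have step: "\<exists>A' B' k. lnk (=) (handles (cmt A B)) (A, B) (A', B') \<and> B' \<in> J k k"
    if 1: "lnk (=) (handles (cmt A B)) (A, B) (A1, B1)"
      and 2: "A1 \<in> Gt \<Longrightarrow> B1 \<in> Gt \<Longrightarrow> \<exists>A' B' k. lnk (=) (handles (cmt A1 B1)) (A1, B1) (A', B') \<and> B' \<in> J k k" for A1 B1
  proof -
    have "(A1, B1) \<in> handles (cmt A B)" using handles_cmt[OF 1 _ m] by blast
    then have "A1 \<in> Gt" "B1 \<in> Gt" "cmt A1 B1 = cmt A B" by (auto simp: handles_def)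
    then show ?thesis using 2 lnk_trans[OF 1] by metis
  qed
  \<comment> \<open>With \<open>A1\<close> central the commutator does not depend on the second
    entry, so this entry may run to the center and from there along the diagonal group to a
    hyperbolic element.\<close>
  have central: "\<exists>A' B' k. lnk (=) (handles (cmt A1 B1)) (A1, B1) (A', B') \<and> B' \<in> J k k"
    if A1: "A1 = T (of_int j)" and B1: "B1 \<in> Gt" for A1 B1 and j :: int
  proof -
    obtain K and k :: int where K: "continuous_on UNIV K" "\<And>s. K s \<in> Gt" "K 0 = id" "\<And>s. K s \<circ> B1 = B1 \<circ> K s"
      "K (1::real) = T (of_int k) \<circ> ginv B1" by (rule twist_inverse[OF B1]) (rule that)
    have A1G: "A1 \<in> Gt" by (simp add: A1)
    have c: "F \<circ> A1 = A1 \<circ> F" if "F \<in> Gt" for F using T_int_comm[OF that] by (simp add: A1)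
    have "lnk (=) (handles (cmt A1 B1)) (A1, B1) (A1, B1 \<circ> K 1)"
      using handle_twist(2)[OF A1G B1 K(1-3), of 1] c K(2) by blast
    moreover have "B1 \<circ> K 1 = T (of_int k)"
      unfolding K(5) using B1 by (simp add: fun_eq_iff T_def Gt_period_int)
    moreover have "lnk (=) (handles (cmt A1 (B1 \<circ> K 1))) (A1, B1 \<circ> K 1) (A1, B1 \<circ> K 1 \<circ> Uz 1 0)"
      using handle_twist(2)[OF A1G, of "B1 \<circ> K 1" "\<lambda>s. conjG id (Uz s 0)" 1] conj_Uz_path[OF id_Gt] c B1 K(2)
      by (auto simp: conjG_def)
    moreover have "cmt A1 (B1 \<circ> K 1) = cmt A1 B1" using cmt_twist(2)[OF A1G B1 K(2) c] K(2) by blast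
    moreover have "T (of_int k) \<circ> Uz 1 0 \<in> J k k" using hyp_conj[OF id_Gt, of 1 k] by (simp add: conjG_def)
    ultimately show ?thesis by (metis lnk_trans)
  qed
  show ?thesis
  proof (cases rule: Gt_cases[OF B])
    case (1 k) then show ?thesis using lnk_refl by blast
  next
    case (2 k v t)
    have cK: "U v 0 s \<circ> B = B \<circ> U v 0 s" for s
    proof -
      have "U v 0 s \<circ> U v 0 t = U v 0 t \<circ> U v 0 s" by (simp add: U_comp add.commute)
      moreover have "U v 0 s \<circ> T (of_int k) = T (of_int k) \<circ> U v 0 s" by (intro T_int_comm) auto
      ultimately show ?thesis unfolding 2 by (metis comp_assoc)
    qed
    have cU: "continuous_on UNIV (\<lambda>s. U v 0 s)" by (intro continuous_intros)
    have tw: "lnk (=) (handles (cmt A B)) (A, B) (A \<circ> U v 0 s, B)" for s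
      using handle_twist(1)[OF A B cU, of s] cK by simp
    show ?thesis
    proof (cases "\<exists>j::int. A v = v + of_int j")
      case True
      then obtain j :: int where j: "A v = v + of_int j" by blast
      obtain l s where ls: "A = T (of_int j) \<circ> U v l s" using Gt_fix_int_U[OF A j] by blast
      show ?thesis
      proof (cases "l = 0")
        case True
        have "A \<circ> U v 0 (- s) = T (of_int j)" unfolding ls True by (simp add: o_assoc[symmetric] U_comp)
        from step[OF tw[of "- s"] central[OF this B]] show ?thesis .
      next
        case False
        then have "A \<in> J j j" unfolding ls using hyp_U[of l v s] J_shift[of j _ 0 0] by simp
        from hyp_first[OF this B] show ?thesis .
      qed
    next
      case False
      \<comment> \<open>At \<open>v\<close>, which the twist fixes, the displacement stays below
        \<open>i + 1\<close>; a strong twist raises it above \<open>i + 1\<close> at another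
        point.\<close>
      define i where "i = \<lfloor>A v - v\<rfloor>"
      have i: "v + of_int i \<le> A v" "A v < v + of_int i + 1" unfolding i_def by linarith+
      then have i': "A v > v + of_int i" using False by (metis order_le_less)
      obtain s0 where "\<forall>s\<ge>s0. \<exists>x. A (U v 0 s x) > x + of_int i + 1" using reach_up[OF A i', of 0] by blast
      then obtain x where "A (U v 0 s0 x) > x + of_int (i + 1)" by (auto simp: add.assoc)
      moreover have "A (U v 0 s0 v) < v + of_int (i + 1)" using i by simp
      ultimately have "A \<circ> U v 0 s0 \<in> J (i + 1) (i + 1)"
        by (intro JI[OF comp_Gt[OF A U_Gt], of x _ _ _ _ v]) simp_all
      from step[OF tw[of s0] hyp_first[OF this B]] show ?thesis .
    qed
  next
    case (3 k)
    then obtain g \<theta> where g: "g \<in> Gt" "B = conjG g (T \<theta>)" using elliptic_conj[OF B] by metis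
    define A1 where "A1 = conjG (ginv g) A"
    have A1: "A1 \<in> Gt" "A = conjG g A1" using A g by (simp_all add: A1_def conjG_inverse)
    have cT: "continuous_on UNIV (\<lambda>s. conjG g (T s))" by (intro continuous_intros) (use g in auto)
    have tw: "lnk (=) (handles (cmt A B)) (A, B) (A \<circ> conjG g (T s), B)" for s
      by (rule handle_twist(1)[OF A B cT]) (use g in \<open>auto simp flip: conjG_comp simp: add.commute\<close>)
    have tA: "A \<circ> conjG g (T s) = conjG g (A1 \<circ> T s)" for s unfolding A1(2) using g by (simp add: conjG_comp)
    show ?thesis
    proof (cases "\<exists>c. \<forall>x. A1 x = x + c")
      case True
      then obtain c where "A1 = T c" by (auto simp: fun_eq_iff T_def)
      then have "A \<circ> conjG g (T (- c)) = T (of_int 0)" unfolding tA using g by simp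
      from step[OF tw[of "- c"] central[OF this B]] show ?thesis .
    next
      case False
      then obtain y where "A1 y - y \<noteq> A1 0 - 0" by (metis add.commute diff_add_cancel)
      then obtain x1 x2 where x12: "A1 x1 - x1 < A1 x2 - x2" by (metis linorder_neqE_linordered_idom)
      \<comment> \<open>The twist shifts all displacements by the same amount; shifting by minus the
        mean of two distinct values makes both signs occur.\<close>
      define s where "s = - ((A1 x1 - x1) + (A1 x2 - x2)) / 2"
      have "(A1 \<circ> T s) (x1 - s) < (x1 - s)" "(A1 \<circ> T s) (x2 - s) > (x2 - s)" using x12 by (simp_all add: T_def s_def field_simps)
      then have "A1 \<circ> T s \<in> J 0 0" by (intro JI[OF comp_Gt[OF A1(1) T_Gt], of "x2 - s" _ _ "x1 - s"]) simp_all
      then have "A \<circ> conjG g (T s) \<in> J 0 0" unfolding tA by (rule J_conj[OF g(1)])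
      from step[OF tw[of s] hyp_first[OF this B]] show ?thesis .
    qed
  qed
qed

text \<open>The strength of the last hyperbolic block cannot be solved for if its fixed point
  \<open>K 0\<close> is a touching point. This deformation moves the fixed point to a different
  class modulo integers without changing the commutator.\<close>

lemma handle_point:
  assumes K: "K \<in> Gt" and l: "l > 0" and A: "A \<in> Gt" and B: "B = T (of_int k) \<circ> conjG K (Uz l 0)"
  shows "\<exists>A' B' K' m (k'::int). lnk (=) (handles (cmt A B)) (A, B) (A', B') \<and> K' \<in> Gt \<and> m > 0 \<and>
     B' = T (of_int k') \<circ> conjG K' (Uz m 0) \<and> (\<forall>j::int. K' 0 \<noteq> K 0 + of_int j)"
proof (cases "\<exists>j::int. A (K 0) = K 0 + of_int j")
  case True
  then obtain j0 :: int where j0: "A (K 0) = K 0 + of_int j0" by blast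
  have BG: "B \<in> Gt" using B K by simp
  obtain A' and j :: int where lk: "lnk (=) (handles (cmt A B)) (A, B) (A', T (of_int j) \<circ> conjG A (ginv B))"
    using handle_move3[OF A BG] by blast
  \<comment> \<open>The quarter turn keeps the parameter positive although \<open>B\<close> was
    inverted. The new origin is the image under \<open>A\<close> of the second fixed point
    \<open>K (1/2)\<close>, while \<open>A\<close> maps \<open>K 0\<close> to a translate of
    itself.\<close>
  define K' where "K' = A \<circ> (K \<circ> T (1/2))"
  have K': "K' \<in> Gt" using A K by (simp add: K'_def)
  have "ginv (Uz l 0) = Uz (- l) 0" using ginv_U[of 0 l 0] by (simp add: U_zero)
  then have "ginv B = T (of_int (- k)) \<circ> conjG K (Uz (- l) 0)"
    using K T_int_comm[of "conjG K (Uz (- l) 0)" "- k"] by (simp add: B inv_comp_Gt conjG_ginv)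
  then have "conjG A (ginv B) = T (of_int (- k)) \<circ> conjG A (conjG K (Uz (- l) 0))"
    using T_int_comm[OF A, of "- k"] by (simp add: conjG_def o_assoc)
  also have "conjG A (conjG K (Uz (- l) 0)) = conjG K' (Uz l 0)"
    using conjG_half[OF comp_Gt[OF A K], of "- l"] A K by (simp add: K'_def conjG_conjG o_assoc)
  finally have "T (of_int j) \<circ> conjG A (ginv B) = T (of_int (j - k)) \<circ> conjG K' (Uz l 0)" by (simp add: fun_eq_iff T_def)
  moreover have "K' 0 \<noteq> K 0 + of_int i" for i :: int
  proof
    assume "K' 0 = K 0 + of_int i"
    then have "A (K (1/2)) = A (K (of_int (i - j0)))"
      using j0 Gt_period_int[OF K, of 0 "i - j0"] Gt_period_int[OF A, of "K 0" "i - j0"] by (simp add: K'_def T_def)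
    then show False using A K no_half[of "i - j0"] by simp
  qed
  ultimately show ?thesis using lk K' l by metis
next
  case False
  have BG: "B \<in> Gt" using B K by simp
  obtain P where P: "continuous_on UNIV P" "\<And>s::real. P s \<in> Gt" "P 0 = id" "\<And>s. P s \<circ> A = A \<circ> P s"
    "\<And>s x. s \<noteq> 0 \<Longrightarrow> P s x = x \<Longrightarrow> \<exists>j::int. A x = x + of_int j" using one_parameter[OF A] by metis
  have "continuous_on UNIV (\<lambda>s. B \<circ> P s)"
    by (rule continuous_on_Gt_comp[OF continuous_on_const]) (use BG P in auto)
  then have "open {s. B \<circ> P s \<in> J k k}"
    using openin_region[OF open_region_J, of UNIV "\<lambda>s. B \<circ> P s" k k] BG P(2) by simp
  moreover have "B \<circ> P 0 \<in> J k k" using P(3) hyp_conj[OF K, of l k] l by (simp add: B)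
  ultimately obtain e where e: "e > 0" "\<And>s. dist s 0 < e \<Longrightarrow> B \<circ> P s \<in> J k k" unfolding open_dist by blast
  define s where "s = e / 2"
  have s: "s \<noteq> 0" "B \<circ> P s \<in> J k k" using e by (auto simp: s_def)
  obtain K' m where K': "K' \<in> Gt" "m > 0" "B \<circ> P s = T (of_int k) \<circ> conjG K' (Uz m 0)" using hyp_two[OF s(2)] by metis
  \<comment> \<open>Otherwise \<open>B\<close> and \<open>B \<circ> P s\<close> agree at
    \<open>K 0\<close>, so \<open>P s\<close> fixes it. Then \<open>A\<close> moves it by an
    integer, which is the case treated before.\<close>
  have "K' 0 \<noteq> K 0 + of_int j" for j :: int
  proof
    assume *: "K' 0 = K 0 + of_int j"
    have "(B \<circ> P s) (K' 0) = K' 0 + of_int k" unfolding K'(3) using conjG_app[OF K'(1), of "Uz m 0" 0] by (simp add: T_def)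
    then have "(B \<circ> P s) (K 0) = K 0 + of_int k"
      using Gt_period_int[of "B \<circ> P s" "K 0" j] BG P(2) unfolding * by (auto intro: comp_Gt)
    moreover have "B (K 0) = K 0 + of_int k" unfolding B using conjG_app[OF K, of "Uz l 0" 0] by (simp add: T_def)
    ultimately have "B (P s (K 0)) = B (K 0)" by (simp only: comp_apply)
    then have "P s (K 0) = K 0" using BG by simp
    then show False using P(5)[OF s(1)] False by blast
  qed
  moreover have "lnk (=) (handles (cmt A B)) (A, B) (A, B \<circ> P s)" by (rule handle_twist(2)[OF A BG P(1-3)]) (rule P(4))
  ultimately show ?thesis using K' by blast
qed

subsection \<open>Lifted representations\<close>

text \<open>Lifts of one and the same representation: each generator is determined up to the
  center.\<close>

definition zeq :: "(surface_gen \<Rightarrow> real \<Rightarrow> real) \<Rightarrow> (surface_gen \<Rightarrow> real \<Rightarrow> real) \<Rightarrow> bool" where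
  "zeq h h' \<longleftrightarrow> (\<forall>x. \<exists>k::int. h' x = T (of_int k) \<circ> h x)"

definition hprod :: "nat list \<Rightarrow> (surface_gen \<Rightarrow> real \<Rightarrow> real) \<Rightarrow> real \<Rightarrow> real" where
  "hprod is h = gprod is (\<lambda>j. cmt (h (GenA j)) (h (GenB j)))"

definition cprod :: "nat list \<Rightarrow> (surface_gen \<Rightarrow> real \<Rightarrow> real) \<Rightarrow> real \<Rightarrow> real" where
  "cprod is h = gprod is (\<lambda>i. h (GenC i))"

text \<open>A peripheral generator has its lift with fixed points, the one that enters the relative
  Euler class. Handle generators have arbitrary lifts, which the commutators do not
  distinguish.\<close>

definition lifted_reps :: "nat \<Rightarrow> nat \<Rightarrow> (nat \<Rightarrow> int) \<Rightarrow> int \<Rightarrow> (surface_gen \<Rightarrow> real \<Rightarrow> real) set" where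
  "lifted_reps g p s n = {h. (\<forall>x. h x \<in> Gt) \<and> (\<forall>x. x \<notin> surface_gens g p \<longrightarrow> h x = id) \<and>
     (\<forall>i\<in>{1..p}. h (GenC i) \<in> block (s i) 0) \<and>
     hprod [1..<Suc g] h \<circ> cprod [1..<Suc p] h = T (of_int n)}"

lemma zeq_refl [simp]: "zeq h h" unfolding zeq_def by (intro allI exI[of _ 0]) simp

lemma zeq_sym: assumes "zeq h h'" shows "zeq h' h"
  unfolding zeq_def
proof
  fix x
  obtain k :: int where "h' x = T (of_int k) \<circ> h x" using assms unfolding zeq_def by blast
  then have "h x = T (of_int (- k)) \<circ> h' x" by (simp add: o_assoc)
  then show "\<exists>k::int. h x = T (of_int k) \<circ> h' x" by blast
qed

lemma gprod_Gt': "(\<And>j. h (GenA j) \<in> Gt) \<Longrightarrow> (\<And>j. h (GenB j) \<in> Gt) \<Longrightarrow> hprod is h \<in> Gt"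
  "(\<And>j. h (GenC j) \<in> Gt) \<Longrightarrow> cprod is h \<in> Gt"
  unfolding hprod_def cprod_def by (auto intro!: gprod_Gt)

lemma T_int_left_cancel: "X \<in> Gt \<Longrightarrow> Y \<in> Gt \<Longrightarrow> X \<circ> Y = T (of_int n) \<longleftrightarrow> Y \<circ> X = T (of_int n)"
proof -
  have "Y \<circ> X = T (of_int n)" if "X \<in> Gt" "Y \<in> Gt" "X \<circ> Y = T (of_int n)" for X Y :: "real \<Rightarrow> real"
  proof -
    have "Y \<circ> X = ginv X \<circ> (X \<circ> Y) \<circ> X" using that(1) by (simp add: o_assoc)
    also have "\<dots> = ginv X \<circ> (T (of_int n) \<circ> X)" unfolding that(3) by (simp add: o_assoc)
    also have "\<dots> = ginv X \<circ> X \<circ> T (of_int n)" unfolding T_int_comm[OF that(1), symmetric] by (simp add: o_assoc)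
    finally show ?thesis using that(1) by simp
  qed
  then show "X \<in> Gt \<Longrightarrow> Y \<in> Gt \<Longrightarrow> X \<circ> Y = T (of_int n) \<longleftrightarrow> Y \<circ> X = T (of_int n)" by blast
qed

lemma Gt_solve: assumes W: "W \<in> Gt" shows "W \<circ> X = Y \<longleftrightarrow> X = ginv W \<circ> Y"
proof
  assume "W \<circ> X = Y"
  then have "ginv W \<circ> Y = (ginv W \<circ> W) \<circ> X" by (auto simp only: o_assoc)
  then show "X = ginv W \<circ> Y" using W by simp
next
  assume "X = ginv W \<circ> Y"
  then have "W \<circ> X = (W \<circ> ginv W) \<circ> Y" by (auto simp only: o_assoc)
  then show "W \<circ> X = Y" using W by simp
qed

text \<open>The right-hand side is central, so the relation may be rotated cyclically until the
  first peripheral factor stands last and can be isolated.\<close>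

lemma relation_rotate:
  assumes "g \<ge> 1" "p \<ge> 1" "\<And>x. h x \<in> Gt"
  shows "hprod [1..<Suc g] h \<circ> cprod [1..<Suc p] h = T (of_int n) \<longleftrightarrow>
    h (GenC 1) = ginv (cprod [2..<Suc p] h \<circ> hprod [1..<g] h \<circ> cmt (h (GenA g)) (h (GenB g))) \<circ> T (of_int n)"
proof -
  let ?C = "cprod [2..<Suc p] h" and ?H = "hprod [1..<g] h" and ?c = "cmt (h (GenA g)) (h (GenB g))"
  have g: "hprod [1..<Suc g] h = ?H \<circ> ?c" using assms(1) by (simp add: hprod_def gprod_append)
  have "[1..<Suc p] = 1 # [2..<Suc p]" using assms(2) by (simp add: upt_conv_Cons numeral_2_eq_2)
  then have c: "cprod [1..<Suc p] h = h (GenC 1) \<circ> ?C" by (simp add: cprod_def)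
  have G: "?C \<in> Gt" "?H \<in> Gt" "?c \<in> Gt" "h (GenC 1) \<in> Gt" using assms(3) by (auto intro: gprod_Gt')
  have W: "?C \<circ> ?H \<circ> ?c \<in> Gt" using G by simp
  have "hprod [1..<Suc g] h \<circ> cprod [1..<Suc p] h = T (of_int n) \<longleftrightarrow> (?H \<circ> ?c \<circ> h (GenC 1)) \<circ> ?C = T (of_int n)"
    unfolding g c by (simp add: o_assoc)
  also have "\<dots> \<longleftrightarrow> ?C \<circ> (?H \<circ> ?c \<circ> h (GenC 1)) = T (of_int n)"
    using G by (intro T_int_left_cancel) auto
  also have "\<dots> \<longleftrightarrow> (?C \<circ> ?H \<circ> ?c) \<circ> h (GenC 1) = T (of_int n)" by (simp add: o_assoc)
  also have "\<dots> \<longleftrightarrow> h (GenC 1) = ginv (?C \<circ> ?H \<circ> ?c) \<circ> T (of_int n)"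
    by (rule Gt_solve[OF W])
  finally show ?thesis .
qed

lemma centralizer_Uz:
  assumes "M \<in> Gt" "M 0 = 0" "M \<circ> Uz l 0 = Uz l 0 \<circ> M" "l \<noteq> 0"
  obtains \<rho> where "M = Uz \<rho> 0"
proof -
  obtain \<rho> t where M: "M = Uz \<rho> t" using Gt_fix_U[OF assms(1,2)] by (auto simp: U_zero)
  have e: "Uz (\<rho> + l) (t * exp (- 2 * l)) = Uz (\<rho> + l) t"
    using assms(3) unfolding M Uz_comp by (simp add: add.commute)
  define s where "s = t * exp (- 2 * l)"
  have "s = t"
  proof (cases s t rule: linorder_cases)
    case less
    then show ?thesis using Uz_less[of "1/2" s t "\<rho> + l"] e unfolding s_def[symmetric] by simp
  next
    case greater
    then show ?thesis using Uz_less[of "1/2" t s "\<rho> + l"] e unfolding s_def[symmetric] by simp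
  qed
  then have "t * exp (- 2 * l) = t" by (simp only: s_def)
  then have "t * (exp (- 2 * l) - 1) = 0" by (simp add: right_diff_distrib)
  then have "t = 0" using assms(4) by simp
  then show ?thesis using that M by simp
qed

text \<open>Two conjugators of the same hyperbolic element differ by its centralizer, which among
  the maps fixing 0 is the diagonal group.\<close>

lemma frame_unique:
  assumes K: "K \<in> Gt" and l: "l \<noteq> 0"
  obtains \<rho> t where "conjG K (Uz l 0) = U (K 0) l t" "K = frame (K 0) l t \<circ> Uz \<rho> 0"
proof -
  obtain t where t: "conjG K (Uz l 0) = U (K 0) l t" using conj_Uz(1)[OF K] by blast
  define M where "M = ginv (frame (K 0) l t) \<circ> K"
  have fG: "frame (K 0) l t \<in> Gt" by simp
  have KM: "K = frame (K 0) l t \<circ> M" unfolding M_def by (simp add: o_assoc)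
  have MG: "M \<in> Gt" using K by (simp add: M_def)
  have M0: "M 0 = 0" using Gt_inv_simps(1)[OF fG, of 0] by (simp add: M_def)
  have "conjG (frame (K 0) l t) (conjG M (Uz l 0)) = conjG (frame (K 0) l t) (Uz l 0)"
    using t frame_conj[OF l, of "K 0" t] MG by (simp add: conjG_conjG flip: KM)
  then have "conjG M (Uz l 0) = Uz l 0" by (metis conjG_inverse(2) fG)
  then have "M \<circ> Uz l 0 = Uz l 0 \<circ> M" using MG unfolding conjG_def by (metis comp_assoc comp_id Gt_inv_comp(1))
  then obtain \<rho> where "M = Uz \<rho> 0" using centralizer_Uz[OF MG M0 _ l] by blast
  then show ?thesis using that t KM by simp
qed

text \<open>\<open>A\<close> carries the frame \<open>K'\<close> to the frame \<open>K\<close>, and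
  its diagonal part commutes with \<open>Uz l 0\<close>. So the commutator is a conjugate in the
  frame \<open>K\<close> times the inverse in the frame \<open>K'\<close>.\<close>

lemma cmt_frames:
  assumes "K \<in> Gt" "K' \<in> Gt"
  shows "cmt (K \<circ> Uz r 0 \<circ> ginv K') (conjG K' (Uz l 0)) = conjG K (Uz l 0) \<circ> conjG K' (Uz (- l) 0)"
proof -
  have gU: "ginv (Uz r 0) = Uz (- r) 0" "ginv (Uz l 0) = Uz (- l) 0" for r l using ginv_U[of 0 _ 0] by (simp_all add: U_zero)
  have c: "Uz r 0 (Uz l 0 (Uz (- r) 0 x)) = Uz l 0 x" for x
    using Uz_comp[of r 0 l 0] Uz_comp[of "r + l" 0 "- r" 0] by (metis (no_types, lifting) add.commute add_diff_cancel_left' comp_apply diff_conv_add_uminus mult_zero_left add_0_right)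
  show ?thesis using assms
    by (simp add: cmt_def conjG_def inv_comp_Gt gU fun_eq_iff c)
qed

lemma cmt_shift: assumes "A \<in> Gt" "B \<in> Gt"
  shows "cmt (T (of_int i) \<circ> A) (T (of_int k) \<circ> B) = cmt A B"
proof -
  have "cmt (T (of_int i) \<circ> A) (T (of_int k) \<circ> B) x = cmt A B x" for x
  proof -
    have e: "ginv A (y - of_int i) = ginv A y - of_int i" "B (y - of_int i) = B y - of_int i"
      "A (y + of_int i) = A y + of_int i" "ginv B (y - of_int k) = ginv B y - of_int k"
      "ginv A (y - of_int k) = ginv A y - of_int k" "B (y - of_int k) = B y - of_int k"
      "A (y + of_int k) = A y + of_int k" "B (y + of_int k) = B y + of_int k" "A (y - of_int i) = A y - of_int i" for y
      using assms Gt_period_int[of A y "- i"] Gt_period_int[of "ginv A" y "- i"] Gt_period_int[of "ginv A" y "- k"] Gt_period_int[of B y "- i"] Gt_period_int[of B y "- k"]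
        Gt_period_int[of "ginv B" y "- k"] Gt_period_int[of A y i] Gt_period_int[of A y k] Gt_period_int[of B y k] by simp_all
    show ?thesis using assms by (simp add: cmt_def inv_comp_Gt T_def e)
  qed
  then show ?thesis by blast
qed

lemma lnk_handle:
  assumes h: "h \<in> lifted_reps g p s n" and j: "j \<in> {1..g}"
    and l: "lnk (=) (handles (cmt (h (GenA j)) (h (GenB j)))) (h (GenA j), h (GenB j)) (A, B)"
  shows "h(GenA j := A, GenB j := B) \<in> lifted_reps g p s n"
    "lnk zeq (lifted_reps g p s n) h (h(GenA j := A, GenB j := B))"
proof -
  let ?H = "handles (cmt (h (GenA j)) (h (GenB j)))"
  define \<Psi> where "\<Psi> = (\<lambda>(A, B). h(GenA j := A, GenB j := B))"
  have G: "h x \<in> Gt" for x using h by (simp add: lifted_reps_def)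
  have m: "(h (GenA j), h (GenB j)) \<in> ?H" using G by (simp add: handles_def)
  have m': "(A, B) \<in> ?H" using handles_cmt[OF l _ m] by blast
  have gen: "GenA j \<in> surface_gens g p" "GenB j \<in> surface_gens g p" using j by (auto simp: surface_gens_def)
  have sub: "\<Psi> ` ?H \<subseteq> lifted_reps g p s n"
  proof
    fix h' assume "h' \<in> \<Psi> ` ?H"
    then obtain A B where AB: "A \<in> Gt" "B \<in> Gt" "cmt A B = cmt (h (GenA j)) (h (GenB j))" "h' = h(GenA j := A, GenB j := B)"
      unfolding handles_def \<Psi>_def by auto
    have "hprod is h' = hprod is h" "cprod is h' = cprod is h" for "is"
      unfolding hprod_def cprod_def by (rule gprod_cong; use AB in auto)+
    then show "h' \<in> lifted_reps g p s n" using h AB gen unfolding lifted_reps_def by auto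
  qed
  show "h(GenA j := A, GenB j := B) \<in> lifted_reps g p s n" using sub m' unfolding \<Psi>_def by auto
  have c: "continuous_on ?H \<Psi>" unfolding \<Psi>_def case_prod_unfold
  proof (rule continuous_on_coordinatewise_then_product)
    fix x show "continuous_on ?H (\<lambda>q. (h(GenA j := fst q, GenB j := snd q)) x)"
      by (cases "x = GenA j"; cases "x = GenB j") (simp_all add: continuous_on_fst continuous_on_snd continuous_on_id)
  qed
  have "lnk zeq (lifted_reps g p s n) (\<Psi> (h (GenA j), h (GenB j))) (\<Psi> (A, B))"
    by (rule lnk_image[OF c sub _ l m m']) simp
  then show "lnk zeq (lifted_reps g p s n) h (h(GenA j := A, GenB j := B))" by (simp add: \<Psi>_def)
qed

lemma lnk_all_hyp:
  assumes h: "h \<in> lifted_reps g p s n"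
  shows "\<exists>h'\<in>lifted_reps g p s n. lnk zeq (lifted_reps g p s n) h h' \<and> (\<forall>j\<in>{1..g}. \<exists>k. h' (GenB j) \<in> J k k)"
proof -
  have "\<exists>h'\<in>lifted_reps g p s n. lnk zeq (lifted_reps g p s n) h h' \<and> (\<forall>j\<in>{1..m}. \<exists>k. h' (GenB j) \<in> J k k)" if "m \<le> g" for m
    using that
  proof (induct m)
    case 0 then show ?case by (intro bexI[OF _ h]) auto
  next
    case (Suc m)
    then obtain h1 where h1: "h1 \<in> lifted_reps g p s n" "lnk zeq (lifted_reps g p s n) h h1" "\<forall>j\<in>{1..m}. \<exists>k. h1 (GenB j) \<in> J k k" by auto
    have G: "h1 x \<in> Gt" for x using h1 by (simp add: lifted_reps_def)
    obtain A B k where AB: "lnk (=) (handles (cmt (h1 (GenA (Suc m))) (h1 (GenB (Suc m))))) (h1 (GenA (Suc m)), h1 (GenB (Suc m))) (A, B)" "B \<in> J k k"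
      using handle_hyp[OF G G] by blast
    have j: "Suc m \<in> {1..g}" using Suc by simp
    show ?case
    proof (intro bexI conjI)
      show "h1(GenA (Suc m) := A, GenB (Suc m) := B) \<in> lifted_reps g p s n" by (rule lnk_handle(1)[OF h1(1) j AB(1)])
      show "lnk zeq (lifted_reps g p s n) h (h1(GenA (Suc m) := A, GenB (Suc m) := B))"
        using lnk_trans[OF h1(2) lnk_handle(2)[OF h1(1) j AB(1)]] .
      show "\<forall>j\<in>{1..Suc m}. \<exists>k. (h1(GenA (Suc m) := A, GenB (Suc m) := B)) (GenB j) \<in> J k k"
        using AB(2) h1(3) by (auto simp: le_Suc_eq)
    qed
  qed
  then show ?thesis by blast
qed

subsection \<open>Positive genus\<close>

text \<open>The names of the generators also index blocks: \<open>GenA j\<close> and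
  \<open>GenB j\<close> stand for the two hyperbolic factors of a commutator. Absent are
  \<open>GenB g\<close>, whose strength is solved for, and \<open>GenC 1\<close>, which the relation
  determines.\<close>

definition hlist :: "nat \<Rightarrow> nat \<Rightarrow> surface_gen list" where
  "hlist g p = map GenC [2..<Suc p] @ concat (map (\<lambda>j. [GenA j, GenB j]) [1..<g]) @ [GenA g]"

fun hkind :: "(nat \<Rightarrow> int) \<Rightarrow> surface_gen \<Rightarrow> int" where
  "hkind s (GenC i) = s i" | "hkind s (GenA j) = 0" | "hkind s (GenB j) = 0"

fun hlam :: "(nat \<Rightarrow> real) \<Rightarrow> surface_gen \<Rightarrow> real" where
  "hlam \<mu> (GenC i) = 0" | "hlam \<mu> (GenA j) = \<mu> j" | "hlam \<mu> (GenB j) = - \<mu> j"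

lemma set_hlist: "set (hlist g p) = GenC ` {2..p} \<union> GenA ` {1..<g} \<union> GenB ` {1..<g} \<union> {GenA g}"
  unfolding hlist_def by auto

lemma distinct_handles: "distinct is \<Longrightarrow> distinct (concat (map (\<lambda>j. [GenA j, GenB j]) is))"
  by (induct "is") auto

lemma distinct_hlist: "distinct (hlist g p)"
  unfolding hlist_def by (auto simp: distinct_map inj_on_def distinct_handles simp del: upt_Suc)

lemma gprod_handles: "gprod (concat (map (\<lambda>j. [GenA j, GenB j]) is)) X = gprod is (\<lambda>j. X (GenA j) \<circ> X (GenB j))"
  by (induct "is") (simp_all add: o_assoc)

lemma gprod_map: "gprod (map f is) X = gprod is (\<lambda>j. X (f j))"
  by (induct "is") simp_all

lemma gprod_hlist: "gprod (hlist g p) X = gprod [2..<Suc p] (\<lambda>i. X (GenC i)) \<circ> gprod [1..<g] (\<lambda>j. X (GenA j) \<circ> X (GenB j)) \<circ> X (GenA g)"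
  unfolding hlist_def by (simp add: gprod_append gprod_handles gprod_map o_assoc del: upt_Suc)

text \<open>Lengths and twists of the handles, followed by fixed points and strengths of the
  blocks.\<close>

type_synonym handle_params = "((nat \<Rightarrow> real) \<times> (nat \<Rightarrow> real)) \<times> (surface_gen \<Rightarrow> real \<times> real)"

definition par_base :: "((nat \<Rightarrow> real) \<times> (nat \<Rightarrow> real)) set" where
  "par_base = {q. \<forall>j. fst q j > 0}"

definition par1 :: "nat \<Rightarrow> nat \<Rightarrow> (nat \<Rightarrow> int) \<Rightarrow> int \<Rightarrow> handle_params set" where
  "par1 g p s n = {(q, x). q \<in> par_base \<and> x \<in> block_space (hkind s) (hlam (fst q)) (hlist g p) (J (n - 1) n)}"

definition par_u :: "nat \<Rightarrow> nat \<Rightarrow> handle_params \<Rightarrow> real \<Rightarrow> real" where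
  "par_u g p q = gprod (hlist g p) (pblock (hlam (fst (fst q))) (snd q))"

definition par2 where
  "par2 g p s n = {(q, v). q \<in> par1 g p s n \<and> displaced n (par_u g p q) v}"

definition rel1 :: "handle_params \<Rightarrow> handle_params \<Rightarrow> bool" where
  "rel1 q q' \<longleftrightarrow> fst q = fst q' \<and> prel (snd q) (snd q')"

definition rel2 where
  "rel2 e e' \<longleftrightarrow> rel1 (fst e) (fst e') \<and> (\<exists>k::int. snd e' = snd e + of_int k)"

lemma par_u_rel1: assumes "rel1 q q'" shows "par_u g p q = par_u g p q'"
proof -
  have "fst q = fst q'" "prel (snd q) (snd q')" using assms by (simp_all add: rel1_def)
  then show ?thesis using pblock_prel[of "snd q" "snd q'"] by (simp add: par_u_def)
qed

lemma par_u_Gt [simp]: "par_u g p q \<in> Gt" by (simp add: par_u_def)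

lemma continuous_on_hlam [continuous_intros]:
  fixes f :: "'a::topological_space \<Rightarrow> nat \<Rightarrow> real"
  assumes "continuous_on S f" shows "continuous_on S (\<lambda>q. hlam (f q))"
proof (rule continuous_on_coordinatewise_then_product)
  fix x show "continuous_on S (\<lambda>q. hlam (f q) x)"
    by (cases x) (auto intro!: continuous_intros continuous_on_product_then_coordinatewise[OF assms])
qed

lemma continuous_on_par_u: "continuous_on S (par_u g p)"
proof -
  have "continuous_on S (\<lambda>q. gprod (hlist g p) (pblock (hlam (fst (fst q))) (snd q)))"
    by (intro continuous_intros)
  then show ?thesis by (simp add: par_u_def[abs_def])
qed

lemma sconn_par_base: "sconn (=) par_base"
  unfolding sconn_def
proof (intro ballI)
  fix a b assume ab: "a \<in> par_base" "b \<in> par_base"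
  define \<gamma> where "\<gamma> t = ((\<lambda>j. (1 - t) * fst a j + t * fst b j), (\<lambda>j. (1 - t) * snd a j + t * snd b j))" for t :: real
  show "lnk (=) par_base a b"
  proof (rule lnk_connected)
    show "connected (\<gamma> ` {0..1})"
    proof (rule connected_continuous_image)
      show "continuous_on {0..1} \<gamma>" unfolding \<gamma>_def
        by (intro continuous_on_Pair continuous_on_coordinatewise_then_product continuous_intros)
    qed simp
    have "(1 - t) * u + t * w > 0" if "0 \<le> t" "t \<le> 1" "u > 0" "w > 0" for t u w :: real
      using that by (cases "t = 0") (auto intro: add_nonneg_pos)
    then show "\<gamma> ` {0..1} \<subseteq> par_base" using ab by (auto simp: par_base_def \<gamma>_def)
    show "a \<in> \<gamma> ` {0..1}" by (rule image_eqI[of _ _ 0]) (auto simp: \<gamma>_def)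
    show "b \<in> \<gamma> ` {0..1}" by (rule image_eqI[of _ _ 1]) (auto simp: \<gamma>_def)
  qed
qed

lemma sum_list_handles: "(\<Sum>x\<leftarrow>concat (map (\<lambda>j. [GenA j, GenB j]) is). f x) = (\<Sum>j\<leftarrow>is. f (GenA j) + (f (GenB j) :: int))"
  by (induct "is") simp_all

definition pos :: "nat \<Rightarrow> (nat \<Rightarrow> int) \<Rightarrow> int" where "pos p s = (\<Sum>i\<leftarrow>[1..<Suc p]. if s i = 1 then 1 else 0)"
definition neg :: "nat \<Rightarrow> (nat \<Rightarrow> int) \<Rightarrow> int" where "neg p s = (\<Sum>i\<leftarrow>[1..<Suc p]. if s i = -1 then 1 else 0)"

lemma sum_list_cong': "(\<And>x. x \<in> set xs \<Longrightarrow> f x = g x) \<Longrightarrow> (\<Sum>x\<leftarrow>xs. f x) = (\<Sum>x\<leftarrow>xs. g x)"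
  by (metis map_cong)

text \<open>There are \<open>2 * g - 1\<close> hyperbolic blocks in the list. The omitted first
  puncture is positive, so it reduces the number of ups but not that of downs.\<close>

lemma ups_hlist:
  assumes "g \<ge> 1" "p \<ge> 1" "\<And>i. i \<in> {1..p} \<Longrightarrow> s i \<in> {1, -1}" "s 1 = 1"
  shows "ups (hkind s) (hlist g p) = pos p s + 2 * int g - 2" "downs (hkind s) (hlist g p) = neg p s + 2 * int g - 1"
proof -
  have l: "[1..<Suc p] = 1 # [2..<Suc p]" using assms(2) by (simp add: upt_conv_Cons numeral_2_eq_2)
  have "(\<Sum>i\<leftarrow>[2..<Suc p]. if s i = -1 then 0 else 1) = (\<Sum>i\<leftarrow>[2..<Suc p]. if s i = 1 then 1 else (0::int))"
    "(\<Sum>i\<leftarrow>[2..<Suc p]. if s i = 1 then 0 else 1) = (\<Sum>i\<leftarrow>[2..<Suc p]. if s i = -1 then 1 else (0::int))"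
  proof -
    show "(\<Sum>i\<leftarrow>[2..<Suc p]. if s i = -1 then 0 else 1) = (\<Sum>i\<leftarrow>[2..<Suc p]. if s i = 1 then 1 else (0::int))"
      (is "(\<Sum>i\<leftarrow>_. ?f i) = (\<Sum>i\<leftarrow>_. ?g i)")
    proof (rule sum_list_cong')
      fix i assume "i \<in> set [2..<Suc p]"
      then have "i \<in> {1..p}" by auto
      from assms(3)[OF this] show "?f i = ?g i" by auto
    qed
    show "(\<Sum>i\<leftarrow>[2..<Suc p]. if s i = 1 then 0 else 1) = (\<Sum>i\<leftarrow>[2..<Suc p]. if s i = -1 then 1 else (0::int))"
      (is "(\<Sum>i\<leftarrow>_. ?f i) = (\<Sum>i\<leftarrow>_. ?g i)")
    proof (rule sum_list_cong')
      fix i assume "i \<in> set [2..<Suc p]"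
      then have "i \<in> {1..p}" by auto
      from assms(3)[OF this] show "?f i = ?g i" by auto
    qed
  qed
  then show "ups (hkind s) (hlist g p) = pos p s + 2 * int g - 2" "downs (hkind s) (hlist g p) = neg p s + 2 * int g - 1"
    unfolding ups_def downs_def hlist_def pos_def neg_def l using assms(1,4)
    by (simp_all add: sum_list_handles o_def sum_list_triv of_nat_diff del: upt_Suc)
qed

lemma displaced_ex: assumes "u \<in> J (m - 1) m" shows "\<exists>v. displaced m u v"
proof -
  obtain x y where xy: "u x > x + (of_int m - 1)" "u y < y + of_int m" and u: "u \<in> Gt" using assms unfolding J_def by auto
  show ?thesis
  proof (cases "u x < x + of_int m")
    case True then show ?thesis using xy by (auto simp: displaced_def)
  next
    case False
    then have "u y > y + (of_int m - 1)" using Gt_osc[OF u, of x y] by linarith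
    then show ?thesis using xy by (auto simp: displaced_def)
  qed
qed

lemma displaced_arc: "u \<in> Gt \<Longrightarrow> arcset {v. displaced m u v}"
  unfolding displaced_def by (rule arcset_between) auto

lemma open_displaced: assumes "continuous_on S u" "\<And>q. q \<in> S \<Longrightarrow> u q \<in> Gt"
  shows "openin (top_of_set S) {q \<in> S. displaced m (u q) v}"
proof -
  have c: "continuous_on S (\<lambda>q. u q v)" by (rule continuous_on_product_then_coordinatewise[OF assms(1)])
  have "{q \<in> S. displaced m (u q) v} = S \<inter> (\<lambda>q. u q v) -` {v + (of_int m - 1)<..<v + of_int m}"
    by (auto simp: displaced_def)
  then show ?thesis using continuous_openin_preimage_gen[OF c, of "{v + (of_int m - 1)<..<v + of_int m}"] by simp
qed

lemma lifted_block: "h \<in> lifted_reps g p s n \<Longrightarrow> i \<in> {1..p} \<Longrightarrow> h (GenC i) \<in> block (s i) 0"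
  unfolding lifted_reps_def by blast

lemma surface_gens_iff:
  "GenA j \<in> surface_gens g p \<longleftrightarrow> j \<in> {1..g}" "GenB j \<in> surface_gens g p \<longleftrightarrow> j \<in> {1..g}" "GenC j \<in> surface_gens g p \<longleftrightarrow> j \<in> {1..p}"
  by (auto simp: surface_gens_def)

section \<open>Parametrization for a positive first puncture\<close>

context
  fixes g p :: nat and s :: "nat \<Rightarrow> int" and n :: int
  assumes g1: "g \<ge> 1" and p1: "p \<ge> 1" and s: "\<And>i. i \<in> {1..p} \<Longrightarrow> s i \<in> {1, -1}" and s1: "s 1 = 1"
begin

lemma par_block_space:
  "sconn prel (block_space (hkind s) (hlam \<mu>) (hlist g p) (J (n - 1) n)) \<and>
   (block_space (hkind s) (hlam \<mu>) (hlist g p) (J (n - 1) n) \<noteq> {} \<longleftrightarrow>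
     2 - 2 * int g - neg p s \<le> n \<and> n \<le> pos p s + 2 * int g - 2)"
proof -
  have "sconn prel (block_space (hkind s) (hlam \<mu>) (hlist g p) (J (n - 1) n)) \<and>
   (block_space (hkind s) (hlam \<mu>) (hlist g p) (J (n - 1) n) \<noteq> {} \<longleftrightarrow> n - 1 < ups (hkind s) (hlist g p) \<and> 0 < n + downs (hkind s) (hlist g p))"
  proof (rule block_space_J)
    show "hkind s j \<in> {-1, 0, 1}" if "j \<in> set (hlist g p)" for j
    proof (cases j)
      case (GenC i)
      then have "i \<in> {1..p}" using that by (auto simp: set_hlist)
      then show ?thesis using s[of i] GenC by auto
    qed auto
    show "hlam \<mu> j = 0" if "hkind s j \<noteq> 0" for j using that by (cases j) auto
  qed (simp_all add: distinct_hlist)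
  then show ?thesis using ups_hlist[where g=g and p=p and s=s, OF g1 p1 s s1] by auto
qed

text \<open>Fibration over the convex set of lengths and twists. Whether a fibre is empty depends on
  the signs and \<open>n\<close> only, so either all fibres are empty or none is.\<close>

lemma sconn_par1: "sconn rel1 (par1 g p s n)"
proof (cases "2 - 2 * int g - neg p s \<le> n \<and> n \<le> pos p s + 2 * int g - 2")
  case False
  then have "par1 g p s n = {}" using par_block_space unfolding par1_def by blast
  then show ?thesis by simp
next
  case True
  show ?thesis
  proof (rule sconn_fibration[OF sconn_par_base])
    show "y \<in> par_base" if "(y, z) \<in> par1 g p s n" for y z using that by (simp add: par1_def)
    show "\<exists>z. (y, z) \<in> par1 g p s n" if "y \<in> par_base" for y
      using par_block_space[of "fst y"] True that by (auto simp: par1_def)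
    show "sconn (\<lambda>z z'. rel1 (y, z) (y, z')) {z. (y, z) \<in> par1 g p s n}" if "y \<in> par_base" for y
      using par_block_space[of "fst y"] that by (simp add: par1_def rel1_def)
    show "openin (top_of_set (par_base)) {y \<in> par_base. (y, z) \<in> par1 g p s n}" for z
    proof (cases "(\<forall>j\<in>set (hlist g p). snd (z j) \<in> strengths (hkind s j)) \<and> (\<forall>j. j \<notin> set (hlist g p) \<longrightarrow> z j = (0, 0))")
      case True
      have "continuous_on (par_base) (\<lambda>y. gprod (hlist g p) (pblock (hlam (fst y)) z))"
        by (intro continuous_intros)
      then have "openin (top_of_set (par_base)) {y \<in> par_base. gprod (hlist g p) (pblock (hlam (fst y)) z) \<in> J (n - 1) n}"
        by (rule openin_region[OF open_region_J]) simp
      moreover have "{y \<in> par_base. (y, z) \<in> par1 g p s n} = {y \<in> par_base. gprod (hlist g p) (pblock (hlam (fst y)) z) \<in> J (n - 1) n}"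
        using True by (auto simp: par1_def block_space_def)
      ultimately show ?thesis by simp
    next
      case False
      then have e: "{y \<in> par_base. (y, z) \<in> par1 g p s n} = {}" by (auto simp: par1_def block_space_def)
      show ?thesis unfolding e by simp
    qed
    show "(y', z) \<in> par1 g p s n \<and> rel1 (y, z) (y', z)" if "(y, z) \<in> par1 g p s n" "y = y'" for y y' z
      using that by (simp add: rel1_def)
  qed
qed

text \<open>The added coordinate is the fixed point of the block \<open>GenB g\<close>, which ranges
  over an arc.\<close>

lemma sconn_par2: "sconn rel2 (par2 g p s n)"
proof (rule sconn_fibration[OF sconn_par1])
  show "y \<in> par1 g p s n" if "(y, z) \<in> par2 g p s n" for y z using that by (simp add: par2_def)
  show "\<exists>z. (y, z) \<in> par2 g p s n" if "y \<in> par1 g p s n" for y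
  proof -
    have "par_u g p y \<in> J (n - 1) n" using that by (auto simp: par1_def block_space_def par_u_def)
    then show ?thesis using displaced_ex that by (auto simp: par2_def)
  qed
  show "sconn (\<lambda>z z'. rel2 (y, z) (y, z')) {z. (y, z) \<in> par2 g p s n}" if "y \<in> par1 g p s n" for y
    using sconn_arcset[OF displaced_arc[OF par_u_Gt[of g p y], of n]] that
    by (simp add: par2_def rel2_def rel1_def)
  show "openin (top_of_set (par1 g p s n)) {y \<in> par1 g p s n. (y, z) \<in> par2 g p s n}" for z
    using open_displaced[OF continuous_on_par_u, of "par1 g p s n" g p n z] by (simp add: par2_def)
  show "(y', z) \<in> par2 g p s n \<and> rel2 (y, z) (y', z)"
    if "(y, z) \<in> par2 g p s n" "y' \<in> par1 g p s n" "rel1 y y'" for y y' z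
  proof -
    have "par_u g p y = par_u g p y'" using par_u_rel1[OF that(3)] .
    then show ?thesis using that by (auto simp: par2_def rel2_def intro: exI[of _ 0])
  qed
qed

text \<open>With D(l) = Uz l 0, every handle is written as A = K D(r) K'^-1 and B = K' D(l) K'^-1, so that [A, B] is the product
  of the two hyperbolic blocks with frames K and K'; the strength of the last block and the first
  parabolic element are solved for.\<close>

definition par_x :: "handle_params \<times> real \<Rightarrow> surface_gen \<Rightarrow> real \<times> real" where
  "par_x e = (snd (fst e))(GenB g := (snd e, tau n (- fst (fst (fst e)) g) (par_u g p (fst e)) (snd e)))"

definition par_w where
  "par_w e = par_u g p (fst e) \<circ> U (snd e) (- fst (fst (fst e)) g) (tau n (- fst (fst (fst e)) g) (par_u g p (fst e)) (snd e))"

definition frA where "frA e j = frame (fst (par_x e (GenA j))) (fst (fst (fst e)) j) (snd (par_x e (GenA j)))"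
definition frB where "frB e j = frame (fst (par_x e (GenB j))) (- fst (fst (fst e)) j) (snd (par_x e (GenB j)))"

fun par_h :: "handle_params \<times> real \<Rightarrow> surface_gen \<Rightarrow> real \<Rightarrow> real" where
  "par_h e (GenA j) = (if j \<in> {1..g} then frA e j \<circ> Uz (snd (fst (fst e)) j) 0 \<circ> ginv (frB e j) else id)"
| "par_h e (GenB j) = (if j \<in> {1..g} then conjG (frB e j) (Uz (fst (fst (fst e)) j) 0) else id)"
| "par_h e (GenC i) = (if i = 1 then ginv (par_w e) \<circ> T (of_int n) else if i \<in> {2..p} then pblock (hlam (fst (fst (fst e)))) (par_x e) (GenC i) else id)"

lemma fr_Gt [simp]: "frA e j \<in> Gt" "frB e j \<in> Gt" by (simp_all add: frA_def frB_def)
lemma par_w_Gt [simp]: "par_w e \<in> Gt" by (simp add: par_w_def)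
lemma par_h_Gt [simp]: "par_h e x \<in> Gt" by (cases x) auto

lemma par_nz: "e \<in> par2 g p s n \<Longrightarrow> fst (fst (fst e)) j \<noteq> 0"
  unfolding par2_def par1_def par_base_def by (cases e) (auto simp: less_imp_neq[symmetric])

lemma par_cmt:
  assumes "e \<in> par2 g p s n" "j \<in> {1..g}"
  shows "cmt (par_h e (GenA j)) (par_h e (GenB j)) =
    pblock (hlam (fst (fst (fst e)))) (par_x e) (GenA j) \<circ> pblock (hlam (fst (fst (fst e)))) (par_x e) (GenB j)"
proof -
  let ?l = "fst (fst (fst e)) j"
  have nz: "?l \<noteq> 0" using par_nz assms by blast
  have "cmt (par_h e (GenA j)) (par_h e (GenB j)) = conjG (frA e j) (Uz ?l 0) \<circ> conjG (frB e j) (Uz (- ?l) 0)"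
    using assms(2) cmt_frames[of "frA e j" "frB e j" "snd (fst (fst e)) j" ?l] by simp
  also have "conjG (frA e j) (Uz ?l 0) = pblock (hlam (fst (fst (fst e)))) (par_x e) (GenA j)"
    unfolding frA_def frame_conj[OF nz] by (simp add: pblock_def)
  also have "conjG (frB e j) (Uz (- ?l) 0) = pblock (hlam (fst (fst (fst e)))) (par_x e) (GenB j)"
    using nz unfolding frB_def by (subst frame_conj) (simp_all add: pblock_def)
  finally show ?thesis .
qed

lemma par_relation:
  assumes "e \<in> par2 g p s n"
  shows "cprod [2..<Suc p] (par_h e) \<circ> hprod [1..<g] (par_h e) \<circ> cmt (par_h e (GenA g)) (par_h e (GenB g)) = par_w e"
proof -
  let ?X = "pblock (hlam (fst (fst (fst e)))) (par_x e)" and ?Y = "pblock (hlam (fst (fst (fst e)))) (snd (fst e))"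
  have eq: "?X y = ?Y y" if "y \<noteq> GenB g" for y using that by (simp add: pblock_def par_x_def)
  have 1: "cprod [2..<Suc p] (par_h e) = gprod [2..<Suc p] (\<lambda>i. ?Y (GenC i))"
    unfolding cprod_def by (rule gprod_cong) (auto simp: eq)
  have 2: "hprod [1..<g] (par_h e) = gprod [1..<g] (\<lambda>j. ?Y (GenA j) \<circ> ?Y (GenB j))"
    unfolding hprod_def
  proof (rule gprod_cong)
    fix j assume "j \<in> set [1..<g]"
    then have j: "j \<in> {1..g}" "j \<noteq> g" by auto
    show "cmt (par_h e (GenA j)) (par_h e (GenB j)) = ?Y (GenA j) \<circ> ?Y (GenB j)"
      unfolding par_cmt[OF assms j(1)] using eq j(2) by simp
  qed
  have 3: "cmt (par_h e (GenA g)) (par_h e (GenB g)) = ?Y (GenA g) \<circ> ?X (GenB g)"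
    using par_cmt[OF assms, of g] eq g1 by simp
  have 4: "?X (GenB g) = U (snd e) (- fst (fst (fst e)) g) (tau n (- fst (fst (fst e)) g) (par_u g p (fst e)) (snd e))"
    by (simp add: pblock_def par_x_def)
  show ?thesis unfolding 1 2 3 4 par_w_def par_u_def gprod_hlist by (simp only: o_assoc)
qed

lemma par_touches: assumes "e \<in> par2 g p s n" shows "touches n (par_w e)"
proof -
  have d: "displaced n (par_u g p (fst e)) (snd e)" using assms by (auto simp: par2_def)
  show ?thesis unfolding par_w_def
    using solves_touches[OF par_u_Gt d] solves_tau[OF par_u_Gt d] by blast
qed

lemma par_h_lifted:
  assumes "e \<in> par2 g p s n" shows "par_h e \<in> lifted_reps g p s n"
  unfolding lifted_reps_def
proof (intro CollectI conjI ballI allI impI)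
  show "par_h e x = id" if "x \<notin> surface_gens g p" for x
    using that p1 by (cases x) (auto simp: surface_gens_def)
  show "par_h e (GenC i) \<in> block (s i) 0" if i: "i \<in> {1..p}" for i
  proof (cases "i = 1")
    case True
    then show ?thesis using touches_block[OF par_w_Gt, of n e] par_touches[OF assms] s1 by simp
  next
    case False
    then have i2: "i \<in> {2..p}" using i by auto
    then have m: "GenC i \<in> set (hlist g p)" by (simp add: set_hlist)
    have "snd (snd (fst e) (GenC i)) \<in> strengths (hkind s (GenC i))"
      using assms m unfolding par2_def par1_def block_space_def by auto
    then show ?thesis using i2 False by (auto simp: block_def pblock_def par_x_def)
  qed
  show "hprod [1..<Suc g] (par_h e) \<circ> cprod [1..<Suc p] (par_h e) = T (of_int n)"
    unfolding relation_rotate[OF g1 p1 par_h_Gt] par_relation[OF assms] by simp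
qed simp

lemma continuous_on_par_x: "continuous_on (par2 g p s n) (\<lambda>e. par_x e y)"
proof -
  have cu: "continuous_on (par2 g p s n) (\<lambda>e. par_u g p (fst e))"
    by (rule continuous_on_compose2[OF continuous_on_par_u[of UNIV]]) (auto intro: continuous_intros)
  have cl: "continuous_on (par2 g p s n) (\<lambda>e. fst (fst (fst e)) j)" for j
    by (rule continuous_on_product_then_coordinatewise) (intro continuous_intros)
  have ct: "continuous_on (par2 g p s n) (\<lambda>e. tau n (- fst (fst (fst e)) g) (par_u g p (fst e)) (snd e))"
    by (rule continuous_on_tau[OF cu continuous_on_minus[OF cl] continuous_on_snd[OF continuous_on_id]]) (auto simp: par2_def)
  have cx: "continuous_on (par2 g p s n) (\<lambda>e. snd (fst e) y)"
    by (rule continuous_on_product_then_coordinatewise) (intro continuous_intros)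
  show ?thesis
  proof (cases "y = GenB g")
    case True then show ?thesis unfolding par_x_def by (simp, intro continuous_intros ct)
  next
    case False then show ?thesis unfolding par_x_def using cx by simp
  qed
qed

lemma continuous_on_par_h:
  "continuous_on (par2 g p s n) par_h"
proof (rule continuous_on_coordinatewise_then_product)
  fix y
  let ?S = "par2 g p s n"
  have cl: "continuous_on ?S (\<lambda>e. fst (fst (fst e)) j)" for j
    by (rule continuous_on_product_then_coordinatewise) (intro continuous_intros)
  have cr: "continuous_on ?S (\<lambda>e. snd (fst (fst e)) j)" for j
    by (rule continuous_on_product_then_coordinatewise) (intro continuous_intros)
  note cx = continuous_on_par_x
  have cfA: "continuous_on ?S (\<lambda>e. frA e j)" for j unfolding frA_def
    by (rule continuous_on_frame[OF continuous_on_fst[OF cx] cl continuous_on_snd[OF cx]]) (use par_nz in blast)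
  have cfB: "continuous_on ?S (\<lambda>e. frB e j)" for j unfolding frB_def
    by (rule continuous_on_frame[OF continuous_on_fst[OF cx] continuous_on_minus[OF cl] continuous_on_snd[OF cx]]) (use par_nz in auto)
  have cU: "continuous_on ?S (\<lambda>e. Uz (snd (fst (fst e)) j) 0)" "continuous_on ?S (\<lambda>e. Uz (fst (fst (fst e)) j) 0)" for j
    unfolding U_zero[symmetric] by (intro continuous_on_U continuous_on_const cr cl)+
  have cw: "continuous_on ?S par_w"
  proof -
    have cu: "continuous_on ?S (\<lambda>e. par_u g p (fst e))"
      by (rule continuous_on_compose2[OF continuous_on_par_u[of UNIV]]) (auto intro: continuous_intros)
    have ct: "continuous_on ?S (\<lambda>e. tau n (- fst (fst (fst e)) g) (par_u g p (fst e)) (snd e))"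
      using continuous_on_snd[OF cx[of "GenB g"]] by (simp add: par_x_def)
    show ?thesis unfolding par_w_def
      by (rule continuous_on_Gt_comp[OF cu par_u_Gt]) (intro continuous_on_U ct continuous_on_minus cl continuous_on_snd continuous_on_id)
  qed
  show "continuous_on ?S (\<lambda>e. par_h e y)"
  proof (cases y)
    case (GenA j)
    have "continuous_on ?S (\<lambda>e. frA e j \<circ> Uz (snd (fst (fst e)) j) 0 \<circ> ginv (frB e j))"
      by (rule continuous_on_Gt_comp[OF continuous_on_Gt_comp[OF cfA _ cU(1)] _ continuous_on_ginv[OF cfB]]) auto
    then show ?thesis unfolding GenA
      by (cases "j \<in> {1..g}") (simp_all only: par_h.simps if_True if_False continuous_on_const)
  next
    case (GenB j)
    have "continuous_on ?S (\<lambda>e. conjG (frB e j) (Uz (fst (fst (fst e)) j) 0))"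
      by (rule continuous_on_conjG[OF cfB _ cU(2)]) auto
    then show ?thesis unfolding GenB
      by (cases "j \<in> {1..g}") (simp_all only: par_h.simps if_True if_False continuous_on_const)
  next
    case (GenC i)
    have 1: "continuous_on ?S (\<lambda>e. ginv (par_w e) \<circ> T (of_int n))"
      by (rule continuous_on_Gt_comp[OF continuous_on_ginv[OF cw]]) auto
    have 2: "continuous_on ?S (\<lambda>e. pblock (hlam (fst (fst (fst e)))) (par_x e) (GenC i))"
      unfolding pblock_def by (intro continuous_on_U continuous_on_fst[OF cx] continuous_on_snd[OF cx]) simp
    show ?thesis unfolding GenC using 1 2
      by (cases "i = 1"; cases "i \<in> {2..p}") (simp_all only: par_h.simps if_True if_False continuous_on_const simp_thms)
  qed
qed

text \<open>An integer shift of a fixed point multiplies a frame by a translation. This changes the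
  lifts of the first handle generators by central elements and leaves all other generators
  alone.\<close>

lemma par_h_rel: assumes "rel2 e e'" shows "zeq (par_h e) (par_h e')"
proof -
  obtain q v q' v' where e: "e = (q, v)" "e' = (q', v')" by (cases e, cases e')
  have q: "fst q = fst q'" "prel (snd q) (snd q')" and "\<exists>k::int. v' = v + of_int k"
    using assms by (auto simp: e rel2_def rel1_def)
  then obtain k :: int where k: "v' = v + of_int k" by blast
  have u: "par_u g p q = par_u g p q'" using par_u_rel1[of q q'] q by (simp add: rel1_def)
  have t: "tau n l (par_u g p q') (v + of_int k) = tau n l (par_u g p q') v" for l
    by (rule tau_period) simp
  have w: "par_w e = par_w e'" unfolding par_w_def e by (simp add: u q(1) t k U_period)
  have x: "vrel (par_x e y) (par_x e' y)" for y
  proof (cases "y = GenB g")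
    case True
    then have "par_x e y = (v, tau n (- fst (fst q) g) (par_u g p q) v)" "par_x e' y = (v', tau n (- fst (fst q) g) (par_u g p q) v)"
      by (simp_all add: par_x_def e u k t q(1))
    then show ?thesis unfolding vrel_def k by auto
  next
    case False
    then show ?thesis using q(2) by (simp add: par_x_def e prel_def)
  qed
  have fr: "\<exists>i::int. frA e' j = T (of_int i) \<circ> frA e j" "\<exists>i::int. frB e' j = T (of_int i) \<circ> frB e j" for j
  proof -
    obtain i :: int where i: "fst (par_x e' (GenA j)) = fst (par_x e (GenA j)) + of_int i" "snd (par_x e' (GenA j)) = snd (par_x e (GenA j))"
      using x[of "GenA j"] unfolding vrel_def by blast
    show "\<exists>i::int. frA e' j = T (of_int i) \<circ> frA e j"
      by (rule exI[of _ i]) (use q(1) in \<open>simp add: frA_def i[unfolded e] frame_period e\<close>)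
    obtain i :: int where i: "fst (par_x e' (GenB j)) = fst (par_x e (GenB j)) + of_int i" "snd (par_x e' (GenB j)) = snd (par_x e (GenB j))"
      using x[of "GenB j"] unfolding vrel_def by blast
    show "\<exists>i::int. frB e' j = T (of_int i) \<circ> frB e j"
      by (rule exI[of _ i]) (use q(1) in \<open>simp add: frB_def i[unfolded e] frame_period e\<close>)
  qed
  show ?thesis unfolding zeq_def
  proof
    fix y
    show "\<exists>k::int. par_h e' y = T (of_int k) \<circ> par_h e y"
    proof (cases y)
      case (GenA j)
      obtain a b :: int where ab: "frA e' j = T (of_int a) \<circ> frA e j" "frB e' j = T (of_int b) \<circ> frB e j" using fr by blast
      define r where "r = snd (fst q) j"
      have "frA e' j \<circ> Uz r 0 \<circ> ginv (frB e' j) = T (of_int a) \<circ> (frA e j \<circ> Uz r 0 \<circ> ginv (frB e j)) \<circ> T (of_int (- b))"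
        unfolding ab by (simp add: inv_comp_Gt o_assoc)
      also have "\<dots> = T (of_int a) \<circ> (T (of_int (- b)) \<circ> (frA e j \<circ> Uz r 0 \<circ> ginv (frB e j)))"
        unfolding o_assoc[symmetric, of "T (of_int a)"] by (subst T_int_comm) auto
      also have "\<dots> = T (of_int (a - b)) \<circ> (frA e j \<circ> Uz r 0 \<circ> ginv (frB e j))" by (simp add: o_assoc)
      finally show ?thesis unfolding GenA e[symmetric] using q(1)
        by (cases "j \<in> {1..g}") (auto simp: e r_def intro: exI[of _ "a - b"] exI[of _ "0::int"])
    next
      case (GenB j)
      obtain b :: int where b: "frB e' j = T (of_int b) \<circ> frB e j" using fr by blast
      define l where "l = fst (fst q) j"
      have "conjG (frB e' j) (Uz l 0) = conjG (T (of_int b)) (conjG (frB e j) (Uz l 0))"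
        unfolding b by (simp add: conjG_conjG)
      also have "\<dots> = conjG (frB e j) (Uz l 0)" by (rule conjG_T_left) simp
      finally show ?thesis unfolding GenB using q(1) by (auto simp: e l_def intro: exI[of _ "0::int"])
    next
      case (GenC i)
      have "pblock l (par_x e) = pblock l (par_x e')" for l using x pblock_prel unfolding prel_def by blast
      then have "par_h e' y = par_h e y" unfolding GenC using w q(1) by (simp add: e)
      then show ?thesis by (auto intro: exI[of _ "0::int"])
    qed
  qed
qed

lemma par_lnk: assumes "e \<in> par2 g p s n" "e' \<in> par2 g p s n"
  shows "lnk zeq (lifted_reps g p s n) (par_h e) (par_h e')"
proof (rule lnk_image[OF continuous_on_par_h])
  show "par_h ` par2 g p s n \<subseteq> lifted_reps g p s n" using par_h_lifted by blast
  show "lnk rel2 (par2 g p s n) e e'" using sconn_par2 assms unfolding sconn_def by blast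
qed (use assms par_h_rel in auto)

text \<open>Reads the parameters off a representation. The frame of the second block of a handle is
  \<open>K j\<close>, and \<open>d\<close> says that the fixed point of the last block is not a
  touching point, which is the condition for recovering its strength as \<open>tau\<close>.\<close>

lemma par_cover:
  assumes h: "h \<in> lifted_reps g p s n"
    and B: "\<And>j. j \<in> {1..g} \<Longrightarrow> K j \<in> Gt \<and> l j > 0 \<and> (\<exists>k::int. h (GenB j) = T (of_int k) \<circ> conjG (K j) (Uz (l j) 0))"
    and w: "w = cprod [2..<Suc p] h \<circ> hprod [1..<g] h \<circ> cmt (h (GenA g)) (h (GenB g))"
    and d: "w (K g 0) \<noteq> K g 0 + of_int n"
  shows "\<exists>e\<in>par2 g p s n. zeq (par_h e) h"
proof -
  have hG: "h x \<in> Gt" for x using h by (simp add: lifted_reps_def)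
  have hid: "x \<notin> surface_gens g p \<Longrightarrow> h x = id" for x using h by (simp add: lifted_reps_def)
  have lnz: "l j \<noteq> 0" if "j \<in> {1..g}" for j using B[OF that] by auto
  have "\<exists>\<rho> t. conjG (K j) (Uz (- l j) 0) = U (K j 0) (- l j) t \<and> K j = frame (K j 0) (- l j) t \<circ> Uz \<rho> 0" if "j \<in> {1..g}" for j
    using frame_unique[of "K j" "- l j"] B[OF that] lnz[OF that] by (metis neg_equal_0_iff_equal)
  then obtain \<rho>B tB where fB: "\<And>j. j \<in> {1..g} \<Longrightarrow> conjG (K j) (Uz (- l j) 0) = U (K j 0) (- l j) (tB j) \<and> K j = frame (K j 0) (- l j) (tB j) \<circ> Uz (\<rho>B j) 0"
    by metis
  \<comment> \<open>\<open>h (GenA j)\<close> carries the frame of \<open>h (GenB j)\<close> to that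
    of its conjugate, the first factor of the commutator.\<close>
  define KA where "KA j = h (GenA j) \<circ> K j" for j
  have KAG: "KA j \<in> Gt" if "j \<in> {1..g}" for j using B[OF that] hG by (simp add: KA_def)
  have "\<exists>\<rho> t. conjG (KA j) (Uz (l j) 0) = U (KA j 0) (l j) t \<and> KA j = frame (KA j 0) (l j) t \<circ> Uz \<rho> 0" if "j \<in> {1..g}" for j
    using frame_unique[of "KA j" "l j"] KAG[OF that] lnz[OF that] by metis
  then obtain \<rho>A tA where fA: "\<And>j. j \<in> {1..g} \<Longrightarrow> conjG (KA j) (Uz (l j) 0) = U (KA j 0) (l j) (tA j) \<and> KA j = frame (KA j 0) (l j) (tA j) \<circ> Uz (\<rho>A j) 0"
    by metis
  have "\<exists>v t. h (GenC i) = U v 0 t \<and> t \<in> strengths (s i)" if "i \<in> {1..p}" for i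
    using h that unfolding lifted_reps_def block_def by blast
  then obtain vC tC where C: "\<And>i. i \<in> {1..p} \<Longrightarrow> h (GenC i) = U (vC i) 0 (tC i) \<and> tC i \<in> strengths (s i)" by metis
  define \<mu> where "\<mu> j = (if j \<in> {1..g} then l j else 1)" for j
  \<comment> \<open>Both frames are standard frames up to a diagonal factor, and the twist is what
    these two factors leave over.\<close>
  define r where "r j = \<rho>A j - \<rho>B j" for j
  define x where "x y = (case y of GenA j \<Rightarrow> if j \<in> {1..g} then (KA j 0, tA j) else (0, 0)
     | GenB j \<Rightarrow> if j \<in> {1..<g} then (K j 0, tB j) else (0, 0) | GenC i \<Rightarrow> if i \<in> {2..p} then (vC i, tC i) else (0, 0))" for y
  define q where "q = ((\<mu>, r), x)"
  define e where "e = (q, K g 0)"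
  have gg: "g \<in> {1..g}" using g1 by simp
  have base: "(\<mu>, r) \<in> par_base" using B by (auto simp: par_base_def \<mu>_def)
  have cm: "cmt (h (GenA j)) (h (GenB j)) = U (KA j 0) (l j) (tA j) \<circ> U (K j 0) (- l j) (tB j)" if j: "j \<in> {1..g}" for j
  proof -
    obtain k :: int where k: "h (GenB j) = T (of_int k) \<circ> conjG (K j) (Uz (l j) 0)" using B[OF j] by blast
    have KG: "K j \<in> Gt" using B[OF j] by blast
    have "h (GenA j) = KA j \<circ> Uz 0 0 \<circ> ginv (K j)" using KG by (simp add: KA_def o_assoc[symmetric])
    then have "cmt (h (GenA j)) (conjG (K j) (Uz (l j) 0)) = conjG (KA j) (Uz (l j) 0) \<circ> conjG (K j) (Uz (- l j) 0)"
      using cmt_frames[OF KAG[OF j] KG, of 0 "l j"] by simp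
    moreover have "cmt (h (GenA j)) (h (GenB j)) = cmt (h (GenA j)) (conjG (K j) (Uz (l j) 0))"
      using cmt_shift[where A="h (GenA j)" and B="conjG (K j) (Uz (l j) 0)" and i=0 and k=k] hG KG unfolding k by simp
    ultimately show ?thesis using fA[OF j] fB[OF j] by simp
  qed
  have pA: "pblock (hlam \<mu>) x (GenA j) = U (KA j 0) (l j) (tA j)" if "j \<in> {1..g}" for j using that by (simp add: pblock_def x_def \<mu>_def)
  have pB: "pblock (hlam \<mu>) x (GenB j) = U (K j 0) (- l j) (tB j)" if "j \<in> {1..<g}" for j using that by (simp add: pblock_def x_def \<mu>_def)
  have pC: "pblock (hlam \<mu>) x (GenC i) = h (GenC i)" if "i \<in> {2..p}" for i using that C[of i] by (simp add: pblock_def x_def)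
  have wu: "w = par_u g p q \<circ> U (K g 0) (- l g) (tB g)"
  proof -
    have 1: "cprod [2..<Suc p] h = gprod [2..<Suc p] (\<lambda>i. pblock (hlam \<mu>) x (GenC i))"
      unfolding cprod_def by (rule gprod_cong) (auto simp: pC)
    have 2: "hprod [1..<g] h = gprod [1..<g] (\<lambda>j. pblock (hlam \<mu>) x (GenA j) \<circ> pblock (hlam \<mu>) x (GenB j))"
      unfolding hprod_def by (rule gprod_cong) (auto simp: cm pA pB)
    show ?thesis unfolding w 1 2 cm[OF gg] par_u_def q_def fst_conv snd_conv gprod_hlist pA[OF gg] by (simp only: o_assoc)
  qed
  have wG: "w \<in> Gt" unfolding wu by simp
  have C1: "h (GenC 1) = ginv w \<circ> T (of_int n)"
    using h relation_rotate[OF g1 p1 hG, where n=n] unfolding w lifted_reps_def by simp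
  have tw: "touches n w"
    using lifted_block[OF h, of 1] p1 touches_block[OF wG, of n] unfolding C1[symmetric] s1 by simp
  have dis: "displaced n (par_u g p q) (K g 0)"
    using displaced_iff_touches[OF par_u_Gt] tw d unfolding wu by blast
  have tau: "tau n (- l g) (par_u g p q) (K g 0) = tB g"
    by (rule tau_eqI[OF par_u_Gt dis]) (use solves_touches[OF par_u_Gt dis] tw in \<open>simp add: wu\<close>)
  have uJ: "par_u g p q \<in> J (n - 1) n" using dis by (auto simp: displaced_def J_def)
  have xb: "x \<in> block_space (hkind s) (hlam \<mu>) (hlist g p) (J (n - 1) n)"
    unfolding block_space_def
  proof (intro CollectI conjI ballI allI impI)
    show "snd (x y) \<in> strengths (hkind s y)" if "y \<in> set (hlist g p)" for y
      by (insert that C, cases y) (auto simp: x_def set_hlist strengths_def)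
    show "x y = (0, 0)" if "y \<notin> set (hlist g p)" for y
      by (insert that g1, cases y) (auto simp: x_def set_hlist)
    show "gprod (hlist g p) (pblock (hlam \<mu>) x) \<in> J (n - 1) n" using uJ by (simp add: par_u_def q_def)
  qed
  have e2: "e \<in> par2 g p s n" using base xb dis by (simp add: e_def q_def par2_def par1_def)
  have pxA: "par_x e (GenA j) = (KA j 0, tA j)" if "j \<in> {1..g}" for j using that by (simp add: par_x_def e_def q_def x_def)
  have pxB: "par_x e (GenB j) = (K j 0, tB j)" if "j \<in> {1..g}" for j
    using that tau by (cases "j = g") (auto simp: par_x_def e_def q_def x_def \<mu>_def gg)
  have pw: "par_w e = w" using tau g1 by (simp add: par_w_def e_def q_def wu \<mu>_def)
  have "zeq (par_h e) h" unfolding zeq_def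
  proof
    fix y
    show "\<exists>k::int. h y = T (of_int k) \<circ> par_h e y"
    proof (cases y)
      case (GenA j)
      show ?thesis
      proof (cases "j \<in> {1..g}")
        case True
        have 1: "frA e j = frame (KA j 0) (l j) (tA j)" "frB e j = frame (K j 0) (- l j) (tB j)"
          using True unfolding frA_def frB_def pxA[OF True] pxB[OF True] by (simp_all add: e_def q_def \<mu>_def)
        have "frA e j \<circ> Uz (\<rho>A j) 0 = h (GenA j) \<circ> (frB e j \<circ> Uz (\<rho>B j) 0)"
          using fA[OF True] fB[OF True] unfolding 1 KA_def by metis
        then have "frA e j \<circ> Uz (\<rho>A j) 0 \<circ> Uz (- \<rho>B j) 0 \<circ> ginv (frB e j) = h (GenA j) \<circ> (frB e j \<circ> (Uz (\<rho>B j) 0 \<circ> Uz (- \<rho>B j) 0) \<circ> ginv (frB e j))"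
          by (simp add: o_assoc)
        also have "\<dots> = h (GenA j)" by (simp add: Uz_comp)
        finally have "h (GenA j) = frA e j \<circ> (Uz (\<rho>A j) 0 \<circ> Uz (- \<rho>B j) 0) \<circ> ginv (frB e j)" by (simp add: o_assoc)
        also have "\<dots> = par_h e (GenA j)" using True by (simp add: Uz_comp e_def q_def r_def)
        finally show ?thesis unfolding GenA by (intro exI[of _ 0]) simp
      next
        case False
        then have "h (GenA j) = id" using hid[of "GenA j"] by (simp add: surface_gens_iff)
        then show ?thesis unfolding GenA using False by (intro exI[of _ 0]) auto
      qed
    next
      case (GenB j)
      show ?thesis
      proof (cases "j \<in> {1..g}")
        case True
        obtain k :: int where k: "h (GenB j) = T (of_int k) \<circ> conjG (K j) (Uz (l j) 0)" using B[OF True] by blast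
        have 1: "frB e j = frame (K j 0) (- l j) (tB j)"
          using True unfolding frB_def pxB[OF True] by (simp add: e_def q_def \<mu>_def)
        have "K j = frB e j \<circ> Uz (\<rho>B j) 0" using fB[OF True] unfolding 1 by blast
        then have "conjG (K j) (Uz (l j) 0) = conjG (frB e j) (conjG (Uz (\<rho>B j) 0) (Uz (l j) 0))" by (simp add: conjG_conjG)
        also have "conjG (Uz (\<rho>B j) 0) (Uz (l j) 0) = Uz (l j) 0"
        proof -
          have "Uz (\<rho>B j) 0 \<circ> Uz (l j) 0 = Uz (l j) 0 \<circ> Uz (\<rho>B j) 0" by (simp add: Uz_comp add.commute)
          then show ?thesis by (simp add: conjG_def o_assoc[symmetric])
        qed
        finally have "h (GenB j) = T (of_int k) \<circ> par_h e (GenB j)" using True k by (simp add: e_def q_def \<mu>_def)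
        then show ?thesis unfolding GenB by blast
      next
        case False
        then have "h (GenB j) = id" using hid[of "GenB j"] by (simp add: surface_gens_iff)
        then show ?thesis unfolding GenB using False by (intro exI[of _ 0]) auto
      qed
    next
      case (GenC i)
      have "h (GenC i) = par_h e (GenC i)"
      proof (cases "i = 1")
        case True then show ?thesis using C1 pw by simp
      next
        case i1: False
        show ?thesis
        proof (cases "i \<in> {2..p}")
          case True
          then show ?thesis using i1 pC[OF True] by (simp add: pblock_def par_x_def e_def q_def)
        next
          case False
          then have "h (GenC i) = id" using hid[of "GenC i"] i1 by (simp add: surface_gens_iff)
          then show ?thesis using False i1 by auto
        qed
      qed
      then show ?thesis unfolding GenC by (intro exI[of _ 0]) simp
    qed
  qed
  then show ?thesis using e2 by blast
qed

text \<open>After all second handle generators are made hyperbolic, one obstruction remains: the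
  fixed point of the last block may be a touching point. Then \<open>handle_point\<close> moves it,
  and the new one cannot touch because the touching points form a single class modulo
  integers.\<close>

lemma lnk_to_par:
  assumes h: "h \<in> lifted_reps g p s n"
  shows "\<exists>e\<in>par2 g p s n. lnk zeq (lifted_reps g p s n) h (par_h e)"
proof -
  let ?L = "lifted_reps g p s n"
  obtain h1 where h1: "h1 \<in> ?L" "lnk zeq ?L h h1" "\<forall>j\<in>{1..g}. \<exists>k. h1 (GenB j) \<in> J k k"
    using lnk_all_hyp[OF h] by blast
  have "\<exists>K l. K \<in> Gt \<and> l > 0 \<and> (\<exists>k::int. h1 (GenB j) = T (of_int k) \<circ> conjG K (Uz l 0))" if "j \<in> {1..g}" for j
    using h1(3) that hyp_two by metis
  then obtain K l where K: "\<And>j. j \<in> {1..g} \<Longrightarrow> K j \<in> Gt \<and> l j > 0 \<and> (\<exists>k::int. h1 (GenB j) = T (of_int k) \<circ> conjG (K j) (Uz (l j) 0))"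
    by metis
  define w where "w h = cprod [2..<Suc p] h \<circ> hprod [1..<g] h \<circ> cmt (h (GenA g)) (h (GenB g))" for h
  have hG: "h1 x \<in> Gt" for x using h1 by (simp add: lifted_reps_def)
  have gg: "g \<in> {1..g}" using g1 by simp
  have fin: ?thesis if h2: "h2 \<in> ?L" "lnk zeq ?L h h2"
    and K2: "\<And>j. j \<in> {1..g} \<Longrightarrow> K j \<in> Gt \<and> l j > 0 \<and> (\<exists>k::int. h2 (GenB j) = T (of_int k) \<circ> conjG (K j) (Uz (l j) 0))"
    and ne: "w h2 (K g 0) \<noteq> K g 0 + of_int n" for h2 K l
  proof -
    have "\<exists>e\<in>par2 g p s n. zeq (par_h e) h2" by (rule par_cover[OF h2(1) K2 w_def ne])
    then obtain e where e: "e \<in> par2 g p s n" "zeq (par_h e) h2" by blast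
    have "lnk zeq ?L h2 (par_h e)"
      using lnk_rel[where rel=zeq and X="?L" and h=h2 and h'="par_h e"] par_h_lifted[OF e(1)] zeq_sym[OF e(2)] e(2) h2(1) by blast
    then show ?thesis using lnk_trans[OF h2(2)] e(1) by blast
  qed
  show ?thesis
  proof (cases "w h1 (K g 0) = K g 0 + of_int n")
    case False
    show ?thesis by (rule fin[OF h1(1,2) K False])
  next
    case True
    have wG: "w h1 \<in> Gt" unfolding w_def using hG by (auto intro!: comp_Gt gprod_Gt')
    have C1: "h1 (GenC 1) = ginv (w h1) \<circ> T (of_int n)"
      using h1(1) relation_rotate[OF g1 p1 hG, where n=n] unfolding w_def lifted_reps_def by simp
    obtain v t where vt: "h1 (GenC 1) = U v 0 t" "t > 0" using lifted_block[OF h1(1), of 1] p1 unfolding s1 block_one by auto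
    \<comment> \<open>Touching points of \<open>w h1\<close> are fixed points of the parabolic first
      peripheral element, which has one fixed point on the circle.\<close>
    have fixC: "\<exists>k::int. y = v + of_int k" if y: "w h1 y = y + of_int n" for y
    proof (rule ccontr)
      assume "\<nexists>k::int. y = v + of_int k"
      then have "U v 0 t y > y" using parabolic_displacement(3)[OF vt(2)] by blast
      moreover have "U v 0 t y = y" unfolding vt(1)[symmetric] C1 comp_apply T_def y[symmetric] using wG by simp
      ultimately show False by simp
    qed
    obtain k :: int where k: "h1 (GenB g) = T (of_int k) \<circ> conjG (K g) (Uz (l g) 0)" using K[OF gg] by blast
    obtain A' B' K' m and k' :: int where P: "lnk (=) (handles (cmt (h1 (GenA g)) (h1 (GenB g)))) (h1 (GenA g), h1 (GenB g)) (A', B')"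
      "K' \<in> Gt" "m > 0" "B' = T (of_int k') \<circ> conjG K' (Uz m 0)" "\<forall>j::int. K' 0 \<noteq> K g 0 + of_int j"
      using handle_point[of "K g" "l g" "h1 (GenA g)", OF _ _ hG k] K[OF gg] by blast
    define h2 where "h2 = h1(GenA g := A', GenB g := B')"
    have h2: "h2 \<in> ?L" "lnk zeq ?L h h2"
      using lnk_handle[OF h1(1) gg P(1)] lnk_trans[OF h1(2)] by (simp_all add: h2_def)
    have "cmt A' B' = cmt (h1 (GenA g)) (h1 (GenB g))"
      using handles_cmt[OF P(1)] hG by (auto simp: handles_def)
    moreover have "cprod [2..<Suc p] h2 = cprod [2..<Suc p] h1" "hprod [1..<g] h2 = hprod [1..<g] h1"
      unfolding cprod_def hprod_def by (rule gprod_cong; auto simp: h2_def)+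
    ultimately have w2: "w h2 = w h1" by (simp add: w_def h2_def)
    have "w h2 (K' 0) \<noteq> K' 0 + of_int n"
    proof
      assume "w h2 (K' 0) = K' 0 + of_int n"
      then obtain a b :: int where "K' 0 = v + of_int a" "K g 0 = v + of_int b" using fixC[OF True] fixC[of "K' 0"] unfolding w2 by blast
      then show False using P(5)[rule_format, of "a - b"] by simp
    qed
    then show ?thesis
      by (intro fin[OF h2, of "K(g := K')" "l(g := m)"]) (use K P(2-4) in \<open>auto simp: h2_def\<close>)
  qed
qed

theorem lifted_reps_genus_pos_aux:
  "sconn zeq (lifted_reps g p s n)"
  "lifted_reps g p s n \<noteq> {} \<longleftrightarrow> 2 - 2 * int g - neg p s \<le> n \<and> n \<le> pos p s + 2 * int g - 2"
proof -
  show "sconn zeq (lifted_reps g p s n)"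
    unfolding sconn_def
  proof (intro ballI)
    fix h h' assume "h \<in> lifted_reps g p s n" "h' \<in> lifted_reps g p s n"
    then obtain e e' where e: "e \<in> par2 g p s n" "lnk zeq (lifted_reps g p s n) h (par_h e)"
      "e' \<in> par2 g p s n" "lnk zeq (lifted_reps g p s n) h' (par_h e')" using lnk_to_par by metis
    show "lnk zeq (lifted_reps g p s n) h h'"
      using lnk_trans[OF lnk_trans[OF e(2) par_lnk[OF e(1,3)]] lnk_sym[OF e(4)]] .
  qed
  show "lifted_reps g p s n \<noteq> {} \<longleftrightarrow> 2 - 2 * int g - neg p s \<le> n \<and> n \<le> pos p s + 2 * int g - 2"
  proof
    assume "lifted_reps g p s n \<noteq> {}"
    then obtain q where "q \<in> par1 g p s n" using lnk_to_par unfolding par2_def by fast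
    then show "2 - 2 * int g - neg p s \<le> n \<and> n \<le> pos p s + 2 * int g - 2"
      using par_block_space[of "fst (fst q)"] unfolding par1_def by auto
  next
    assume a: "2 - 2 * int g - neg p s \<le> n \<and> n \<le> pos p s + 2 * int g - 2"
    define b :: "(nat \<Rightarrow> real) \<times> (nat \<Rightarrow> real)" where "b = ((\<lambda>_. 1), (\<lambda>_. 0))"
    have b: "b \<in> par_base" by (simp add: b_def par_base_def)
    obtain x where "x \<in> block_space (hkind s) (hlam (fst b)) (hlist g p) (J (n - 1) n)"
      using par_block_space[of "fst b"] a by blast
    then have "(b, x) \<in> par1 g p s n" "par_u g p (b, x) \<in> J (n - 1) n"
      using b by (auto simp: par1_def par_u_def block_space_def)
    then show "lifted_reps g p s n \<noteq> {}" using displaced_ex par_h_lifted unfolding par2_def by blast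
  qed
qed

end

section \<open>Reflection to a positive first puncture, and arbitrary signs\<close>

lemma mirr_gprod: "mirr (gprod is C) = gprod is (\<lambda>i. mirr (C i))"
  by (induct "is") (simp_all only: gprod_Nil gprod_Cons mirr_comp mirr_id)

lemma mirr_cmt: "A \<in> Gt \<Longrightarrow> B \<in> Gt \<Longrightarrow> mirr (cmt A B) = cmt (mirr A) (mirr B)"
  by (simp add: cmt_def mirr_comp mirr_ginv)

lemma mirr_lifted:
  assumes "h \<in> lifted_reps g p s n" shows "(\<lambda>x. mirr (h x)) \<in> lifted_reps g p (\<lambda>i. - s i) (- n)"
proof -
  have G: "h x \<in> Gt" for x using assms by (simp add: lifted_reps_def)
  have "mirr (h (GenC i)) \<in> block (- s i) 0" if "i \<in> {1..p}" for i
    using assms that unfolding lifted_reps_def mirr_block[symmetric] by blast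
  moreover have "hprod [1..<Suc g] (\<lambda>x. mirr (h x)) \<circ> cprod [1..<Suc p] (\<lambda>x. mirr (h x)) = mirr (hprod [1..<Suc g] h \<circ> cprod [1..<Suc p] h)"
    unfolding hprod_def cprod_def mirr_comp mirr_gprod by (simp only: mirr_cmt G)
  ultimately show ?thesis using assms by (simp add: lifted_reps_def)
qed

lemma lifted_reps_mirr: "(\<lambda>h x. mirr (h x)) ` lifted_reps g p (\<lambda>i. - s i) (- n) = lifted_reps g p s n"
proof
  show "(\<lambda>h x. mirr (h x)) ` lifted_reps g p (\<lambda>i. - s i) (- n) \<subseteq> lifted_reps g p s n"
    using mirr_lifted[of _ g p "\<lambda>i. - s i" "- n"] by auto
  show "lifted_reps g p s n \<subseteq> (\<lambda>h x. mirr (h x)) ` lifted_reps g p (\<lambda>i. - s i) (- n)"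
  proof
    fix h assume "h \<in> lifted_reps g p s n"
    then show "h \<in> (\<lambda>h x. mirr (h x)) ` lifted_reps g p (\<lambda>i. - s i) (- n)"
      by (intro image_eqI[OF _ mirr_lifted]) auto
  qed
qed

lemma sconn_mirr:
  assumes "sconn zeq (lifted_reps g p (\<lambda>i. - s i) (- n))" shows "sconn zeq (lifted_reps g p s n)"
proof -
  have "zeq (\<lambda>x. mirr (h x)) (\<lambda>x. mirr (h' x))" if "zeq h h'" for h h'
    unfolding zeq_def
  proof
    fix x
    obtain k :: int where "h' x = T (of_int k) \<circ> h x" using \<open>zeq h h'\<close> unfolding zeq_def by blast
    then have "mirr (h' x) = T (of_int (- k)) \<circ> mirr (h x)" by (simp add: mirr_comp)
    then show "\<exists>k::int. mirr (h' x) = T (of_int k) \<circ> mirr (h x)" by blast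
  qed
  moreover have "continuous_on (lifted_reps g p (\<lambda>i. - s i) (- n)) (\<lambda>h x. mirr (h x))"
    by (rule continuous_on_coordinatewise_then_product)
      (rule continuous_on_mirr[OF continuous_on_product_then_coordinatewise[OF continuous_on_id]])
  ultimately have "sconn zeq ((\<lambda>h x. mirr (h x)) ` lifted_reps g p (\<lambda>i. - s i) (- n))"
    using sconn_image[OF assms] by blast
  then show ?thesis by (simp only: lifted_reps_mirr)
qed

lemma mirr_nonempty: "lifted_reps g p s n \<noteq> {} \<longleftrightarrow> lifted_reps g p (\<lambda>i. - s i) (- n) \<noteq> {}"
  using lifted_reps_mirr[of g p s n] by blast

lemma pos_mirr: "pos p (\<lambda>i. - s i) = neg p s" "neg p (\<lambda>i. - s i) = pos p s"
  by (simp_all add: pos_def neg_def minus_equation_iff[of _ 1] eq_commute[of _ "-1"] cong: if_cong)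

theorem lifted_reps_genus_pos:
  assumes "g \<ge> 1" "p \<ge> 1" "\<And>i. i \<in> {1..p} \<Longrightarrow> s i \<in> {1, -1}"
  shows "sconn zeq (lifted_reps g p s n)"
    "lifted_reps g p s n \<noteq> {} \<longleftrightarrow> 2 - 2 * int g - neg p s \<le> n \<and> n \<le> pos p s + 2 * int g - 2"
proof -
  have "sconn zeq (lifted_reps g p s n) \<and>
    (lifted_reps g p s n \<noteq> {} \<longleftrightarrow> 2 - 2 * int g - neg p s \<le> n \<and> n \<le> pos p s + 2 * int g - 2)"
  proof (cases "s 1 = 1")
    case True
    show ?thesis using lifted_reps_genus_pos_aux[of g p s n, OF assms True] by blast
  next
    case False
    have "\<And>i. i \<in> {1..p} \<Longrightarrow> - s i \<in> {1, -1}" "- s 1 = 1" using assms(3)[of 1] assms(2) False assms(3) by force+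
    note * = lifted_reps_genus_pos_aux[of g p "\<lambda>i. - s i" "- n", OF assms(1,2) this]
    have "sconn zeq (lifted_reps g p s n)" by (rule sconn_mirr[OF *(1)])
    moreover have "lifted_reps g p s n \<noteq> {} \<longleftrightarrow> 2 - 2 * int g - neg p s \<le> n \<and> n \<le> pos p s + 2 * int g - 2"
      using *(2) unfolding pos_mirr mirr_nonempty[of g p s n, symmetric] by linarith
    ultimately show ?thesis by blast
  qed
  then show "sconn zeq (lifted_reps g p s n)"
    "lifted_reps g p s n \<noteq> {} \<longleftrightarrow> 2 - 2 * int g - neg p s \<le> n \<and> n \<le> pos p s + 2 * int g - 2" by blast+
qed

subsection \<open>Genus zero\<close>

text \<open>The relation of the punctured sphere for an arbitrary list of factors; the list can then
  be rotated to bring suitable punctures to its end.\<close>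

definition cyc :: "('i \<Rightarrow> int) \<Rightarrow> 'i list \<Rightarrow> int \<Rightarrow> ('i \<Rightarrow> real \<Rightarrow> real) set" where
  "cyc s js n = {C. (\<forall>i. if i \<in> set js then C i \<in> block (s i) 0 else C i = id) \<and> gprod js C = T (of_int n)}"

lemma cyc_Gt: "C \<in> cyc s js n \<Longrightarrow> C i \<in> Gt"
  unfolding cyc_def using block_Gt by (cases "i \<in> set js") (auto split: if_splits)

lemma cyc_block: "C \<in> cyc s js n \<Longrightarrow> i \<in> set js \<Longrightarrow> C i \<in> block (s i) 0"
  unfolding cyc_def by (auto split: if_splits)

lemma cyc_prod: "C \<in> cyc s js n \<Longrightarrow> gprod js C = T (of_int n)" by (simp add: cyc_def)

lemma cyc_rotate: "cyc s (xs @ ys) n = cyc s (ys @ xs) n"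
proof -
  have "C \<in> cyc s (ys @ xs) n" if C: "C \<in> cyc s (xs @ ys) n" for C xs and ys :: "'a list"
  proof -
    have "gprod xs C \<circ> gprod ys C = T (of_int n)" using cyc_prod[OF C] by (simp add: gprod_append)
    then have "gprod ys C \<circ> gprod xs C = T (of_int n)"
      by (subst T_int_left_cancel) (auto intro!: gprod_Gt cyc_Gt[OF C])
    moreover have "(i \<in> set (ys @ xs)) = (i \<in> set (xs @ ys))" for i by auto
    ultimately show ?thesis using C unfolding cyc_def gprod_append by (simp only: mem_Collect_eq) blast
  qed
  then show ?thesis by blast
qed

text \<open>The products \<open>u\<close> for which the strength solved for has sign
  \<open>\<sigma>\<close>, see \<open>tau_strengths\<close>.\<close>

definition reg_region :: "int \<Rightarrow> int \<Rightarrow> (real \<Rightarrow> real) set" where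
  "reg_region \<sigma> n = (if \<sigma> = -1 then J n n else Lr (n - 1) (n - 1))"

text \<open>The block of strength 0 is the identity, so comparing \<open>tau\<close> with 0 means
  comparing the maximal displacement of \<open>u\<close> itself with \<open>n\<close>.\<close>

lemma tau_strengths:
  assumes "u \<in> Gt" "displaced n u v" "\<sigma> \<in> {1, -1}"
  shows "tau n 0 u v \<in> strengths \<sigma> \<longleftrightarrow> u \<in> reg_region \<sigma> n"
proof -
  have "0 < tau n 0 u v \<longleftrightarrow> below n u" "tau n 0 u v < 0 \<longleftrightarrow> exceeds n u"
    using tau_less[OF assms(1,2), of 0 0] by simp_all
  then show ?thesis
    using assms unfolding strengths_def reg_region_def below_def exceeds_def displaced_def J_def Lr_def by auto
qed

lemma reg_region_displaced: assumes "u \<in> reg_region \<sigma> n" shows "\<exists>v. displaced n u v"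
proof (cases "\<sigma> = -1")
  case True
  then obtain x y where "u \<in> Gt" "x + of_int n < u x" "u y < y + of_int n" using assms unfolding reg_region_def J_def by auto
  then have "u \<in> J (n - 1) n" by (intro JI[where x=x and y=y]) auto
  then show ?thesis by (rule displaced_ex)
next
  case False
  then show ?thesis using assms unfolding reg_region_def Lr_def displaced_def by auto
qed

lemma gprod_U: "gprod is (\<lambda>i. U v 0 (t i)) = U v 0 (\<Sum>i\<leftarrow>is. t i)"
proof (induct "is")
  case (Cons i "is")
  then show ?case by (simp only: gprod_Cons U_comp) (simp add: add.commute)
qed simp

definition abel :: "'i list \<Rightarrow> real \<Rightarrow> ('i \<Rightarrow> real) \<Rightarrow> 'i \<Rightarrow> real \<Rightarrow> real" where
  "abel L v t i = (if i \<in> set L then U v 0 (t i) else id)"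

lemma gprod_abel: "gprod L (abel L v t) = U v 0 (\<Sum>i\<leftarrow>L. t i)"
proof -
  have "gprod L (abel L v t) = gprod L (\<lambda>i. U v 0 (t i))" by (rule gprod_cong) (simp add: abel_def)
  then show ?thesis by (simp only: gprod_U)
qed

lemma abel_in:
  assumes "\<And>i. i \<in> set L \<Longrightarrow> t i \<in> strengths (s i)" "(\<Sum>i\<leftarrow>L. t i) = 0"
  shows "abel L v t \<in> cyc s L 0"
  using assms gprod_abel[of L v t] unfolding cyc_def by (auto simp: abel_def block_def)

text \<open>A common fixed point puts all factors into one parabolic one-parameter group. The fixed
  point then shows \<open>n = 0\<close>, and the moving point \<open>v + 1/2\<close> shows that the
  strengths add up to 0.\<close>

lemma abelian_form:
  assumes C: "C \<in> cyc s L n" and sg: "\<And>i. i \<in> set L \<Longrightarrow> s i \<in> {1, -1}" and v: "\<forall>i\<in>set L. C i v = v"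
  shows "\<exists>t. C = abel L v t \<and> (\<forall>i\<in>set L. t i \<in> strengths (s i)) \<and> (\<Sum>i\<leftarrow>L. t i) = 0 \<and> n = 0"
proof -
  have "\<exists>t. C i = U v 0 t \<and> t \<in> strengths (s i)" if i: "i \<in> set L" for i
  proof -
    obtain w t where w: "C i = U w 0 t" "t \<in> strengths (s i)" using cyc_block[OF C i] by (auto simp: block_def)
    have "t \<noteq> 0" using w(2) sg[OF i] by (auto simp: strengths_def)
    moreover have "U w 0 t v = v" using v i w(1) by metis
    ultimately obtain k :: int where "v = w + of_int k" using parabolic_fix[of t w v] by auto
    then show ?thesis using w by (auto simp: U_period)
  qed
  then obtain t where t: "\<And>i. i \<in> set L \<Longrightarrow> C i = U v 0 (t i) \<and> t i \<in> strengths (s i)" by metis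
  have e: "C = abel L v t" using t C by (auto simp: abel_def cyc_def fun_eq_iff)
  have p: "U v 0 (\<Sum>i\<leftarrow>L. t i) = T (of_int n)" using cyc_prod[OF C] unfolding e gprod_abel .
  have n: "n = 0" using fun_cong[OF p, of v] by (simp add: T_def)
  have "(\<Sum>i\<leftarrow>L. t i) = 0"
  proof (rule ccontr)
    assume "(\<Sum>i\<leftarrow>L. t i) \<noteq> 0"
    then obtain k :: int where "v + 1/2 = v + of_int k" using parabolic_fix[of _ v "v + 1/2"] fun_cong[OF p, of "v + 1/2"] n by auto
    then have "of_int (2 * k) = (1::real)" by simp
    then have "2 * k = 1" by (metis of_int_eq_1_iff)
    then show False by presburger
  qed
  then show ?thesis using e t n by blast
qed

text \<open>Strengths with prescribed signs and sum 0 form a convex set, so two such representations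
  are joined by a straight line in fixed point and strengths.\<close>

lemma abel_lnk:
  assumes sg: "\<And>i. i \<in> set L \<Longrightarrow> s i \<in> {1, -1}" and C: "abel L v t \<in> cyc s L n" "abel L v' t' \<in> cyc s L n"
  shows "lnk (=) (cyc s L n) (abel L v t) (abel L v' t')"
proof -
  have ab: "(\<forall>i\<in>set L. t i \<in> strengths (s i)) \<and> (\<Sum>i\<leftarrow>L. t i) = 0 \<and> n = 0" if m: "abel L v t \<in> cyc s L n" for v t
  proof -
    obtain t2 where t2: "abel L v t = abel L v t2" "\<forall>i\<in>set L. t2 i \<in> strengths (s i)" "(\<Sum>i\<leftarrow>L. t2 i) = 0" "n = 0"
      using abelian_form[OF m sg, of v] by (auto simp: abel_def)
    have "t i = t2 i" if "i \<in> set L" for i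
    proof (rule ccontr)
      assume "t i \<noteq> t2 i"
      then consider "t i < t2 i" | "t2 i < t i" by linarith
      then have "U v 0 (t i) (v + 1/2) \<noteq> U v 0 (t2 i) (v + 1/2)"
        using U_less[of v "v + 1/2" "t i" "t2 i" 0] U_less[of v "v + 1/2" "t2 i" "t i" 0] by cases simp_all
      then show False using fun_cong[OF t2(1), of i] that by (simp add: abel_def)
    qed
    moreover from this have "(\<Sum>i\<leftarrow>L. t i) = (\<Sum>i\<leftarrow>L. t2 i)" by (rule sum_list_cong')
    ultimately show ?thesis using t2 by simp
  qed
  \<comment> \<open>Clamping to the unit interval defines the segment for all real times, as
    \<open>lnk_path\<close> expects.\<close>
  define c where "c r = max 0 (min 1 r)" for r :: real
  have c: "0 \<le> c r" "c r \<le> 1" for r by (auto simp: c_def)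
  define \<gamma> where "\<gamma> r = abel L ((1 - c r) * v + c r * v') (\<lambda>i. (1 - c r) * t i + c r * t' i)" for r
  have "\<gamma> r \<in> cyc s L n" for r
  proof -
    have "(1 - c r) * t i + c r * t' i \<in> strengths (s i)" if "i \<in> set L" for i
    proof -
      have "convex (strengths (s i))" using is_interval_strengths by (simp add: is_interval_convex_1)
      then show ?thesis using ab[OF C(1)] ab[OF C(2)] that c[of r] unfolding convex_alt by fastforce
    qed
    moreover have "(\<Sum>i\<leftarrow>L. (1 - c r) * t i + c r * t' i) = 0"
      using ab[OF C(1)] ab[OF C(2)] by (simp add: sum_list_addf sum_list_const_mult)
    ultimately show ?thesis
      using abel_in[of L "\<lambda>i. (1 - c r) * t i + c r * t' i" s "(1 - c r) * v + c r * v'"] ab[OF C(1)] by (simp add: \<gamma>_def)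
  qed
  moreover have "continuous_on UNIV \<gamma>"
  proof (rule continuous_on_coordinatewise_then_product)
    fix i show "continuous_on UNIV (\<lambda>r. \<gamma> r i)"
      unfolding \<gamma>_def abel_def c_def by (cases "i \<in> set L") (auto intro!: continuous_intros)
  qed
  ultimately have "lnk (=) (cyc s L n) (\<gamma> 0) (\<gamma> 1)" by (intro lnk_path)
  then show ?thesis by (simp add: \<gamma>_def c_def)
qed

section \<open>Solving for the last two punctures of a sphere\<close>

context
  fixes s :: "'i \<Rightarrow> int" and js :: "'i list" and a b :: 'i and n :: int
  assumes dist: "distinct (js @ [a, b])" and sg: "\<And>i. i \<in> set (js @ [a, b]) \<Longrightarrow> s i \<in> {1, -1}"
    and sb: "s b = 1" and sa: "s a = 1 \<Longrightarrow> \<forall>j\<in>set js. s j = 1"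
begin

abbreviation (input) "uu x \<equiv> gprod js (pblock (\<lambda>_. 0) x)"

text \<open>For negative \<open>a\<close> the region is \<open>J n n\<close>, from which blocks of
  either sign can be removed. For positive \<open>a\<close> it is an \<open>Lr\<close>, where
  \<open>peel_L\<close> removes positive blocks; this is why all signs are assumed positive in that
  case.\<close>

definition pair_base where "pair_base = block_space s (\<lambda>_. 0) js (reg_region (s a) n)"

definition pair_params where
  "pair_params = {(x, v). x \<in> pair_base \<and> displaced n (uu x) v}"

definition pair_a where "pair_a e = U (snd e) 0 (tau n 0 (uu (fst e)) (snd e))"

definition pair_map where
  "pair_map e i = (if i = a then pair_a e else if i = b then ginv (uu (fst e) \<circ> pair_a e) \<circ> T (of_int n)
     else pblock (\<lambda>_. 0) (fst e) i)"

lemma pair_a_Gt [simp]: "pair_a e \<in> Gt" by (simp add: pair_a_def)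

lemma pair_base_props:
  "sconn prel pair_base"
  "pair_base \<noteq> {} \<longleftrightarrow> (if s a = -1 then n < ups s js \<and> 0 < n + downs s js else 1 \<le> n \<and> n \<le> int (length js))"
proof -
  have "sconn prel pair_base \<and>
    (pair_base \<noteq> {} \<longleftrightarrow> (if s a = -1 then n < ups s js \<and> 0 < n + downs s js else 1 \<le> n \<and> n \<le> int (length js)))"
  proof (cases "s a = -1")
    case True
    have "s j \<in> {-1, 0, 1}" "s j \<noteq> 0" if "j \<in> set js" for j using sg[of j] that by auto
    then show ?thesis using block_space_J[of js n n s "\<lambda>_. 0"] dist True by (simp add: pair_base_def reg_region_def)
  next
    case False
    then have "s a = 1" using sg[of a] by simp
    then show ?thesis using block_space_L[of js "n - 1" "n - 1" s "\<lambda>_. 0"] dist sa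
      by (auto simp add: pair_base_def reg_region_def)
  qed
  then show "sconn prel pair_base"
  "pair_base \<noteq> {} \<longleftrightarrow> (if s a = -1 then n < ups s js \<and> 0 < n + downs s js else 1 \<le> n \<and> n \<le> int (length js))" by blast+
qed

lemma pair_map_in: assumes "e \<in> pair_params" shows "pair_map e \<in> cyc s (js @ [a, b]) n"
proof -
  obtain x v where e: "e = (x, v)" by (cases e)
  have x: "x \<in> pair_base" "displaced n (uu x) v" using assms by (auto simp: e pair_params_def)
  have uR: "uu x \<in> reg_region (s a) n" using x(1) by (simp add: pair_base_def block_space_def)
  have A: "pair_map e a \<in> block (s a) 0"
    using tau_strengths[of "uu x" n v "s a"] uR x(2) sg[of a] by (auto simp: pair_map_def pair_a_def e block_def)
  have "touches n (uu x \<circ> pair_a e)"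
    unfolding pair_a_def e fst_conv snd_conv using solves_touches[OF _ x(2)] solves_tau[OF _ x(2)] by simp
  then have B: "pair_map e b \<in> block (s b) 0"
    using touches_block[of "uu x \<circ> pair_a e" n] dist unfolding sb by (auto simp: pair_map_def e)
  have C: "pair_map e i = pblock (\<lambda>_. 0) x i" if "i \<noteq> a" "i \<noteq> b" for i using that by (simp add: pair_map_def e)
  have js: "pair_map e i \<in> block (s i) 0" if "i \<in> set js" for i
  proof -
    have "i \<noteq> a" "i \<noteq> b" using that dist by auto
    then show ?thesis using x(1) that C unfolding pair_base_def block_space_def block_def pblock_def by force
  qed
  have id: "pair_map e i = id" if "i \<notin> set (js @ [a, b])" for i
    using that x(1) C[of i] unfolding pair_base_def block_space_def by (simp add: pblock_def)
  have "gprod js (pair_map e) = uu x"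
  proof (rule gprod_cong)
    fix j assume "j \<in> set js"
    then have "j \<noteq> a" "j \<noteq> b" using dist by auto
    then show "pair_map e j = pblock (\<lambda>_. 0) x j" by (rule C)
  qed
  then have "gprod (js @ [a, b]) (pair_map e) = uu x \<circ> (pair_a e \<circ> (ginv (uu x \<circ> pair_a e) \<circ> T (of_int n)))"
    using dist by (auto simp add: gprod_append pair_map_def e)
  also have "\<dots> = (uu x \<circ> pair_a e) \<circ> ginv (uu x \<circ> pair_a e) \<circ> T (of_int n)" by (simp only: o_assoc)
  also have "\<dots> = T (of_int n)" by (subst Gt_inv_comp) auto
  finally show ?thesis using A B js id unfolding cyc_def by auto
qed

text \<open>Touching points of the product in front of \<open>C b\<close> are fixed points of
  \<open>C b\<close>. If \<open>C a\<close> and \<open>C b\<close> share none, the fixed point of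
  \<open>C a\<close> is displaced and its strength is the one solved for.\<close>

lemma pair_cover:
  assumes C: "C \<in> cyc s (js @ [a, b]) n" and r: "\<And>x. C a x = x \<Longrightarrow> C b x \<noteq> x"
  shows "C \<in> pair_map ` pair_params"
proof -
  have "\<exists>v t. C i = U v 0 t \<and> t \<in> strengths (s i)" if "i \<in> set (js @ [a, b])" for i
    using cyc_block[OF C that] unfolding block_def by blast
  then obtain v t where vt: "\<And>i. i \<in> set (js @ [a, b]) \<Longrightarrow> C i = U (v i) 0 (t i) \<and> t i \<in> strengths (s i)" by metis
  define x where "x i = (if i \<in> set js then (v i, t i) else (0, 0))" for i
  have xC: "pblock (\<lambda>_. 0) x i = C i" if "i \<noteq> a" "i \<noteq> b" for i
    using vt[of i] C that by (cases "i \<in> set js") (auto simp: x_def pblock_def cyc_def)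
  have u: "uu x = gprod js C"
  proof (rule gprod_cong)
    fix j assume "j \<in> set js"
    then have "j \<noteq> a" "j \<noteq> b" using dist by auto
    then show "pblock (\<lambda>_. 0) x j = C j" by (rule xC)
  qed
  have G: "C i \<in> Gt" for i using cyc_Gt[OF C] .
  define w where "w = gprod js C \<circ> C a"
  have uG: "gprod js C \<in> Gt" using G by (intro gprod_Gt)
  have wG: "w \<in> Gt" unfolding w_def using uG G by blast
  have "w \<circ> C b = T (of_int n)" using cyc_prod[OF C] by (simp add: gprod_append w_def o_assoc)
  then have Cb: "C b = ginv w \<circ> T (of_int n)" using Gt_solve[OF wG] by blast
  then have tw: "touches n w" using touches_block[OF wG] cyc_block[OF C, of b] sb by simp
  have Ca: "C a = U (v a) 0 (t a)" "t a \<in> strengths (s a)" using vt[of a] by auto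
  have "w (v a) \<noteq> v a + of_int n"
  proof
    assume "w (v a) = v a + of_int n"
    then have "C b (v a) = ginv w (w (v a))" unfolding Cb by (simp add: T_def)
    then have "C b (v a) = v a" using wG by simp
    then show False using r[of "v a"] Ca by simp
  qed
  then have dis: "displaced n (gprod js C) (v a)"
    using displaced_iff_touches[OF uG, of n "v a" 0 "t a"] tw unfolding w_def Ca by blast
  have tau: "tau n 0 (gprod js C) (v a) = t a"
    by (rule tau_eqI[OF uG dis]) (use solves_touches[OF uG dis] tw Ca in \<open>simp add: w_def\<close>)
  have "gprod js C \<in> reg_region (s a) n" using tau_strengths[OF uG dis, of "s a"] tau Ca sg[of a] by simp
  then have "x \<in> pair_base" using vt unfolding pair_base_def block_space_def mem_Collect_eq u by (auto simp: x_def)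
  then have "(x, v a) \<in> pair_params" using dis by (simp add: pair_params_def u)
  moreover have "pair_map (x, v a) = C"
  proof
    fix i show "pair_map (x, v a) i = C i"
      using xC[of i] Ca Cb tau by (auto simp: pair_map_def pair_a_def u w_def)
  qed
  ultimately show ?thesis by blast
qed

definition "pair_rel e e' \<longleftrightarrow> prel (fst e) (fst e') \<and> (\<exists>k::int. snd e' = snd e + of_int k)"

lemma sconn_pair_params: "sconn pair_rel pair_params"
proof (rule sconn_fibration[OF pair_base_props(1)])
  show "y \<in> pair_base" if "(y, z) \<in> pair_params" for y z using that by (simp add: pair_params_def)
  show "\<exists>z. (y, z) \<in> pair_params" if "y \<in> pair_base" for y
    using reg_region_displaced that unfolding pair_params_def pair_base_def block_space_def by blast
  show "sconn (\<lambda>z z'. pair_rel (y, z) (y, z')) {z. (y, z) \<in> pair_params}" if "y \<in> pair_base" for y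
    using sconn_arcset[OF displaced_arc[of "uu y" n]] that by (simp add: pair_params_def pair_rel_def)
  show "openin (top_of_set pair_base) {y \<in> pair_base. (y, z) \<in> pair_params}" for z
    using open_displaced[of pair_base "\<lambda>x. uu x" n z]
    by (simp add: pair_params_def continuous_on_gprod_pblock continuous_on_const continuous_on_id)
  show "(y', z) \<in> pair_params \<and> pair_rel (y, z) (y', z)"
    if "(y, z) \<in> pair_params" "y' \<in> pair_base" "prel y y'" for y y' z
  proof -
    have "uu y = uu y'" using pblock_prel[OF that(3)] by metis
    then show ?thesis using that by (auto simp: pair_params_def pair_rel_def intro: exI[of _ 0])
  qed
qed

lemma continuous_on_pair_map: "continuous_on pair_params pair_map"
proof (rule continuous_on_coordinatewise_then_product)
  fix i
  have cu: "continuous_on pair_params (\<lambda>e. uu (fst e))"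
    by (rule continuous_on_gprod_pblock[OF continuous_on_const continuous_on_fst[OF continuous_on_id]])
  have ct: "continuous_on pair_params (\<lambda>e. tau n 0 (uu (fst e)) (snd e))"
    by (rule continuous_on_tau[OF cu continuous_on_const continuous_on_snd[OF continuous_on_id]]) (auto simp: pair_params_def)
  have ca: "continuous_on pair_params pair_a"
    unfolding pair_a_def by (rule continuous_on_U[OF continuous_on_snd[OF continuous_on_id] continuous_on_const ct])
  have cw: "continuous_on pair_params (\<lambda>e. uu (fst e) \<circ> pair_a e)"
    by (rule continuous_on_Gt_comp[OF cu _ ca]) simp
  have cb: "continuous_on pair_params (\<lambda>e. ginv (uu (fst e) \<circ> pair_a e) \<circ> T (of_int n))"
    by (rule continuous_on_Gt_comp[OF continuous_on_ginv[OF cw] _ continuous_on_const]) auto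
  have cx: "continuous_on pair_params (\<lambda>e. pblock (\<lambda>_. 0) (fst e) i)"
    by (rule continuous_on_pblock[OF continuous_on_const continuous_on_fst[OF continuous_on_id]])
  show "continuous_on pair_params (\<lambda>e. pair_map e i)"
    using ca cb cx unfolding pair_map_def by (cases "i = a"; cases "i = b") simp_all
qed

lemma pair_map_rel: assumes "pair_rel e e'" shows "pair_map e = pair_map e'"
proof -
  obtain x v x' v' where e: "e = (x, v)" "e' = (x', v')" by (cases e, cases e')
  obtain k :: int where k: "v' = v + of_int k" using assms by (auto simp: e pair_rel_def)
  have p: "pblock (\<lambda>_. 0) x = pblock (\<lambda>_. 0) x'" using assms pblock_prel unfolding pair_rel_def e by auto
  have pa: "pair_a e = pair_a e'" unfolding pair_a_def e k by (simp add: p tau_period U_period)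
  show ?thesis unfolding pair_map_def pa by (simp only: e fst_conv p)
qed

text \<open>A representation with no common fixed point is deformed into one for which a and b share no fixed
  point by conjugating a cyclically consecutive block with the centralizer of its product.\<close>

lemma pair_reach:
  assumes C: "C \<in> cyc s (js @ [a, b]) n" and ba: "C b v = v" and j: "j \<in> set js" "C j v \<noteq> v"
    and av: "C a v = v"
  shows "\<exists>C'\<in>cyc s (js @ [a, b]) n. lnk (=) (cyc s (js @ [a, b]) n) C C' \<and> (\<forall>x. C' a x = x \<longrightarrow> C' b x \<noteq> x)"
proof -
  \<comment> \<open>\<open>j\<close> is the first factor that moves \<open>v\<close>, so all factors
    strictly between \<open>b\<close> and \<open>j\<close> in the cyclic order fix
    \<open>v\<close>.\<close>
  obtain js1 j js2 where js: "js = js1 @ j # js2" "C j v \<noteq> v" "\<forall>i\<in>set js1. C i v = v"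
    using split_list_first_prop[of js "\<lambda>i. C i v \<noteq> v"] j by blast
  define M where "M = set (b # js1 @ [j])"
  define Q where "Q = gprod (b # js1 @ [j]) C"
  have G: "C i \<in> Gt" for i using cyc_Gt[OF C] .
  have QG: "Q \<in> Gt" unfolding Q_def using G by (intro gprod_Gt)
  obtain K k where K: "continuous_on UNIV K" "\<And>r. K r \<in> Gt" "K 0 = id" "\<And>r. K r \<circ> Q = Q \<circ> K r"
    "Q = T (of_int k) \<circ> K (1::real)" using one_parameter[OF QG] by metis
  define D where "D r i = (if i \<in> M then conjG (K r) (C i) else C i)" for r :: real and i
  have bM: "b \<in> M" and aM: "a \<notin> M" using dist by (auto simp: M_def js)
  have gc: "gprod is (\<lambda>i. conjG (K r) (C i)) = conjG (K r) (gprod is C)" for "is" r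
    by (induct "is") (simp_all only: gprod_Nil gprod_Cons conjG_comp conjG_id K(2))
  have DQ: "gprod (b # js1 @ [j]) (D r) = Q" for r
  proof -
    have "gprod (b # js1 @ [j]) (D r) = gprod (b # js1 @ [j]) (\<lambda>i. conjG (K r) (C i))"
      by (rule gprod_cong) (auto simp: D_def M_def)
    also have "\<dots> = conjG (K r) Q" by (simp only: gc Q_def)
    also have "\<dots> = Q \<circ> K r \<circ> ginv (K r)" unfolding conjG_def K(4) ..
    also have "\<dots> = Q" using K(2) by (simp add: o_assoc[symmetric])
    finally show ?thesis .
  qed
  \<comment> \<open>In cyclic order \<open>b\<close>, \<open>js1\<close> and \<open>j\<close> are
    consecutive, so conjugating all of them by the centralizer of their product \<open>Q\<close>
    preserves the relation.\<close>
  have rot: "cyc s (js @ [a, b]) n = cyc s ((b # js1 @ [j]) @ (js2 @ [a])) n"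
    using cyc_rotate[of s "js @ [a]" "[b]" n] by (simp add: js)
  have D: "D r \<in> cyc s (js @ [a, b]) n" for r
  proof -
    have "D r i \<in> block (s i) 0" if "i \<in> set (js @ [a, b])" for i
      unfolding D_def using conj_block[OF K(2) cyc_block[OF C that]] cyc_block[OF C that] sg[OF that] by simp
    moreover have "D r i = id" if "i \<notin> set (js @ [a, b])" for i
      using that C by (auto simp: D_def M_def js cyc_def)
    moreover have "gprod ((b # js1 @ [j]) @ (js2 @ [a])) (D r) = gprod ((b # js1 @ [j]) @ (js2 @ [a])) C"
    proof -
      have "gprod (js2 @ [a]) (D r) = gprod (js2 @ [a]) C"
        by (rule gprod_cong) (use dist in \<open>auto simp: D_def M_def js\<close>)
      then show ?thesis unfolding gprod_append[of "b # js1 @ [j]"] DQ by (simp only: Q_def)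
    qed
    moreover have "gprod ((b # js1 @ [j]) @ (js2 @ [a])) C = T (of_int n)"
      by (rule cyc_prod[where s=s]) (use C rot in simp)
    ultimately show ?thesis unfolding rot unfolding cyc_def by (auto simp: js)
  qed
  have D0: "D 0 = C" unfolding D_def K(3) by (rule ext) (simp add: conjG_def)
  have cD: "continuous_on UNIV D"
  proof (rule continuous_on_coordinatewise_then_product)
    fix i show "continuous_on UNIV (\<lambda>r. D r i)"
      unfolding D_def by (cases "i \<in> M") (simp_all add: continuous_on_conjG K G)
  qed
  have "lnk (=) (cyc s (js @ [a, b]) n) C (D 1)"
    using lnk_path[OF cD D, of "(=)" 0 1] by (simp add: D0)
  moreover have "D 1 b x \<noteq> x" if "D 1 a x = x" for x
  proof
    have fix_iff: "(C i x = x \<and> C i v = v) \<longrightarrow> (\<exists>m::int. x = v + of_int m)" if i: "i \<in> set (js @ [a, b])" for i x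
    proof (intro impI)
      assume c: "C i x = x \<and> C i v = v"
      obtain w t where w: "C i = U w 0 t" "t \<in> strengths (s i)" using cyc_block[OF C i] by (auto simp: block_def)
      have t: "t > 0 \<or> t < 0" using w sg[OF i] by (auto simp: strengths_def)
      have "\<exists>m::int. y = w + of_int m" if "C i y = y" for y
        using t that parabolic_displacement(3,4)[of t y w] unfolding w(1) by (metis less_irrefl)
      then obtain m m' :: int where "x = w + of_int m" "v = w + of_int m'" using c by metis
      then have "x = v + of_int (m - m')" by simp
      then show "\<exists>m::int. x = v + of_int m" by blast
    qed
    \<comment> \<open>A shared fixed point \<open>x\<close> would be a translate of
      \<open>v\<close>, as a fixed point of \<open>C a\<close>. At time 1 the conjugator is
      \<open>Q\<close> up to the center, so \<open>ginv Q x\<close> is fixed by \<open>C b\<close>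
      and again a translate of \<open>v\<close>. Hence \<open>Q\<close> moves \<open>v\<close> by an
      integer, and as \<open>b\<close> and \<open>js1\<close> fix \<open>v\<close>, so does
      \<open>j\<close>. A parabolic displacement is less than 1 in absolute value, so
      \<open>j\<close> fixes \<open>v\<close>.\<close>
    assume b: "D 1 b x = x"
    have "C a x = x" using that aM by (simp add: D_def)
    then obtain m :: int where m: "x = v + of_int m" using fix_iff[of a x] av by auto
    have "Q (ginv Q x) = x" using QG by simp
    define y where "y = ginv Q x"
    have y: "Q y = x" using QG by (simp add: y_def)
    have "C b y = y"
    proof -
      have "conjG (K 1) (C b) (K 1 y) = K 1 y"
        using b bM y Gt_period_int[OF conjG_Gt[OF K(2) G], of 1 b "K 1 y" k] by (simp add: D_def K(5) T_def)
      then have "K 1 (C b y) = K 1 y" by (simp add: conjG_app K(2))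
      then show ?thesis using K(2) by simp
    qed
    then obtain m' :: int where m': "y = v + of_int m'" using fix_iff[of b y] ba by auto
    have "gprod (b # js1) C v = v" using ba js(3)
    proof -
      have "gprod is C v = v" if "\<forall>i\<in>set is. C i v = v" for "is" using that by (induct "is") auto
      then show ?thesis using ba js(3) by simp
    qed
    moreover have "Q = gprod (b # js1) C \<circ> C j" by (simp add: Q_def gprod_append o_assoc)
    moreover have "Q v = v + of_int (m - m')" using y m Gt_period_int[OF QG, of v m'] m' by simp
    ultimately have "gprod (b # js1) C (C j v) = gprod (b # js1) C (v + of_int (m - m'))"
      using Gt_period_int[of "gprod (b # js1) C" v "m - m'"] gprod_Gt[of "b # js1" C] G by simp
    then have Cj: "C j v = v + of_int (m - m')" using gprod_Gt[of "b # js1" C] G Gt_eq_iff by metis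
    obtain w t where w: "C j = U w 0 t" using cyc_block[OF C, of j] by (auto simp: block_def js)
    have "\<bar>C j v - v\<bar> < 1" using Gt_osc[of "C j" w v] Gt_osc[of "C j" v w] G[of j] by (simp add: w)
    then have "m - m' = 0" unfolding Cj by (metis add_diff_cancel_left' of_int_abs of_int_less_1_iff zabs_less_one_iff)
    then show False using js(2) Cj by simp
  qed
  ultimately show ?thesis using D[of 1] by blast
qed

lemma pair_main:
  assumes C: "C \<in> cyc s (js @ [a, b]) n"
  shows "(\<exists>C'\<in>pair_map ` pair_params. lnk (=) (cyc s (js @ [a, b]) n) C C') \<or> (\<exists>v. \<forall>i\<in>set (js @ [a, b]). C i v = v)"
proof (cases "\<forall>x. C a x = x \<longrightarrow> C b x \<noteq> x")
  case True
  then have "C \<in> pair_map ` pair_params" by (intro pair_cover[OF C]) blast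
  then show ?thesis using lnk_refl by blast
next
  case False
  then obtain v where v: "C a v = v" "C b v = v" by blast
  show ?thesis
  proof (cases "\<forall>j\<in>set js. C j v = v")
    case True
    then have "\<forall>i\<in>set (js @ [a, b]). C i v = v" using v by simp
    then show ?thesis by blast
  next
    case False
    then obtain C' where C': "C' \<in> cyc s (js @ [a, b]) n" "lnk (=) (cyc s (js @ [a, b]) n) C C'" "\<forall>x. C' a x = x \<longrightarrow> C' b x \<noteq> x"
      using pair_reach[OF C v(2) _ _ v(1)] by blast
    then have "C' \<in> pair_map ` pair_params" by (intro pair_cover[OF C'(1)]) blast
    then show ?thesis using C'(2) by blast
  qed
qed

text \<open>With strengths -1 and 1 the factors \<open>a\<close> and \<open>b\<close> cancel, and
  the remaining strengths add up to 0 by themselves. The fixed point of the pair can therefore be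
  moved away from that of the other factors, which ends the abelian situation.\<close>

lemma pair_split_lnk:
  assumes js: "js \<noteq> []" and ne: "pair_params \<noteq> {}" and n0: "n = 0" and sa: "s a = -1"
  shows "\<exists>v t. abel (js @ [a, b]) v t \<in> cyc s (js @ [a, b]) n \<and> (\<exists>C'\<in>pair_map ` pair_params. lnk (=) (cyc s (js @ [a, b]) n) (abel (js @ [a, b]) v t) C')"
proof -
  define P where "P = ups s js"
  define N where "N = downs s js"
  have "pair_base \<noteq> {}" using ne unfolding pair_params_def by auto
  then have PN: "P > 0" "N > 0" using pair_base_props(2) sa n0 by (simp_all add: P_def N_def)
  \<comment> \<open>In \<open>js\<close> each positive factor gets the number of negative ones and
    each negative factor minus the number of positive ones, so the sum vanishes.\<close>
  define t where "t i = (if i = a then -1 else if i = b then 1 else if s i = 1 then of_int N else - real_of_int P)" for i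
  have ab: "a \<noteq> b" "a \<notin> set js" "b \<notin> set js" using dist by auto
  have "(\<Sum>i\<leftarrow>is. if s i = 1 then of_int N else - real_of_int P) = of_int (N * ups s is - P * downs s is)"
    if "\<forall>i\<in>set is. s i \<in> {1, -1}" for "is"
    using that by (induct "is") (auto simp: ups_def downs_def algebra_simps)
  moreover have "(\<Sum>i\<leftarrow>js. t i) = (\<Sum>i\<leftarrow>js. if s i = 1 then of_int N else - real_of_int P)"
    by (rule sum_list_cong') (use ab in \<open>auto simp: t_def\<close>)
  ultimately have sum: "(\<Sum>i\<leftarrow>js. t i) = 0" using sg by (simp add: P_def N_def)
  have tab: "t a = -1" "t b = 1" using ab by (simp_all add: t_def)
  have str: "t i \<in> strengths (s i)" if "i \<in> set (js @ [a, b])" for i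
    using sg[OF that] PN sa sb by (auto simp: t_def strengths_def)
  \<comment> \<open>At time \<open>r\<close> the pair has fixed point \<open>r\<close> and the other
    factors keep the fixed point 0; at \<open>r = 1/2\<close> no point is common to all.\<close>
  define D where "D r i = (if i = a \<or> i = b then U r 0 (t i) else abel js 0 t i)" for r :: real and i
  have D: "D r \<in> cyc s (js @ [a, b]) n" for r
  proof -
    have "gprod js (D r) = gprod js (\<lambda>i. U 0 0 (t i))"
      by (rule gprod_cong) (use ab in \<open>auto simp: D_def abel_def\<close>)
    then have "gprod (js @ [a, b]) (D r) = T (of_int n)"
      using ab tab by (simp add: gprod_append gprod_U sum D_def U_comp n0)
    moreover have "D r i \<in> block (s i) 0" if "i \<in> set (js @ [a, b])" for i
      using str[OF that] that by (auto simp: D_def abel_def block_def)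
    moreover have "D r i = id" if "i \<notin> set (js @ [a, b])" for i using that by (simp add: D_def abel_def)
    ultimately show ?thesis by (auto simp: cyc_def)
  qed
  have cD: "continuous_on UNIV D"
  proof (rule continuous_on_coordinatewise_then_product)
    fix i show "continuous_on UNIV (\<lambda>r. D r i)"
      unfolding D_def by (cases "i = a \<or> i = b") (simp_all add: continuous_on_U continuous_on_id continuous_on_const)
  qed
  have D0: "D 0 = abel (js @ [a, b]) 0 t" by (auto simp: D_def abel_def fun_eq_iff)
  have nex: "\<nexists>v. \<forall>i\<in>set (js @ [a, b]). D (1/2) i v = v"
  proof
    assume "\<exists>v. \<forall>i\<in>set (js @ [a, b]). D (1/2) i v = v"
    then obtain v where v: "D (1/2) a v = v" "D (1/2) (hd js) v = v" using js by auto
    have hd: "hd js \<in> set js" using js by simp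
    then have "hd js \<noteq> a" "hd js \<noteq> b" using ab by metis+
    then have "U (1/2) 0 (t a) v = v" "U 0 0 (t (hd js)) v = v" using v hd by (simp_all add: D_def abel_def)
    moreover have "t a \<noteq> 0" "t (hd js) \<noteq> 0" using PN by (auto simp: t_def)
    ultimately have "\<exists>k::int. v = 1/2 + of_int k" "\<exists>m::int. v = 0 + of_int m" using parabolic_fix by blast+
    then obtain k m :: int where "v = 1/2 + of_int k" "v = 0 + of_int m" by blast
    then have "of_int (2 * (m - k)) = (1::real)" by simp
    then have "2 * (m - k) = 1" by (metis of_int_eq_1_iff)
    then show False by presburger
  qed
  have "\<exists>C'\<in>pair_map ` pair_params. lnk (=) (cyc s (js @ [a, b]) n) (D (1/2)) C'"
    by (rule disjE[OF pair_main[OF D[of "1/2"]]], assumption) (rule notE[OF nex])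
  then obtain C' where C': "C' \<in> pair_map ` pair_params" "lnk (=) (cyc s (js @ [a, b]) n) (D (1/2)) C'" by blast
  have "lnk (=) (cyc s (js @ [a, b]) n) (D 0) (D (1/2))" by (rule lnk_path[OF cD D])
  then have "lnk (=) (cyc s (js @ [a, b]) n) (abel (js @ [a, b]) 0 t) C'" using C'(2) unfolding D0 by (rule lnk_trans)
  then show ?thesis using C'(1) D[of 0] unfolding D0 by blast
qed

text \<open>Every solution is linked to a parametrized one or is abelian. If parametrized ones
  exist, \<open>pair_split_lnk\<close> joins the abelian ones to them; if not, the abelian ones are
  the whole space and connected by \<open>abel_lnk\<close>.\<close>

lemma pair_cyc:
  assumes js: "js \<noteq> []"
  shows "sconn (=) (cyc s (js @ [a, b]) n)" "cyc s (js @ [a, b]) n \<noteq> {} \<longleftrightarrow> pair_base \<noteq> {} \<or> n = 0 \<and> s a = -1"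
proof -
  let ?L = "js @ [a, b]" and ?X = "cyc s (js @ [a, b]) n"
  have pp: "pair_params \<noteq> {} \<longleftrightarrow> pair_base \<noteq> {}"
    using reg_region_displaced unfolding pair_params_def pair_base_def block_space_def by fast
  have ab: "n = 0 \<and> s a = -1 \<and> (\<exists>t. C = abel ?L v t)" if C: "C \<in> ?X" and v: "\<forall>i\<in>set ?L. C i v = v" for C v
  proof -
    obtain t where t: "C = abel ?L v t" "\<forall>i\<in>set ?L. t i \<in> strengths (s i)" "(\<Sum>i\<leftarrow>?L. t i) = 0" "n = 0"
      using abelian_form[OF C _ v] sg by blast
    \<comment> \<open>If \<open>a\<close> were positive, all signs would be, and positive strengths
      do not add up to 0.\<close>
    have "s a \<noteq> 1"
    proof
      assume 1: "s a = 1"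
      then have "\<forall>i\<in>set ?L. 0 < t i" using t(2) sa sb by (auto simp: strengths_def)
      then have "\<forall>i\<in>set js. 0 < t i" "t a > 0" "t b > 0" by auto
      moreover have "(\<Sum>i\<leftarrow>js. t i) \<ge> 0" using calculation(1) by (intro sum_list_nonneg) auto
      ultimately show False using t(3) by simp
    qed
    then show ?thesis using t sg[of a] by auto
  qed
  have l_img: "lnk (=) ?X (pair_map e) (pair_map e')" if "e \<in> pair_params" "e' \<in> pair_params" for e e'
  proof -
    have "lnk pair_rel pair_params e e'" using sconn_pair_params that unfolding sconn_def by blast
    then show ?thesis
      by (intro lnk_image[OF continuous_on_pair_map, where relP=pair_rel]) (use pair_map_in pair_map_rel that in auto)
  qed
  have cases: "(\<exists>C'\<in>pair_map ` pair_params. lnk (=) ?X C C') \<or> n = 0 \<and> s a = -1 \<and> (\<exists>v t. C = abel ?L v t)" if "C \<in> ?X" for C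
    using pair_main[OF that]
  proof (elim disjE exE)
    fix v assume "\<forall>i\<in>set ?L. C i v = v"
    then show ?thesis using ab[OF that, of v] by blast
  qed simp
  show "sconn (=) ?X"
  proof (cases "pair_params = {}")
    case True
    show ?thesis unfolding sconn_def
    proof (intro ballI)
      fix C C' assume C: "C \<in> ?X" "C' \<in> ?X"
      obtain v t v' t' where e: "C = abel ?L v t" "C' = abel ?L v' t'" using cases[OF C(1)] cases[OF C(2)] True by blast
      show "lnk (=) ?X C C'" unfolding e by (rule abel_lnk[OF sg]) (use C e in simp_all)
    qed
  next
    case False
    have all: "\<exists>C'\<in>pair_map ` pair_params. lnk (=) ?X C C'" if C: "C \<in> ?X" for C
      using cases[OF C]
    proof (elim disjE)
      assume "n = 0 \<and> s a = -1 \<and> (\<exists>v t. C = abel ?L v t)"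
      then obtain v t where t: "n = 0" "s a = -1" "C = abel ?L v t" by blast
      obtain v' t' C' where t': "abel ?L v' t' \<in> ?X" "C' \<in> pair_map ` pair_params" "lnk (=) ?X (abel ?L v' t') C'"
        using pair_split_lnk[OF js False t(1,2)] by blast
      have "lnk (=) ?X C (abel ?L v' t')" unfolding t(3) by (rule abel_lnk[OF sg]) (use t'(1) C t(3) in simp_all)
      then have "lnk (=) ?X C C'" using t'(3) by (rule lnk_trans)
      then show ?thesis using t'(2) by blast
    qed
    show ?thesis unfolding sconn_def
    proof (intro ballI)
      fix C C' assume C: "C \<in> ?X" "C' \<in> ?X"
      obtain e e' where e: "e \<in> pair_params" "e' \<in> pair_params" "lnk (=) ?X C (pair_map e)" "lnk (=) ?X C' (pair_map e')"
        using all[OF C(1)] all[OF C(2)] by blast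
      show "lnk (=) ?X C C'" using lnk_trans[OF e(3) lnk_trans[OF l_img[OF e(1,2)] lnk_sym[OF e(4)]]] .
    qed
  qed
  show "?X \<noteq> {} \<longleftrightarrow> pair_base \<noteq> {} \<or> n = 0 \<and> s a = -1"
  proof
    assume "?X \<noteq> {}"
    then obtain C where C: "C \<in> ?X" by blast
    show "pair_base \<noteq> {} \<or> n = 0 \<and> s a = -1" using cases[OF C] pp by blast
  next
    assume "pair_base \<noteq> {} \<or> n = 0 \<and> s a = -1"
    then show "?X \<noteq> {}"
    proof
      assume "pair_base \<noteq> {}"
      then show ?thesis using pp pair_map_in by blast
    next
      assume na: "n = 0 \<and> s a = -1"
      define P where "P = ups s ?L"
      define N where "N = downs s ?L"
      have nn: "ups s js \<ge> 0" "downs s js \<ge> 0" unfolding ups_def downs_def by (intro sum_list_nonneg; auto)+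
      have PN: "P > 0" "N > 0" using na sb nn by (simp_all add: P_def N_def ups_def downs_def)
      define t where "t i = (if s i = 1 then of_int N else - real_of_int P)" for i
      have "(\<Sum>i\<leftarrow>is. t i) = of_int (N * ups s is - P * downs s is)" if "\<forall>i\<in>set is. s i \<in> {1, -1}" for "is"
        using that by (induct "is") (auto simp: ups_def downs_def algebra_simps t_def)
      from this[of ?L] have "(\<Sum>i\<leftarrow>?L. t i) = 0" using sg by (simp only: P_def N_def) auto
      moreover have "t i \<in> strengths (s i)" if "i \<in> set ?L" for i
        using sg[OF that] PN by (auto simp: t_def strengths_def)
      ultimately have "abel ?L 0 t \<in> cyc s ?L 0" using abel_in by blast
      then show ?thesis using na by blast
    qed
  qed
qed

end

section \<open>Punctured spheres with arbitrary signs\<close>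

lemma lifted_cyc:
  "(\<lambda>C x. case x of GenC i \<Rightarrow> C i | _ \<Rightarrow> id) ` cyc s [1..<Suc p] n = lifted_reps 0 p s n" (is "?\<Phi> ` _ = _")
proof
  show "?\<Phi> ` cyc s [1..<Suc p] n \<subseteq> lifted_reps 0 p s n"
  proof
    fix h assume "h \<in> ?\<Phi> ` cyc s [1..<Suc p] n"
    then obtain C where C: "C \<in> cyc s [1..<Suc p] n" "h = ?\<Phi> C" by blast
    have G: "C i \<in> Gt" for i using cyc_Gt[OF C(1)] .
    have set: "set [1..<Suc p] = {1..p}" by auto
    have id: "C i = id" if "i \<notin> {1..p}" for i using C(1) that unfolding cyc_def set by auto
    show "h \<in> lifted_reps 0 p s n"
      unfolding lifted_reps_def
    proof (intro CollectI conjI allI ballI impI)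
      show "h x \<in> Gt" for x unfolding C(2) by (cases x) (simp_all add: G)
      show "h x = id" if "x \<notin> surface_gens 0 p" for x
        using that id unfolding C(2) by (cases x) (simp_all add: surface_gens_iff)
      show "h (GenC i) \<in> block (s i) 0" if "i \<in> {1..p}" for i
        using cyc_block[OF C(1), of i] that unfolding C(2) set by simp
      show "hprod [1..<Suc 0] h \<circ> cprod [1..<Suc p] h = T (of_int n)"
        using cyc_prod[OF C(1)] unfolding hprod_def cprod_def C(2) by (simp del: upt_Suc)
    qed
  qed
  show "lifted_reps 0 p s n \<subseteq> ?\<Phi> ` cyc s [1..<Suc p] n"
  proof
    fix h assume h: "h \<in> lifted_reps 0 p s n"
    have id: "x \<notin> surface_gens 0 p \<Longrightarrow> h x = id" for x using h by (simp add: lifted_reps_def)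
    have "h = ?\<Phi> (\<lambda>i. h (GenC i))"
      using id by (auto simp: fun_eq_iff surface_gens_iff split: surface_gen.split)
    moreover have "(\<lambda>i. h (GenC i)) \<in> cyc s [1..<Suc p] n"
      unfolding cyc_def
    proof (intro CollectI conjI allI)
      have set: "set [1..<Suc p] = {1..p}" by auto
      show "if i \<in> set [1..<Suc p] then h (GenC i) \<in> block (s i) 0 else h (GenC i) = id" for i
        using lifted_block[OF h, of i] id[of "GenC i"] unfolding set surface_gens_iff by simp
      show "gprod [1..<Suc p] (\<lambda>i. h (GenC i)) = T (of_int n)"
        using h unfolding lifted_reps_def hprod_def cprod_def by (simp del: upt_Suc)
    qed
    ultimately show "h \<in> ?\<Phi> ` cyc s [1..<Suc p] n" by blast
  qed
qed

text \<open>Rotate a positive puncture to the end. The last negative one is then followed by a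
  positive one, and a second rotation brings this pair to the end.\<close>

lemma adjacent_signs:
  assumes "i \<in> set L" "s i = (1::int)" "j \<in> set L" "s j \<noteq> 1"
  shows "\<exists>js a b. mset (js @ [a, b]) = mset L \<and> s a \<noteq> 1 \<and> s b = 1 \<and> (\<forall>n. cyc s L n = cyc s (js @ [a, b]) n)"
proof -
  obtain xs ys where L: "L = xs @ i # ys" using split_list[OF assms(1)] by blast
  have 1: "cyc s L n = cyc s (ys @ xs @ [i]) n" for n
    using cyc_rotate[of s "xs @ [i]" ys n] by (simp add: L)
  have "\<exists>x\<in>set (ys @ xs @ [i]). s x \<noteq> 1" using assms by (auto simp: L)
  from split_list_last_prop[OF this] obtain us a ws where M: "ys @ xs @ [i] = us @ a # ws" "s a \<noteq> 1" "\<forall>c\<in>set ws. s c = 1" by auto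
  then obtain c ws' where ws: "ws = c # ws'" using assms(2) by (cases ws) auto
  have 2: "cyc s L n = cyc s ((ws' @ us) @ [a, c]) n" for n
    unfolding 1 M(1) ws using cyc_rotate[of s "us @ [a, c]" ws' n] by simp
  have "mset ((ws' @ us) @ [a, c]) = mset (us @ a # ws)" by (simp add: ws)
  also have "\<dots> = mset L" unfolding M(1)[symmetric] by (simp add: L)
  finally have 3: "mset ((ws' @ us) @ [a, c]) = mset L" .
  have "s c = 1" using M(3) ws by simp
  then show ?thesis
    by (intro exI[of _ "ws' @ us"] exI[of _ a] exI[of _ c] conjI allI 2 3 M(2))
qed

lemma pos_neg:
  assumes "\<And>i. i \<in> {1..p} \<Longrightarrow> s i \<in> {1, -1}" "mset L = mset [1..<Suc p]"
  shows "ups s L = pos p s" "downs s L = neg p s"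
proof -
  have "(\<Sum>i\<leftarrow>L. f i) = (\<Sum>i\<leftarrow>[1..<Suc p]. f i)" for f :: "nat \<Rightarrow> int"
    using arg_cong[OF assms(2), of "\<lambda>m. sum_mset (image_mset f m)"]
    by (simp only: mset_map[symmetric] sum_mset_sum_list)
  then have "ups s L = ups s [1..<Suc p]" "downs s L = downs s [1..<Suc p]"
    unfolding ups_def downs_def by blast+
  moreover have "ups s [1..<Suc p] = pos p s" "downs s [1..<Suc p] = neg p s"
    unfolding ups_def downs_def pos_def neg_def by (rule sum_list_cong'; use assms(1) in force)+
  ultimately show "ups s L = pos p s" "downs s L = neg p s" by simp_all
qed

text \<open>The first range comes from \<open>J n n\<close>. The case \<open>n = 0\<close> with both
  signs present adds the abelian representations, and for equal positive signs the region
  \<open>Lr\<close> starts at \<open>n = 1\<close> instead of 2. The disjunct with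
  \<open>pos p s = 0\<close> is the mirror image of the latter and makes the statement
  symmetric.\<close>

lemma lifted_reps_genus_zero_aux:
  assumes p: "p \<ge> 3" and sg: "\<And>i. i \<in> {1..p} \<Longrightarrow> s i \<in> {1, -1}" and i: "i \<in> {1..p}" "s i = 1"
  shows "sconn zeq (lifted_reps 0 p s n) \<and> (lifted_reps 0 p s n \<noteq> {} \<longleftrightarrow> 2 - neg p s \<le> n \<and> n \<le> pos p s - 2 \<or>
    n = 0 \<and> pos p s > 0 \<and> neg p s > 0 \<or> n = 1 \<and> neg p s = 0 \<or> n = -1 \<and> pos p s = 0)"
proof -
  have set_L: "set [1..<Suc p] = {1..p}" by auto
  have "\<exists>js a b. mset (js @ [a, b]) = mset [1..<Suc p] \<and> s b = 1 \<and> (s a = 1 \<longrightarrow> (\<forall>j\<in>set js. s j = 1)) \<and>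
    cyc s [1..<Suc p] n = cyc s (js @ [a, b]) n"
  proof (cases "\<exists>j\<in>{1..p}. s j \<noteq> 1")
    case True
    then obtain j where "j \<in> {1..p}" "s j \<noteq> 1" by blast
    then have "i \<in> set [1..<Suc p]" "j \<in> set [1..<Suc p]" "s j \<noteq> 1" using i(1) unfolding set_L by auto
    from adjacent_signs[of i _ s j, OF this(1) i(2) this(2,3)]
    obtain js a b where "mset (js @ [a, b]) = mset [1..<Suc p]" "s a \<noteq> 1" "s b = 1" "\<forall>n. cyc s [1..<Suc p] n = cyc s (js @ [a, b]) n"
      by (elim exE conjE)
    then show ?thesis by (intro exI[of _ js] exI[of _ a] exI[of _ b]) (simp del: upt_Suc)
  next
    case False
    obtain q where "p = Suc (Suc (Suc q))" using p by (metis Suc_le_D numeral_3_eq_3 Suc_le_mono)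
    then have "[1..<Suc p] = [1..<p - 1] @ [p - 1, p]" by simp
    then show ?thesis using False p by (intro exI[of _ "[1..<p - 1]"] exI[of _ "p - 1"] exI[of _ p]) auto
  qed
  then obtain js a b where L: "mset (js @ [a, b]) = mset [1..<Suc p]" "s b = 1" "s a = 1 \<Longrightarrow> \<forall>j\<in>set js. s j = 1"
    "cyc s [1..<Suc p] n = cyc s (js @ [a, b]) n" by blast
  have sL: "set (js @ [a, b]) = {1..p}" using mset_eq_setD[OF L(1)] set_L by simp
  have dL: "distinct (js @ [a, b])" using mset_eq_imp_distinct_iff[OF L(1)] by simp
  have len: "length (js @ [a, b]) = p" using mset_eq_length[OF L(1)] by simp
  have sgL: "i \<in> set (js @ [a, b]) \<Longrightarrow> s i \<in> {1, -1}" for i using sg unfolding sL by blast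
  have ud: "ups s (js @ [a, b]) = pos p s" "downs s (js @ [a, b]) = neg p s" using pos_neg[of p s, OF sg L(1)] by blast+
  have js: "js \<noteq> []" using len p by auto
  note P = pair_cyc[where s=s and n=n, OF dL sgL L(2,3) js] pair_base_props(2)[where s=s and n=n, OF dL sgL L(2,3)]
  let ?\<Phi> = "\<lambda>C x. case x of GenC i \<Rightarrow> C i | _ \<Rightarrow> (id :: real \<Rightarrow> real)"
  have "sconn (=) (cyc s [1..<Suc p] n)" unfolding L(4) by (rule P(1))
  moreover have "continuous_on (cyc s [1..<Suc p] n) ?\<Phi>"
  proof (rule continuous_on_coordinatewise_then_product)
    fix x show "continuous_on (cyc s [1..<Suc p] n) (\<lambda>C. ?\<Phi> C x)"
      by (cases x) (auto intro: continuous_on_product_then_coordinatewise continuous_on_id)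
  qed
  ultimately have c: "sconn zeq (lifted_reps 0 p s n)" unfolding lifted_cyc[symmetric] by (rule sconn_image) simp
  have "lifted_reps 0 p s n \<noteq> {} \<longleftrightarrow> cyc s (js @ [a, b]) n \<noteq> {}" unfolding lifted_cyc[symmetric] L(4) by blast
  moreover have "s a = 1 \<or> s a = -1" using sgL[of a] by auto
  moreover have "ups s js \<ge> 0" "downs s js \<ge> 0" unfolding ups_def downs_def by (intro sum_list_nonneg; auto)+
  moreover have "downs s js = 0 \<and> ups s js = int (length js)" if "\<forall>j\<in>set js. s j = 1"
    using that by (induct js) (auto simp: ups_def downs_def)
  moreover have "ups s (js @ [a, b]) = ups s js + (if s a = -1 then 0 else 1) + 1" "downs s (js @ [a, b]) = downs s js + (if s a = 1 then 0 else 1)"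
    using L(2) by (simp_all add: ups_def downs_def)
  ultimately have "lifted_reps 0 p s n \<noteq> {} \<longleftrightarrow> 2 - neg p s \<le> n \<and> n \<le> pos p s - 2 \<or>
    n = 0 \<and> pos p s > 0 \<and> neg p s > 0 \<or> n = 1 \<and> neg p s = 0 \<or> n = -1 \<and> pos p s = 0"
    using P(2,3) L(3) ud len p by (elim disjE) (simp; linarith)+
  then show ?thesis using c by blast
qed

theorem lifted_reps_genus_zero:
  assumes "p \<ge> 3" "\<And>i. i \<in> {1..p} \<Longrightarrow> s i \<in> {1, -1}"
  shows "sconn zeq (lifted_reps 0 p s n)"
    "lifted_reps 0 p s n \<noteq> {} \<longleftrightarrow> 2 - neg p s \<le> n \<and> n \<le> pos p s - 2 \<or>
       n = 0 \<and> pos p s > 0 \<and> neg p s > 0 \<or> n = 1 \<and> neg p s = 0 \<or> n = -1 \<and> pos p s = 0"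
proof -
  have "sconn zeq (lifted_reps 0 p s n) \<and> (lifted_reps 0 p s n \<noteq> {} \<longleftrightarrow> 2 - neg p s \<le> n \<and> n \<le> pos p s - 2 \<or>
    n = 0 \<and> pos p s > 0 \<and> neg p s > 0 \<or> n = 1 \<and> neg p s = 0 \<or> n = -1 \<and> pos p s = 0)"
  proof (cases "\<exists>i\<in>{1..p}. s i = 1")
    case True
    then obtain i where i: "i \<in> {1..p}" "s i = 1" by blast
    show ?thesis by (rule lifted_reps_genus_zero_aux[of p s i n, OF assms i])
  next
    case False
    have n1: "- s i \<in> {1, -1}" if "i \<in> {1..p}" for i using assms(2)[OF that] by auto
    have p1: "1 \<in> {1..p}" using assms(1) by simp
    have n2: "- s 1 = 1"
    proof -
      have "s 1 = 1 \<or> s 1 = -1" "s 1 \<noteq> 1" using assms(2)[OF p1] False p1 by blast+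
      then show ?thesis by simp
    qed
    have *: "sconn zeq (lifted_reps 0 p (\<lambda>i. - s i) (- n)) \<and> (lifted_reps 0 p (\<lambda>i. - s i) (- n) \<noteq> {} \<longleftrightarrow>
      2 - neg p (\<lambda>i. - s i) \<le> - n \<and> - n \<le> pos p (\<lambda>i. - s i) - 2 \<or>
      - n = 0 \<and> pos p (\<lambda>i. - s i) > 0 \<and> neg p (\<lambda>i. - s i) > 0 \<or> - n = 1 \<and> neg p (\<lambda>i. - s i) = 0 \<or> - n = -1 \<and> pos p (\<lambda>i. - s i) = 0)"
      by (rule lifted_reps_genus_zero_aux[of p "\<lambda>i. - s i" 1 "- n", OF assms(1) n1 p1 n2])
    have "sconn zeq (lifted_reps 0 p s n)" by (rule sconn_mirr[OF conjunct1[OF *]])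
    moreover have "lifted_reps 0 p s n \<noteq> {} \<longleftrightarrow> 2 - neg p s \<le> n \<and> n \<le> pos p s - 2 \<or>
      n = 0 \<and> pos p s > 0 \<and> neg p s > 0 \<or> n = 1 \<and> neg p s = 0 \<or> n = -1 \<and> pos p s = 0"
    proof -
      have "2 - pos p s \<le> - n \<and> - n \<le> neg p s - 2 \<or> - n = 0 \<and> neg p s > 0 \<and> pos p s > 0 \<or> - n = 1 \<and> pos p s = 0 \<or> - n = -1 \<and> neg p s = 0 \<longleftrightarrow>
        2 - neg p s \<le> n \<and> n \<le> pos p s - 2 \<or> n = 0 \<and> pos p s > 0 \<and> neg p s > 0 \<or> n = 1 \<and> neg p s = 0 \<or> n = -1 \<and> pos p s = 0"
        by presburger
      with conjunct2[OF *] show ?thesis unfolding pos_mirr mirr_nonempty[of 0 p s n, symmetric] by (simp only:)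
    qed
    ultimately show ?thesis by blast
  qed
  then show "sconn zeq (lifted_reps 0 p s n)"
    "lifted_reps 0 p s n \<noteq> {} \<longleftrightarrow> 2 - neg p s \<le> n \<and> n \<le> pos p s - 2 \<or>
       n = 0 \<and> pos p s > 0 \<and> neg p s > 0 \<or> n = 1 \<and> neg p s = 0 \<or> n = -1 \<and> pos p s = 0" by blast+
qed

subsection \<open>Coordinates on the universal cover\<close>

definition mt :: "real \<Rightarrow> real \<Rightarrow> real \<Rightarrow> real \<Rightarrow> mat2" where
  "mt a b c d = vector [vector [a, b], vector [c, d]]"

lemma mt_nth [simp]: "mt a b c d $ 1 $ 1 = a" "mt a b c d $ 1 $ 2 = b" "mt a b c d $ 2 $ 1 = c" "mt a b c d $ 2 $ 2 = d"
  by (simp_all add: mt_def)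

lemma mat2_eq_iff: "(A::mat2) = B \<longleftrightarrow> A$1$1 = B$1$1 \<and> A$1$2 = B$1$2 \<and> A$2$1 = B$2$1 \<and> A$2$2 = B$2$2"
  by (auto simp: vec_eq_iff forall_2)

lemma mt_collapse: "mt (A$1$1) (A$1$2) (A$2$1) (A$2$2) = A" by (simp add: mat2_eq_iff)
lemma mt_mult: "mt a b c d ** mt a' b' c' d' = mt (a*a' + b*c') (a*b' + b*d') (c*a' + d*c') (c*b' + d*d')"
  by (simp add: mat2_eq_iff matrix_matrix_mult_def sum_2)
lemma mt_det: "det (mt a b c d) = a * d - b * c" by (simp add: det_2)
lemma mt_one: "mat 1 = mt 1 0 0 1" by (simp add: mat2_eq_iff mat_def)
lemma mt_uminus: "- mt a b c d = mt (- a) (- b) (- c) (- d)" by (simp add: mat2_eq_iff)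
lemma mt_add: "mt a b c d + mt a' b' c' d' = mt (a + a') (b + b') (c + c') (d + d')" by (simp add: mat2_eq_iff)
lemma mt_scale: "x *\<^sub>R mt a b c d = mt (x * a) (x * b) (x * c) (x * d)" by (simp add: mat2_eq_iff)
lemma mt_trace: "trace (mt a b c d) = a + d" by (simp add: trace_def sum_2)
lemma mem_SL2R: "A \<in> carrier SL2R \<longleftrightarrow> det A = 1" by (simp add: SL2R_def)

lemma continuous_on_mt:
  assumes "continuous_on S a" "continuous_on S b" "continuous_on S c" "continuous_on S d"
  shows "continuous_on S (\<lambda>x. mt (a x) (b x) (c x) (d x))"
proof -
  have "continuous_on S (\<lambda>x. a x *\<^sub>R mt 1 0 0 0 + b x *\<^sub>R mt 0 1 0 0 + c x *\<^sub>R mt 0 0 1 0 + d x *\<^sub>R mt 0 0 0 1)"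
    by (intro continuous_intros assms)
  then show ?thesis by (simp add: mt_scale mt_add)
qed

lemma psl_mult: "A \<in> carrier SL2R \<Longrightarrow> B \<in> carrier SL2R \<Longrightarrow> psl_class A \<otimes>\<^bsub>PSL2R\<^esub> psl_class B = psl_class (A ** B)"
  using normal.rcos_sum[OF normal_pm_one, of A B] by (simp add: PSL2R_def FactGroup_def psl_class_def) (simp add: SL2R_def)

lemma psl_one: "\<one>\<^bsub>PSL2R\<^esub> = psl_class (mat 1)"
  by (simp add: PSL2R_def FactGroup_def psl_class_eq)

lemma psl_class_in [simp]: "det A = 1 \<Longrightarrow> psl_class A \<in> carrier PSL2R"
  by (simp add: carrier_PSL2R mem_SL2R)

lemma psl_class_iff: "psl_class A = psl_class B \<longleftrightarrow> A = B \<or> A = - B"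
  unfolding psl_class_eq by (auto simp: doubleton_eq_iff)

text \<open>Iwasawa coordinates. They identify the lifted group with a real vector space, in which
  paths with common ends are deformed linearly.\<close>

definition mk :: "real \<times> real \<times> real \<Rightarrow> real \<Rightarrow> real" where
  "mk e = T (fst e) \<circ> Uz (fst (snd e)) (snd (snd e))"

definition pmat :: "real \<times> real \<times> real \<Rightarrow> mat2" where
  "pmat = (\<lambda>(\<theta>, l, t). mt (exp l * cos (pi * \<theta>)) (- t * exp l * cos (pi * \<theta>) - exp (- l) * sin (pi * \<theta>))
     (exp l * sin (pi * \<theta>)) (- t * exp l * sin (pi * \<theta>) + exp (- l) * cos (pi * \<theta>)))"

definition pm :: "real \<times> real \<times> real \<Rightarrow> mat2 set" where "pm e = psl_class (pmat e)"

lemma mk_Gt [simp]: "mk e \<in> Gt" by (simp add: mk_def)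

lemma lifts_cong: "lifts a b c d F \<Longrightarrow> a = a' \<Longrightarrow> b = b' \<Longrightarrow> c = c' \<Longrightarrow> d = d' \<Longrightarrow> lifts a' b' c' d' F"
  by simp

lemma lifts_mk: "lifts (pmat e $ 1 $ 1) (pmat e $ 1 $ 2) (pmat e $ 2 $ 1) (pmat e $ 2 $ 2) (mk e)"
  unfolding mk_def by (rule lifts_cong[OF lifts_comp[OF lifts_T lifts_Uz]])
    (simp_all add: pmat_def case_prod_unfold algebra_simps)

lemma det_pmat [simp]: "det (pmat e) = 1" using lifts_mk[of e] by (simp add: lifts_def det_2)

lemma pm_lifts: assumes "lifts a b c d (mk e)" shows "pm e = psl_class (mt a b c d)"
proof -
  have "mt a b c d = pmat e" using lifts_matrix_unique[OF assms lifts_mk] by (simp add: mat2_eq_iff)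
  then show ?thesis by (simp add: pm_def)
qed

lemma pm_in [simp]: "pm e \<in> carrier PSL2R" by (simp add: pm_def)

lemma mk_inj: assumes "mk e = mk e'" shows "e = e'"
proof -
  obtain \<theta> l t \<theta>' l' t' where e: "e = (\<theta>, l, t)" "e' = (\<theta>', l', t')" by (cases e, cases e')
  have "\<theta> = \<theta>'" using fun_cong[OF assms, of 0] by (simp add: e mk_def T_def)
  then have "Uz l t = Uz l' t'" using assms by (simp add: e mk_def T_def fun_eq_iff)
  then have "exp l = exp l'" "- t * exp l = - t' * exp l'"
    using lifts_matrix_unique[of _ _ _ _ "Uz l t", OF lifts_Uz] lifts_Uz[of l' t'] by metis+
  then show ?thesis using \<open>\<theta> = \<theta>'\<close> by (simp add: e)
qed

definition co :: "(real \<Rightarrow> real) \<Rightarrow> real \<times> real \<times> real" where "co = inv_into UNIV mk"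

lemma co_mk [simp]: "co (mk e) = e"
  unfolding co_def by (rule inv_f_f) (auto intro: injI mk_inj)

lemma mk_co [simp]: assumes "F \<in> Gt" shows "mk (co F) = F"
proof -
  obtain l t where "F = T (F 0) \<circ> Uz l t" using Gt_decomp[OF assms] .
  then have "F = mk (F 0, l, t)" by (simp add: mk_def)
  then show ?thesis using co_mk by metis
qed

lemma co_id [simp]: "co id = (0, 0, 0)" using co_mk[of "(0, 0, 0)"] by (simp add: mk_def)

lemma continuous_on_mk: "continuous_on S mk"
  unfolding mk_def
proof (rule continuous_on_coordinatewise_then_product)
  fix x show "continuous_on S (\<lambda>e. (T (fst e) \<circ> Uz (fst (snd e)) (snd (snd e))) x)"
    unfolding T_def comp_apply by (intro continuous_intros)
qed

text \<open>In the cotangent an upper triangular matrix acts by an affine map, from which both of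
  its parameters can be recovered.\<close>

lemma Uz_cot: assumes "0 < x" "x < 1"
  shows "cot (pi * Uz l t x) = exp (2 * l) * (cot (pi * x) - t)"
proof -
  have s: "sin (pi * x) > 0" using assms by (intro sin_gt_zero) auto
  obtain r where r: "r > 0" "exp l * cos (pi * x) + - t * exp l * sin (pi * x) = r * cos (pi * Uz l t x)"
    "0 * cos (pi * x) + exp (- l) * sin (pi * x) = r * sin (pi * Uz l t x)"
    using lifts_Uz[of l t] unfolding lifts_def by blast
  have "cot (pi * Uz l t x) = (r * cos (pi * Uz l t x)) / (r * sin (pi * Uz l t x))" using r(1) by (simp add: cot_def)
  also have "\<dots> = (exp l * (cos (pi * x) - t * sin (pi * x))) / (exp (- l) * sin (pi * x))"
    using r(2,3) by (simp add: algebra_simps)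
  also have "\<dots> = exp (2 * l) * (cot (pi * x) - t)"
  proof -
    have "E * (C - t * S) / (inverse E * S) = E * E * (C / S - t)" if "E > 0" "S > 0" for E C S :: real
      using that by (simp add: divide_simps)
    from this[of "exp l" "sin (pi * x)" "cos (pi * x)"] show ?thesis
      using s exp_add[of l l] by (simp add: cot_def exp_minus)
  qed
  finally show ?thesis .
qed

text \<open>The directions 1/4 and 1/2 have cotangents 1 and 0. So the coordinates are continuous
  expressions in the values at 0, 1/4 and 1/2, and pointwise convergence controls them.\<close>

lemma continuous_on_co: "continuous_on Gt co"
proof -
  define c where "c x F = cot (pi * (F x - F 0))" for x and F :: "real \<Rightarrow> real"
  have c: "c x F = exp (2 * fst (snd (co F))) * (cot (pi * x) - snd (snd (co F)))" if "F \<in> Gt" "0 < x" "x < 1" for F x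
  proof -
    define e where "e = co F"
    have F: "F = mk e" using that(1) by (simp add: e_def)
    show ?thesis using Uz_cot[OF that(2,3)] unfolding c_def e_def[symmetric] unfolding F by (simp add: mk_def T_def)
  qed
  have 14: "cot (pi * (1/4)) = 1" "cot (pi * (1/2)) = 0" by (simp_all add: cot_def sin_45 cos_45)
  have e: "co F = (F 0, ln (c (1/4) F - c (1/2) F) / 2, - c (1/2) F / (c (1/4) F - c (1/2) F))" if "F \<in> Gt" for F
  proof -
    obtain \<theta> l t where e: "co F = (\<theta>, l, t)" by (cases "co F")
    have "\<theta> = F 0" using fun_cong[OF mk_co[OF that], of 0] unfolding e by (simp add: mk_def T_def)
    moreover have "c (1/4) F = exp (2 * l) * (1 - t)" "c (1/2) F = - exp (2 * l) * t"
      using c[OF that, of "1/4"] c[OF that, of "1/2"] 14 by (simp_all add: e)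
    ultimately show ?thesis unfolding e by (simp add: algebra_simps)
  qed
  have cc: "continuous_on Gt (c x)" if "0 < x" "x < 1" for x
  proof -
    have F: "continuous_on Gt (\<lambda>F. F y)" for y :: real
      by (rule continuous_on_product_then_coordinatewise[OF continuous_on_id])
    have cy: "continuous_on Gt (\<lambda>F. pi * (F x - F 0))"
      by (rule continuous_on_mult[OF continuous_on_const continuous_on_diff[OF F F]])
    have "sin (pi * (F x - F 0)) \<noteq> 0" if F: "F \<in> Gt" for F
    proof -
      have "0 < F x - F 0" "F x - F 0 < 1"
        using Gt_less[OF F \<open>0 < x\<close>] Gt_less[OF F, of x 1] Gt_period[OF F, of 0] \<open>x < 1\<close> by simp_all
      then have "sin (pi * (F x - F 0)) > 0" by (intro sin_gt_zero) auto
      then show ?thesis by simp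
    qed
    then show ?thesis unfolding c_def cot_def
      by (intro continuous_on_divide continuous_on_compose2[OF continuous_on_cos[OF continuous_on_id, of UNIV] cy]
          continuous_on_compose2[OF continuous_on_sin[OF continuous_on_id, of UNIV] cy]) auto
  qed
  have pos: "c (1/4) F - c (1/2) F > 0" if "F \<in> Gt" for F
  proof -
    have "c (1/4) F - c (1/2) F = exp (2 * fst (snd (co F)))"
      using c[OF that, of "1/4"] c[OF that, of "1/2"] 14 by (simp add: algebra_simps)
    then show ?thesis by simp
  qed
  have nz: "c (1/4) F - c (1/2) F \<noteq> 0" if "F \<in> Gt" for F using pos[OF that] by simp
  have c4: "continuous_on Gt (c (1/4))" and c2: "continuous_on Gt (c (1/2))" by (rule cc; simp)+
  have "continuous_on Gt (\<lambda>F. (F 0, ln (c (1/4) F - c (1/2) F) / 2, - c (1/2) F / (c (1/4) F - c (1/2) F)))"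
    by (intro continuous_intros c4 c2 continuous_on_product_then_coordinatewise[OF continuous_on_id])
      (use nz pos in \<open>auto simp: less_imp_neq\<close>)
  then show ?thesis by (rule continuous_on_eq) (use e in simp)
qed

definition cls :: "(real \<Rightarrow> real) \<Rightarrow> mat2 set" where "cls F = pm (co F)"

lemma cls_lifts: assumes "lifts a b c d F" shows "cls F = psl_class (mt a b c d)"
  unfolding cls_def by (rule pm_lifts) (use assms lifts_Gt[OF assms] in simp)

lemma cls_in [simp]: "cls F \<in> carrier PSL2R" by (simp add: cls_def)

lemma cls_comp: assumes "F \<in> Gt" "G \<in> Gt" shows "cls (F \<circ> G) = cls F \<otimes>\<^bsub>PSL2R\<^esub> cls G"
proof -
  obtain a b c d a' b' c' d' where L: "lifts a b c d F" "lifts a' b' c' d' G" using assms unfolding Gt_def by blast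
  have "det (mt a b c d) = 1" "det (mt a' b' c' d') = 1" using L by (simp_all add: lifts_def mt_det)
  then show ?thesis unfolding cls_lifts[OF L(1)] cls_lifts[OF L(2)] cls_lifts[OF lifts_comp[OF L]]
    by (simp add: psl_mult mem_SL2R mt_mult)
qed

lemma cls_id [simp]: "cls id = \<one>\<^bsub>PSL2R\<^esub>"
  unfolding cls_lifts[OF lifts_id] psl_one mt_one ..

lemma cls_surj: assumes "P \<in> carrier PSL2R" obtains F where "F \<in> Gt" "cls F = P"
proof -
  obtain A where A: "det A = 1" "P = psl_class A" using assms by (auto simp: carrier_PSL2R mem_SL2R)
  then have "A$1$1 * A$2$2 - A$1$2 * A$2$1 = 1" by (simp add: det_2)
  then obtain \<theta> l t where L: "lifts (A$1$1) (A$1$2) (A$2$1) (A$2$2) (T \<theta> \<circ> Uz l t)" using lifts_exists by blast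
  show ?thesis using that[OF lifts_Gt[OF L]] cls_lifts[OF L] A(2) by (simp add: mt_collapse)
qed

text \<open>The kernel of the projection consists of the integer translations; even ones lift the
  identity matrix, odd ones its negative.\<close>

lemma cls_eq_iff: assumes "F \<in> Gt" "G \<in> Gt" shows "cls F = cls G \<longleftrightarrow> (\<exists>k::int. G = T (of_int k) \<circ> F)"
proof
  obtain a b c d a' b' c' d' where L: "lifts a b c d F" "lifts a' b' c' d' G" using assms unfolding Gt_def by blast
  assume "cls F = cls G"
  then have "mt a' b' c' d' = mt a b c d \<or> mt a' b' c' d' = - mt a b c d"
    unfolding cls_lifts[OF L(1)] cls_lifts[OF L(2)] psl_class_iff by auto
  then obtain k :: int where "\<And>x. G x = F x + of_int k"
    using lifts_unique_mod[OF L] by (auto simp: mat2_eq_iff)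
  then have "G = T (of_int k) \<circ> F" by (simp add: fun_eq_iff T_def)
  then show "\<exists>k::int. G = T (of_int k) \<circ> F" by blast
next
  have one: "cls (T (of_int k)) = \<one>\<^bsub>PSL2R\<^esub>" for k :: int
  proof -
    have "sin (pi * of_int k) = 0" unfolding sin_eq_0_pi by blast
    moreover from this have "cos (pi * of_int k) = 1 \<or> cos (pi * of_int k) = -1"
      using sin_cos_squared_add[of "pi * of_int k"] by (simp add: power2_eq_1_iff)
    ultimately show ?thesis unfolding cls_lifts[OF lifts_T] psl_one mt_one psl_class_iff mt_uminus by auto
  qed
  assume "\<exists>k::int. G = T (of_int k) \<circ> F"
  then obtain k :: int where "G = T (of_int k) \<circ> F" by blast
  then show "cls F = cls G" using cls_comp[OF T_Gt assms(1), of "of_int k"] one monoid.l_one[OF group.is_monoid[OF group_PSL2R] cls_in] by simp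
qed

lemma continuous_map_pm: "continuous_map euclidean PSL2R_topology pm"
proof -
  have "continuous_on UNIV pmat"
    unfolding pmat_def case_prod_unfold by (intro continuous_on_mt continuous_intros)
  then have "continuous_map euclidean (top_of_set (carrier SL2R)) pmat"
    by (auto simp: continuous_map_in_subtopology mem_SL2R)
  then show ?thesis unfolding pm_def
    using continuous_map_compose[OF _ quotient_imp_continuous_map[OF quotient_map_psl_class]] by (simp add: o_def)
qed

lemma continuous_map_pm_comp: "continuous_on S f \<Longrightarrow> continuous_map (top_of_set S) PSL2R_topology (\<lambda>x. pm (f x))"
  using continuous_map_compose[OF _ continuous_map_pm, of "top_of_set S" f] by (simp add: o_def)

lemma continuous_map_cls: "continuous_map (top_of_set Gt) PSL2R_topology cls"
proof -
  show ?thesis unfolding cls_def[abs_def] by (rule continuous_map_pm_comp[OF continuous_on_co])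
qed

subsection \<open>Path lifting\<close>

text \<open>The square of the first column and the inner product of the columns do not depend on the sign of the matrix and
  determine it up to sign.\<close>

definition ws :: "mat2 set \<Rightarrow> complex \<times> real" where
  "ws X = the_elem ((\<lambda>A. ((of_real (A$1$1) + \<i> * of_real (A$2$1))\<^sup>2, A$1$1 * A$1$2 + A$2$1 * A$2$2)) ` X)"

lemma ws_psl: "ws (psl_class A) = ((of_real (A$1$1) + \<i> * of_real (A$2$1))\<^sup>2, A$1$1 * A$1$2 + A$2$1 * A$2$2)"
proof -
  have "(- of_real a - \<i> * of_real c)\<^sup>2 = (of_real a + \<i> * of_real c)\<^sup>2" for a c :: real
    by (simp add: power2_eq_square algebra_simps)
  then show ?thesis unfolding ws_def psl_class_eq by simp
qed

lemma continuous_map_ws: "continuous_map PSL2R_topology euclidean ws"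
proof (rule continuous_compose_quotient_map[OF quotient_map_psl_class])
  have "continuous_map (top_of_set (carrier SL2R)) euclidean
    (\<lambda>A::mat2. ((of_real (A$1$1) + \<i> * of_real (A$2$1))\<^sup>2 :: complex, A$1$1 * A$1$2 + A$2$1 * A$2$2))"
    unfolding continuous_map_iff_continuous by (intro continuous_intros)
  then show "continuous_map (top_of_set (carrier SL2R)) euclidean (ws \<circ> psl_class)" by (simp add: o_def ws_psl)
qed

lemma ws_pm: "ws (pm (\<theta>, l, t)) = (exp (Complex (2 * l) (2 * (pi * \<theta>))), - t * exp (2 * l))"
proof -
  have "of_real (exp l * cos (pi * \<theta>)) + \<i> * of_real (exp l * sin (pi * \<theta>)) = exp (Complex l (pi * \<theta>))"
    by (simp add: exp_eq_polar complex_eq_iff cis.ctr)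
  moreover have "(exp (Complex l (pi * \<theta>)))\<^sup>2 = exp (Complex (2 * l) (2 * (pi * \<theta>)))"
  proof -
    have "Complex (2 * l) (2 * (pi * \<theta>)) = 2 * Complex l (pi * \<theta>)" by (simp add: complex_eq_iff)
    then show ?thesis by (simp only: exp_double)
  qed
  moreover have "E * C * (- t * E * C - F * S) + E * S * (- t * E * S + F * C) = - t * (E * E) * (C * C + S * S)" for E C S F :: real
    by (simp add: algebra_simps)
  from this[of "exp l" "cos (pi * \<theta>)" "exp (- l)" "sin (pi * \<theta>)"]
  have "exp l * cos (pi * \<theta>) * (- t * exp l * cos (pi * \<theta>) - exp (- l) * sin (pi * \<theta>)) +
    exp l * sin (pi * \<theta>) * (- t * exp l * sin (pi * \<theta>) + exp (- l) * cos (pi * \<theta>)) = - t * exp (2 * l)"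
    using exp_add[of l l] by (simp flip: power2_eq_square)
  ultimately show ?thesis by (simp only: pm_def ws_psl pmat_def case_prod_conv mt_nth)
qed

lemma pm_eq_iff: "pm e = pm e' \<longleftrightarrow> (\<exists>k::int. e' = (fst e + of_int k, snd e))"
proof -
  have "pm e = pm e' \<longleftrightarrow> (\<exists>k::int. mk e' = T (of_int k) \<circ> mk e)"
    using cls_eq_iff[of "mk e" "mk e'"] by (simp add: cls_def)
  moreover have "T (of_int k) \<circ> mk e = mk (fst e + of_int k, snd e)" for k :: int by (simp add: mk_def o_assoc add.commute)
  ultimately show ?thesis using mk_inj by metis
qed

lemma pm_ws:
  assumes "Y \<in> carrier PSL2R" "ws Y = (exp w, s)" shows "pm (Im w / (2 * pi), Re w / 2, - s * exp (- Re w)) = Y"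
proof -
  obtain F where F: "F \<in> Gt" "cls F = Y" using cls_surj[OF assms(1)] .
  obtain \<theta> l t where e: "co F = (\<theta>, l, t)" by (cases "co F")
  have Y: "Y = pm (\<theta>, l, t)" using F(2) by (simp add: cls_def e)
  have "exp w = exp (Complex (2 * l) (2 * (pi * \<theta>)))" and s: "s = - t * exp (2 * l)" using assms(2) unfolding Y ws_pm by auto
  then obtain n :: int where "w = Complex (2 * l) (2 * (pi * \<theta>)) + of_int (2 * n) * pi * \<i>" unfolding exp_eq by blast
  then have w: "Re w = 2 * l" "Im w = 2 * pi * (\<theta> + of_int n)" by (simp_all add: algebra_simps)
  have "t * exp (2 * l) * exp (- (2 * l)) = t" by (simp flip: exp_add)
  then show ?thesis unfolding Y pm_eq_iff w s by (intro exI[of _ "- n"]) simp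
qed

text \<open>Through \<open>ws\<close> a map into PSL(2,R) becomes a map into the punctured plane
  times a line, and on a contractible domain its first component has a continuous logarithm.\<close>

lemma lift_map:
  fixes S :: "'a::real_normed_vector set"
  assumes "contractible S" "continuous_map (top_of_set S) PSL2R_topology H"
  obtains Q where "continuous_on S Q" "\<And>x. x \<in> S \<Longrightarrow> pm (Q x) = H x"
proof -
  have "continuous_map (top_of_set S) euclidean (ws \<circ> H)" by (rule continuous_map_compose[OF assms(2) continuous_map_ws])
  then have c: "continuous_on S (\<lambda>x. ws (H x))" by (simp add: o_def)
  have H: "H x \<in> carrier PSL2R" if "x \<in> S" for x
    using continuous_map_image_subset_topspace[OF assms(2)] that unfolding topspace_PSL2R_topology by auto
  have nz: "fst (ws (H x)) \<noteq> 0" if x: "x \<in> S" for x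
  proof -
    obtain F where "cls F = H x" using cls_surj[OF H[OF x]] by blast
    then have "H x = pm (co F)" by (simp add: cls_def)
    then show ?thesis by (cases "co F") (simp add: ws_pm)
  qed
  obtain g where g: "continuous_on S g" "\<And>x. x \<in> S \<Longrightarrow> fst (ws (H x)) = exp (g x)"
    using continuous_logarithm_on_contractible[OF continuous_on_fst[OF c] assms(1) nz] by blast
  show ?thesis
  proof (rule that)
    show "continuous_on S (\<lambda>x. (Im (g x) / (2 * pi), Re (g x) / 2, - snd (ws (H x)) * exp (- Re (g x))))"
      by (intro continuous_intros g c) auto
    show "pm (Im (g x) / (2 * pi), Re (g x) / 2, - snd (ws (H x)) * exp (- Re (g x))) = H x" if "x \<in> S" for x
      by (rule pm_ws[OF H[OF that]]) (simp flip: g(2)[OF that])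
  qed
qed

lemma lift_unique:
  fixes Q Q' :: "'a::real_normed_vector \<Rightarrow> real \<times> real \<times> real"
  assumes "connected S" "continuous_on S Q" "continuous_on S Q'" "\<And>x. x \<in> S \<Longrightarrow> pm (Q x) = pm (Q' x)"
    and x0: "x0 \<in> S" "Q x0 = Q' x0" and x: "x \<in> S"
  shows "Q x = Q' x"
proof -
  have k: "\<exists>k::int. Q' x = (fst (Q x) + of_int k, snd (Q x))" if "x \<in> S" for x using assms(4)[OF that] unfolding pm_eq_iff .
  define d where "d x = fst (Q' x) - fst (Q x)" for x
  have di: "\<exists>k::int. d x = of_int k" if "x \<in> S" for x using k[OF that] by (auto simp: d_def)
  have "d constant_on S"
  proof (rule continuous_discrete_range_constant[OF assms(1)])
    show "continuous_on S d" unfolding d_def by (intro continuous_intros assms)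
    fix x assume x: "x \<in> S"
    have "1 \<le> norm (d y - d x)" if y: "y \<in> S" "d y \<noteq> d x" for y
    proof -
      obtain k m :: int where km: "d x = of_int k" "d y = of_int m" using di x y(1) by blast
      then have "1 \<le> \<bar>m - k\<bar>" using y(2) by auto
      then have "(1::real) \<le> of_int \<bar>m - k\<bar>" by (simp only: of_int_1_le_iff)
      then show ?thesis by (simp add: km)
    qed
    then show "\<exists>e>0. \<forall>y. y \<in> S \<and> d y \<noteq> d x \<longrightarrow> e \<le> norm (d y - d x)" by (intro exI[of _ 1]) auto
  qed
  then have "d x = d x0" using x x0 unfolding constant_on_def by auto
  then have "d x = 0" using x0 by (simp add: d_def)
  then show ?thesis using k[OF x] by (auto simp: d_def)
qed

text \<open>The homotopy is constant along the two sides where the ends of the paths run. By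
  uniqueness its lift is constant there too, so homotopic paths have lifts with the same
  ends.\<close>

lemma homotopy_lift:
  assumes hom: "homotopic_with (\<lambda>r. r 0 = a \<and> r 1 = b) (top_of_set {0..1::real}) PSL2R_topology p p'"
    and q: "continuous_on {0..1} q" "\<And>r. r \<in> {0..1} \<Longrightarrow> pm (q r) = p r"
  obtains q' where "continuous_on {0..1} q'" "\<And>r. r \<in> {0..1} \<Longrightarrow> pm (q' r) = p' r" "q' 0 = q 0" "q' 1 = q 1"
proof -
  let ?I = "{0..1::real}"
  obtain h where h: "continuous_map (top_of_set (?I \<times> ?I)) PSL2R_topology h" "\<And>x. h (0, x) = p x" "\<And>x. h (1, x) = p' x"
    "\<And>t. t \<in> ?I \<Longrightarrow> h (t, 0) = a \<and> h (t, 1) = b"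
    using hom unfolding homotopic_with_def by auto
  have "contractible (?I \<times> ?I)" by (intro convex_imp_contractible convex_Times) auto
  then obtain Q0 where Q0: "continuous_on (?I \<times> ?I) Q0" "\<And>x. x \<in> ?I \<times> ?I \<Longrightarrow> pm (Q0 x) = h x"
    using lift_map h(1) by blast
  have "pm (Q0 (0, 0)) = pm (q 0)" using Q0(2)[of "(0, 0)"] q(2)[of 0] by (simp add: h(2))
  then obtain k :: int where k: "q 0 = (fst (Q0 (0, 0)) + of_int k, snd (Q0 (0, 0)))" unfolding pm_eq_iff by blast
  define Q where "Q x = (fst (Q0 x) + of_int k, snd (Q0 x))" for x
  have Q: "continuous_on (?I \<times> ?I) Q" unfolding Q_def by (intro continuous_intros Q0)
  have pQ: "pm (Q x) = h x" if "x \<in> ?I \<times> ?I" for x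
    using Q0(2)[OF that] pm_eq_iff[of "Q0 x" "Q x"] unfolding Q_def by auto
  have cl: "continuous_on ?I (\<lambda>r. Q (s, r))" if "s \<in> ?I" for s
    by (rule continuous_on_compose2[OF Q]) (use that in \<open>auto intro!: continuous_intros\<close>)
  have cr: "continuous_on ?I (\<lambda>s. Q (s, r))" if "r \<in> ?I" for r
    by (rule continuous_on_compose2[OF Q]) (use that in \<open>auto intro!: continuous_intros\<close>)
  have Q00: "Q (0, 0) = q 0" by (simp add: Q_def k)
  have 0: "Q (0, r) = q r" if "r \<in> ?I" for r
    by (rule lift_unique[OF _ cl q(1) _ _ Q00]) (use that pQ q(2) h(2) in auto)
  have 1: "Q (s, 0) = q 0" if "s \<in> ?I" for s
    by (rule lift_unique[OF _ cr continuous_on_const _ _ Q00]) (use that pQ h(4) pQ[of "(0, 0)"] Q00 in auto)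
  have 2: "Q (s, 1) = q 1" if "s \<in> ?I" for s
    by (rule lift_unique[OF _ cr continuous_on_const _ _ 0[of 1]]) (use that pQ h(4) pQ[of "(0, 1)"] 0[of 1] in auto)
  show ?thesis
    by (rule that[of "\<lambda>r. Q (1, r)"]) (use cl pQ h(3) 1 2 in auto)
qed

text \<open>Straight-line homotopy in the Iwasawa coordinates; it keeps the common ends.\<close>

lemma pm_path_hom:
  assumes q: "continuous_on {0..1::real} q" "continuous_on {0..1} q'" "q' 0 = q 0" "q' 1 = q 1"
    and p: "\<And>r. r \<in> {0..1} \<Longrightarrow> p r = pm (q r)" "\<And>r. r \<in> {0..1} \<Longrightarrow> p' r = pm (q' r)"
  shows "homotopic_with (\<lambda>r. r 0 = p 0 \<and> r 1 = p 1) (top_of_set {0..1}) PSL2R_topology p p'"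
proof (subst homotopic_with)
  define h where "h x = pm ((1 - fst x) *\<^sub>R q (snd x) + fst x *\<^sub>R q' (snd x))" for x
  have "continuous_on ({0..1} \<times> {0..1}) (\<lambda>x. (1 - fst x) *\<^sub>R q (snd x) + fst x *\<^sub>R q' (snd x))"
    by (intro continuous_intros continuous_on_compose2[OF q(1)] continuous_on_compose2[OF q(2)]) auto
  then have c: "continuous_map (prod_topology (top_of_set {0..1}) (top_of_set {0..1})) PSL2R_topology h"
    unfolding h_def prod_topology_subtopology_eu by (rule continuous_map_pm_comp)
  have e: "(1 - s) *\<^sub>R x + s *\<^sub>R x = x" for s :: real and x :: "real \<times> real \<times> real"
    by (simp flip: scaleR_left_distrib)
  have "h (0, x) = pm (q x)" "h (1, x) = pm (q' x)" "h (x, 0) = pm (q 0)" "h (x, 1) = pm (q 1)" for x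
    using q e by (simp_all add: h_def)
  then show "\<exists>h. continuous_map (prod_topology (top_of_set {0..1::real}) (top_of_set {0..1})) PSL2R_topology h \<and>
    (\<forall>x\<in>topspace (top_of_set {0..1}). h (0, x) = p x) \<and> (\<forall>x\<in>topspace (top_of_set {0..1}). h (1, x) = p' x) \<and>
    (\<forall>t\<in>{0..1}. h (t, 0) = p 0 \<and> h (t, 1) = p 1)"
    using c p by (intro exI[of _ h] conjI ballI) auto
qed auto

section \<open>Path classes as increasing maps\<close>

lemma path_class_eqI:
  assumes "homotopic_with (\<lambda>r. r 0 = p 0 \<and> r 1 = p 1) (top_of_set {0..1}) X p p'"
  shows "path_class X p = path_class X p'"
proof -
  have "p' 0 = p 0" "p' 1 = p 1" using homotopic_with_imp_property[OF assms] by auto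
  then show ?thesis unfolding path_class_def
    using assms homotopic_with_symD[OF assms] homotopic_with_trans by auto blast+
qed

text \<open>The isomorphism onto the universal covering group; the straight path in coordinates is a
  convenient representative of the class that ends at \<open>F\<close>.\<close>

definition Gam :: "(real \<Rightarrow> real) \<Rightarrow> (real \<Rightarrow> mat2 set) set" where
  "Gam F = path_class PSL2R_topology (\<lambda>r. pm (r *\<^sub>R co F))"

definition Gpath :: "(real \<Rightarrow> real) \<Rightarrow> (real \<Rightarrow> real \<Rightarrow> real) \<Rightarrow> bool" where
  "Gpath F f \<longleftrightarrow> continuous_on {0..1} f \<and> (\<forall>r\<in>{0..1}. f r \<in> Gt) \<and> f 0 = id \<and> f 1 = F"

lemma Gpath_coords: assumes "Gpath F f" shows "continuous_on {0..1} (\<lambda>r. co (f r))"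
  by (rule continuous_on_compose2[OF continuous_on_co]) (use assms in \<open>auto simp: Gpath_def\<close>)

lemma Gam_eqI:
  assumes "Gpath F f" "\<And>r. r \<in> {0..1} \<Longrightarrow> p r = cls (f r)"
  shows "path_class PSL2R_topology p = Gam F"
  unfolding Gam_def
  by (rule path_class_eqI[OF pm_path_hom[OF Gpath_coords[OF assms(1)], of "\<lambda>r. r *\<^sub>R co F"]])
    (use assms in \<open>auto simp: Gpath_def cls_def zero_prod_def intro!: continuous_intros\<close>)

lemma Gpath_mk: assumes "continuous_on {0..1} q" "q 0 = 0" shows "Gpath (mk (q 1)) (\<lambda>r. mk (q r))"
proof -
  have "continuous_on {0..1} (\<lambda>r. mk (q r))" by (rule continuous_on_compose2[OF continuous_on_mk assms(1)]) auto
  then show ?thesis using assms(2) by (simp add: Gpath_def mk_def zero_prod_def)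
qed

lemma Gam_self: "(\<lambda>r. pm (r *\<^sub>R co F)) \<in> Gam F"
  unfolding Gam_def path_class_def
  by (auto intro!: continuous_map_pm_comp continuous_intros)

lemma Gam_memD:
  assumes F: "F \<in> Gt" and p: "p \<in> Gam F" shows "\<exists>f. Gpath F f \<and> (\<forall>r\<in>{0..1}. p r = cls (f r))"
proof -
  obtain q' where q': "continuous_on {0..1} q'" "\<And>r. r \<in> {0..1} \<Longrightarrow> pm (q' r) = p r" "q' 0 = 0" "q' 1 = co F"
  proof (rule homotopy_lift[where q="\<lambda>r. r *\<^sub>R co F" and p'=p])
    show "homotopic_with (\<lambda>r. r 0 = pm (0 *\<^sub>R co F) \<and> r 1 = pm (1 *\<^sub>R co F)) (top_of_set {0..1}) PSL2R_topology (\<lambda>r. pm (r *\<^sub>R co F)) p"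
      using p unfolding Gam_def path_class_def by simp
  qed (auto intro!: continuous_intros)
  have "Gpath F (\<lambda>r. mk (q' r))" using Gpath_mk[OF q'(1,3)] q'(4) F by simp
  then show ?thesis using q'(2) by (intro exI[of _ "\<lambda>r. mk (q' r)"]) (simp add: cls_def)
qed

lemma cover_proj_Gam: assumes "F \<in> Gt" shows "cover_proj (Gam F) = cls F"
proof -
  have "p 1 \<in> {cls F}" if m: "p \<in> Gam F" for p
  proof -
    obtain f where f: "Gpath F f" "\<forall>r\<in>{0..1}. p r = cls (f r)" using Gam_memD[OF assms m] by blast
    then have "p 1 = cls (f 1)" by simp
    then show ?thesis using f(1) by (simp add: Gpath_def)
  qed
  then have "(\<lambda>p. p 1) ` Gam F \<subseteq> {cls F}" by (rule image_subsetI)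
  moreover have "(\<lambda>p. p 1) ` Gam F \<noteq> {}" using Gam_self[of F] by blast
  ultimately have "(\<lambda>p. p 1) ` Gam F = {cls F}" by (metis subset_singletonD)
  then show ?thesis by (simp add: cover_proj_def)
qed

text \<open>A path in the class of \<open>F\<close> has one lift that starts at the identity, and
  this lift ends at \<open>F\<close>.\<close>

lemma Gam_inj: assumes "F \<in> Gt" "G \<in> Gt" "Gam F = Gam G" shows "F = G"
proof -
  have "(\<lambda>r. pm (r *\<^sub>R co G)) \<in> Gam F" using Gam_self[of G] assms(3) by simp
  then obtain f where f: "Gpath F f" "\<forall>r\<in>{0..1}. pm (r *\<^sub>R co G) = cls (f r)" using Gam_memD[OF assms(1)] by blast
  have "co (f 1) = 1 *\<^sub>R co G"
    by (rule lift_unique[OF _ Gpath_coords[OF f(1)], of "\<lambda>r. r *\<^sub>R co G" 0])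
      (use f in \<open>auto simp: Gpath_def cls_def zero_prod_def intro!: continuous_intros\<close>)
  then have "co F = co G" using f(1) by (simp add: Gpath_def)
  then show ?thesis using mk_co assms by metis
qed

lemma carrier_tilde: "carrier SL2R_tilde = Gam ` Gt"
proof
  show "Gam ` Gt \<subseteq> carrier SL2R_tilde"
  proof
    fix u assume "u \<in> Gam ` Gt"
    then obtain F where F: "u = Gam F" by blast
    have "pathin PSL2R_topology (\<lambda>r. pm (r *\<^sub>R co F))"
      unfolding pathin_def by (intro continuous_map_pm_comp continuous_intros)
    moreover have "pm (0 *\<^sub>R co F) = \<one>\<^bsub>PSL2R\<^esub>" using cls_id by (simp add: cls_def zero_prod_def)
    ultimately show "u \<in> carrier SL2R_tilde" unfolding universal_cover_def F Gam_def by auto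
  qed
  show "carrier SL2R_tilde \<subseteq> Gam ` Gt"
  proof
    fix u assume "u \<in> carrier SL2R_tilde"
    then obtain p where p: "u = path_class PSL2R_topology p" "pathin PSL2R_topology p" "p 0 = \<one>\<^bsub>PSL2R\<^esub>"
      unfolding universal_cover_def by auto
    obtain q0 where q0: "continuous_on {0..1} q0" "\<And>r. r \<in> {0..1} \<Longrightarrow> pm (q0 r) = p r"
      using lift_map[of "{0..1::real}" p] p(2) by (auto simp: pathin_def convex_imp_contractible)
    have "pm (q0 0) = pm (0, 0, 0)" using q0(2)[of 0] p(3) cls_id by (simp add: cls_def)
    then obtain k :: int where k: "(0, 0, 0) = (fst (q0 0) + of_int k, snd (q0 0))" unfolding pm_eq_iff by blast
    define q where "q r = (fst (q0 r) + of_int k, snd (q0 r))" for r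
    have "continuous_on {0..1} q" unfolding q_def by (intro continuous_intros q0)
    moreover have "q 0 = 0" using k by (simp add: q_def zero_prod_def)
    ultimately have "Gpath (mk (q 1)) (\<lambda>r. mk (q r))" by (rule Gpath_mk)
    moreover have "p r = cls (mk (q r))" if "r \<in> {0..1}" for r
      using q0(2)[OF that] pm_eq_iff[of "q0 r" "q r"] by (auto simp: cls_def q_def)
    ultimately have "u = Gam (mk (q 1))" unfolding p(1) by (rule Gam_eqI)
    then show "u \<in> Gam ` Gt" by simp
  qed
qed

text \<open>Lifts of two representatives compose pointwise to a lift of their product, so the union
  in the definition of the product runs over copies of a single class.\<close>

lemma Gam_mult: assumes F: "F \<in> Gt" and G: "G \<in> Gt"
  shows "Gam F \<otimes>\<^bsub>SL2R_tilde\<^esub> Gam G = Gam (F \<circ> G)"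
proof -
  have K: "path_class PSL2R_topology (\<lambda>t. p t \<otimes>\<^bsub>PSL2R\<^esub> q t) = Gam (F \<circ> G)" if pq: "p \<in> Gam F" "q \<in> Gam G" for p q
  proof -
    obtain f where f: "Gpath F f" "\<forall>r\<in>{0..1}. p r = cls (f r)" using Gam_memD[OF F pq(1)] by blast
    obtain f' where f': "Gpath G f'" "\<forall>r\<in>{0..1}. q r = cls (f' r)" using Gam_memD[OF G pq(2)] by blast
    have "continuous_on {0..1} (\<lambda>r. f r \<circ> f' r)"
      by (rule continuous_on_Gt_comp) (use f f' in \<open>auto simp: Gpath_def\<close>)
    then have "Gpath (F \<circ> G) (\<lambda>r. f r \<circ> f' r)" using f f' unfolding Gpath_def by (simp add: comp_Gt)
    then show ?thesis by (rule Gam_eqI) (use f f' in \<open>auto simp: Gpath_def cls_comp\<close>)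
  qed
  have "Gam F \<otimes>\<^bsub>SL2R_tilde\<^esub> Gam G = (\<Union>p\<in>Gam F. \<Union>q\<in>Gam G. path_class PSL2R_topology (\<lambda>t. p t \<otimes>\<^bsub>PSL2R\<^esub> q t))"
    by (simp add: universal_cover_def)
  also have "\<dots> = (\<Union>p\<in>Gam F. \<Union>q\<in>Gam G. Gam (F \<circ> G))" by (intro SUP_cong HOL.refl K)
  also have "\<dots> = Gam (F \<circ> G)" using Gam_self[of F] Gam_self[of G] by blast
  finally show ?thesis .
qed

lemma Gam_one: "\<one>\<^bsub>SL2R_tilde\<^esub> = Gam id"
  unfolding universal_cover_def monoid.simps
  by (rule Gam_eqI[where f="\<lambda>_. id"]) (auto simp: Gpath_def)

lemma group_tilde: "group SL2R_tilde"
proof (rule groupI)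
  show "\<one>\<^bsub>SL2R_tilde\<^esub> \<in> carrier SL2R_tilde" unfolding carrier_tilde Gam_one by (rule imageI[OF id_Gt])
next
  fix x assume "x \<in> carrier SL2R_tilde"
  then obtain F where F: "F \<in> Gt" "x = Gam F" unfolding carrier_tilde by blast
  show "\<one>\<^bsub>SL2R_tilde\<^esub> \<otimes>\<^bsub>SL2R_tilde\<^esub> x = x" unfolding Gam_one F(2) Gam_mult[OF id_Gt F(1)] by simp
  have "Gam (ginv F) \<otimes>\<^bsub>SL2R_tilde\<^esub> x = \<one>\<^bsub>SL2R_tilde\<^esub>"
    unfolding F(2) Gam_mult[OF inv_Gt[OF F(1)] F(1)] Gam_one using F(1) by simp
  then show "\<exists>y\<in>carrier SL2R_tilde. y \<otimes>\<^bsub>SL2R_tilde\<^esub> x = \<one>\<^bsub>SL2R_tilde\<^esub>" using F(1) unfolding carrier_tilde by blast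
  fix y assume "y \<in> carrier SL2R_tilde"
  then obtain G where G: "G \<in> Gt" "y = Gam G" unfolding carrier_tilde by blast
  show "x \<otimes>\<^bsub>SL2R_tilde\<^esub> y \<in> carrier SL2R_tilde" unfolding F(2) G(2) Gam_mult[OF F(1) G(1)] carrier_tilde using F(1) G(1) by blast
  fix z assume "z \<in> carrier SL2R_tilde"
  then obtain H where H: "H \<in> Gt" "z = Gam H" unfolding carrier_tilde by blast
  show "x \<otimes>\<^bsub>SL2R_tilde\<^esub> y \<otimes>\<^bsub>SL2R_tilde\<^esub> z = x \<otimes>\<^bsub>SL2R_tilde\<^esub> (y \<otimes>\<^bsub>SL2R_tilde\<^esub> z)"
    unfolding F(2) G(2) H(2) Gam_mult[OF F(1) G(1)] Gam_mult[OF G(1) H(1)]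
      Gam_mult[OF comp_Gt[OF F(1) G(1)] H(1)] Gam_mult[OF F(1) comp_Gt[OF G(1) H(1)]] o_assoc ..
qed

lemma Gam_in [simp]: "F \<in> Gt \<Longrightarrow> Gam F \<in> carrier SL2R_tilde" unfolding carrier_tilde by blast

lemma Gam_inv: assumes "F \<in> Gt" shows "inv\<^bsub>SL2R_tilde\<^esub> (Gam F) = Gam (ginv F)"
proof (rule group.inv_equality[OF group_tilde])
  show "Gam (ginv F) \<otimes>\<^bsub>SL2R_tilde\<^esub> Gam F = \<one>\<^bsub>SL2R_tilde\<^esub>"
    unfolding Gam_mult[OF inv_Gt[OF assms] assms] Gam_one Gt_inv_comp[OF assms] ..
qed (use assms in simp_all)

lemma Gam_pow: "Gam (T (-1)) [^]\<^bsub>SL2R_tilde\<^esub> (n::int) = Gam (T (- of_int n))"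
proof -
  interpret group SL2R_tilde by (rule group_tilde)
  have nat: "Gam (T (-1)) [^]\<^bsub>SL2R_tilde\<^esub> (m::nat) = Gam (T (- real m))" for m
  proof (induct m)
    case 0 show ?case by (simp only: nat_pow_0 Gam_one of_nat_0 minus_zero T_0)
  next
    case (Suc m) then show ?case by (simp add: Gam_mult add.commute)
  qed
  show ?thesis
  proof (cases "n < 0")
    case True
    then show ?thesis unfolding int_pow_def2 by (simp add: nat Gam_inv)
  next
    case False
    then show ?thesis unfolding int_pow_def2 by (simp add: nat)
  qed
qed

subsection \<open>The exponential map and parabolic lifts\<close>

lemma cayley_hamilton: assumes "trace (X::mat2) = 0" shows "X ** X = (- det X) *\<^sub>R mat 1"
proof -
  have t: "X$2$2 = - X$1$1" using assms by (simp add: trace_def sum_2)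
  show ?thesis by (simp add: mat2_eq_iff matrix_matrix_mult_def sum_2 mat_def det_2 t)
qed

lemma mat_scale_mult: "(a *\<^sub>R A) ** B = a *\<^sub>R ((A::mat2) ** (B::mat2))" "(A::mat2) ** (a *\<^sub>R B) = a *\<^sub>R (A ** (B::mat2))"
  by (simp_all add: mat2_eq_iff matrix_matrix_mult_def sum_2 algebra_simps)

lemma power_trace0:
  assumes "trace (X::mat2) = 0"
  shows "((**) X ^^ n) (mat 1) = (if even n then (- det X) ^ (n div 2) *\<^sub>R mat 1 else (- det X) ^ (n div 2) *\<^sub>R X)"
proof (induct n)
  case (Suc n)
  then show ?case
    by (cases "even n") (auto simp: mat_scale_mult cayley_hamilton[OF assms] elim!: evenE oddE)
qed simp

lemma matrix_exp_nilpotent: assumes "trace (X::mat2) = 0" "det X = 0" shows "matrix_exp X = mat 1 + X"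
proof -
  have "(\<Sum>n. (1 / fact n) *\<^sub>R (((**) X ^^ n) (mat 1))) = (\<Sum>n<2. (1 / fact n) *\<^sub>R (((**) X ^^ n) (mat 1)))"
  proof (rule suminf_finite)
    fix n :: nat assume "n \<notin> {..<2}"
    then have "n div 2 > 0" by (simp add: div_greater_zero_iff)
    then show "(1 / fact n) *\<^sub>R (((**) X ^^ n) (mat 1)) = 0" using assms by (simp add: power_trace0)
  qed simp
  then show ?thesis by (simp add: matrix_exp_def numeral_2_eq_2)
qed

lemma matrix_exp_elliptic: assumes "trace (X::mat2) = 0" "det X = \<omega>\<^sup>2" "\<omega> \<noteq> 0"
  shows "matrix_exp X = cos \<omega> *\<^sub>R mat 1 + (sin \<omega> / \<omega>) *\<^sub>R X"
proof -
  have "(\<lambda>n. (cos_coeff n *\<^sub>R \<omega> ^ n) *\<^sub>R (mat 1 :: mat2) + ((sin_coeff n *\<^sub>R \<omega> ^ n) / \<omega>) *\<^sub>R X) sums (cos \<omega> *\<^sub>R mat 1 + (sin \<omega> / \<omega>) *\<^sub>R X)"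
    by (intro sums_add sums_scaleR_left sums_divide cos_converges sin_converges)
  moreover have "(cos_coeff n *\<^sub>R \<omega> ^ n) *\<^sub>R mat 1 + ((sin_coeff n *\<^sub>R \<omega> ^ n) / \<omega>) *\<^sub>R X = (1 / fact n) *\<^sub>R (((**) X ^^ n) (mat 1))" for n
    unfolding power_trace0[OF assms(1)] assms(2) cos_coeff_def sin_coeff_def
    using assms(3) by (auto simp: power_minus[of "\<omega>\<^sup>2"] power_mult[symmetric] elim!: evenE oddE)
  ultimately show ?thesis unfolding matrix_exp_def by (simp add: sums_iff)
qed

lemma matrix_exp_hyperbolic: assumes "trace (X::mat2) = 0" "det X = - \<omega>\<^sup>2" "\<omega> \<noteq> 0"
  shows "matrix_exp X = cosh \<omega> *\<^sub>R mat 1 + (sinh \<omega> / \<omega>) *\<^sub>R X"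
proof -
  have "(\<lambda>n. (if even n then \<omega> ^ n /\<^sub>R fact n else 0) *\<^sub>R (mat 1 :: mat2) + ((if even n then 0 else \<omega> ^ n /\<^sub>R fact n) / \<omega>) *\<^sub>R X) sums (cosh \<omega> *\<^sub>R mat 1 + (sinh \<omega> / \<omega>) *\<^sub>R X)"
    by (intro sums_add sums_scaleR_left sums_divide cosh_converges sinh_converges)
  moreover have "(if even n then \<omega> ^ n /\<^sub>R fact n else 0) *\<^sub>R mat 1 + ((if even n then 0 else \<omega> ^ n /\<^sub>R fact n) / \<omega>) *\<^sub>R X = (1 / fact n) *\<^sub>R (((**) X ^^ n) (mat 1))" for n
    unfolding power_trace0[OF assms(1)] assms(2)
    using assms(3) by (auto simp: power_mult[symmetric] field_simps elim!: evenE oddE)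
  ultimately show ?thesis unfolding matrix_exp_def by (simp add: sums_iff)
qed

text \<open>All three types of elements of the Lie algebra are treated alike: only the case C = 1 and S = id
  can produce a parabolic element.\<close>

lemma matrix_exp_form:
  assumes X: "trace X = 0"
  obtains C S where "continuous_on UNIV C" "continuous_on UNIV S" "\<And>r. matrix_exp (r *\<^sub>R X) = C r *\<^sub>R mat 1 + S r *\<^sub>R X"
    "\<And>r::real. (C r)\<^sup>2 + (S r)\<^sup>2 * det X = 1" "det X = 0 \<Longrightarrow> C = (\<lambda>_. 1) \<and> S = (\<lambda>r. r)"
proof -
  have tr: "trace (r *\<^sub>R X) = 0" "det (r *\<^sub>R X) = r\<^sup>2 * det X" for r
    using X by (simp_all add: trace_def sum_2 det_2 power2_eq_square algebra_simps) (metis distrib_left mult_zero_right)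
  have z: "matrix_exp (0 *\<^sub>R X) = mat 1" using matrix_exp_nilpotent[of "0 *\<^sub>R X"] by (simp add: trace_def sum_2 det_2)
  consider "det X = 0" | \<omega> where "det X = \<omega>\<^sup>2" "\<omega> \<noteq> 0" | \<omega> where "det X = - \<omega>\<^sup>2" "\<omega> \<noteq> 0"
  proof (cases "det X" "0::real" rule: linorder_cases)
    case less then show ?thesis using that(3)[of "sqrt (- det X)"] by simp
  next
    case greater then show ?thesis using that(2)[of "sqrt (det X)"] by simp
  qed (use that in simp)
  then show ?thesis
  proof cases
    case 1
    show ?thesis by (rule that[of "\<lambda>_. 1" "\<lambda>r. r"]) (use 1 matrix_exp_nilpotent[OF tr(1)] tr in \<open>auto intro: continuous_intros\<close>)
  next
    case 2
    show ?thesis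
    proof (rule that[of "\<lambda>r. cos (r * \<omega>)" "\<lambda>r. sin (r * \<omega>) / \<omega>"])
      show "matrix_exp (r *\<^sub>R X) = cos (r * \<omega>) *\<^sub>R mat 1 + (sin (r * \<omega>) / \<omega>) *\<^sub>R X" for r
        using matrix_exp_elliptic[OF tr(1), of r "r * \<omega>"] z 2 tr by (cases "r = 0") (simp_all add: power_mult_distrib)
    qed (use 2 in \<open>auto intro!: continuous_intros simp: power_divide\<close>)
  next
    case 3
    show ?thesis
    proof (rule that[of "\<lambda>r. cosh (r * \<omega>)" "\<lambda>r. sinh (r * \<omega>) / \<omega>"])
      show "matrix_exp (r *\<^sub>R X) = cosh (r * \<omega>) *\<^sub>R mat 1 + (sinh (r * \<omega>) / \<omega>) *\<^sub>R X" for r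
        using matrix_exp_hyperbolic[OF tr(1), of r "r * \<omega>"] z 3 tr by (cases "r = 0") (simp_all add: power_mult_distrib)
      show "(cosh (r * \<omega>))\<^sup>2 + (sinh (r * \<omega>) / \<omega>)\<^sup>2 * det X = 1" for r
        using 3 cosh_square_eq[of "r * \<omega>"] by (simp add: power_divide)
    qed (use 3 in \<open>auto intro!: continuous_intros\<close>)
  qed
qed

text \<open>The nilpotent matrix whose kernel is the direction \<open>v\<close>, the infinitesimal
  generator of the group \<open>U v 0\<close>.\<close>

definition pY :: "real \<Rightarrow> mat2" where
  "pY v = mt (cos (pi * v) * sin (pi * v)) (- (cos (pi * v))\<^sup>2) ((sin (pi * v))\<^sup>2) (- (cos (pi * v) * sin (pi * v)))"

lemma pY: "trace (pY v) = 0" "det (pY v) = 0" by (simp_all add: pY_def mt_trace mt_det power2_eq_square)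

lemma cls_U: "cls (U v 0 t) = psl_class (mat 1 + t *\<^sub>R pY v)"
proof -
  define c s where "c = cos (pi * v)" and "s = sin (pi * v)"
  have cs: "c * c = 1 - s * s" using sin_cos_squared_add[of "pi * v"] by (simp add: c_def s_def power2_eq_square)
  have cs3: "c * (c * t) = t - s * (s * t)" using cs by algebra
  have "lifts (1 + t * (c * s)) (- t * (c * c)) (t * (s * s)) (1 - t * (c * s)) (U v 0 t)"
    unfolding U_def by (rule lifts_cong[OF lifts_comp[OF lifts_comp[OF lifts_T lifts_Uz] lifts_T]])
      (simp_all add: c_def[symmetric] s_def[symmetric] algebra_simps cs cs3)
  from cls_lifts[OF this] show ?thesis
    by (simp add: pY_def mt_one mt_scale mt_add c_def s_def power2_eq_square)
qed

lemma det_par [simp]: "det (mat 1 + t *\<^sub>R pY v) = 1"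
  using lifts_mk by (simp add: pY_def mt_one mt_scale mt_add mt_det power2_eq_square algebra_simps)

lemma cover_exp:
  assumes "trace X = 0" shows "cover_proj (exp_tilde X) = psl_class (matrix_exp X)"
proof -
  obtain C S where CS: "continuous_on UNIV C" "continuous_on UNIV S" "\<And>r. matrix_exp (r *\<^sub>R X) = C r *\<^sub>R mat 1 + S r *\<^sub>R X"
    "\<And>r::real. (C r)\<^sup>2 + (S r)\<^sup>2 * det X = 1" "det X = 0 \<Longrightarrow> C = (\<lambda>_. 1) \<and> S = (\<lambda>r. r)" by (rule matrix_exp_form[OF assms]) (rule that)
  define p where "p = (\<lambda>t. psl_class (matrix_exp (t *\<^sub>R X)))"
  have "X$2$2 = - X$1$1" using assms by (simp add: trace_def sum_2)
  then have d: "det (a *\<^sub>R mat 1 + b *\<^sub>R X) = a\<^sup>2 + b\<^sup>2 * det X" for a b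
    by (simp add: det_2 mat_def power2_eq_square algebra_simps)
  have "continuous_on {0..1} (\<lambda>r. C r *\<^sub>R mat 1 + S r *\<^sub>R X)"
    by (intro continuous_intros continuous_on_subset[OF CS(1)] continuous_on_subset[OF CS(2)]) auto
  then have "continuous_map (top_of_set {0..1}) (top_of_set (carrier SL2R)) (\<lambda>r. matrix_exp (r *\<^sub>R X))"
    using CS by (auto simp: continuous_map_in_subtopology mem_SL2R d)
  from continuous_map_compose[OF this quotient_imp_continuous_map[OF quotient_map_psl_class]]
  have "continuous_map (top_of_set {0..1}) PSL2R_topology p" by (simp add: p_def o_def)
  then have "p \<in> exp_tilde X" by (simp add: exp_tilde_def path_class_def p_def)
  moreover have "q 1 \<in> {p 1}" if "q \<in> exp_tilde X" for q
  proof -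
    have "homotopic_with (\<lambda>r. r 0 = p 0 \<and> r 1 = p 1) (top_of_set {0..1}) PSL2R_topology p q"
      using that unfolding exp_tilde_def path_class_def p_def by simp
    from homotopic_with_imp_property[OF this] show ?thesis by simp
  qed
  ultimately have "(\<lambda>p. p 1) ` exp_tilde X = {p 1}" by blast
  then show ?thesis by (simp add: cover_proj_def p_def)
qed

lemma exp_par: "exp_tilde (t *\<^sub>R pY v) = Gam (U v 0 t)"
  unfolding exp_tilde_def
proof (rule Gam_eqI[where f="\<lambda>r. U v 0 (r * t)"])
  show "Gpath (U v 0 t) (\<lambda>r. U v 0 (r * t))" unfolding Gpath_def by (auto intro!: continuous_intros)
  show "psl_class (matrix_exp (r *\<^sub>R (t *\<^sub>R pY v))) = cls (U v 0 (r * t))" for r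
  proof -
    have "trace ((r * t) *\<^sub>R pY v) = 0" "det ((r * t) *\<^sub>R pY v) = 0"
      by (simp_all add: pY_def mt_scale mt_trace mt_det power2_eq_square)
    from matrix_exp_nilpotent[OF this] show ?thesis by (simp add: cls_U)
  qed
qed

lemma psl_par_ne_one: assumes "t \<noteq> 0" shows "cls (U v 0 t) \<noteq> \<one>\<^bsub>PSL2R\<^esub>"
proof
  assume "cls (U v 0 t) = \<one>\<^bsub>PSL2R\<^esub>"
  then have "mat 1 + t *\<^sub>R pY v = mat 1 \<or> mat 1 + t *\<^sub>R pY v = - mat 1" unfolding cls_U psl_one psl_class_iff .
  moreover have "trace (mat 1 + t *\<^sub>R pY v) = 2" by (simp add: pY_def mt_one mt_scale mt_add mt_trace)
  then have "trace (mat 1 + t *\<^sub>R pY v) \<noteq> trace (- mat 1 :: mat2)" by (simp add: mt_one mt_uminus mt_trace)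
  ultimately have "mat 1 + t *\<^sub>R pY v = mat 1" by metis
  then have "t *\<^sub>R pY v = 0" by simp
  then have "pY v = 0" using assms by simp
  then have "(pY v)$1$2 = 0" "(pY v)$2$1 = 0" by simp_all
  then have "cos (pi * v) = 0" "sin (pi * v) = 0" by (simp_all add: pY_def)
  then show False using sin_cos_squared_add[of "pi * v"] by simp
qed

text \<open>Only uniqueness is at stake. If \<open>exp_tilde X\<close> lies over the parabolic
  element, the trace gives \<open>C 1\<close> = 1 or -1; a nonzero determinant of \<open>X\<close>
  would then force \<open>S 1 = 0\<close> and the identity class. So \<open>X\<close> is nilpotent
  and can be read off from its exponential.\<close>

lemma parabolic_lift_U: assumes "t \<noteq> 0" shows "parabolic_lift (cls (U v 0 t)) = Gam (U v 0 t)"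
  unfolding parabolic_lift_def
proof (rule the_equality)
  have "t *\<^sub>R pY v \<in> sl2" by (simp add: sl2_def pY_def mt_scale mt_trace)
  then show "Gam (U v 0 t) \<in> exp_tilde ` sl2 \<and> cover_proj (Gam (U v 0 t)) = cls (U v 0 t)"
    using exp_par[of t v] by (simp add: cover_proj_Gam) (metis image_eqI)
  fix u assume u: "u \<in> exp_tilde ` sl2 \<and> cover_proj u = cls (U v 0 t)"
  then obtain X where X: "trace X = 0" "u = exp_tilde X" by (auto simp: sl2_def)
  obtain C S where CS: "\<And>r. matrix_exp (r *\<^sub>R X) = C r *\<^sub>R mat 1 + S r *\<^sub>R X"
    "\<And>r::real. (C r)\<^sup>2 + (S r)\<^sup>2 * det X = 1" "det X = 0 \<Longrightarrow> C = (\<lambda>_. 1) \<and> S = (\<lambda>r. r)" by (rule matrix_exp_form[OF X(1)]) (rule that)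
  let ?N = "mat 1 + t *\<^sub>R pY v"
  have e: "matrix_exp X = C 1 *\<^sub>R mat 1 + S 1 *\<^sub>R X" using CS(1)[of 1] by simp
  have "psl_class (matrix_exp X) = psl_class ?N" using u X cover_exp[OF X(1)] by (simp add: cls_U)
  then have N: "C 1 *\<^sub>R mat 1 + S 1 *\<^sub>R X = ?N \<or> C 1 *\<^sub>R mat 1 + S 1 *\<^sub>R X = - ?N" unfolding psl_class_iff e .
  have tX: "X$2$2 = - X$1$1" using X(1) by (simp add: trace_def sum_2)
  have trN: "?N$1$1 + ?N$2$2 = 2" by (simp add: pY_def mt_one mt_scale mt_add)
  have tC: "(C 1 *\<^sub>R mat 1 + S 1 *\<^sub>R X)$1$1 + (C 1 *\<^sub>R mat 1 + S 1 *\<^sub>R X)$2$2 = 2 * C 1" by (simp add: mat_def tX)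
  have C: "C 1 = 1 \<and> C 1 *\<^sub>R mat 1 + S 1 *\<^sub>R X = ?N \<or> C 1 = -1 \<and> C 1 *\<^sub>R mat 1 + S 1 *\<^sub>R X = - ?N"
    using N
  proof
    assume n: "C 1 *\<^sub>R mat 1 + S 1 *\<^sub>R X = ?N"
    then show ?thesis using tC trN by simp
  next
    assume n: "C 1 *\<^sub>R mat 1 + S 1 *\<^sub>R X = - ?N"
    have "(- ?N)$1$1 + (- ?N)$2$2 = - 2" using trN by simp
    then have "2 * C 1 = - 2" using tC unfolding n by linarith
    then show ?thesis using n by simp
  qed
  have "det X = 0"
  proof (rule ccontr)
    assume "det X \<noteq> 0"
    moreover have "(C 1)\<^sup>2 = 1" using C by auto
    ultimately have "S 1 = 0" using CS(2)[of 1] by simp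
    then have n1: "?N = mat 1" using C by auto
    show False using psl_par_ne_one[OF assms, of v] unfolding cls_U psl_one n1 by simp
  qed
  then have "C 1 = 1" "S 1 = 1" using CS(3) by auto
  then have "X = t *\<^sub>R pY v" using C by simp
  then show "u = Gam (U v 0 t)" using X(2) exp_par by simp
qed

lemma central_z_Gam: "central_z = Gam (T (-1))"
  unfolding central_z_def exp_tilde_def
proof (rule Gam_eqI[where f="\<lambda>r. T (- r)"])
  show "Gpath (T (-1)) (\<lambda>r. T (- r))" unfolding Gpath_def by (auto intro!: continuous_intros)
  have X: "vector [vector [0, pi], vector [- pi, 0]] = mt 0 pi (- pi) 0" by (simp add: mt_def)
  show "psl_class (matrix_exp (r *\<^sub>R vector [vector [0, pi], vector [- pi, 0]])) = cls (T (- r))" for r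
  proof (cases "r = 0")
    case True
    then show ?thesis using matrix_exp_nilpotent[of "0::mat2"] cls_id by (simp add: psl_one trace_def det_2)
  next
    case False
    have "matrix_exp (r *\<^sub>R mt 0 pi (- pi) 0) = mt (cos (r * pi)) (sin (r * pi)) (- sin (r * pi)) (cos (r * pi))"
      using matrix_exp_elliptic[of "r *\<^sub>R mt 0 pi (- pi) 0" "r * pi"] False
      by (simp add: mt_scale mt_trace mt_det mt_one mt_add power2_eq_square)
    then show ?thesis unfolding X cls_lifts[OF lifts_T] by (simp add: mult.commute)
  qed
qed

text \<open>Trace 2 or -2 gives the eigenvalue 1 or -1 and thus a fixed direction \<open>w\<close>.
  The lift is then \<open>U w l s\<close> up to the center, and the trace forces
  \<open>l = 0\<close>.\<close>

lemma parabolic_iff: "parabolic P \<longleftrightarrow> (\<exists>v t. t \<noteq> 0 \<and> P = cls (U v 0 t))"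
proof
  assume "\<exists>v t. t \<noteq> 0 \<and> P = cls (U v 0 t)"
  then obtain v t where P: "t \<noteq> 0" "P = cls (U v 0 t)" by blast
  have "trace (mat 1 + t *\<^sub>R pY v) = 2" by (simp add: pY_def mt_one mt_scale mt_add mt_trace)
  moreover have "mat 1 + t *\<^sub>R pY v \<in> P" unfolding P(2) cls_U psl_class_eq by simp
  ultimately show "parabolic P" unfolding parabolic_def
    by (intro conjI bexI[of _ "mat 1 + t *\<^sub>R pY v"]) (use P psl_par_ne_one[OF P(1), of v] in simp_all)
next
  assume p: "parabolic P"
  then obtain A where A: "A \<in> P" "\<bar>trace A\<bar> = 2" "P \<in> carrier PSL2R" "P \<noteq> \<one>\<^bsub>PSL2R\<^esub>" by (auto simp: parabolic_def)
  obtain B where B: "det B = 1" "P = psl_class B" using A(3) by (auto simp: carrier_PSL2R mem_SL2R)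
  have "A = B \<or> A = - B" using A(1) B(2) by (auto simp: psl_class_eq)
  then have PA: "P = psl_class A" "det A = 1" using B by (auto simp: psl_class_eq det_mat2_uminus)
  define \<sigma> where "\<sigma> = trace A / 2"
  define a b c d where "a = A$1$1" and "b = A$1$2" and "c = A$2$1" and "d = A$2$2"
  have abcd: "A = mt a b c d" by (simp add: a_def b_def c_def d_def mt_collapse)
  have \<sigma>: "\<sigma> = 1 \<or> \<sigma> = -1" "a + d = 2 * \<sigma>" "\<sigma> * \<sigma> = 1" "a * d - b * c = 1"
  proof -
    have "a + d = 2 \<or> a + d = -2" using A(2) by (auto simp: abcd mt_trace)
    then show "\<sigma> = 1 \<or> \<sigma> = -1" "a + d = 2 * \<sigma>" "\<sigma> * \<sigma> = 1" by (auto simp: \<sigma>_def abcd mt_trace)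
    show "a * d - b * c = 1" using PA(2) by (simp add: abcd mt_det)
  qed
  obtain \<theta> l t where L: "lifts a b c d (T \<theta> \<circ> Uz l t)" by (rule lifts_exists[OF \<sigma>(4)])
  define F where "F = T \<theta> \<circ> Uz l t"
  have F: "F \<in> Gt" "lifts a b c d F" using L by (simp_all add: F_def)
  have PF: "P = cls F" unfolding cls_lifts[OF F(2)] PA(1) abcd ..
  \<comment> \<open>Eigenvectors are \<open>(b, \<sigma> - a)\<close> and
    \<open>(\<sigma> - d, c)\<close>, at least one of them nonzero unless the matrix is
    diagonal.\<close>
  have "\<exists>x y. (x, y) \<noteq> (0, 0) \<and> a * x + b * y = \<sigma> * x \<and> c * x + d * y = \<sigma> * y"
  proof (cases "b = 0 \<and> c = 0")
    case True
    then have "(a - d) * (a - d) = 0" using \<sigma> by algebra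
    then have "a = \<sigma>" "d = \<sigma>" using \<sigma>(2) by auto
    then show ?thesis using True by (intro exI[of _ 1] exI[of _ 0]) simp
  next
    case False
    have "c * b + d * (\<sigma> - a) = \<sigma> * (\<sigma> - a)" "a * (\<sigma> - d) + b * c = \<sigma> * (\<sigma> - d)" using \<sigma> by algebra+
    moreover have "a * b + b * (\<sigma> - a) = \<sigma> * b" "c * (\<sigma> - d) + d * c = \<sigma> * c" by algebra+
    moreover have "(b, \<sigma> - a) \<noteq> (0, 0) \<or> (\<sigma> - d, c) \<noteq> (0, 0)" using False by auto
    ultimately show ?thesis by (metis mult.commute)
  qed
  then obtain x y where xy: "(x, y) \<noteq> (0, 0)" "a * x + b * y = \<sigma> * x" "c * x + d * y = \<sigma> * y" by blast
  define z where "z = Complex x y"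
  have z: "z \<noteq> 0" using xy(1) by (auto simp: z_def complex_eq_iff)
  define w where "w = Arg z / pi"
  have "z = of_real (cmod z) * cis (Arg z)" by (metis rcis_cmod_Arg rcis_def)
  then have zw: "x = cmod z * cos (pi * w)" "y = cmod z * sin (pi * w)" by (simp_all add: z_def w_def complex_eq_iff)
  have nz: "cmod z \<noteq> 0" using z by simp
  have e: "a * cos (pi * w) + b * sin (pi * w) = \<sigma> * cos (pi * w)" "c * cos (pi * w) + d * sin (pi * w) = \<sigma> * sin (pi * w)"
  proof -
    have "cmod z * (a * cos (pi * w) + b * sin (pi * w)) = cmod z * (\<sigma> * cos (pi * w))"
      "cmod z * (c * cos (pi * w) + d * sin (pi * w)) = cmod z * (\<sigma> * sin (pi * w))"
      using xy(2,3) zw by (simp_all add: algebra_simps)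
    then show "a * cos (pi * w) + b * sin (pi * w) = \<sigma> * cos (pi * w)" "c * cos (pi * w) + d * sin (pi * w) = \<sigma> * sin (pi * w)"
      using nz by (simp_all only: mult_cancel_left) simp_all
  qed
  obtain r where r: "r > 0" "\<sigma> * cos (pi * w) = r * cos (pi * F w)" "\<sigma> * sin (pi * w) = r * sin (pi * F w)"
    using F(2) e unfolding lifts_def by metis
  have "r * sin (pi * (F w - w)) = (r * sin (pi * F w)) * cos (pi * w) - (r * cos (pi * F w)) * sin (pi * w)"
    by (simp add: sin_diff algebra_simps)
  also have "\<dots> = 0" using r(2,3) by (simp flip: r(2,3))
  finally have "sin (pi * (F w - w)) = 0" using r(1) by simp
  then obtain k :: int where "F w - w = of_int k" unfolding sin_eq_0_pi by blast
  then have "F w = w + of_int k" by simp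
  then obtain l s where ls: "F = T (of_int k) \<circ> U w l s" using Gt_fix_int_U[OF F(1)] by blast
  then have PU: "P = cls (U w l s)" unfolding PF using cls_eq_iff[of "U w l s" F] F(1) by auto
  define C S where "C = cos (pi * w)" and "S = sin (pi * w)"
  have cs: "C * C + S * S = 1" by (simp add: C_def S_def flip: power2_eq_square)
  have "lifts (cos (pi * w)) (- sin (pi * w)) (sin (pi * w)) (cos (pi * w)) (T w)" by (rule lifts_T)
  then have L': "\<exists>a' b' c' d'. lifts a' b' c' d' (U w l s) \<and> a' + d' = exp l + exp (- l)"
    unfolding C_def[symmetric] S_def[symmetric]
  proof -
    assume 1: "lifts C (- S) S C (T w)"
    have 2: "lifts C S (- S) C (T (- w))" using lifts_T[of "- w"] by (simp add: C_def S_def)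
    note * = lifts_comp[OF lifts_comp[OF 1 lifts_Uz[of l s]] 2]
    have "((C * E + - S * 0) * C + (C * (- s * E) + - S * D) * - S) + ((S * E + C * 0) * S + (S * (- s * E) + C * D) * C) = E + D" for E D
      using cs by algebra
    then show ?thesis using * unfolding U_def by blast
  qed
  then obtain a' b' c' d' where L': "lifts a' b' c' d' (U w l s)" "a' + d' = exp l + exp (- l)" by blast
  have "mt a' b' c' d' = A \<or> mt a' b' c' d' = - A"
    using PU unfolding PA(1) cls_lifts[OF L'(1)] psl_class_iff by auto
  then have "\<bar>a' + d'\<bar> = 2" using A(2) by (auto simp: abcd mt_trace mt_uminus mat2_eq_iff abs_minus_commute)
  moreover have "exp l + exp (- l) > 0" by (simp add: add_pos_pos)
  \<comment> \<open>The sum is positive, so of the two signs only 2 remains, and a positive number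
    plus its inverse is 2 only at 1.\<close>
  ultimately have "exp l + inverse (exp l) = 2" using L'(2) by (simp add: exp_minus)
  then have "(exp l - 1)\<^sup>2 = 0" by (simp add: field_simps power2_eq_square)
  then have l: "l = 0" by simp
  have "s \<noteq> 0" using A(4) PU l cls_id by auto
  then show "\<exists>v t. t \<noteq> 0 \<and> P = cls (U v 0 t)" using PU l by blast
qed

subsection \<open>Representations of a presented group\<close>

lemma words_append [simp]: "u @ v \<in> words S \<longleftrightarrow> u \<in> words S \<and> v \<in> words S" by (auto simp: words_def)
lemma words_Nil [simp]: "[] \<in> words S" by (simp add: words_def)
lemma words_Cons [simp]: "(s, b) # w \<in> words S \<longleftrightarrow> s \<in> S \<and> w \<in> words S" by (auto simp: words_def)

lemma word_eq_words: "word_eq S R v w \<Longrightarrow> v \<in> words S \<and> w \<in> words S"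
  by (induct rule: word_eq.induct) auto

lemma word_eq_append: assumes "word_eq S R v w" "x \<in> words S" "y \<in> words S" shows "word_eq S R (x @ v @ y) (x @ w @ y)"
  using assms
proof (induct rule: word_eq.induct)
  case (cancel u v s b)
  then show ?case using word_eq.cancel[of "x @ u" S "v @ y" s R b] by simp
next
  case (relator u v r)
  then show ?case using word_eq.relator[of "x @ u" S "v @ y" r R] by simp
qed (auto intro: word_eq.intros)

lemma word_class_eqI: "word_eq S R v w \<Longrightarrow> word_class S R v = word_class S R w"
  unfolding word_class_def by (auto intro: word_eq.sym word_eq.trans)

lemma word_class_mult:
  assumes "v \<in> words S" "w \<in> words S"
  shows "word_class S R v \<otimes>\<^bsub>presented_group S R\<^esub> word_class S R w = word_class S R (v @ w)"
proof -
  have K: "word_class S R (x @ y) = word_class S R (v @ w)" if "x \<in> word_class S R v" "y \<in> word_class S R w" for x y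
  proof -
    have e: "word_eq S R v x" "word_eq S R w y" using that by (auto simp: word_class_def)
    have "word_eq S R (v @ w) (x @ w)" "word_eq S R (x @ w) (x @ y)"
      using word_eq_append[OF e(1), of "[]" w] word_eq_append[OF e(2), of x "[]"] word_eq_words[OF e(1)] assms by auto
    then show ?thesis by (metis word_class_eqI)
  qed
  have ne: "v \<in> word_class S R v" "w \<in> word_class S R w" using assms by (auto simp: word_class_def word_eq.refl)
  have "word_class S R v \<otimes>\<^bsub>presented_group S R\<^esub> word_class S R w = (\<Union>x\<in>word_class S R v. \<Union>y\<in>word_class S R w. word_class S R (x @ y))"
    by (simp add: presented_group_def)
  also have "\<dots> = (\<Union>x\<in>word_class S R v. \<Union>y\<in>word_class S R w. word_class S R (v @ w))" by (intro SUP_cong HOL.refl K)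
  also have "\<dots> = word_class S R (v @ w)" using ne by blast
  finally show ?thesis .
qed

definition evG :: "('s \<Rightarrow> real \<Rightarrow> real) \<Rightarrow> 's word \<Rightarrow> real \<Rightarrow> real" where
  "evG h w = foldr (\<lambda>(s, b) F. (if b then h s else ginv (h s)) \<circ> F) w id"

lemma evG_simps [simp]: "evG h [] = id" "evG h ((s, b) # w) = (if b then h s else ginv (h s)) \<circ> evG h w"
  by (simp_all add: evG_def)

lemma evG_append: "evG h (v @ w) = evG h v \<circ> evG h w"
  by (induct v) (auto simp: o_assoc)

lemma evG_Gt: "(\<And>s. h s \<in> Gt) \<Longrightarrow> evG h w \<in> Gt"
  by (induct w) auto

lemma cls_append: "(\<And>s. h s \<in> Gt) \<Longrightarrow> cls (evG h (v @ w)) = cls (evG h v) \<otimes>\<^bsub>PSL2R\<^esub> cls (evG h w)"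
  by (simp add: evG_append cls_comp evG_Gt)

lemma cls_word_eq:
  assumes "\<And>s. h s \<in> Gt" "\<And>r. r \<in> R \<Longrightarrow> cls (evG h r) = \<one>\<^bsub>PSL2R\<^esub>" "word_eq S R v w"
  shows "cls (evG h v) = cls (evG h w)"
  using assms(3)
proof (induct rule: word_eq.induct)
  case (cancel u v s b)
  have "evG h (u @ [(s, b), (s, \<not> b)] @ v) = evG h u \<circ> (evG h [(s, b), (s, \<not> b)] \<circ> evG h v)" by (simp only: evG_append)
  also have "evG h [(s, b), (s, \<not> b)] = id" using assms(1) by (cases b) simp_all
  finally show ?case by (simp add: evG_append)
next
  case (relator u v r)
  interpret group PSL2R by (rule group_PSL2R)
  show ?case unfolding cls_append[OF assms(1)] assms(2)[OF relator(3)] by simp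
qed simp_all

definition lift_rel :: "nat \<Rightarrow> nat \<Rightarrow> (surface_gen \<Rightarrow> real \<Rightarrow> real) \<Rightarrow> bool" where
  "lift_rel g p h \<longleftrightarrow> (\<forall>x. h x \<in> Gt) \<and> cls (evG h (surface_relator g p)) = \<one>\<^bsub>PSL2R\<^esub>"

text \<open>The value is computed from an arbitrary word in the class; \<open>cls_word_eq\<close>
  makes it independent of this choice once the relator evaluates to the identity.\<close>

definition Rep :: "nat \<Rightarrow> nat \<Rightarrow> (surface_gen \<Rightarrow> real \<Rightarrow> real) \<Rightarrow> surface_gen word set \<Rightarrow> mat2 set" where
  "Rep g p h = (\<lambda>X\<in>carrier (surface_group g p). cls (evG h (SOME w. w \<in> X)))"

abbreviation "swords g p \<equiv> words (surface_gens g p)"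
abbreviation "sclass g p \<equiv> word_class (surface_gens g p) {surface_relator g p}"

lemma carrier_surface: "carrier (surface_group g p) = sclass g p ` swords g p"
  by (simp add: surface_group_def presented_group_def)

lemma Rep_class: assumes "lift_rel g p h" "w \<in> swords g p" shows "Rep g p h (sclass g p w) = cls (evG h w)"
proof -
  have "w \<in> sclass g p w" using assms(2) by (simp add: word_class_def word_eq.refl)
  then have "word_eq (surface_gens g p) {surface_relator g p} w (SOME v. v \<in> sclass g p w)"
    by (metis (mono_tags, lifting) mem_Collect_eq someI_ex word_class_def)
  from cls_word_eq[OF _ _ this, of h] show ?thesis
    using assms by (simp add: Rep_def carrier_surface lift_rel_def)
qed

lemma Rep_in: assumes h: "lift_rel g p h" shows "Rep g p h \<in> representations g p"
  unfolding representations_def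
proof (intro IntI homI)
  show "Rep g p h \<in> extensional (carrier (surface_group g p))" by (simp add: Rep_def)
  fix X assume "X \<in> carrier (surface_group g p)"
  then obtain v where v: "v \<in> swords g p" "X = sclass g p v" unfolding carrier_surface by blast
  show "Rep g p h X \<in> carrier PSL2R" using Rep_class[OF h v(1)] by (simp add: v(2))
  fix Y assume "Y \<in> carrier (surface_group g p)"
  then obtain w where w: "w \<in> swords g p" "Y = sclass g p w" unfolding carrier_surface by blast
  have e: "X \<otimes>\<^bsub>surface_group g p\<^esub> Y = sclass g p (v @ w)"
    unfolding v(2) w(2) surface_group_def by (rule word_class_mult[OF v(1) w(1)])
  have hG: "h x \<in> Gt" for x using h by (simp add: lift_rel_def)
  have vw: "v @ w \<in> swords g p" using v(1) w(1) by simp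
  show "Rep g p h (X \<otimes>\<^bsub>surface_group g p\<^esub> Y) = Rep g p h X \<otimes>\<^bsub>PSL2R\<^esub> Rep g p h Y"
    unfolding e unfolding v(2) w(2) Rep_class[OF h v(1)] Rep_class[OF h w(1)] Rep_class[OF h vw] by (rule cls_append[OF hG])
qed

lemma surface_relator_in: "surface_relator g p \<in> swords g p"
  by (auto simp: surface_relator_def words_def surface_gens_def)

text \<open>By induction on words a homomorphism agrees with the projected evaluation of chosen
  lifts of the generators. Applied to the relator, this gives the relation for the lifts.\<close>

lemma Rep_surj:
  assumes \<phi>: "\<phi> \<in> representations g p" and G: "\<And>x. h x \<in> Gt"
    and h: "\<And>x. x \<in> surface_gens g p \<Longrightarrow> cls (h x) = \<phi> (surface_elem g p x)"
  shows "lift_rel g p h" "\<phi> = Rep g p h"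
proof -
  interpret group PSL2R by (rule group_PSL2R)
  have hom: "\<phi> (sclass g p (v @ w)) = \<phi> (sclass g p v) \<otimes>\<^bsub>PSL2R\<^esub> \<phi> (sclass g p w)" if "v \<in> swords g p" "w \<in> swords g p" for v w
  proof -
    have "sclass g p v \<in> carrier (surface_group g p)" "sclass g p w \<in> carrier (surface_group g p)"
      using that by (auto simp: carrier_surface)
    then show ?thesis
      using \<phi> word_class_mult[OF that, of "{surface_relator g p}"] unfolding representations_def surface_group_def hom_def by force
  qed
  have cl: "\<phi> (sclass g p w) \<in> carrier PSL2R" if "w \<in> swords g p" for w
    using \<phi> that unfolding representations_def hom_def carrier_surface by blast
  have one: "\<phi> (sclass g p []) = \<one>\<^bsub>PSL2R\<^esub>" using hom[of "[]" "[]"] cl[of "[]"] by simp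
  have ev: "\<phi> (sclass g p w) = cls (evG h w)" if "w \<in> swords g p" for w
    using that
  proof (induct w)
    case Nil then show ?case by (simp only: one evG_simps cls_id)
  next
    case (Cons a w)
    obtain s b where a: "a = (s, b)" by (cases a)
    have sw: "s \<in> surface_gens g p" "w \<in> swords g p" "[(s, c)] \<in> swords g p" for c using Cons(2) by (auto simp: a)
    have t: "\<phi> (sclass g p [(s, True)]) = cls (h s)" using h[OF sw(1)] by (simp add: surface_elem_def)
    have "word_eq (surface_gens g p) {surface_relator g p} ([] @ [(s, False), (s, \<not> False)] @ []) ([] @ [])"
      by (rule word_eq.cancel) (use sw in auto)
    then have "sclass g p ([(s, False)] @ [(s, True)]) = sclass g p []" using word_class_eqI by fastforce
    then have "\<phi> (sclass g p [(s, False)]) \<otimes>\<^bsub>PSL2R\<^esub> cls (h s) = \<one>\<^bsub>PSL2R\<^esub>"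
      using hom[OF sw(3)[of False] sw(3)[of True]] one t by simp
    moreover have "cls (ginv (h s)) \<otimes>\<^bsub>PSL2R\<^esub> cls (h s) = \<one>\<^bsub>PSL2R\<^esub>"
      using cls_comp[OF inv_Gt[OF G] G, of s s] Gt_inv_comp(1)[OF G] cls_id by metis
    ultimately have f: "\<phi> (sclass g p [(s, False)]) = cls (ginv (h s))"
      using right_cancel[OF cls_in cl[OF sw(3)[of False]] cls_in] by metis
    have "\<phi> (sclass g p [(s, b)]) = cls (evG h [(s, b)])" using t f by (cases b) simp_all
    then have "\<phi> (sclass g p ([(s, b)] @ w)) = cls (evG h ([(s, b)] @ w))"
      unfolding hom[OF sw(3)[of b] sw(2)] cls_append[of h, OF G] Cons(1)[OF sw(2)] by (simp only:)
    then show ?case by (simp only: a append.simps)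
  qed
  have "word_eq (surface_gens g p) {surface_relator g p} ([] @ surface_relator g p @ []) ([] @ [])"
    by (rule word_eq.relator) (use surface_relator_in in auto)
  then have "sclass g p (surface_relator g p) = sclass g p []" using word_class_eqI by fastforce
  then show l: "lift_rel g p h" using ev[OF surface_relator_in] one G by (simp add: lift_rel_def)
  show "\<phi> = Rep g p h"
  proof
    fix X show "\<phi> X = Rep g p h X"
    proof (cases "X \<in> carrier (surface_group g p)")
      case True
      then show ?thesis using ev Rep_class[OF l] unfolding carrier_surface by auto
    next
      case False
      then show ?thesis using \<phi> by (auto simp: representations_def Rep_def extensional_def)
    qed
  qed
qed

lemma evG_surface_relator: "evG h (surface_relator g p) = hprod [1..<Suc g] h \<circ> cprod [1..<Suc p] h"
proof -
  have "evG h (concat (map (\<lambda>j. [(GenA j, True), (GenB j, True), (GenA j, False), (GenB j, False)]) js)) = hprod js h" for js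
    unfolding hprod_def by (induct js) (simp_all only: concat.simps list.map append.simps evG_simps gprod_Nil gprod_Cons cmt_def o_assoc if_True if_False)
  moreover have "evG h (map (\<lambda>i. (GenC i, True)) js) = cprod js h" for js
    unfolding cprod_def by (induct js) (simp_all only: list.map evG_simps gprod_Nil gprod_Cons if_True)
  ultimately show ?thesis unfolding surface_relator_def evG_append by (simp only:)
qed

lemma lifted_lift_rel: assumes "h \<in> lifted_reps g p s m" shows "lift_rel g p h"
proof -
  have "evG h (surface_relator g p) = T (of_int m)" unfolding evG_surface_relator using assms by (simp add: lifted_reps_def)
  moreover have "cls (T (of_int m)) = cls id" using cls_eq_iff[OF id_Gt T_Gt, of "of_int m"] by auto
  ultimately show ?thesis using assms by (simp add: lift_rel_def lifted_reps_def)
qed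

lemma Rep_gen: assumes "lift_rel g p h" "x \<in> surface_gens g p" shows "Rep g p h (surface_elem g p x) = cls (h x)"
  using Rep_class[OF assms(1), of "[(x, True)]"] assms(2) by (simp add: surface_elem_def)

section \<open>The relative Euler class of a lifted representation\<close>

lemma list_mult_Cons: "list_mult G (x # xs) = x \<otimes>\<^bsub>G\<^esub> list_mult G xs" by (simp add: list_mult_def)

lemma list_mult_Gam:
  assumes "\<And>j. j \<in> set js \<Longrightarrow> X j = Gam (F j)" "\<And>j. j \<in> set js \<Longrightarrow> F j \<in> Gt"
    "\<And>i. i \<in> set ks \<Longrightarrow> Y i = Gam (H i)" "\<And>i. i \<in> set ks \<Longrightarrow> H i \<in> Gt"
  shows "list_mult SL2R_tilde (map X js @ map Y ks) = Gam (gprod js F \<circ> gprod ks H)"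
proof -
  have k: "list_mult SL2R_tilde (map Y ks) = Gam (gprod ks H)"
    using assms(3,4) by (induct ks) (simp_all add: list_mult_def Gam_one Gam_mult gprod_Gt)
  have G: "gprod ks H \<in> Gt" using assms(4) by (rule gprod_Gt)
  show ?thesis using assms(1,2)
  proof (induct js)
    case Nil then show ?case using k by simp
  next
    case (Cons j js)
    have "list_mult SL2R_tilde (map X js @ map Y ks) = Gam (gprod js F \<circ> gprod ks H)"
      by (rule Cons(1)) (rule Cons(2,3), simp)+
    moreover have "gprod js F \<in> Gt" using Cons(3) by (intro gprod_Gt) simp
    ultimately show ?case using Cons(2,3) G
      by (simp only: list.map append_Cons list_mult_Cons gprod_Cons list.set_intros Gam_mult comp_Gt o_assoc)
  qed
qed

lemma is_lift_Gam: assumes "F \<in> Gt" shows "is_lift u (cls F) \<longleftrightarrow> (\<exists>k::int. u = Gam (T (of_int k) \<circ> F))"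
proof
  assume "is_lift u (cls F)"
  then obtain F' where F': "F' \<in> Gt" "u = Gam F'" "cls F' = cls F" unfolding is_lift_def carrier_tilde using cover_proj_Gam by auto
  then show "\<exists>k::int. u = Gam (T (of_int k) \<circ> F)" using cls_eq_iff[OF assms F'(1)] by auto
next
  assume "\<exists>k::int. u = Gam (T (of_int k) \<circ> F)"
  then obtain k :: int where k: "u = Gam (T (of_int k) \<circ> F)" by blast
  have "cls F = cls (T (of_int k) \<circ> F)" using cls_eq_iff[OF assms, of "T (of_int k) \<circ> F"] assms by auto
  then show "is_lift u (cls F)" unfolding is_lift_def k using assms by (simp add: cover_proj_Gam comp_Gt)
qed

lemma lifted_U:
  assumes "h \<in> lifted_reps g p s m" "i \<in> {1..p}" "s i \<in> {1, -1}"
  obtains v t where "h (GenC i) = U v 0 t" "t \<noteq> 0" "s i = 1 \<longleftrightarrow> t > 0"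
proof -
  obtain v t where "h (GenC i) = U v 0 t" "t \<in> strengths (s i)" using lifted_block[OF assms(1,2)] by (auto simp: block_def)
  then show ?thesis using that[of v t] assms(3) by (auto simp: strengths_def)
qed

text \<open>Commutators do not depend on the lifts of the handle generators, and the prescribed
  peripheral lifts are the given maps by \<open>parabolic_lift_U\<close>. So the product is
  translation by \<open>m\<close>, while \<open>central_z\<close> is translation by -1.\<close>

lemma euler_class:
  assumes h: "h \<in> lifted_reps g p s m" and s: "\<And>i. i \<in> {1..p} \<Longrightarrow> s i \<in> {1, -1}"
  shows "relative_euler_class g p (Rep g p h) = - m"
proof -
  note l = lifted_lift_rel[OF h]
  have G: "h x \<in> Gt" for x using h by (simp add: lifted_reps_def)
  let ?\<phi> = "Rep g p h"
  let ?prod = "\<lambda>\<alpha> \<beta>. list_mult SL2R_tilde (map (\<lambda>j. group_commutator SL2R_tilde (\<alpha> j) (\<beta> j)) [1..<Suc g]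
    @ map (\<lambda>i. parabolic_lift (?\<phi> (surface_elem g p (GenC i)))) [1..<Suc p])"
  let ?lifts = "\<lambda>\<alpha> \<beta>. \<forall>j\<in>{1..g}. is_lift (\<alpha> j) (?\<phi> (surface_elem g p (GenA j))) \<and> is_lift (\<beta> j) (?\<phi> (surface_elem g p (GenB j)))"
  have ph: "?\<phi> (surface_elem g p (GenA j)) = cls (h (GenA j))" "?\<phi> (surface_elem g p (GenB j)) = cls (h (GenB j))" if "j \<in> {1..g}" for j
    using Rep_gen[OF l] that by (auto simp: surface_gens_iff)
  have prod: "?prod \<alpha> \<beta> = Gam (T (of_int m))" if L: "?lifts \<alpha> \<beta>" for \<alpha> \<beta>
  proof -
    have "group_commutator SL2R_tilde (\<alpha> j) (\<beta> j) = Gam (cmt (h (GenA j)) (h (GenB j)))" if "j \<in> set [1..<Suc g]" for j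
    proof -
      have j: "j \<in> {1..g}" using that by auto
      obtain a b :: int where ab: "\<alpha> j = Gam (T (of_int a) \<circ> h (GenA j))" "\<beta> j = Gam (T (of_int b) \<circ> h (GenB j))"
        using L j ph is_lift_Gam[OF G] by metis
      have AB: "T (of_int a) \<circ> h (GenA j) \<in> Gt" "T (of_int b) \<circ> h (GenB j) \<in> Gt" by (intro comp_Gt T_Gt G)+
      have "group_commutator SL2R_tilde (\<alpha> j) (\<beta> j) = Gam (cmt (T (of_int a) \<circ> h (GenA j)) (T (of_int b) \<circ> h (GenB j)))"
        unfolding group_commutator_def ab cmt_def using AB by (simp only: Gam_inv Gam_mult comp_Gt inv_Gt)
      then show ?thesis by (simp only: cmt_shift[OF G G])
    qed
    moreover have "parabolic_lift (?\<phi> (surface_elem g p (GenC i))) = Gam (h (GenC i))" if "i \<in> set [1..<Suc p]" for i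
    proof -
      have i: "i \<in> {1..p}" using that by auto
      obtain v t where "h (GenC i) = U v 0 t" "t \<noteq> 0" by (rule lifted_U[OF h i s[OF i]])
      then show ?thesis using Rep_gen[OF l, of "GenC i"] i parabolic_lift_U by (simp add: surface_gens_iff)
    qed
    ultimately have "?prod \<alpha> \<beta> = Gam (gprod [1..<Suc g] (\<lambda>j. cmt (h (GenA j)) (h (GenB j))) \<circ> gprod [1..<Suc p] (\<lambda>i. h (GenC i)))"
      by (intro list_mult_Gam) (use G in \<open>auto intro!: cmt_Gt simp del: upt_Suc\<close>)
    then show ?thesis using h by (simp add: lifted_reps_def hprod_def cprod_def)
  qed
  show ?thesis unfolding relative_euler_class_def
  proof (rule the_equality)
    show "\<forall>\<alpha> \<beta>. ?lifts \<alpha> \<beta> \<longrightarrow> ?prod \<alpha> \<beta> = central_z [^]\<^bsub>SL2R_tilde\<^esub> (- m)"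
      using prod by (simp only: central_z_Gam Gam_pow of_int_minus minus_minus) blast
    fix n :: int assume n: "\<forall>\<alpha> \<beta>. ?lifts \<alpha> \<beta> \<longrightarrow> ?prod \<alpha> \<beta> = central_z [^]\<^bsub>SL2R_tilde\<^esub> n"
    have "is_lift (Gam (h x)) (cls (h x))" for x using G by (simp add: is_lift_def cover_proj_Gam)
    \<comment> \<open>The condition on \<open>n\<close> ranges over all lifts, so its uniqueness
      needs at least one family of lifts.\<close>
    then have L: "?lifts (\<lambda>j. Gam (h (GenA j))) (\<lambda>j. Gam (h (GenB j)))" using ph by simp
    have "Gam (T (of_int m)) = Gam (T (- of_int n))"
      using HOL.trans[OF prod[OF L, symmetric] n[THEN spec, THEN spec, THEN mp, OF L]] unfolding central_z_Gam Gam_pow .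
    then have "T (of_int m) = T (- of_int n)" by (rule Gam_inj[rotated 2]) simp_all
    then have "(of_int m :: real) = of_int (- n)" by (auto simp: T_def fun_eq_iff)
    then show "n = - m" unfolding of_int_eq_iff by simp
  qed
qed

subsection \<open>Connected components of the representation space\<close>

definition signs :: "nat \<Rightarrow> (nat \<Rightarrow> int) set" where "signs p = {1..p} \<rightarrow>\<^sub>E {1, -1}"

lemma signs_mem: "s \<in> signs p \<Longrightarrow> i \<in> {1..p} \<Longrightarrow> s i \<in> {1, -1}" by (auto simp: signs_def)

definition typed_reps :: "nat \<Rightarrow> nat \<Rightarrow> int \<Rightarrow> (surface_gen word set \<Rightarrow> mat2 set) set" where
  "typed_reps g p n = {\<phi> \<in> representations g p. type_preserving g p \<phi> \<and> relative_euler_class g p \<phi> = n}"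

text \<open>The Euler class changes sign because z rotates clockwise: it is the translation by -1.\<close>

definition piece :: "nat \<Rightarrow> nat \<Rightarrow> int \<Rightarrow> (nat \<Rightarrow> int) \<Rightarrow> (surface_gen word set \<Rightarrow> mat2 set) set" where
  "piece g p n s = Rep g p ` lifted_reps g p s (- n)"

text \<open>The product of the trace and the difference of the off-diagonal entries is well defined on PSL(2,R),
  and it has the sign of t on the class of the parabolic element U v 0 t.\<close>

definition sgn_open :: "int \<Rightarrow> mat2 set set" where
  "sgn_open \<sigma> = psl_class ` {A \<in> carrier SL2R. of_int \<sigma> * (trace A * (A$2$1 - A$1$2)) > 0}"

lemma sgn_open_iff: assumes "A \<in> carrier SL2R"
  shows "psl_class A \<in> sgn_open \<sigma> \<longleftrightarrow> of_int \<sigma> * (trace A * (A$2$1 - A$1$2)) > 0"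
proof
  assume "psl_class A \<in> sgn_open \<sigma>"
  then obtain B where B: "psl_class A = psl_class B" "of_int \<sigma> * (trace B * (B$2$1 - B$1$2)) > 0" by (auto simp: sgn_open_def)
  have "trace (- B) * ((- B)$2$1 - (- B)$1$2) = trace B * (B$2$1 - B$1$2)" by (simp add: trace_def sum_2 algebra_simps)
  then show "of_int \<sigma> * (trace A * (A$2$1 - A$1$2)) > 0" using B unfolding psl_class_iff by (elim disjE) (simp_all only:)
qed (use assms in \<open>auto simp: sgn_open_def\<close>)

lemma openin_sgn_open: "openin PSL2R_topology (sgn_open \<sigma>)"
  unfolding openin_PSL2R_topology
proof
  show "sgn_open \<sigma> \<subseteq> carrier PSL2R" by (auto simp: sgn_open_def carrier_PSL2R)
  have "{A \<in> carrier SL2R. psl_class A \<in> sgn_open \<sigma>} = carrier SL2R \<inter> {A. of_int \<sigma> * (trace A * (A$2$1 - A$1$2)) > 0}"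
    using sgn_open_iff by auto
  moreover have "open {A :: mat2. of_int \<sigma> * (trace A * (A$2$1 - A$1$2)) > 0}"
    unfolding trace_def by (intro open_Collect_less continuous_intros)
  ultimately show "openin (top_of_set (carrier SL2R)) {A \<in> carrier SL2R. psl_class A \<in> sgn_open \<sigma>}" by auto
qed

lemma cls_U_sgn: "cls (U v 0 t) \<in> sgn_open \<sigma> \<longleftrightarrow> of_int \<sigma> * t > 0"
proof -
  have "trace (mat 1 + t *\<^sub>R pY v) = 2" by (simp add: pY_def mt_one mt_scale mt_add mt_trace)
  moreover have "(mat 1 + t *\<^sub>R pY v)$2$1 - (mat 1 + t *\<^sub>R pY v)$1$2 = t"
  proof -
    have "t * (sin (pi * v))\<^sup>2 + t * (cos (pi * v))\<^sup>2 = t" by (simp flip: distrib_left)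
    then show ?thesis by (simp add: pY_def mt_one mt_scale mt_add)
  qed
  ultimately show ?thesis unfolding cls_U by (subst sgn_open_iff) (simp_all add: mem_SL2R mult.left_commute[of _ 2] mult.commute)
qed

lemma surface_elem_C: "i \<in> {1..p} \<Longrightarrow> surface_elem g p (GenC i) \<in> carrier (surface_group g p)"
  by (auto simp: carrier_surface surface_elem_def surface_gens_iff)

lemma piece_sgn:
  assumes "\<phi> \<in> piece g p n s" "i \<in> {1..p}" "s i \<in> {1, -1}" "\<sigma> \<in> {1, -1}"
  shows "\<phi> (surface_elem g p (GenC i)) \<in> sgn_open \<sigma> \<longleftrightarrow> s i = \<sigma>"
proof -
  obtain h where h: "h \<in> lifted_reps g p s (- n)" "\<phi> = Rep g p h" using assms(1) by (auto simp: piece_def)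
  obtain v t where t: "h (GenC i) = U v 0 t" "t \<noteq> 0" "s i = 1 \<longleftrightarrow> t > 0" by (rule lifted_U[OF h(1) assms(2,3)])
  have "\<phi> (surface_elem g p (GenC i)) = cls (U v 0 t)"
    using Rep_gen[OF lifted_lift_rel[OF h(1)], of "GenC i"] assms(2) by (simp add: h(2) surface_gens_iff t(1))
  then show ?thesis using t(2,3) assms(3,4) by (auto simp: cls_U_sgn)
qed

lemma typed_reps_pieces: "typed_reps g p n = (\<Union>s\<in>signs p. piece g p n s)"
proof
  show "(\<Union>s\<in>signs p. piece g p n s) \<subseteq> typed_reps g p n"
  proof
    fix \<phi> assume "\<phi> \<in> (\<Union>s\<in>signs p. piece g p n s)"
    then obtain s h where s: "s \<in> signs p" "h \<in> lifted_reps g p s (- n)" "\<phi> = Rep g p h" by (auto simp: piece_def)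
    note l = lifted_lift_rel[OF s(2)]
    have "parabolic (\<phi> (surface_elem g p (GenC i)))" if i: "i \<in> {1..p}" for i
    proof -
      obtain v t where "h (GenC i) = U v 0 t" "t \<noteq> 0" by (rule lifted_U[OF s(2) i signs_mem[OF s(1) i]])
      then show ?thesis using Rep_gen[OF l, of "GenC i"] i unfolding s(3) parabolic_iff surface_gens_iff by auto
    qed
    then show "\<phi> \<in> typed_reps g p n"
      using Rep_in[OF l] euler_class[OF s(2) signs_mem[OF s(1)]] by (simp add: typed_reps_def type_preserving_def s(3))
  qed
  show "typed_reps g p n \<subseteq> (\<Union>s\<in>signs p. piece g p n s)"
  proof
    fix \<phi> assume "\<phi> \<in> typed_reps g p n"
    then have \<phi>: "\<phi> \<in> representations g p" "type_preserving g p \<phi>" "relative_euler_class g p \<phi> = n" by (auto simp: typed_reps_def)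
    have "\<exists>v t. t \<noteq> 0 \<and> \<phi> (surface_elem g p (GenC i)) = cls (U v 0 t)" if "i \<in> {1..p}" for i
      using \<phi>(2) that parabolic_iff unfolding type_preserving_def by blast
    then obtain v t where vt: "\<And>i. i \<in> {1..p} \<Longrightarrow> t i \<noteq> 0 \<and> \<phi> (surface_elem g p (GenC i)) = cls (U (v i) 0 (t i))" by metis
    have "\<phi> (surface_elem g p x) \<in> carrier PSL2R" if "x \<in> surface_gens g p" for x
      using \<phi>(1) that unfolding representations_def hom_def carrier_surface surface_elem_def by fastforce
    then have "\<exists>F. F \<in> Gt \<and> cls F = \<phi> (surface_elem g p x)" if "x \<in> surface_gens g p" for x using cls_surj that by metis
    then obtain f where f: "\<And>x. x \<in> surface_gens g p \<Longrightarrow> f x \<in> Gt \<and> cls (f x) = \<phi> (surface_elem g p x)" by metis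
    \<comment> \<open>Peripheral generators get their lift with a fixed point, as the Euler class
      demands; for the others any lift will do.\<close>
    define h where "h x = (if x \<notin> surface_gens g p then id else case x of GenC i \<Rightarrow> U (v i) 0 (t i) | _ \<Rightarrow> f x)" for x
    define s where "s = (\<lambda>i\<in>{1..p}. if t i > 0 then 1 else -1 :: int)"
    have G: "h x \<in> Gt" for x using f by (cases x) (auto simp: h_def)
    have c: "cls (h x) = \<phi> (surface_elem g p x)" if "x \<in> surface_gens g p" for x
      using that f vt by (cases x) (auto simp: h_def surface_gens_iff)
    have R: "lift_rel g p h" "\<phi> = Rep g p h" by (rule Rep_surj[OF \<phi>(1) G c], assumption)+
    have "cls (evG h (surface_relator g p)) = cls id" using R(1) by (simp add: lift_rel_def)
    \<comment> \<open>The lifts satisfy the relation up to a translation, and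
      \<open>euler_class\<close> identifies its amount with the given Euler class.\<close>
    then obtain k :: int where "id = T (of_int k) \<circ> evG h (surface_relator g p)"
      using cls_eq_iff[OF evG_Gt[of h, OF G] id_Gt] by blast
    then have "T (of_int (- k)) \<circ> id = T (of_int (- k)) \<circ> (T (of_int k) \<circ> evG h (surface_relator g p))" by (rule arg_cong)
    then have k: "evG h (surface_relator g p) = T (of_int (- k))" by (simp add: o_assoc)
    have hin: "h \<in> lifted_reps g p s (- k)"
      unfolding lifted_reps_def
    proof (intro CollectI conjI allI impI ballI G)
      show "h x = id" if "x \<notin> surface_gens g p" for x using that by (simp add: h_def)
      show "h (GenC i) \<in> block (s i) 0" if i: "i \<in> {1..p}" for i
      proof -
        have "t i \<in> strengths (s i)" using vt[OF i] i by (auto simp: strengths_def s_def)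
        then show ?thesis using i unfolding block_def by (auto simp: h_def surface_gens_iff)
      qed
      show "hprod [1..<Suc g] h \<circ> cprod [1..<Suc p] h = T (of_int (- k))" using k unfolding evG_surface_relator .
    qed
    have s: "s \<in> signs p" by (auto simp: s_def signs_def)
    have "k = n" using euler_class[OF hin signs_mem[OF s]] \<phi>(3) R(2) by simp
    then have "h \<in> lifted_reps g p s (- n)" using hin by simp
    then have "\<phi> \<in> piece g p n s" unfolding piece_def R(2) by (rule imageI)
    with s show "\<phi> \<in> (\<Union>s\<in>signs p. piece g p n s)" by blast
  qed
qed

section \<open>The compact-open topology and the sign pieces\<close>

abbreviation co_top :: "nat \<Rightarrow> nat \<Rightarrow> (surface_gen word set \<Rightarrow> mat2 set) topology" where
  "co_top g p \<equiv> compact_open_topology (discrete_topology (carrier (surface_group g p))) PSL2R_topology"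

text \<open>The subbasis of the compact-open topology for a discrete domain, where compact sets are
  the finite ones.\<close>

definition co_basis :: "surface_gen word set set \<Rightarrow> (surface_gen word set \<Rightarrow> mat2 set) set set" where
  "co_basis C = {{f \<in> extensional C. continuous_map (discrete_topology C) PSL2R_topology f \<and> f ` K \<subseteq> V} |K V.
     (K \<subseteq> C \<and> finite K) \<and> openin PSL2R_topology V}"

lemma co_top_basis: "co_top g p = topology_generated_by (co_basis (carrier (surface_group g p)))"
  by (simp only: compact_open_topology_def co_basis_def compactin_discrete_topology topspace_discrete_topology)

lemma rep_maps:
  assumes "\<phi> \<in> representations g p"
  shows "\<phi> \<in> extensional (carrier (surface_group g p))" "continuous_map (discrete_topology (carrier (surface_group g p))) PSL2R_topology \<phi>"
  using assms by (auto simp: representations_def hom_def topspace_PSL2R_topology continuous_map_def)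

lemma rep_in_topspace: assumes "\<phi> \<in> representations g p" shows "\<phi> \<in> topspace (co_top g p)"
proof -
    have "\<phi> \<in> {f \<in> extensional (carrier (surface_group g p)).
      continuous_map (discrete_topology (carrier (surface_group g p))) PSL2R_topology f \<and> f ` {} \<subseteq> {}}"
      using rep_maps[OF assms] by blast
    moreover have "\<dots> \<in> co_basis (carrier (surface_group g p))" unfolding co_basis_def by blast
    ultimately show "\<phi> \<in> topspace (co_top g p)" unfolding co_top_basis topology_generated_by_topspace by (rule UnionI[rotated])
qed

lemma topspace_rep_space: "topspace (rep_space g p n) = typed_reps g p n"
  unfolding rep_space_def typed_reps_def[symmetric] using rep_in_topspace by (auto simp: typed_reps_def)

lemma continuous_on_evG:
  assumes "\<And>h x. h \<in> X \<Longrightarrow> h x \<in> Gt" shows "continuous_on X (\<lambda>h. evG h w)"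
proof (induct w)
  case (Cons a w)
  obtain s b where a: "a = (s, b)" by (cases a)
  have h: "continuous_on X (\<lambda>h. h s)" by (rule continuous_on_product_then_coordinatewise[OF continuous_on_id])
  then have c: "continuous_on X (\<lambda>h. if b then h s else ginv (h s))"
    using continuous_on_ginv[OF h] assms by (cases b) simp_all
  show ?case unfolding a evG_simps by (rule continuous_on_Gt_comp[OF c _ Cons]) (use assms in simp)
qed (simp add: continuous_on_const)

lemma continuous_map_Rep: "continuous_map (top_of_set (lifted_reps g p s m)) (co_top g p) (Rep g p)"
  unfolding co_top_basis continuous_on_generated_topo_iff
proof (intro conjI allI impI)
  let ?X = "lifted_reps g p s m" and ?C = "carrier (surface_group g p)"
  have maps: "Rep g p h \<in> extensional ?C" "continuous_map (discrete_topology ?C) PSL2R_topology (Rep g p h)" if "h \<in> ?X" for h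
    using rep_maps[OF Rep_in[OF lifted_lift_rel[OF that]]] .
  have op: "openin (top_of_set ?X) {h \<in> ?X. Rep g p h c \<in> V}" if c: "c \<in> ?C" and V: "openin PSL2R_topology V" for c V
  proof -
    obtain w where w: "w \<in> swords g p" "c = sclass g p w" using c unfolding carrier_surface by blast
    have G: "\<And>h x. h \<in> ?X \<Longrightarrow> h x \<in> Gt" by (simp add: lifted_reps_def)
    have "continuous_on ?X (\<lambda>h. evG h w)" by (rule continuous_on_evG) (rule G)
    moreover have "evG h w \<in> Gt" if "h \<in> ?X" for h by (rule evG_Gt) (rule G[OF that])
    ultimately have "continuous_map (top_of_set ?X) (top_of_set Gt) (\<lambda>h. evG h w)"
      unfolding continuous_map_in_subtopology by auto
    from openin_continuous_map_preimage[OF continuous_map_compose[OF this continuous_map_cls] V]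
    have "openin (top_of_set ?X) {h \<in> ?X. cls (evG h w) \<in> V}" by (simp add: o_def)
    moreover have "{h \<in> ?X. cls (evG h w) \<in> V} = {h \<in> ?X. Rep g p h c \<in> V}"
      using Rep_class[OF lifted_lift_rel w(1)] unfolding w(2) by auto
    ultimately show ?thesis by (simp only:)
  qed
  fix W assume "W \<in> co_basis ?C"
  then obtain K V where W: "W = {f \<in> extensional ?C. continuous_map (discrete_topology ?C) PSL2R_topology f \<and> f ` K \<subseteq> V}"
    "K \<subseteq> ?C" "finite K" "openin PSL2R_topology V" unfolding co_basis_def by blast
  have "openin (top_of_set ?X) (?X \<inter> (\<Inter>c\<in>K. {h \<in> ?X. Rep g p h c \<in> V}))"
  proof (cases "K = {}")
    case False
    have "openin (top_of_set ?X) (\<Inter>c\<in>K. {h \<in> ?X. Rep g p h c \<in> V})"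
      by (rule openin_INT2) (use W False op in auto)
    then show ?thesis by (intro openin_Int) auto
  qed simp
  moreover have "Rep g p -` W \<inter> topspace (top_of_set ?X) = ?X \<inter> (\<Inter>c\<in>K. {h \<in> ?X. Rep g p h c \<in> V})"
    unfolding W(1) using maps by auto
  ultimately show "openin (top_of_set ?X) (Rep g p -` W \<inter> topspace (top_of_set ?X))" by (simp only:)
next
  show "Rep g p ` topspace (top_of_set (lifted_reps g p s m)) \<subseteq> \<Union> (co_basis (carrier (surface_group g p)))"
    using rep_in_topspace[OF Rep_in[OF lifted_lift_rel]] unfolding co_top_basis topology_generated_by_topspace by auto
qed

lemma Rep_zeq: assumes "lift_rel g p h" "lift_rel g p h'" "zeq h h'" shows "Rep g p h = Rep g p h'"
proof -
  have G: "h x \<in> Gt" "h' x \<in> Gt" for x using assms by (auto simp: lift_rel_def)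
  have "cls (h' x) = \<phi>x" if "cls (h x) = \<phi>x" for x \<phi>x
    using cls_eq_iff[OF G] assms(3) that unfolding zeq_def by metis
  then have "cls (h' x) = Rep g p h (surface_elem g p x)" if "x \<in> surface_gens g p" for x
    using Rep_gen[OF assms(1) that] by simp
  from Rep_surj(2)[OF Rep_in[OF assms(1)] G(2) this] show ?thesis .
qed

text \<open>\<open>Rep\<close> is continuous and constant on lifts of the same representation, so a
  separation of the piece would pull back to a nontrivial saturated clopen set.\<close>

lemma connectedin_piece:
  assumes "s \<in> signs p" "sconn zeq (lifted_reps g p s (- n))"
  shows "connectedin (rep_space g p n) (piece g p n s)"
  unfolding connectedin
proof (intro conjI notI)
  let ?X = "lifted_reps g p s (- n)"
  show sub: "piece g p n s \<subseteq> topspace (rep_space g p n)"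
    unfolding topspace_rep_space typed_reps_pieces using assms(1) by blast
  have cont: "continuous_map (top_of_set ?X) (rep_space g p n) (Rep g p)"
    using continuous_map_Rep sub unfolding rep_space_def continuous_map_in_subtopology topspace_rep_space[unfolded rep_space_def]
    by (auto simp: piece_def typed_reps_def topspace_rep_space)
  assume "\<exists>E1 E2. openin (rep_space g p n) E1 \<and> openin (rep_space g p n) E2 \<and> piece g p n s \<subseteq> E1 \<union> E2 \<and>
    E1 \<inter> E2 \<inter> piece g p n s = {} \<and> E1 \<inter> piece g p n s \<noteq> {} \<and> E2 \<inter> piece g p n s \<noteq> {}"
  then obtain E1 E2 where E: "openin (rep_space g p n) E1" "openin (rep_space g p n) E2" "piece g p n s \<subseteq> E1 \<union> E2"
    "E1 \<inter> E2 \<inter> piece g p n s = {}" "E1 \<inter> piece g p n s \<noteq> {}" "E2 \<inter> piece g p n s \<noteq> {}" by blast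
  define W where "W = {h \<in> ?X. Rep g p h \<in> E1}"
  have W2: "?X - W = {h \<in> ?X. Rep g p h \<in> E2}" using E(3,4) by (auto simp: W_def piece_def)
  have "openin (top_of_set ?X) W" using openin_continuous_map_preimage[OF cont E(1)] unfolding W_def by simp
  moreover have "openin (top_of_set ?X) (?X - W)" using openin_continuous_map_preimage[OF cont E(2)] unfolding W2 by simp
  moreover have "h' \<in> W" if "h \<in> W" "h' \<in> ?X" "zeq h h'" for h h'
    using Rep_zeq[OF lifted_lift_rel lifted_lift_rel that(3)] that(1,2) unfolding W_def by auto
  ultimately have "sat_clopen zeq ?X W" unfolding sat_clopen_def by (auto simp: W_def)
  then have "W = {} \<or> W = ?X" using sconn_clopen[OF assms(2)] by blast
  then show False using E(5,6) W2 unfolding W_def piece_def by auto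
qed

text \<open>Membership in a piece means that finitely many peripheral values lie in prescribed sign
  sets, and these are open in PSL(2,R).\<close>

lemma openin_piece: assumes "s \<in> signs p" shows "openin (rep_space g p n) (piece g p n s)"
proof -
  let ?C = "carrier (surface_group g p)"
  define B where "B i = {f \<in> extensional ?C. continuous_map (discrete_topology ?C) PSL2R_topology f \<and>
    f ` {surface_elem g p (GenC i)} \<subseteq> sgn_open (s i)}" for i
  have "openin (co_top g p) (B i)" if "i \<in> {1..p}" for i
    unfolding co_top_basis
  proof (rule topology_generated_by_Basis)
    have "{surface_elem g p (GenC i)} \<subseteq> ?C \<and> finite {surface_elem g p (GenC i)}" using surface_elem_C[OF that] by simp
    then show "B i \<in> co_basis ?C" using openin_sgn_open[of "s i"] unfolding co_basis_def B_def by blast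
  qed
  then have o: "openin (rep_space g p n) (typed_reps g p n \<inter> B i)" if "i \<in> {1..p}" for i
    unfolding rep_space_def typed_reps_def[symmetric] using that by (simp add: openin_subtopology_Int2)
  have "openin (rep_space g p n) (typed_reps g p n \<inter> (\<Inter>i\<in>{1..p}. typed_reps g p n \<inter> B i))"
  proof (cases "{1..p} = {}")
    case True then show ?thesis using openin_topspace[of "rep_space g p n"] by (simp add: topspace_rep_space)
  next
    case False
    have "openin (rep_space g p n) (\<Inter>i\<in>{1..p}. typed_reps g p n \<inter> B i)"
      by (rule openin_INT2) (use False o in auto)
    then show ?thesis using openin_topspace[of "rep_space g p n"] by (intro openin_Int) (simp_all add: topspace_rep_space)
  qed
  moreover have "piece g p n s = typed_reps g p n \<inter> (\<Inter>i\<in>{1..p}. typed_reps g p n \<inter> B i)"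
  proof
    show "piece g p n s \<subseteq> typed_reps g p n \<inter> (\<Inter>i\<in>{1..p}. typed_reps g p n \<inter> B i)"
    proof
      fix \<phi> assume \<phi>: "\<phi> \<in> piece g p n s"
      then have t: "\<phi> \<in> typed_reps g p n" unfolding typed_reps_pieces using assms by blast
      have "\<phi> \<in> B i" if i: "i \<in> {1..p}" for i
        using piece_sgn[OF \<phi> i signs_mem[OF assms i] signs_mem[OF assms i]] rep_maps[of \<phi>] t
        unfolding B_def typed_reps_def by simp
      then show "\<phi> \<in> typed_reps g p n \<inter> (\<Inter>i\<in>{1..p}. typed_reps g p n \<inter> B i)" using t by blast
    qed
    show "typed_reps g p n \<inter> (\<Inter>i\<in>{1..p}. typed_reps g p n \<inter> B i) \<subseteq> piece g p n s"
    proof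
      fix \<phi> assume \<phi>: "\<phi> \<in> typed_reps g p n \<inter> (\<Inter>i\<in>{1..p}. typed_reps g p n \<inter> B i)"
      then obtain s' where s': "s' \<in> signs p" "\<phi> \<in> piece g p n s'" unfolding typed_reps_pieces by blast
      have "s' i = s i" if i: "i \<in> {1..p}" for i
        using piece_sgn[OF s'(2) i signs_mem[OF s'(1) i] signs_mem[OF assms i]] \<phi> i unfolding B_def by auto
      then have "s' = s" using s'(1) assms unfolding signs_def by (intro PiE_ext)
      then show "\<phi> \<in> piece g p n s" using s'(2) by simp
    qed
  qed
  ultimately show ?thesis by (simp only:)
qed

lemma piece_inj:
  assumes "s \<in> signs p" "s' \<in> signs p" "\<phi> \<in> piece g p n s" "\<phi> \<in> piece g p n s'" shows "s = s'"
proof -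
  have "s i = s' i" if i: "i \<in> {1..p}" for i
    using piece_sgn[OF assms(3) i signs_mem[OF assms(1) i] signs_mem[OF assms(2) i]]
      piece_sgn[OF assms(4) i signs_mem[OF assms(2) i] signs_mem[OF assms(2) i]] by simp
  then show ?thesis using assms(1,2) unfolding signs_def by (intro PiE_ext)
qed

section \<open>Counting components\<close>

lemma connected_components_of_partition:
  assumes cov: "topspace X = \<Union>F" and op: "\<And>C. C \<in> F \<Longrightarrow> openin X C" and con: "\<And>C. C \<in> F \<Longrightarrow> connectedin X C"
    and dis: "\<And>C D. C \<in> F \<Longrightarrow> D \<in> F \<Longrightarrow> C \<inter> D \<noteq> {} \<Longrightarrow> C = D" and ne: "{} \<notin> F"
  shows "connected_components_of X = F"
proof -
  have comp: "connected_component_of_set X x = C" if C: "C \<in> F" "x \<in> C" for x C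
  proof
    show "C \<subseteq> connected_component_of_set X x" by (rule connected_component_of_maximal[OF con[OF C(1)] C(2)])
    have "topspace X - C = \<Union>(F - {C})" using dis C(1) unfolding cov by blast
    moreover have "openin X (\<Union>(F - {C}))" using op by (intro openin_Union) auto
    ultimately have "closedin X C" unfolding closedin_def using openin_subset[OF op[OF C(1)]] by simp
    then have "connected_component_of_set X x \<subseteq> C \<or> disjnt (connected_component_of_set X x) C"
      by (rule connectedin_clopen_cases[OF connectedin_connected_component_of _ op[OF C(1)]])
    moreover have "x \<in> connected_component_of_set X x" using C cov by (auto simp: connected_component_of_refl)
    ultimately show "connected_component_of_set X x \<subseteq> C" using C(2) unfolding disjnt_def by blast
  qed
  show ?thesis unfolding connected_components_of_def
  proof
    show "connected_component_of_set X ` topspace X \<subseteq> F" unfolding cov using comp by auto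
    show "F \<subseteq> connected_component_of_set X ` topspace X"
    proof
      fix C assume C: "C \<in> F"
      then obtain x where "x \<in> C" using ne by (metis ex_in_conv)
      then show "C \<in> connected_component_of_set X ` topspace X" using comp[OF C] C cov by blast
    qed
  qed
qed

lemma rep_space_components:
  assumes "\<And>s. s \<in> signs p \<Longrightarrow> sconn zeq (lifted_reps g p s (- n))"
  shows "has_components (rep_space g p n) (card {s \<in> signs p. lifted_reps g p s (- n) \<noteq> {}})"
proof -
  let ?S = "{s \<in> signs p. lifted_reps g p s (- n) \<noteq> {}}"
  have ne: "piece g p n s \<noteq> {}" if "s \<in> ?S" for s using that by (simp add: piece_def)
  have "connected_components_of (rep_space g p n) = piece g p n ` ?S"
  proof (rule connected_components_of_partition)
    show "topspace (rep_space g p n) = \<Union> (piece g p n ` ?S)"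
      unfolding topspace_rep_space typed_reps_pieces by (auto simp: piece_def)
    show "{} \<notin> piece g p n ` ?S" using ne by blast
    show "openin (rep_space g p n) C" if "C \<in> piece g p n ` ?S" for C using that openin_piece by blast
    show "connectedin (rep_space g p n) C" if "C \<in> piece g p n ` ?S" for C using that connectedin_piece assms by blast
    show "C = D" if m: "C \<in> piece g p n ` ?S" "D \<in> piece g p n ` ?S" "C \<inter> D \<noteq> {}" for C D
    proof -
      obtain s s' \<phi> where "s \<in> signs p" "C = piece g p n s" "s' \<in> signs p" "D = piece g p n s'" "\<phi> \<in> C" "\<phi> \<in> D"
        using m by blast
      then show ?thesis using piece_inj[of s p s' \<phi> g n] by simp
    qed
  qed
  moreover have "inj_on (piece g p n) ?S"
  proof (rule inj_onI)
    fix s s' assume s: "s \<in> ?S" "s' \<in> ?S" "piece g p n s = piece g p n s'"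
    then obtain \<phi> where "\<phi> \<in> piece g p n s" using ne by blast
    then show "s = s'" using piece_inj[of s p s' \<phi> g n] s by simp
  qed
  moreover have "finite ?S" by (auto simp: signs_def finite_PiE)
  ultimately show ?thesis by (simp add: has_components_def card_image)
qed

text \<open>A sign vector is determined by the set of its negative places, so the vectors with
  \<open>j\<close> negative signs are counted by a binomial coefficient.\<close>

lemma card_signs: "card {s \<in> signs p. Q (neg p s)} = (\<Sum>j | j \<le> p \<and> Q (int j). p choose j)"
proof -
  let ?A = "{1..p}" and ?J = "{j. j \<le> p \<and> Q (int j)}"
  define f where "f B = (\<lambda>i\<in>?A. if i \<in> B then -1 else 1 :: int)" for B
  have neg: "neg p s = int (card {i \<in> ?A. s i = -1})" for s
  proof -
    have "neg p s = (\<Sum>i\<in>?A. if s i = -1 then 1 else 0)"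
      unfolding neg_def by (subst sum_list_distinct_conv_sum_set) (auto intro: sum.cong)
    then show ?thesis by (simp add: sum.If_cases Int_def)
  qed
  have B: "{i \<in> ?A. f B i = -1} = B" if "B \<subseteq> ?A" for B using that by (auto simp: f_def)
  have "{s \<in> signs p. Q (neg p s)} = f ` {B. B \<subseteq> ?A \<and> Q (int (card B))}"
  proof
    show "{s \<in> signs p. Q (neg p s)} \<subseteq> f ` {B. B \<subseteq> ?A \<and> Q (int (card B))}"
    proof
      fix s assume s: "s \<in> {s \<in> signs p. Q (neg p s)}"
      have "s = f {i \<in> ?A. s i = -1}"
        by (rule PiE_ext[of _ ?A "\<lambda>_. {1, -1}"]) (use s in \<open>auto simp: f_def signs_def\<close>)
      then show "s \<in> f ` {B. B \<subseteq> ?A \<and> Q (int (card B))}" using s neg[of s] by (intro image_eqI) auto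
    qed
    show "f ` {B. B \<subseteq> ?A \<and> Q (int (card B))} \<subseteq> {s \<in> signs p. Q (neg p s)}"
    proof
      fix s assume "s \<in> f ` {B. B \<subseteq> ?A \<and> Q (int (card B))}"
      then obtain B' where B': "B' \<subseteq> ?A" "Q (int (card B'))" "s = f B'" by blast
      have "s \<in> signs p" by (auto simp: B'(3) f_def signs_def)
      moreover have "neg p s = int (card B')" unfolding B'(3) neg B[OF B'(1)] ..
      ultimately show "s \<in> {s \<in> signs p. Q (neg p s)}" using B'(2) by simp
    qed
  qed
  moreover have "inj_on f {B. B \<subseteq> ?A \<and> Q (int (card B))}"
    by (rule inj_on_inverseI[where g="\<lambda>s. {i \<in> ?A. s i = -1}"]) (rule B, blast)
  ultimately have "card {s \<in> signs p. Q (neg p s)} = card {B. B \<subseteq> ?A \<and> Q (int (card B))}" by (simp add: card_image)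
  also have "{B. B \<subseteq> ?A \<and> Q (int (card B))} = (\<Union>j\<in>?J. {B. B \<subseteq> ?A \<and> card B = j})"
    using card_mono[of ?A] by auto
  also have "card \<dots> = (\<Sum>j\<in>?J. card {B. B \<subseteq> ?A \<and> card B = j})"
    by (rule card_UN_disjoint) (auto intro: finite_subset[of _ "Pow ?A"])
  also have "\<dots> = (\<Sum>j\<in>?J. p choose j)" by (simp add: n_subsets)
  finally show ?thesis .
qed

lemma pos_signs: assumes "s \<in> signs p" shows "pos p s = int p - neg p s"
proof -
  have "pos p s + neg p s = (\<Sum>i\<leftarrow>[1..<Suc p]. 1)"
    unfolding pos_def neg_def sum_list_addf[symmetric]
    by (rule sum_list_cong') (use signs_mem[OF assms] in fastforce)
  then show ?thesis by (simp add: sum_list_triv del: upt_Suc)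
qed

text \<open>The summation index is the number of negative signs of the lifted
  representation.\<close>

lemma component_sum_eq:
  "component_sum g p n = (\<Sum>j | j \<le> p \<and> n + 2 - 2 * int g \<le> int j \<and> int j \<le> n - 2 + 2 * int g + int p. p choose j)"
  unfolding component_sum_def surface_euler_char_def
  by (rule sum.reindex_bij_witness[where i=int and j=nat]) auto

theorem corollary1p4:
  fixes g p :: nat
  assumes "p \<ge> 1" and "g = 0 \<Longrightarrow> p \<ge> 3"
  shows "(g \<ge> 1 \<longrightarrow> (\<forall>n::int. has_components (rep_space g p n) (component_sum g p n)))
    \<and> (g = 0 \<longrightarrow> has_components (rep_space g p 0) (component_sum g p 0 + 2 * p))
    \<and> (g = 0 \<longrightarrow> (\<forall>n\<in>{1, -1::int}. has_components (rep_space g p n) (component_sum g p n + 1)))"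
proof (intro conjI impI allI ballI)
  fix n :: int assume g: "g \<ge> 1"
  have c: "sconn zeq (lifted_reps g p s (- n))" if "s \<in> signs p" for s
    by (rule lifted_reps_genus_pos(1)[OF g assms(1) signs_mem[OF that]])
  have e: "lifted_reps g p s (- n) \<noteq> {} \<longleftrightarrow> n + 2 - 2 * int g \<le> neg p s \<and> neg p s \<le> n - 2 + 2 * int g + int p"
    if "s \<in> signs p" for s
  proof -
    have "lifted_reps g p s (- n) \<noteq> {} \<longleftrightarrow> 2 - 2 * int g - neg p s \<le> - n \<and> - n \<le> pos p s + 2 * int g - 2"
      by (rule lifted_reps_genus_pos(2)[OF g assms(1) signs_mem[OF that]])
    also have "\<dots> \<longleftrightarrow> n + 2 - 2 * int g \<le> neg p s \<and> neg p s \<le> n - 2 + 2 * int g + int p"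
      unfolding pos_signs[OF that] by auto
    finally show ?thesis .
  qed
  have S: "{s \<in> signs p. lifted_reps g p s (- n) \<noteq> {}} =
    {s \<in> signs p. n + 2 - 2 * int g \<le> neg p s \<and> neg p s \<le> n - 2 + 2 * int g + int p}" using e by blast
  have "has_components (rep_space g p n) (card {s \<in> signs p. lifted_reps g p s (- n) \<noteq> {}})"
    by (rule rep_space_components[OF c])
  then show "has_components (rep_space g p n) (component_sum g p n)"
    unfolding S component_sum_eq
    using card_signs[of p "\<lambda>x. n + 2 - 2 * int g \<le> x \<and> x \<le> n - 2 + 2 * int g + int p"] by (simp only:)
next
  assume g: "g = 0"
  then have p: "p \<ge> 3" using assms(2) by simp
  have main: "has_components (rep_space g p n) (\<Sum>j | j \<le> p \<and> (n + 2 \<le> int j \<and> int j \<le> n - 2 + int p \<or>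
      n = 0 \<and> 0 < int j \<and> int j < int p \<or> n = -1 \<and> int j = 0 \<or> n = 1 \<and> int j = int p). p choose j)" for n
  proof -
    have c: "sconn zeq (lifted_reps 0 p s (- n))" if "s \<in> signs p" for s
      by (rule lifted_reps_genus_zero(1)[OF p signs_mem[OF that]])
    have e: "lifted_reps 0 p s (- n) \<noteq> {} \<longleftrightarrow> n + 2 \<le> neg p s \<and> neg p s \<le> n - 2 + int p \<or>
      n = 0 \<and> 0 < neg p s \<and> neg p s < int p \<or> n = -1 \<and> neg p s = 0 \<or> n = 1 \<and> neg p s = int p" if "s \<in> signs p" for s
    proof -
      have "lifted_reps 0 p s (- n) \<noteq> {} \<longleftrightarrow> 2 - neg p s \<le> - n \<and> - n \<le> pos p s - 2 \<or>
        - n = 0 \<and> pos p s > 0 \<and> neg p s > 0 \<or> - n = 1 \<and> neg p s = 0 \<or> - n = -1 \<and> pos p s = 0"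
        by (rule lifted_reps_genus_zero(2)[OF p signs_mem[OF that]])
      also have "\<dots> \<longleftrightarrow> n + 2 \<le> neg p s \<and> neg p s \<le> n - 2 + int p \<or>
        n = 0 \<and> 0 < neg p s \<and> neg p s < int p \<or> n = -1 \<and> neg p s = 0 \<or> n = 1 \<and> neg p s = int p"
        unfolding pos_signs[OF that] by presburger
      finally show ?thesis .
    qed
    have S: "{s \<in> signs p. lifted_reps 0 p s (- n) \<noteq> {}} = {s \<in> signs p. n + 2 \<le> neg p s \<and> neg p s \<le> n - 2 + int p \<or>
      n = 0 \<and> 0 < neg p s \<and> neg p s < int p \<or> n = -1 \<and> neg p s = 0 \<or> n = 1 \<and> neg p s = int p}" using e by blast
    have "has_components (rep_space 0 p n) (card {s \<in> signs p. lifted_reps 0 p s (- n) \<noteq> {}})"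
      by (rule rep_space_components[OF c])
    then show ?thesis unfolding S g
      using card_signs[of p "\<lambda>x. n + 2 \<le> x \<and> x \<le> n - 2 + int p \<or>
        n = 0 \<and> 0 < x \<and> x < int p \<or> n = -1 \<and> x = 0 \<or> n = 1 \<and> x = int p"] by (simp only:)
  qed
  let ?I = "\<lambda>n. {j. j \<le> p \<and> n + 2 - 2 * int g \<le> int j \<and> int j \<le> n - 2 + 2 * int g + int p}"
  have add: "(\<Sum>j\<in>?I n \<union> E. p choose j) = component_sum g p n + (\<Sum>j\<in>E. p choose j)" if "finite E" "?I n \<inter> E = {}" for n E
    unfolding component_sum_eq by (rule sum.union_disjoint) (use that in auto)
  \<comment> \<open>The general range runs from 2 to \<open>p - 2\<close>. The abelian condition
    admits every \<open>j\<close> strictly between 0 and \<open>p\<close>, which adds 1 and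
    \<open>p - 1\<close> with \<open>p\<close> sign vectors each.\<close>
  have "{j. j \<le> p \<and> (0 + 2 \<le> int j \<and> int j \<le> 0 - 2 + int p \<or> (0::int) = 0 \<and> 0 < int j \<and> int j < int p \<or>
    (0::int) = -1 \<and> int j = 0 \<or> (0::int) = 1 \<and> int j = int p)} = ?I 0 \<union> {1, p - 1}" using p g by auto
  moreover have "(\<Sum>j\<in>?I 0 \<union> {1, p - 1}. p choose j) = component_sum g p 0 + 2 * p"
  proof -
    have "p choose (p - 1) = p" using p binomial_symmetric[of 1 p] by simp
    then have "(\<Sum>j\<in>{1, p - 1}. p choose j) = 2 * p" using p by simp
    then show ?thesis using add[of "{1, p - 1}" 0] p g by simp
  qed
  ultimately show "has_components (rep_space g p 0) (component_sum g p 0 + 2 * p)"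
    using main[of 0] unfolding g by (simp only:)
  fix n :: int assume n: "n \<in> {1, -1}"
  \<comment> \<open>All signs agree in the additional component. The Euler class is the negative of
    the translation number, so \<open>n = 1\<close> belongs to all signs negative and
    \<open>n = -1\<close> to all signs positive.\<close>
  define e where "e = (if n = 1 then p else 0)"
  have "{j. j \<le> p \<and> (n + 2 \<le> int j \<and> int j \<le> n - 2 + int p \<or> n = 0 \<and> 0 < int j \<and> int j < int p \<or>
    n = -1 \<and> int j = 0 \<or> n = 1 \<and> int j = int p)} = ?I n \<union> {e}" using p g n by (auto simp: e_def)
  moreover have "(\<Sum>j\<in>?I n \<union> {e}. p choose j) = component_sum g p n + 1"
    using add[of "{e}" n] p g n by (auto simp: e_def)
  ultimately show "has_components (rep_space g p n) (component_sum g p n + 1)"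
    using main[of n] unfolding g by (simp only:)
qed

end
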